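(* The composite 2-functor $$\mathbf{\Omega_{H'}}\xrightarrow{\;C\;}\mathbf{Span(Gpd)}\xrightarrow{\;\Lambda\;}\mathbf{2Vect}$$ determines a representation of $\mathbf{H'}$ on the category $\Lambda(\mathbf{S})\simeq\coprod_{n\in\mathbb{N}}\mathrm{Rep}(S_n)$ by functors and natural transformations, i.e. a monoidal functor from $\mathbf{H'}$ to the category of linear endofunctors of $\Lambda(\mathbf{S})$ and natural transformations, sending each generating object and each generating morphism of $\mathbf{H'}$ to the image under $\Lambda$ of the span, respectively span of spans, assigned to it by $C$.
   Context: **The category $\mathbf{H'}$.** $\mathbf{H'}$ is the monoidal category with zero object and biproducts (so its hom-sets are commutative monoids, with composition and tensor bilinear) with generating objects $Q_+,Q_-$ (unit object $I$), generating morphisms $c:I\to Q_-\otimes Q_+$, $d:Q_-\otimes Q_+\to I$, $c':I\to Q_+\otimes Q_-$, $d':Q_+\otimes Q_-\to I$, $u:Q_+\otimes Q_+\to Q_+\otimes Q_+$, $v:Q_-\otimes Q_-\to Q_-\otimes Q_-$, $x:Q_+\otimes Q_-\to Q_-\otimes Q_+$, $y:Q_-\otimes Q_+\to Q_+\otimes Q_-$, and relations (juxtaposition is composition, $1_\pm=\mathrm{id}_{Q_\pm}$): - $cd+xy=\mathrm{id}_{Q_-\otimes Q_+}$; $\;yx=\mathrm{id}_{Q_+\otimes Q_-}$; $\;dc=\mathrm{id}_I$; - $(d\otimes 1_+)(1_-\otimes u)(c\otimes 1_+)=0$; - $u^2=\mathrm{id}$, $v^2=\mathrm{id}$, $(u\otimes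 1_+)(1_+\otimes u)(u\otimes 1_+)=(1_+\otimes u)(u\otimes 1_+)(1_+\otimes u)$; - $(d'\otimes 1_+)(1_+\otimes c)=1_+$, $(1_-\otimes d')(c\otimes 1_-)=1_-$, $(d\otimes 1_-)(1_-\otimes c')=1_-$, $(1_+\otimes d)(c'\otimes 1_+)=1_+$. $\mathbf{\Omega_{H'}}$ is the 2-category with one object whose morphisms and 2-morphisms are the objects and morphisms of $\mathbf{H'}$, composition of 1-morphisms being $\otimes$. **The 2-category $\mathbf{Span(Gpd)}$.** A groupoid is tame if it is essentially small, has finite hom-sets, and $\sum_{[x]}|\mathrm{Aut}(x)|^{-1}<\infty$. A span $B\xleftarrow{G}X\xrightarrow{F}A$ of groupoids is a 1-morphism $A\to B$. It is tame if for all $a\in A,b\in B$ the full subgroupoid of $X$ on objects $x$ with $F(x)\cong a$, $G(x)\cong b$ is tame, and for each target object only finitely many source objects (up to isomorphism) make this nonempty; cotame if the converse span is tame. Converse: $(B\xleftarrow{G}X\xrightarrow{F}A)^\dagger=(A\xleftarrow{F}X\xrightarrow{G}B)$. Objects are tame groupoids; 1-morphisms are tame and cotame spans, composed by weak pullback (iso-comma groupoids); 2-morphisms $(B\xleftarrow{G}X\xrightarrow{F}A)\Rightarrow(B\xleftarrow{J}Y\xrightarrow{K}A)$ are equivalence classes of tame and cotame spans of spans $(X\xleftarrow{S}Z\xrightarrow{T}Y,\mu:GS\Rightarrow JT,\nu:FS\Rightarrow KT)$ with $\mu,\nu$ natural isomorphisms, composed by weak pullback; two are equivalent if there is an equivalence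 $U:Z\to Z'$ and natural isomorphisms $\sigma:S\Rightarrow S'U$, $\tau:T\Rightarrow T'U$ with $J\tau\cdot\mu=\mu'U\cdot G\sigma$, $K\tau\cdot\nu=\nu'U\cdot F\sigma$. Converse: $(X\xleftarrow{S}Z\xrightarrow{T}Y,\mu,\nu)^\dagger=(Y\xleftarrow{T}Z\xrightarrow{S}X,\mu^{-1},\nu^{-1})$. Sum of 2-morphisms is disjoint union of the $Z$'s; zero has $Z=\emptyset$; direct sum of spans is disjoint union of apexes. **The 2-functor $C$.** $\mathbf{S}$ is the groupoid of finite sets and bijections, $+1:\mathbf{S}\to\mathbf{S}$ is disjoint union with a one-element set, $+2=(+1)^2$. $A=(\mathbf{S}\xleftarrow{\mathrm{id}}\mathbf{S}\xrightarrow{+1}\mathbf{S})$, $A^\dagger=(\mathbf{S}\xleftarrow{+1}\mathbf{S}\xrightarrow{\mathrm{id}}\mathbf{S})$. $A\circ A^\dagger$ has apex $(+1\downarrow+1)$ with objects $(s,t,\alpha:s+1\xrightarrow{\cong}t+1)$; up to canonical equivalence $A^\dagger\circ A=(\mathbf{S}\xleftarrow{+1}\mathbf{S}\xrightarrow{+1}\mathbf{S})$, $A\circ A=(\mathbf{S}\xleftarrow{\mathrm{id}}\mathbf{S}\xrightarrow{+2}\mathbf{S})$, $A^\dagger\circ A^\dagger=(\mathbf{S}\xleftarrow{+2}\mathbf{S}\xrightarrow{\mathrm{id}}\mathbf{S})$. $C$ sends the object to $\mathbf{S}$, $Q_+\mapsto A^\dagger$, $Q_-\mapsto A$, $c\mapsto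 i_{\mathrm{id}}$, $d\mapsto (i_{\mathrm{id}})^\dagger$, $c'\mapsto\eta$, $d'\mapsto\eta^\dagger$, $x\mapsto i_{A^\dagger\circ A}$, $y\mapsto (i_{A^\dagger\circ A})^\dagger$, $u\mapsto\hat\sigma_{A^\dagger}$, $v\mapsto\hat\sigma_A$, where: - $i_{\mathrm{id}}:\mathrm{id}_{\mathbf S}\Rightarrow A\circ A^\dagger$ is $\mathbf{S}\xleftarrow{\mathrm{id}}\mathbf{S}\xrightarrow{I_1}(+1\downarrow+1)$, $I_1(s)=(s,s,\mathrm{id})$; - $i_{A^\dagger\circ A}:A^\dagger\circ A\Rightarrow A\circ A^\dagger$ is $\mathbf{S}\xleftarrow{\mathrm{id}}\mathbf{S}\xrightarrow{I_2}(+1\downarrow+1)$, $I_2(s)=(s+1,s+1,\text{swap of the two added elements})$; - $\eta:\mathrm{id}_{\mathbf S}\Rightarrow A^\dagger\circ A$ is $\mathbf{S}\xleftarrow{+1}\mathbf{S}\xrightarrow{\mathrm{id}}\mathbf{S}$ (these three with identity natural transformations); - $\hat\sigma_A$ and $\hat\sigma_{A^\dagger}$, endomorphisms of $A\circ A$ and $A^\dagger\circ A^\dagger$, are $\mathbf{S}\xleftarrow{\mathrm{id}}\mathbf{S}\xrightarrow{\mathrm{id}}\mathbf{S}$ with the identity on the leg $\mathrm{id}$ and, on the leg $+2$, the natural automorphism swapping the two added elements. **2-linearization $\Lambda$.** $\mathbf{2Vect}$ has as objects $\mathbb{C}$-linear semisimple additive categories, linear functors as 1-morphisms, natural transformations as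 2-morphisms. $\Lambda$ sends a groupoid $X$ to $\mathrm{Rep}(X)$, its finite-dimensional complex representations; for $\mathbf{S}$ this means finite direct sums of irreducible representations of the symmetric groups $S_n$ (the colimit of the categories obtained from the groupoids of sets with at most $n$ elements, to which $\Lambda$ is extended in this way). For a functor $F$ write $F_*$ for restriction (pullback) of representations along $F$ and $F^*$ for its two-sided adjoint, induction (left and right adjoints identified by the standard Nakayama/norm isomorphism). A span $B\xleftarrow{G}X\xrightarrow{F}A$ goes to $G^*F_*:\mathrm{Rep}(A)\to\mathrm{Rep}(B)$. A span of spans $(X\xleftarrow{S}Z\xrightarrow{T}Y,\mu,\nu)$ from $(B\xleftarrow{G}X\xrightarrow{F}A)$ to $(B\xleftarrow{J}Y\xrightarrow{K}A)$ goes to the natural transformation $$G^*F_*\Rightarrow G^*S^*S_*F_*\cong (GS)^*(FS)_*\cong (JT)^*(KT)_*\cong J^*T^*T_*K_*\Rightarrow J^*K_*,$$ where the first map is the unit of $S_*\dashv S^*$, the last is the counit of $T^*\dashv T_*$, and the middle isomorphism is induced by $\mu$ and $\nu$. *)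

theory Defs
  imports
    "HOL-Library.FuncSet"
    "HOL-Algebra.Sym_Groups"
    "Jordan_Normal_Form.Matrix"
begin

section \<open>Categories, functors, natural transformations\<close>

text \<open>\<open>Cmp C g f\<close> is the composite \<open>g\<close> after \<open>f\<close>.\<close>

record ('o, 'm) cat =
  Obj :: "'o set"
  Arr :: "'m set"
  Dom :: "'m \<Rightarrow> 'o"
  Cod :: "'m \<Rightarrow> 'o"
  Idn :: "'o \<Rightarrow> 'm"
  Cmp :: "'m \<Rightarrow> 'm \<Rightarrow> 'm"

record ('o, 'm) addcat = "('o, 'm) cat" +
  Add :: "'m \<Rightarrow> 'm \<Rightarrow> 'm"
  Zer :: "'o \<Rightarrow> 'o \<Rightarrow> 'm"

record ('o, 'm) lincat = "('o, 'm) addcat" +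
  Scl :: "complex \<Rightarrow> 'm \<Rightarrow> 'm"

definition homset :: "('o, 'm, 'z) cat_scheme \<Rightarrow> 'o \<Rightarrow> 'o \<Rightarrow> 'm set" where
  "homset C a b = {f \<in> Arr C. Dom C f = a \<and> Cod C f = b}"

definition category :: "('o, 'm, 'z) cat_scheme \<Rightarrow> bool" where
  "category C \<longleftrightarrow>
     (\<forall>f\<in>Arr C. Dom C f \<in> Obj C \<and> Cod C f \<in> Obj C) \<and>
     (\<forall>a\<in>Obj C. Idn C a \<in> homset C a a) \<and>
     (\<forall>f\<in>Arr C. \<forall>g\<in>Arr C. Dom C g = Cod C f \<longrightarrow> Cmp C g f \<in> homset C (Dom C f) (Cod C g)) \<and>
     (\<forall>f\<in>Arr C. Cmp C f (Idn C (Dom C f)) = f \<and> Cmp C (Idn C (Cod C f)) f = f) \<and>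
     (\<forall>f\<in>Arr C. \<forall>g\<in>Arr C. \<forall>h\<in>Arr C. Dom C g = Cod C f \<longrightarrow> Dom C h = Cod C g \<longrightarrow>
        Cmp C h (Cmp C g f) = Cmp C (Cmp C h g) f)"

definition inverse_arrows :: "('o, 'm, 'z) cat_scheme \<Rightarrow> 'm \<Rightarrow> 'm \<Rightarrow> bool" where
  "inverse_arrows C f g \<longleftrightarrow> f \<in> Arr C \<and> g \<in> homset C (Cod C f) (Dom C f) \<and>
     Cmp C g f = Idn C (Dom C f) \<and> Cmp C f g = Idn C (Cod C f)"

definition is_iso :: "('o, 'm, 'z) cat_scheme \<Rightarrow> 'm \<Rightarrow> bool" where
  "is_iso C f \<longleftrightarrow> (\<exists>g. inverse_arrows C f g)"

definition cat_inv :: "('o, 'm, 'z) cat_scheme \<Rightarrow> 'm \<Rightarrow> 'm" where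
  "cat_inv C f = (THE g. inverse_arrows C f g)"

definition isomorphic_obj :: "('o, 'm, 'z) cat_scheme \<Rightarrow> 'o \<Rightarrow> 'o \<Rightarrow> bool" where
  "isomorphic_obj C a b \<longleftrightarrow> (\<exists>f\<in>homset C a b. is_iso C f)"

definition full_sub :: "('o, 'm, 'z) cat_scheme \<Rightarrow> ('o \<Rightarrow> bool) \<Rightarrow> ('o, 'm, 'z) cat_scheme" where
  "full_sub C P = C\<lparr>Obj := {a \<in> Obj C. P a}, Arr := {f \<in> Arr C. P (Dom C f) \<and> P (Cod C f)}\<rparr>"

definition is_zero_obj :: "('o, 'm, 'z) cat_scheme \<Rightarrow> 'o \<Rightarrow> bool" where
  "is_zero_obj C a \<longleftrightarrow> a \<in> Obj C \<and>
     (\<forall>b\<in>Obj C. (\<exists>!f. f \<in> homset C a b) \<and> (\<exists>!f. f \<in> homset C b a))"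

record ('a, 'b, 'c, 'd) fctr =
  fo :: "'a \<Rightarrow> 'c"
  fm :: "'b \<Rightarrow> 'd"

definition is_functor ::
  "('a, 'b, 'y) cat_scheme \<Rightarrow> ('c, 'd, 'z) cat_scheme \<Rightarrow> ('a, 'b, 'c, 'd) fctr \<Rightarrow> bool" where
  "is_functor C D F \<longleftrightarrow>
     (\<forall>a\<in>Obj C. fo F a \<in> Obj D \<and> fm F (Idn C a) = Idn D (fo F a)) \<and>
     (\<forall>f\<in>Arr C. fm F f \<in> homset D (fo F (Dom C f)) (fo F (Cod C f))) \<and>
     (\<forall>f\<in>Arr C. \<forall>g\<in>Arr C. Dom C g = Cod C f \<longrightarrow> fm F (Cmp C g f) = Cmp D (fm F g) (fm F f))"

text \<open>Functors are not required to be normalised outside the objects and arrows of their source.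
  Hence composition is plain function composition, strictly associative and unital.\<close>

definition idF :: "('a, 'b, 'a, 'b) fctr" where
  "idF = \<lparr>fo = (\<lambda>a. a), fm = (\<lambda>f. f)\<rparr>"

definition fcmp :: "('c, 'd, 'e, 'f) fctr \<Rightarrow> ('a, 'b, 'c, 'd) fctr \<Rightarrow> ('a, 'b, 'e, 'f) fctr" where
  "fcmp G F = \<lparr>fo = (\<lambda>a. fo G (fo F a)), fm = (\<lambda>f. fm G (fm F f))\<rparr>"

record ('a, 'b, 'c, 'd) ntr =
  nsrc :: "('a, 'b, 'c, 'd) fctr"
  ntgt :: "('a, 'b, 'c, 'd) fctr"
  nt :: "'a \<Rightarrow> 'd"

text \<open>Components of natural transformations are normalised to \<^const>\<open>undefined\<close> off the objects, so
  that equality of natural transformations is componentwise equality.\<close>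

definition is_nat ::
  "('a, 'b, 'y) cat_scheme \<Rightarrow> ('c, 'd, 'z) cat_scheme \<Rightarrow> ('a, 'b, 'c, 'd) ntr \<Rightarrow> bool" where
  "is_nat C D \<tau> \<longleftrightarrow> is_functor C D (nsrc \<tau>) \<and> is_functor C D (ntgt \<tau>) \<and>
     nt \<tau> \<in> extensional (Obj C) \<and>
     (\<forall>a\<in>Obj C. nt \<tau> a \<in> homset D (fo (nsrc \<tau>) a) (fo (ntgt \<tau>) a)) \<and>
     (\<forall>f\<in>Arr C. Cmp D (nt \<tau> (Cod C f)) (fm (nsrc \<tau>) f) = Cmp D (fm (ntgt \<tau>) f) (nt \<tau> (Dom C f)))"

definition nt_id ::
  "('a, 'b, 'y) cat_scheme \<Rightarrow> ('c, 'd, 'z) cat_scheme \<Rightarrow> ('a, 'b, 'c, 'd) fctr \<Rightarrow>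
   ('a, 'b, 'c, 'd) ntr" where
  "nt_id C D F = \<lparr>nsrc = F, ntgt = F, nt = (\<lambda>a\<in>Obj C. Idn D (fo F a))\<rparr>"

definition vcomp ::
  "('a, 'b, 'y) cat_scheme \<Rightarrow> ('c, 'd, 'z) cat_scheme \<Rightarrow> ('a, 'b, 'c, 'd) ntr \<Rightarrow>
   ('a, 'b, 'c, 'd) ntr \<Rightarrow> ('a, 'b, 'c, 'd) ntr" where
  "vcomp C D \<tau> \<sigma> = \<lparr>nsrc = nsrc \<sigma>, ntgt = ntgt \<tau>, nt = (\<lambda>a\<in>Obj C. Cmp D (nt \<tau> a) (nt \<sigma> a))\<rparr>"

definition nt_inv ::
  "('a, 'b, 'y) cat_scheme \<Rightarrow> ('c, 'd, 'z) cat_scheme \<Rightarrow> ('a, 'b, 'c, 'd) ntr \<Rightarrow>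
   ('a, 'b, 'c, 'd) ntr" where
  "nt_inv C D \<tau> = \<lparr>nsrc = ntgt \<tau>, ntgt = nsrc \<tau>, nt = (\<lambda>a\<in>Obj C. cat_inv D (nt \<tau> a))\<rparr>"

definition whisk_l ::
  "('a, 'b, 'y) cat_scheme \<Rightarrow> ('c, 'd, 'e, 'f) fctr \<Rightarrow> ('a, 'b, 'c, 'd) ntr \<Rightarrow>
   ('a, 'b, 'e, 'f) ntr" where
  "whisk_l C H \<tau> =
     \<lparr>nsrc = fcmp H (nsrc \<tau>), ntgt = fcmp H (ntgt \<tau>), nt = (\<lambda>a\<in>Obj C. fm H (nt \<tau> a))\<rparr>"

definition whisk_r ::
  "('a, 'b, 'y) cat_scheme \<Rightarrow> ('c, 'd, 'e, 'f) ntr \<Rightarrow> ('a, 'b, 'c, 'd) fctr \<Rightarrow>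
   ('a, 'b, 'e, 'f) ntr" where
  "whisk_r C \<tau> K =
     \<lparr>nsrc = fcmp (nsrc \<tau>) K, ntgt = fcmp (ntgt \<tau>) K, nt = (\<lambda>a\<in>Obj C. nt \<tau> (fo K a))\<rparr>"

definition is_equivalence ::
  "('a, 'b, 'y) cat_scheme \<Rightarrow> ('c, 'd, 'z) cat_scheme \<Rightarrow> ('a, 'b, 'c, 'd) fctr \<Rightarrow> bool" where
  "is_equivalence C D F \<longleftrightarrow> category C \<and> category D \<and> is_functor C D F \<and>
     (\<exists>G \<eta> \<epsilon>. is_functor D C G \<and>
        is_nat C C \<eta> \<and> nsrc \<eta> = idF \<and> ntgt \<eta> = fcmp G F \<and> (\<forall>a\<in>Obj C. is_iso C (nt \<eta> a)) \<and>
        is_nat D D \<epsilon> \<and> nsrc \<epsilon> = fcmp F G \<and> ntgt \<epsilon> = idF \<and> (\<forall>b\<in>Obj D. is_iso D (nt \<epsilon> b)))"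

text \<open>Functor category, with the pointwise linear structure inherited from the target.\<close>

definition fun_cat ::
  "('a, 'b, 'y) cat_scheme \<Rightarrow> ('c, 'd, 'z) lincat_scheme \<Rightarrow>
   (('a, 'b, 'c, 'd) fctr, ('a, 'b, 'c, 'd) ntr) lincat" where
  "fun_cat C D = \<lparr>
     Obj = {F. is_functor C D F},
     Arr = {\<tau>. is_nat C D \<tau>},
     Dom = nsrc,
     Cod = ntgt,
     Idn = nt_id C D,
     Cmp = vcomp C D,
     Add = (\<lambda>\<tau> \<sigma>. \<lparr>nsrc = nsrc \<tau>, ntgt = ntgt \<tau>, nt = (\<lambda>a\<in>Obj C. Add D (nt \<tau> a) (nt \<sigma> a))\<rparr>),
     Zer = (\<lambda>F G. \<lparr>nsrc = F, ntgt = G, nt = (\<lambda>a\<in>Obj C. Zer D (fo F a) (fo G a))\<rparr>),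
     Scl = (\<lambda>r \<tau>. \<lparr>nsrc = nsrc \<tau>, ntgt = ntgt \<tau>, nt = (\<lambda>a\<in>Obj C. Scl D r (nt \<tau> a))\<rparr>)\<rparr>"

definition parallel_arrows :: "('o, 'm, 'z) cat_scheme \<Rightarrow> 'm \<Rightarrow> 'm \<Rightarrow> bool" where
  "parallel_arrows C f g \<longleftrightarrow> f \<in> Arr C \<and> g \<in> Arr C \<and> Dom C f = Dom C g \<and> Cod C f = Cod C g"

definition additive_functor ::
  "('a, 'b, 'y) addcat_scheme \<Rightarrow> ('c, 'd, 'z) addcat_scheme \<Rightarrow> ('a, 'b, 'c, 'd) fctr \<Rightarrow> bool" where
  "additive_functor C D F \<longleftrightarrow> is_functor C D F \<and>
     (\<forall>f g. parallel_arrows C f g \<longrightarrow> fm F (Add C f g) = Add D (fm F f) (fm F g)) \<and>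
     (\<forall>a\<in>Obj C. \<forall>b\<in>Obj C. fm F (Zer C a b) = Zer D (fo F a) (fo F b))"

definition linear_functor ::
  "('a, 'b, 'y) lincat_scheme \<Rightarrow> ('c, 'd, 'z) lincat_scheme \<Rightarrow> ('a, 'b, 'c, 'd) fctr \<Rightarrow> bool" where
  "linear_functor C D F \<longleftrightarrow> additive_functor C D F \<and>
     (\<forall>r. \<forall>f\<in>Arr C. fm F (Scl C r f) = Scl D r (fm F f))"

subsection \<open>Monoidal categories and strong monoidal functors\<close>

record ('o, 'm) tens =
  tob :: "'o \<Rightarrow> 'o \<Rightarrow> 'o"
  tar :: "'m \<Rightarrow> 'm \<Rightarrow> 'm"
  tun :: "'o"
  asc :: "'o \<Rightarrow> 'o \<Rightarrow> 'o \<Rightarrow> 'm"  \<comment> \<open>\<open>(X \<otimes> Y) \<otimes> Z \<rightarrow> X \<otimes> (Y \<otimes> Z)\<close>\<close>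
  lun :: "'o \<Rightarrow> 'm"              \<comment> \<open>\<open>I \<otimes> X \<rightarrow> X\<close>\<close>
  run :: "'o \<Rightarrow> 'm"              \<comment> \<open>\<open>X \<otimes> I \<rightarrow> X\<close>\<close>

definition monoidal_cat :: "('o, 'm, 'z) cat_scheme \<Rightarrow> ('o, 'm) tens \<Rightarrow> bool" where
  "monoidal_cat C T \<longleftrightarrow> category C \<and> tun T \<in> Obj C \<and>
     (\<forall>X\<in>Obj C. \<forall>Y\<in>Obj C. tob T X Y \<in> Obj C \<and> tar T (Idn C X) (Idn C Y) = Idn C (tob T X Y)) \<and>
     (\<forall>f\<in>Arr C. \<forall>g\<in>Arr C.
        tar T f g \<in> homset C (tob T (Dom C f) (Dom C g)) (tob T (Cod C f) (Cod C g))) \<and>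
     (\<forall>f\<in>Arr C. \<forall>f'\<in>Arr C. \<forall>g\<in>Arr C. \<forall>g'\<in>Arr C. Dom C f' = Cod C f \<longrightarrow> Dom C g' = Cod C g \<longrightarrow>
        tar T (Cmp C f' f) (Cmp C g' g) = Cmp C (tar T f' g') (tar T f g)) \<and>
     (\<forall>X\<in>Obj C. \<forall>Y\<in>Obj C. \<forall>Z\<in>Obj C.
        asc T X Y Z \<in> homset C (tob T (tob T X Y) Z) (tob T X (tob T Y Z)) \<and>
        is_iso C (asc T X Y Z)) \<and>
     (\<forall>X\<in>Obj C.
        lun T X \<in> homset C (tob T (tun T) X) X \<and> is_iso C (lun T X) \<and>
        run T X \<in> homset C (tob T X (tun T)) X \<and> is_iso C (run T X)) \<and>
     (\<forall>f\<in>Arr C. \<forall>g\<in>Arr C. \<forall>h\<in>Arr C.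
        Cmp C (asc T (Cod C f) (Cod C g) (Cod C h)) (tar T (tar T f g) h) =
        Cmp C (tar T f (tar T g h)) (asc T (Dom C f) (Dom C g) (Dom C h))) \<and>
     (\<forall>f\<in>Arr C.
        Cmp C (lun T (Cod C f)) (tar T (Idn C (tun T)) f) = Cmp C f (lun T (Dom C f)) \<and>
        Cmp C (run T (Cod C f)) (tar T f (Idn C (tun T))) = Cmp C f (run T (Dom C f))) \<and>
     (\<forall>W\<in>Obj C. \<forall>X\<in>Obj C. \<forall>Y\<in>Obj C. \<forall>Z\<in>Obj C.
        Cmp C (tar T (Idn C W) (asc T X Y Z))
          (Cmp C (asc T W (tob T X Y) Z) (tar T (asc T W X Y) (Idn C Z))) =
        Cmp C (asc T W X (tob T Y Z)) (asc T (tob T W X) Y Z)) \<and>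
     (\<forall>X\<in>Obj C. \<forall>Y\<in>Obj C.
        Cmp C (tar T (Idn C X) (lun T Y)) (asc T X (tun T) Y) = tar T (run T X) (Idn C Y))"

definition strong_monoidal_functor ::
  "('a, 'b, 'y) cat_scheme \<Rightarrow> ('a, 'b) tens \<Rightarrow> ('c, 'd, 'z) cat_scheme \<Rightarrow> ('c, 'd) tens \<Rightarrow>
   ('a, 'b, 'c, 'd) fctr \<Rightarrow> ('a \<Rightarrow> 'a \<Rightarrow> 'd) \<Rightarrow> 'd \<Rightarrow> bool" where
  "strong_monoidal_functor C T D U F \<phi> \<phi>0 \<longleftrightarrow>
     monoidal_cat C T \<and> monoidal_cat D U \<and> is_functor C D F \<and>
     \<phi>0 \<in> homset D (tun U) (fo F (tun T)) \<and> is_iso D \<phi>0 \<and>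
     (\<forall>X\<in>Obj C. \<forall>Y\<in>Obj C.
        \<phi> X Y \<in> homset D (tob U (fo F X) (fo F Y)) (fo F (tob T X Y)) \<and> is_iso D (\<phi> X Y)) \<and>
     (\<forall>f\<in>Arr C. \<forall>g\<in>Arr C.
        Cmp D (\<phi> (Cod C f) (Cod C g)) (tar U (fm F f) (fm F g)) =
        Cmp D (fm F (tar T f g)) (\<phi> (Dom C f) (Dom C g))) \<and>
     (\<forall>X\<in>Obj C. \<forall>Y\<in>Obj C. \<forall>Z\<in>Obj C.
        Cmp D (fm F (asc T X Y Z))
          (Cmp D (\<phi> (tob T X Y) Z) (tar U (\<phi> X Y) (Idn D (fo F Z)))) =
        Cmp D (\<phi> X (tob T Y Z))
          (Cmp D (tar U (Idn D (fo F X)) (\<phi> Y Z)) (asc U (fo F X) (fo F Y) (fo F Z)))) \<and>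
     (\<forall>X\<in>Obj C.
        Cmp D (fm F (lun T X)) (Cmp D (\<phi> (tun T) X) (tar U \<phi>0 (Idn D (fo F X)))) =
          lun U (fo F X) \<and>
        Cmp D (fm F (run T X)) (Cmp D (\<phi> X (tun T)) (tar U (Idn D (fo F X)) \<phi>0)) =
          run U (fo F X))"

text \<open>The category of linear endofunctors of \<open>C\<close> and natural transformations; its tensor product
  is composition of functors, resp. horizontal composition of natural transformations.\<close>

definition End_cat ::
  "('a, 'b, 'z) lincat_scheme \<Rightarrow> (('a, 'b, 'a, 'b) fctr, ('a, 'b, 'a, 'b) ntr) lincat" where
  "End_cat C = full_sub (fun_cat C C) (linear_functor C C)"

definition End_tens ::
  "('a, 'b, 'z) lincat_scheme \<Rightarrow> (('a, 'b, 'a, 'b) fctr, ('a, 'b, 'a, 'b) ntr) tens" where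
  "End_tens C = \<lparr>
     tob = fcmp,
     tar = (\<lambda>\<sigma> \<tau>. vcomp C C (whisk_r C \<sigma> (ntgt \<tau>)) (whisk_l C (nsrc \<sigma>) \<tau>)),
     tun = idF,
     asc = (\<lambda>F G H. nt_id C C (fcmp F (fcmp G H))),
     lun = nt_id C C,
     run = nt_id C C\<rparr>"

section \<open>The category \<open>H'\<close>\<close>

text \<open>\<open>H'\<close> is constructed syntactically: objects are formal expressions; arrows are typed terms
  modulo the smallest congruence containing the axioms of a monoidal category with zero object and
  biproducts, bilinearity, and the defining relations.  As \<open>H'\<close> is not taken to be strict, the
  relations have the associators and unitors that are suppressed on paper.\<close>

datatype hobj = HI | HQp | HQm | HTen hobj hobj (infixr "\<otimes>\<^sub>h" 70) | HZero
  | HSum hobj hobj (infixr "\<oplus>\<^sub>h" 65)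

datatype hgen = gen_c | gen_d | gen_c' | gen_d' | gen_u | gen_v | gen_x | gen_y

datatype hterm =
    HId hobj
  | HCmp hterm hterm (infixr "\<cdot>\<^sub>h" 60)
  | HTar hterm hterm (infixr "\<otimes>\<^sub>a" 70)
  | HAsc hobj hobj hobj | HAscI hobj hobj hobj
  | HLun hobj | HLunI hobj
  | HRun hobj | HRunI hobj
  | HZer hobj hobj
  | HAdd hterm hterm (infixl "+\<^sub>h" 55)
  | HIn1 hobj hobj | HIn2 hobj hobj
  | HPr1 hobj hobj | HPr2 hobj hobj
  | HGen hgen

fun gen_dom :: "hgen \<Rightarrow> hobj" where
  "gen_dom gen_c = HI"
| "gen_dom gen_d = HQm \<otimes>\<^sub>h HQp"
| "gen_dom gen_c' = HI"
| "gen_dom gen_d' = HQp \<otimes>\<^sub>h HQm"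
| "gen_dom gen_u = HQp \<otimes>\<^sub>h HQp"
| "gen_dom gen_v = HQm \<otimes>\<^sub>h HQm"
| "gen_dom gen_x = HQp \<otimes>\<^sub>h HQm"
| "gen_dom gen_y = HQm \<otimes>\<^sub>h HQp"

fun gen_cod :: "hgen \<Rightarrow> hobj" where
  "gen_cod gen_c = HQm \<otimes>\<^sub>h HQp"
| "gen_cod gen_d = HI"
| "gen_cod gen_c' = HQp \<otimes>\<^sub>h HQm"
| "gen_cod gen_d' = HI"
| "gen_cod gen_u = HQp \<otimes>\<^sub>h HQp"
| "gen_cod gen_v = HQm \<otimes>\<^sub>h HQm"
| "gen_cod gen_x = HQm \<otimes>\<^sub>h HQp"
| "gen_cod gen_y = HQp \<otimes>\<^sub>h HQm"

fun hdom :: "hterm \<Rightarrow> hobj" where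
  "hdom (HId X) = X"
| "hdom (g \<cdot>\<^sub>h f) = hdom f"
| "hdom (f \<otimes>\<^sub>a g) = hdom f \<otimes>\<^sub>h hdom g"
| "hdom (HAsc X Y Z) = (X \<otimes>\<^sub>h Y) \<otimes>\<^sub>h Z"
| "hdom (HAscI X Y Z) = X \<otimes>\<^sub>h (Y \<otimes>\<^sub>h Z)"
| "hdom (HLun X) = HI \<otimes>\<^sub>h X"
| "hdom (HLunI X) = X"
| "hdom (HRun X) = X \<otimes>\<^sub>h HI"
| "hdom (HRunI X) = X"
| "hdom (HZer X Y) = X"
| "hdom (f +\<^sub>h g) = hdom f"
| "hdom (HIn1 X Y) = X"
| "hdom (HIn2 X Y) = Y"
| "hdom (HPr1 X Y) = X \<oplus>\<^sub>h Y"
| "hdom (HPr2 X Y) = X \<oplus>\<^sub>h Y"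
| "hdom (HGen k) = gen_dom k"

fun hcod :: "hterm \<Rightarrow> hobj" where
  "hcod (HId X) = X"
| "hcod (g \<cdot>\<^sub>h f) = hcod g"
| "hcod (f \<otimes>\<^sub>a g) = hcod f \<otimes>\<^sub>h hcod g"
| "hcod (HAsc X Y Z) = X \<otimes>\<^sub>h (Y \<otimes>\<^sub>h Z)"
| "hcod (HAscI X Y Z) = (X \<otimes>\<^sub>h Y) \<otimes>\<^sub>h Z"
| "hcod (HLun X) = X"
| "hcod (HLunI X) = HI \<otimes>\<^sub>h X"
| "hcod (HRun X) = X"
| "hcod (HRunI X) = X \<otimes>\<^sub>h HI"
| "hcod (HZer X Y) = Y"
| "hcod (f +\<^sub>h g) = hcod f"
| "hcod (HIn1 X Y) = X \<oplus>\<^sub>h Y"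
| "hcod (HIn2 X Y) = X \<oplus>\<^sub>h Y"
| "hcod (HPr1 X Y) = X"
| "hcod (HPr2 X Y) = Y"
| "hcod (HGen k) = gen_cod k"

fun hwf :: "hterm \<Rightarrow> bool" where
  "hwf (g \<cdot>\<^sub>h f) \<longleftrightarrow> hwf g \<and> hwf f \<and> hdom g = hcod f"
| "hwf (f \<otimes>\<^sub>a g) \<longleftrightarrow> hwf f \<and> hwf g"
| "hwf (f +\<^sub>h g) \<longleftrightarrow> hwf f \<and> hwf g \<and> hdom f = hdom g \<and> hcod f = hcod g"
| "hwf _ \<longleftrightarrow> True"

abbreviation "hgc \<equiv> HGen gen_c"
abbreviation "hgd \<equiv> HGen gen_d"
abbreviation "hgc' \<equiv> HGen gen_c'"
abbreviation "hgd' \<equiv> HGen gen_d'"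
abbreviation "hgu \<equiv> HGen gen_u"
abbreviation "hgv \<equiv> HGen gen_v"
abbreviation "hgx \<equiv> HGen gen_x"
abbreviation "hgy \<equiv> HGen gen_y"
abbreviation "h1p \<equiv> HId HQp"
abbreviation "h1m \<equiv> HId HQm"

text \<open>\<open>hu1\<close> and \<open>hu2\<close> are \<open>u \<otimes> 1\<close> and \<open>1 \<otimes> u\<close> as endomorphisms of \<open>(Q\<^sub>+ \<otimes> Q\<^sub>+) \<otimes> Q\<^sub>+\<close>.\<close>

abbreviation "hu1 \<equiv> hgu \<otimes>\<^sub>a h1p"
abbreviation "hu2 \<equiv> HAscI HQp HQp HQp \<cdot>\<^sub>h (h1p \<otimes>\<^sub>a hgu) \<cdot>\<^sub>h HAsc HQp HQp HQp"

inductive heq :: "hterm \<Rightarrow> hterm \<Rightarrow> bool" (infix "\<approx>\<^sub>h" 50) where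
  refl: "hwf f \<Longrightarrow> f \<approx>\<^sub>h f"
| sym: "f \<approx>\<^sub>h g \<Longrightarrow> g \<approx>\<^sub>h f"
| trans: "f \<approx>\<^sub>h g \<Longrightarrow> g \<approx>\<^sub>h h \<Longrightarrow> f \<approx>\<^sub>h h"
  \<comment> \<open>congruence\<close>
| cong_cmp: "g \<approx>\<^sub>h g' \<Longrightarrow> f \<approx>\<^sub>h f' \<Longrightarrow> hwf (g \<cdot>\<^sub>h f) \<Longrightarrow> g \<cdot>\<^sub>h f \<approx>\<^sub>h g' \<cdot>\<^sub>h f'"
| cong_tar: "f \<approx>\<^sub>h f' \<Longrightarrow> g \<approx>\<^sub>h g' \<Longrightarrow> f \<otimes>\<^sub>a g \<approx>\<^sub>h f' \<otimes>\<^sub>a g'"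
| cong_add: "f \<approx>\<^sub>h f' \<Longrightarrow> g \<approx>\<^sub>h g' \<Longrightarrow> hwf (f +\<^sub>h g) \<Longrightarrow> f +\<^sub>h g \<approx>\<^sub>h f' +\<^sub>h g'"
  \<comment> \<open>category\<close>
| cmp_id_right: "hwf f \<Longrightarrow> f \<cdot>\<^sub>h HId (hdom f) \<approx>\<^sub>h f"
| cmp_id_left: "hwf f \<Longrightarrow> HId (hcod f) \<cdot>\<^sub>h f \<approx>\<^sub>h f"
| cmp_assoc: "hwf (h \<cdot>\<^sub>h (g \<cdot>\<^sub>h f)) \<Longrightarrow> h \<cdot>\<^sub>h (g \<cdot>\<^sub>h f) \<approx>\<^sub>h (h \<cdot>\<^sub>h g) \<cdot>\<^sub>h f"
  \<comment> \<open>monoidal category\<close>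
| tar_id: "HId X \<otimes>\<^sub>a HId Y \<approx>\<^sub>h HId (X \<otimes>\<^sub>h Y)"
| tar_cmp: "hwf (f' \<cdot>\<^sub>h f) \<Longrightarrow> hwf (g' \<cdot>\<^sub>h g) \<Longrightarrow>
    (f' \<cdot>\<^sub>h f) \<otimes>\<^sub>a (g' \<cdot>\<^sub>h g) \<approx>\<^sub>h (f' \<otimes>\<^sub>a g') \<cdot>\<^sub>h (f \<otimes>\<^sub>a g)"
| asc_inv1: "HAscI X Y Z \<cdot>\<^sub>h HAsc X Y Z \<approx>\<^sub>h HId ((X \<otimes>\<^sub>h Y) \<otimes>\<^sub>h Z)"
| asc_inv2: "HAsc X Y Z \<cdot>\<^sub>h HAscI X Y Z \<approx>\<^sub>h HId (X \<otimes>\<^sub>h (Y \<otimes>\<^sub>h Z))"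
| lun_inv1: "HLunI X \<cdot>\<^sub>h HLun X \<approx>\<^sub>h HId (HI \<otimes>\<^sub>h X)"
| lun_inv2: "HLun X \<cdot>\<^sub>h HLunI X \<approx>\<^sub>h HId X"
| run_inv1: "HRunI X \<cdot>\<^sub>h HRun X \<approx>\<^sub>h HId (X \<otimes>\<^sub>h HI)"
| run_inv2: "HRun X \<cdot>\<^sub>h HRunI X \<approx>\<^sub>h HId X"
| asc_nat: "hwf f \<Longrightarrow> hwf g \<Longrightarrow> hwf h \<Longrightarrow>
    HAsc (hcod f) (hcod g) (hcod h) \<cdot>\<^sub>h ((f \<otimes>\<^sub>a g) \<otimes>\<^sub>a h) \<approx>\<^sub>h
    (f \<otimes>\<^sub>a (g \<otimes>\<^sub>a h)) \<cdot>\<^sub>h HAsc (hdom f) (hdom g) (hdom h)"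
| lun_nat: "hwf f \<Longrightarrow> HLun (hcod f) \<cdot>\<^sub>h (HId HI \<otimes>\<^sub>a f) \<approx>\<^sub>h f \<cdot>\<^sub>h HLun (hdom f)"
| run_nat: "hwf f \<Longrightarrow> HRun (hcod f) \<cdot>\<^sub>h (f \<otimes>\<^sub>a HId HI) \<approx>\<^sub>h f \<cdot>\<^sub>h HRun (hdom f)"
| pentagon: "(HId W \<otimes>\<^sub>a HAsc X Y Z) \<cdot>\<^sub>h HAsc W (X \<otimes>\<^sub>h Y) Z \<cdot>\<^sub>h (HAsc W X Y \<otimes>\<^sub>a HId Z) \<approx>\<^sub>h
    HAsc W X (Y \<otimes>\<^sub>h Z) \<cdot>\<^sub>h HAsc (W \<otimes>\<^sub>h X) Y Z"
| triangle: "(HId X \<otimes>\<^sub>a HLun Y) \<cdot>\<^sub>h HAsc X HI Y \<approx>\<^sub>h HRun X \<otimes>\<^sub>a HId Y"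
  \<comment> \<open>hom-sets are commutative monoids; composition and tensor are bilinear\<close>
| add_assoc: "hwf ((f +\<^sub>h g) +\<^sub>h h) \<Longrightarrow> (f +\<^sub>h g) +\<^sub>h h \<approx>\<^sub>h f +\<^sub>h (g +\<^sub>h h)"
| add_comm: "hwf (f +\<^sub>h g) \<Longrightarrow> f +\<^sub>h g \<approx>\<^sub>h g +\<^sub>h f"
| add_zero: "hwf f \<Longrightarrow> f +\<^sub>h HZer (hdom f) (hcod f) \<approx>\<^sub>h f"
| cmp_add_right: "hwf (h \<cdot>\<^sub>h (f +\<^sub>h g)) \<Longrightarrow> h \<cdot>\<^sub>h (f +\<^sub>h g) \<approx>\<^sub>h (h \<cdot>\<^sub>h f) +\<^sub>h (h \<cdot>\<^sub>h g)"
| cmp_add_left: "hwf ((f +\<^sub>h g) \<cdot>\<^sub>h h) \<Longrightarrow> (f +\<^sub>h g) \<cdot>\<^sub>h h \<approx>\<^sub>h (f \<cdot>\<^sub>h h) +\<^sub>h (g \<cdot>\<^sub>h h)"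
| cmp_zero_right: "hwf f \<Longrightarrow> f \<cdot>\<^sub>h HZer X (hdom f) \<approx>\<^sub>h HZer X (hcod f)"
| cmp_zero_left: "hwf f \<Longrightarrow> HZer (hcod f) Y \<cdot>\<^sub>h f \<approx>\<^sub>h HZer (hdom f) Y"
| tar_add_right: "hwf (h \<otimes>\<^sub>a (f +\<^sub>h g)) \<Longrightarrow> h \<otimes>\<^sub>a (f +\<^sub>h g) \<approx>\<^sub>h (h \<otimes>\<^sub>a f) +\<^sub>h (h \<otimes>\<^sub>a g)"
| tar_add_left: "hwf ((f +\<^sub>h g) \<otimes>\<^sub>a h) \<Longrightarrow> (f +\<^sub>h g) \<otimes>\<^sub>a h \<approx>\<^sub>h (f \<otimes>\<^sub>a h) +\<^sub>h (g \<otimes>\<^sub>a h)"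
| tar_zero_right: "hwf f \<Longrightarrow> f \<otimes>\<^sub>a HZer X Y \<approx>\<^sub>h HZer (hdom f \<otimes>\<^sub>h X) (hcod f \<otimes>\<^sub>h Y)"
| tar_zero_left: "hwf f \<Longrightarrow> HZer X Y \<otimes>\<^sub>a f \<approx>\<^sub>h HZer (X \<otimes>\<^sub>h hdom f) (Y \<otimes>\<^sub>h hcod f)"
  \<comment> \<open>zero object and biproducts\<close>
| zero_obj: "HId HZero \<approx>\<^sub>h HZer HZero HZero"
| pr1_in1: "HPr1 X Y \<cdot>\<^sub>h HIn1 X Y \<approx>\<^sub>h HId X"
| pr2_in2: "HPr2 X Y \<cdot>\<^sub>h HIn2 X Y \<approx>\<^sub>h HId Y"
| pr1_in2: "HPr1 X Y \<cdot>\<^sub>h HIn2 X Y \<approx>\<^sub>h HZer Y X"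
| pr2_in1: "HPr2 X Y \<cdot>\<^sub>h HIn1 X Y \<approx>\<^sub>h HZer X Y"
| biprod: "(HIn1 X Y \<cdot>\<^sub>h HPr1 X Y) +\<^sub>h (HIn2 X Y \<cdot>\<^sub>h HPr2 X Y) \<approx>\<^sub>h HId (X \<oplus>\<^sub>h Y)"
  \<comment> \<open>defining relations\<close>
| rel_cd_xy: "(hgc \<cdot>\<^sub>h hgd) +\<^sub>h (hgx \<cdot>\<^sub>h hgy) \<approx>\<^sub>h HId (HQm \<otimes>\<^sub>h HQp)"
| rel_yx: "hgy \<cdot>\<^sub>h hgx \<approx>\<^sub>h HId (HQp \<otimes>\<^sub>h HQm)"
| rel_dc: "hgd \<cdot>\<^sub>h hgc \<approx>\<^sub>h HId HI"
| rel_duc: "HLun HQp \<cdot>\<^sub>h (hgd \<otimes>\<^sub>a h1p) \<cdot>\<^sub>h HAscI HQm HQp HQp \<cdot>\<^sub>h (h1m \<otimes>\<^sub>a hgu) \<cdot>\<^sub>h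
    HAsc HQm HQp HQp \<cdot>\<^sub>h (hgc \<otimes>\<^sub>a h1p) \<cdot>\<^sub>h HLunI HQp \<approx>\<^sub>h HZer HQp HQp"
| rel_uu: "hgu \<cdot>\<^sub>h hgu \<approx>\<^sub>h HId (HQp \<otimes>\<^sub>h HQp)"
| rel_vv: "hgv \<cdot>\<^sub>h hgv \<approx>\<^sub>h HId (HQm \<otimes>\<^sub>h HQm)"
| rel_braid: "hu1 \<cdot>\<^sub>h hu2 \<cdot>\<^sub>h hu1 \<approx>\<^sub>h hu2 \<cdot>\<^sub>h hu1 \<cdot>\<^sub>h hu2"
| rel_zigzag1: "HLun HQp \<cdot>\<^sub>h (hgd' \<otimes>\<^sub>a h1p) \<cdot>\<^sub>h HAscI HQp HQm HQp \<cdot>\<^sub>h (h1p \<otimes>\<^sub>a hgc) \<cdot>\<^sub>h HRunI HQp \<approx>\<^sub>h h1p"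
| rel_zigzag2: "HRun HQm \<cdot>\<^sub>h (h1m \<otimes>\<^sub>a hgd') \<cdot>\<^sub>h HAsc HQm HQp HQm \<cdot>\<^sub>h (hgc \<otimes>\<^sub>a h1m) \<cdot>\<^sub>h HLunI HQm \<approx>\<^sub>h h1m"
| rel_zigzag3: "HLun HQm \<cdot>\<^sub>h (hgd \<otimes>\<^sub>a h1m) \<cdot>\<^sub>h HAscI HQm HQp HQm \<cdot>\<^sub>h (h1m \<otimes>\<^sub>a hgc') \<cdot>\<^sub>h HRunI HQm \<approx>\<^sub>h h1m"
| rel_zigzag4: "HRun HQp \<cdot>\<^sub>h (h1p \<otimes>\<^sub>a hgd) \<cdot>\<^sub>h HAsc HQp HQm HQp \<cdot>\<^sub>h (hgc' \<otimes>\<^sub>a h1p) \<cdot>\<^sub>h HLunI HQp \<approx>\<^sub>h h1p"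

definition hcls :: "hterm \<Rightarrow> hterm set" where
  "hcls f = {g. f \<approx>\<^sub>h g}"

definition hrep :: "hterm set \<Rightarrow> hterm" where
  "hrep A = (SOME f. f \<in> A)"

definition Hp :: "(hobj, hterm set) addcat" where
  "Hp = \<lparr>
     Obj = UNIV,
     Arr = {hcls f | f. hwf f},
     Dom = (\<lambda>A. hdom (hrep A)),
     Cod = (\<lambda>A. hcod (hrep A)),
     Idn = (\<lambda>X. hcls (HId X)),
     Cmp = (\<lambda>A B. hcls (hrep A \<cdot>\<^sub>h hrep B)),
     Add = (\<lambda>A B. hcls (hrep A +\<^sub>h hrep B)),
     Zer = (\<lambda>X Y. hcls (HZer X Y))\<rparr>"

definition Hp_tens :: "(hobj, hterm set) tens" where
  "Hp_tens = \<lparr>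
     tob = HTen,
     tar = (\<lambda>A B. hcls (hrep A \<otimes>\<^sub>a hrep B)),
     tun = HI,
     asc = (\<lambda>X Y Z. hcls (HAsc X Y Z)),
     lun = (\<lambda>X. hcls (HLun X)),
     run = (\<lambda>X. hcls (HRun X))\<rparr>"

section \<open>Representations of groupoids, restriction and induction\<close>

text \<open>Finite-dimensional complex vector spaces, on the skeleton given by the spaces of column
  vectors: objects are dimensions, arrows are matrices.\<close>

definition matcat :: "(nat, complex mat) lincat" where
  "matcat = \<lparr>
     Obj = UNIV,
     Arr = UNIV,
     Dom = dim_col,
     Cod = dim_row,
     Idn = (\<lambda>n. 1\<^sub>m n),
     Cmp = (*),
     Add = (+),
     Zer = (\<lambda>n m. 0\<^sub>m m n),
     Scl = (\<cdot>\<^sub>m)\<rparr>"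

type_synonym ('x, 'xm) rep = "('x, 'xm, nat, complex mat) fctr"
type_synonym ('x, 'xm) intw = "('x, 'xm, nat, complex mat) ntr"

text \<open>\<open>Rep X\<close>: functors from \<open>X\<close> to vector spaces, vanishing outside finitely many isomorphism
  classes.  The support condition is void if \<open>X\<close> has finitely many classes; for the groupoid of
  finite sets it singles out the colimit of the categories of representations of the groupoids of
  sets with at most \<open>n\<close> elements, i.e. finite direct sums of irreducibles.\<close>

definition fin_supp :: "('x, 'xm, 'z) cat_scheme \<Rightarrow> ('x, 'xm) rep \<Rightarrow> bool" where
  "fin_supp X V \<longleftrightarrow> (\<exists>K. finite K \<and> K \<subseteq> Obj X \<and>
     (\<forall>x\<in>Obj X. fo V x \<noteq> 0 \<longrightarrow> (\<exists>k\<in>K. isomorphic_obj X k x)))"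

definition Rep :: "('x, 'xm, 'z) cat_scheme \<Rightarrow> (('x, 'xm) rep, ('x, 'xm) intw) lincat" where
  "Rep X = full_sub (fun_cat X matcat) (fin_supp X)"

text \<open>Restriction \<open>F\<^sub>*\<close> along \<open>F : X \<rightarrow> A\<close>.\<close>

definition Res :: "('x, 'xm, 'z) cat_scheme \<Rightarrow> ('x, 'xm, 'a, 'am) fctr \<Rightarrow>
  (('a, 'am) rep, ('a, 'am) intw, ('x, 'xm) rep, ('x, 'xm) intw) fctr" where
  "Res X F = \<lparr>fo = (\<lambda>V. fcmp V F), fm = (\<lambda>\<tau>. whisk_r X \<tau> F)\<rparr>"

text \<open>Induction \<open>G\<^sup>*\<close> along \<open>G : X \<rightarrow> B\<close> is the pointwise left Kan extension: \<open>(G\<^sup>* V) b\<close> is a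
  (chosen) colimit of \<open>V x\<close> over the pairs \<open>(x, g : G x \<rightarrow> b)\<close>.  A cocone is a family
  \<open>\<iota> x g : V x \<rightarrow> n\<close>.\<close>

definition ind_cocone ::
  "('x, 'xm, 'y) cat_scheme \<Rightarrow> ('b, 'bm, 'z) cat_scheme \<Rightarrow> ('x, 'xm, 'b, 'bm) fctr \<Rightarrow>
   ('x, 'xm) rep \<Rightarrow> 'b \<Rightarrow> nat \<Rightarrow> ('x \<Rightarrow> 'bm \<Rightarrow> complex mat) \<Rightarrow> bool" where
  "ind_cocone X B G V b n \<iota> \<longleftrightarrow>
     (\<forall>x\<in>Obj X. \<forall>g\<in>homset B (fo G x) b. \<iota> x g \<in> carrier_mat n (fo V x)) \<and>
     (\<forall>k\<in>Arr X. \<forall>g\<in>homset B (fo G (Cod X k)) b.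
        \<iota> (Cod X k) g * fm V k = \<iota> (Dom X k) (Cmp B g (fm G k)))"

definition ind_colimit ::
  "('x, 'xm, 'y) cat_scheme \<Rightarrow> ('b, 'bm, 'z) cat_scheme \<Rightarrow> ('x, 'xm, 'b, 'bm) fctr \<Rightarrow>
   ('x, 'xm) rep \<Rightarrow> 'b \<Rightarrow> nat \<Rightarrow> ('x \<Rightarrow> 'bm \<Rightarrow> complex mat) \<Rightarrow> bool" where
  "ind_colimit X B G V b n \<iota> \<longleftrightarrow> ind_cocone X B G V b n \<iota> \<and>
     (\<forall>m \<theta>. ind_cocone X B G V b m \<theta> \<longrightarrow>
        (\<exists>!h. h \<in> carrier_mat m n \<and>
           (\<forall>x\<in>Obj X. \<forall>g\<in>homset B (fo G x) b. h * \<iota> x g = \<theta> x g)))"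

definition ind_choice ::
  "('x, 'xm, 'y) cat_scheme \<Rightarrow> ('b, 'bm, 'z) cat_scheme \<Rightarrow> ('x, 'xm, 'b, 'bm) fctr \<Rightarrow>
   ('x, 'xm) rep \<Rightarrow> 'b \<Rightarrow> nat \<times> ('x \<Rightarrow> 'bm \<Rightarrow> complex mat)" where
  "ind_choice X B G V b = (SOME (n, \<iota>). ind_colimit X B G V b n \<iota>)"

definition "ind_dim X B G V b = fst (ind_choice X B G V b)"

definition "ind_inj X B G V b = snd (ind_choice X B G V b)"

text \<open>The map out of the colimit into an \<open>m\<close>-dimensional space induced by a cocone \<open>\<theta>\<close>.\<close>

definition ind_desc ::
  "('x, 'xm, 'y) cat_scheme \<Rightarrow> ('b, 'bm, 'z) cat_scheme \<Rightarrow> ('x, 'xm, 'b, 'bm) fctr \<Rightarrow>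
   ('x, 'xm) rep \<Rightarrow> 'b \<Rightarrow> nat \<Rightarrow> ('x \<Rightarrow> 'bm \<Rightarrow> complex mat) \<Rightarrow> complex mat" where
  "ind_desc X B G V b m \<theta> = (THE h. h \<in> carrier_mat m (ind_dim X B G V b) \<and>
     (\<forall>x\<in>Obj X. \<forall>g\<in>homset B (fo G x) b. h * ind_inj X B G V b x g = \<theta> x g))"

definition Ind_obj ::
  "('x, 'xm, 'y) cat_scheme \<Rightarrow> ('b, 'bm, 'z) cat_scheme \<Rightarrow> ('x, 'xm, 'b, 'bm) fctr \<Rightarrow>
   ('x, 'xm) rep \<Rightarrow> ('b, 'bm) rep" where
  "Ind_obj X B G V = \<lparr>
     fo = ind_dim X B G V,
     fm = (\<lambda>h. ind_desc X B G V (Dom B h) (ind_dim X B G V (Cod B h))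
                 (\<lambda>x g. ind_inj X B G V (Cod B h) x (Cmp B h g)))\<rparr>"

definition Ind ::
  "('x, 'xm, 'y) cat_scheme \<Rightarrow> ('b, 'bm, 'z) cat_scheme \<Rightarrow> ('x, 'xm, 'b, 'bm) fctr \<Rightarrow>
   (('x, 'xm) rep, ('x, 'xm) intw, ('b, 'bm) rep, ('b, 'bm) intw) fctr" where
  "Ind X B G = \<lparr>
     fo = Ind_obj X B G,
     fm = (\<lambda>\<tau>. \<lparr>
       nsrc = Ind_obj X B G (nsrc \<tau>),
       ntgt = Ind_obj X B G (ntgt \<tau>),
       nt = (\<lambda>b\<in>Obj B. ind_desc X B G (nsrc \<tau>) b (ind_dim X B G (ntgt \<tau>) b)
               (\<lambda>x g. ind_inj X B G (ntgt \<tau>) b x g * nt \<tau> x))\<rparr>)\<rparr>"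

text \<open>Unit \<open>1 \<Rightarrow> G\<^sub>* G\<^sup>*\<close> and counit \<open>G\<^sup>* G\<^sub>* \<Rightarrow> 1\<close> of the adjunction with \<open>G\<^sup>*\<close> on the left.\<close>

definition unit_left ::
  "('x, 'xm, 'y) cat_scheme \<Rightarrow> ('b, 'bm, 'z) cat_scheme \<Rightarrow> ('x, 'xm, 'b, 'bm) fctr \<Rightarrow>
   (('x, 'xm) rep, ('x, 'xm) intw, ('x, 'xm) rep, ('x, 'xm) intw) ntr" where
  "unit_left X B G = \<lparr>
     nsrc = idF,
     ntgt = fcmp (Res X G) (Ind X B G),
     nt = (\<lambda>V\<in>Obj (Rep X). \<lparr>
       nsrc = V,
       ntgt = fcmp (Ind_obj X B G V) G,
       nt = (\<lambda>x\<in>Obj X. ind_inj X B G V (fo G x) x (Idn B (fo G x)))\<rparr>)\<rparr>"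

definition counit_left ::
  "('x, 'xm, 'y) cat_scheme \<Rightarrow> ('b, 'bm, 'z) cat_scheme \<Rightarrow> ('x, 'xm, 'b, 'bm) fctr \<Rightarrow>
   (('b, 'bm) rep, ('b, 'bm) intw, ('b, 'bm) rep, ('b, 'bm) intw) ntr" where
  "counit_left X B G = \<lparr>
     nsrc = fcmp (Ind X B G) (Res X G),
     ntgt = idF,
     nt = (\<lambda>W\<in>Obj (Rep B). \<lparr>
       nsrc = Ind_obj X B G (fcmp W G),
       ntgt = W,
       nt = (\<lambda>b\<in>Obj B. ind_desc X B G (fcmp W G) b (fo W b) (\<lambda>x g. fm W g))\<rparr>)\<rparr>"

text \<open>Right adjoint structure.  Coinduction of \<open>V\<close> at \<open>b\<close> is the limit of \<open>V x\<close> over the pairs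
  \<open>(x, h : G x \<cong> b)\<close>.  The norm (Nakayama) map from the colimit to the limit is given, from the
  colimit summand \<open>(x', g)\<close> to the limit factor \<open>(x, h)\<close>, by the sum of \<open>V k\<close> over all
  \<open>k : x' \<rightarrow> x\<close> with \<open>h (G k) = g\<close>.  (For finite groups its inverse is the usual
  \<open>\<phi> \<mapsto> 1/|Aut x| \<Sum>\<^sub>g g\<^sup>-\<^sup>1 \<otimes> \<phi> g\<close>.)  \<open>ind_proj\<close> is the \<open>(x, h)\<close> projection of the limit pulled back
  along the norm isomorphism.\<close>

definition mat_sum :: "nat \<Rightarrow> nat \<Rightarrow> ('k \<Rightarrow> complex mat) \<Rightarrow> 'k set \<Rightarrow> complex mat" where
  "mat_sum r c M K = mat r c (\<lambda>ij. \<Sum>k\<in>K. M k $$ ij)"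

definition ind_proj ::
  "('x, 'xm, 'y) cat_scheme \<Rightarrow> ('b, 'bm, 'z) cat_scheme \<Rightarrow> ('x, 'xm, 'b, 'bm) fctr \<Rightarrow>
   ('x, 'xm) rep \<Rightarrow> 'b \<Rightarrow> 'x \<Rightarrow> 'bm \<Rightarrow> complex mat" where
  "ind_proj X B G V b x h = ind_desc X B G V b (fo V x)
     (\<lambda>x' g. mat_sum (fo V x) (fo V x') (fm V) {k \<in> homset X x' x. Cmp B h (fm G k) = g})"

text \<open>The unit \<open>1 \<Rightarrow> G\<^sup>* G\<^sub>*\<close> of the adjunction with \<open>G\<^sup>*\<close> on the right: the map into the limit
  with components \<open>W (h\<^sup>-\<^sup>1)\<close>.\<close>

definition unit_right ::
  "('x, 'xm, 'y) cat_scheme \<Rightarrow> ('b, 'bm, 'z) cat_scheme \<Rightarrow> ('x, 'xm, 'b, 'bm) fctr \<Rightarrow>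
   (('b, 'bm) rep, ('b, 'bm) intw, ('b, 'bm) rep, ('b, 'bm) intw) ntr" where
  "unit_right X B G = \<lparr>
     nsrc = idF,
     ntgt = fcmp (Ind X B G) (Res X G),
     nt = (\<lambda>W\<in>Obj (Rep B). \<lparr>
       nsrc = W,
       ntgt = Ind_obj X B G (fcmp W G),
       nt = (\<lambda>b\<in>Obj B. THE m. m \<in> carrier_mat (ind_dim X B G (fcmp W G) b) (fo W b) \<and>
               (\<forall>x\<in>Obj X. \<forall>h\<in>homset B (fo G x) b.
                  ind_proj X B G (fcmp W G) b x h * m = fm W (cat_inv B h)))\<rparr>)\<rparr>"

text \<open>Canonical isomorphisms: \<open>(G S)\<^sup>* \<Rightarrow> G\<^sup>* S\<^sup>*\<close>; \<open>G\<^sup>* \<Rightarrow> G'\<^sup>*\<close> and \<open>G\<^sub>* \<Rightarrow> G'\<^sub>*\<close> induced by a natural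
  isomorphism \<open>G \<Rightarrow> G'\<close>.\<close>

definition ind_comp ::
  "('w, 'wm, 'u) cat_scheme \<Rightarrow> ('x, 'xm, 'y) cat_scheme \<Rightarrow> ('b, 'bm, 'z) cat_scheme \<Rightarrow>
   ('w, 'wm, 'x, 'xm) fctr \<Rightarrow> ('x, 'xm, 'b, 'bm) fctr \<Rightarrow>
   (('w, 'wm) rep, ('w, 'wm) intw, ('b, 'bm) rep, ('b, 'bm) intw) ntr" where
  "ind_comp Z X B S G = \<lparr>
     nsrc = Ind Z B (fcmp G S),
     ntgt = fcmp (Ind X B G) (Ind Z X S),
     nt = (\<lambda>V\<in>Obj (Rep Z). \<lparr>
       nsrc = Ind_obj Z B (fcmp G S) V,
       ntgt = Ind_obj X B G (Ind_obj Z X S V),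
       nt = (\<lambda>b\<in>Obj B. ind_desc Z B (fcmp G S) V b (ind_dim X B G (Ind_obj Z X S V) b)
               (\<lambda>z g. ind_inj X B G (Ind_obj Z X S V) b (fo S z) g *
                      ind_inj Z X S V (fo S z) z (Idn X (fo S z))))\<rparr>)\<rparr>"

definition ind_cong ::
  "('x, 'xm, 'y) cat_scheme \<Rightarrow> ('b, 'bm, 'z) cat_scheme \<Rightarrow> ('x, 'xm, 'b, 'bm) ntr \<Rightarrow>
   (('x, 'xm) rep, ('x, 'xm) intw, ('b, 'bm) rep, ('b, 'bm) intw) ntr" where
  "ind_cong X B \<mu> = \<lparr>
     nsrc = Ind X B (nsrc \<mu>),
     ntgt = Ind X B (ntgt \<mu>),
     nt = (\<lambda>V\<in>Obj (Rep X). \<lparr>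
       nsrc = Ind_obj X B (nsrc \<mu>) V,
       ntgt = Ind_obj X B (ntgt \<mu>) V,
       nt = (\<lambda>b\<in>Obj B. ind_desc X B (nsrc \<mu>) V b (ind_dim X B (ntgt \<mu>) V b)
               (\<lambda>x g. ind_inj X B (ntgt \<mu>) V b x (Cmp B g (cat_inv B (nt \<mu> x)))))\<rparr>)\<rparr>"

definition res_cong ::
  "('x, 'xm, 'y) cat_scheme \<Rightarrow> ('a, 'am, 'z) cat_scheme \<Rightarrow> ('x, 'xm, 'a, 'am) ntr \<Rightarrow>
   (('a, 'am) rep, ('a, 'am) intw, ('x, 'xm) rep, ('x, 'xm) intw) ntr" where
  "res_cong X A \<nu> = \<lparr>
     nsrc = Res X (nsrc \<nu>),
     ntgt = Res X (ntgt \<nu>),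
     nt = (\<lambda>V\<in>Obj (Rep A). whisk_l X V \<nu>)\<rparr>"

section \<open>Spans of groupoids and 2-linearization\<close>

text \<open>A span \<open>B \<leftarrow> X \<rightarrow> A\<close>, regarded as a 1-morphism from \<open>A = rbase\<close> to \<open>B = lbase\<close>.\<close>

record ('x, 'xm, 'b, 'bm, 'a, 'am) gspan =
  apex :: "('x, 'xm) cat"
  lbase :: "('b, 'bm) cat"
  rbase :: "('a, 'am) cat"
  lleg :: "('x, 'xm, 'b, 'bm) fctr"
  rleg :: "('x, 'xm, 'a, 'am) fctr"

definition id_span :: "('x, 'xm) cat \<Rightarrow> ('x, 'xm, 'x, 'xm, 'x, 'xm) gspan" where
  "id_span X = \<lparr>apex = X, lbase = X, rbase = X, lleg = idF, rleg = idF\<rparr>"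

definition conv_span ::
  "('x, 'xm, 'b, 'bm, 'a, 'am) gspan \<Rightarrow> ('x, 'xm, 'a, 'am, 'b, 'bm) gspan" where
  "conv_span P = \<lparr>apex = apex P, lbase = rbase P, rbase = lbase P, lleg = rleg P, rleg = lleg P\<rparr>"

text \<open>Iso-comma groupoid \<open>(G \<down> F)\<close> of \<open>G : X \<rightarrow> B\<close> and \<open>F : Y \<rightarrow> B\<close>: objects \<open>(x, y, \<alpha> : G x \<cong> F y)\<close>;
  an arrow is recorded together with its source and target.\<close>

type_synonym ('x, 'y, 'bm) com_obj = "'x \<times> 'y \<times> 'bm"
type_synonym ('x, 'xm, 'y, 'ym, 'bm) com_arr =
  "('x, 'y, 'bm) com_obj \<times> ('x, 'y, 'bm) com_obj \<times> 'xm \<times> 'ym"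

definition iso_comma ::
  "('x, 'xm) cat \<Rightarrow> ('y, 'ym) cat \<Rightarrow> ('b, 'bm) cat \<Rightarrow>
   ('x, 'xm, 'b, 'bm) fctr \<Rightarrow> ('y, 'ym, 'b, 'bm) fctr \<Rightarrow>
   (('x, 'y, 'bm) com_obj, ('x, 'xm, 'y, 'ym, 'bm) com_arr) cat" where
  "iso_comma X Y B G F = (let ob = {(x, y, \<alpha>). x \<in> Obj X \<and> y \<in> Obj Y \<and>
                                     \<alpha> \<in> homset B (fo G x) (fo F y) \<and> is_iso B \<alpha>} in \<lparr>
     Obj = ob,
     Arr = {((x, y, \<alpha>), (x', y', \<alpha>'), p, q) | x y \<alpha> x' y' \<alpha>' p q.
              (x, y, \<alpha>) \<in> ob \<and> (x', y', \<alpha>') \<in> ob \<and> p \<in> homset X x x' \<and> q \<in> homset Y y y' \<and>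
              Cmp B \<alpha>' (fm G p) = Cmp B (fm F q) \<alpha>},
     Dom = (\<lambda>(s, t, p, q). s),
     Cod = (\<lambda>(s, t, p, q). t),
     Idn = (\<lambda>(x, y, \<alpha>). ((x, y, \<alpha>), (x, y, \<alpha>), Idn X x, Idn Y y)),
     Cmp = (\<lambda>(s', t', p', q') (s, t, p, q). (s, t', Cmp X p' p, Cmp Y q' q))\<rparr>)"

definition com_p1 ::
  "(('x, 'y, 'bm) com_obj, ('x, 'xm, 'y, 'ym, 'bm) com_arr, 'x, 'xm) fctr" where
  "com_p1 = \<lparr>fo = (\<lambda>(x, y, \<alpha>). x), fm = (\<lambda>(s, t, p, q). p)\<rparr>"

definition com_p2 ::
  "(('x, 'y, 'bm) com_obj, ('x, 'xm, 'y, 'ym, 'bm) com_arr, 'y, 'ym) fctr" where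
  "com_p2 = \<lparr>fo = (\<lambda>(x, y, \<alpha>). y), fm = (\<lambda>(s, t, p, q). q)\<rparr>"

text \<open>\<open>pb Q P\<close> is the apex of the composite \<open>Q \<circ> P\<close> (first \<open>P\<close>, then \<open>Q\<close>).\<close>

definition pb ::
  "('y, 'ym, 'c, 'cm, 'b, 'bm) gspan \<Rightarrow> ('x, 'xm, 'b, 'bm, 'a, 'am) gspan \<Rightarrow>
   (('x, 'y, 'bm) com_obj, ('x, 'xm, 'y, 'ym, 'bm) com_arr) cat" where
  "pb Q P = iso_comma (apex P) (apex Q) (lbase P) (lleg P) (rleg Q)"

definition comp_span ::
  "('y, 'ym, 'c, 'cm, 'b, 'bm) gspan \<Rightarrow> ('x, 'xm, 'b, 'bm, 'a, 'am) gspan \<Rightarrow>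
   (('x, 'y, 'bm) com_obj, ('x, 'xm, 'y, 'ym, 'bm) com_arr, 'c, 'cm, 'a, 'am) gspan" where
  "comp_span Q P = \<lparr>
     apex = pb Q P,
     lbase = lbase Q,
     rbase = rbase P,
     lleg = fcmp (lleg Q) com_p2,
     rleg = fcmp (rleg P) com_p1\<rparr>"

text \<open>A span of spans \<open>(X \<leftarrow> Z \<rightarrow> Y, \<mu> : G S \<Rightarrow> J T, \<nu> : F S \<Rightarrow> K T)\<close> from \<open>B \<leftarrow>\<^sub>G X \<rightarrow>\<^sub>F A\<close> (\<open>sdom\<close>) to
  \<open>B \<leftarrow>\<^sub>J Y \<rightarrow>\<^sub>K A\<close> (\<open>scod\<close>).\<close>

record ('w, 'wm, 'x, 'xm, 'y, 'ym, 'b, 'bm, 'a, 'am) sspan =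
  sdom :: "('x, 'xm, 'b, 'bm, 'a, 'am) gspan"
  scod :: "('y, 'ym, 'b, 'bm, 'a, 'am) gspan"
  smid :: "('w, 'wm) cat"
  sS :: "('w, 'wm, 'x, 'xm) fctr"
  sT :: "('w, 'wm, 'y, 'ym) fctr"
  smu :: "('w, 'wm, 'b, 'bm) ntr"
  snu :: "('w, 'wm, 'a, 'am) ntr"

definition conv_sspan ::
  "('w, 'wm, 'x, 'xm, 'y, 'ym, 'b, 'bm, 'a, 'am) sspan \<Rightarrow>
   ('w, 'wm, 'y, 'ym, 'x, 'xm, 'b, 'bm, 'a, 'am) sspan" where
  "conv_sspan \<alpha> = \<lparr>
     sdom = scod \<alpha>,
     scod = sdom \<alpha>,
     smid = smid \<alpha>,
     sS = sT \<alpha>,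
     sT = sS \<alpha>,
     smu = nt_inv (smid \<alpha>) (lbase (sdom \<alpha>)) (smu \<alpha>),
     snu = nt_inv (smid \<alpha>) (rbase (sdom \<alpha>)) (snu \<alpha>)\<rparr>"

text \<open>Span of spans with identity natural transformations; meant for \<open>G S = J T\<close>, \<open>F S = K T\<close>.\<close>

definition strict_sspan ::
  "('x, 'xm, 'b, 'bm, 'a, 'am) gspan \<Rightarrow> ('y, 'ym, 'b, 'bm, 'a, 'am) gspan \<Rightarrow> ('w, 'wm) cat \<Rightarrow>
   ('w, 'wm, 'x, 'xm) fctr \<Rightarrow> ('w, 'wm, 'y, 'ym) fctr \<Rightarrow>
   ('w, 'wm, 'x, 'xm, 'y, 'ym, 'b, 'bm, 'a, 'am) sspan" where
  "strict_sspan P Q Z S T = \<lparr>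
     sdom = P,
     scod = Q,
     smid = Z,
     sS = S,
     sT = T,
     smu = \<lparr>nsrc = fcmp (lleg P) S, ntgt = fcmp (lleg Q) T,
            nt = (\<lambda>z\<in>Obj Z. Idn (lbase P) (fo (fcmp (lleg P) S) z))\<rparr>,
     snu = \<lparr>nsrc = fcmp (rleg P) S, ntgt = fcmp (rleg Q) T,
            nt = (\<lambda>z\<in>Obj Z. Idn (rbase P) (fo (fcmp (rleg P) S) z))\<rparr>\<rparr>"

subsection \<open>\<open>\<Lambda>\<close> on spans and on spans of spans\<close>

definition Lam1 :: "('x, 'xm, 'b, 'bm, 'a, 'am) gspan \<Rightarrow>
  (('a, 'am) rep, ('a, 'am) intw, ('b, 'bm) rep, ('b, 'bm) intw) fctr" where
  "Lam1 P = fcmp (Ind (apex P) (lbase P) (lleg P)) (Res (apex P) (rleg P))"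

text \<open>The composite
  \<open>G\<^sup>* F\<^sub>* \<Rightarrow> G\<^sup>* S\<^sup>* S\<^sub>* F\<^sub>* \<Rightarrow> (G S)\<^sup>* (F S)\<^sub>* \<Rightarrow> (J T)\<^sup>* (F S)\<^sub>* \<Rightarrow> (J T)\<^sup>* (K T)\<^sub>* \<Rightarrow> J\<^sup>* T\<^sup>* T\<^sub>* K\<^sub>* \<Rightarrow> J\<^sup>* K\<^sub>*\<close>.\<close>

definition Lam2 :: "('w, 'wm, 'x, 'xm, 'y, 'ym, 'b, 'bm, 'a, 'am) sspan \<Rightarrow>
  (('a, 'am) rep, ('a, 'am) intw, ('b, 'bm) rep, ('b, 'bm) intw) ntr" where
  "Lam2 \<alpha> = (let
     A = rbase (sdom \<alpha>); B = lbase (sdom \<alpha>);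
     X = apex (sdom \<alpha>); Y = apex (scod \<alpha>); Z = smid \<alpha>;
     G = lleg (sdom \<alpha>); F = rleg (sdom \<alpha>); J = lleg (scod \<alpha>); K = rleg (scod \<alpha>);
     S = sS \<alpha>; T = sT \<alpha>; RA = Rep A;
     step1 = whisk_l RA (Ind X B G) (whisk_r RA (unit_right Z X S) (Res X F));
     step2 = whisk_r RA (nt_inv (Rep Z) (Rep B) (ind_comp Z X B S G)) (Res Z (fcmp F S));
     step3 = whisk_r RA (ind_cong Z B (smu \<alpha>)) (Res Z (fcmp F S));
     step4 = whisk_l RA (Ind Z B (fcmp J T)) (res_cong Z A (snu \<alpha>));
     step5 = whisk_r RA (ind_comp Z Y B T J) (Res Z (fcmp K T));
     step6 = whisk_l RA (Ind Y B J) (whisk_r RA (counit_left Z Y T) (Res Y K))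
   in vcomp RA (Rep B) step6 (vcomp RA (Rep B) step5 (vcomp RA (Rep B) step4
        (vcomp RA (Rep B) step3 (vcomp RA (Rep B) step2 step1)))))"

subsection \<open>The coherence isomorphisms of \<open>\<Lambda>\<close>\<close>

text \<open>\<open>\<Lambda>(1) \<cong> 1\<close>: the counit \<open>id\<^sup>* id\<^sub>* \<Rightarrow> 1\<close>.\<close>

definition Lam_unit :: "('x, 'xm) cat \<Rightarrow>
  (('x, 'xm) rep, ('x, 'xm) intw, ('x, 'xm) rep, ('x, 'xm) intw) ntr" where
  "Lam_unit X = counit_left X X idF"

text \<open>The Beck-Chevalley isomorphism \<open>p\<^sub>2\<^sup>* p\<^sub>1\<^sub>* \<Rightarrow> F\<^sub>* G\<^sup>*\<close> of the iso-comma square of \<open>G : X \<rightarrow> B\<close> and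
  \<open>F : Y \<rightarrow> B\<close>, i.e. the mate
  \<open>p\<^sub>2\<^sup>* p\<^sub>1\<^sub>* \<Rightarrow> p\<^sub>2\<^sup>* p\<^sub>1\<^sub>* G\<^sub>* G\<^sup>* = p\<^sub>2\<^sup>* (G p\<^sub>1)\<^sub>* G\<^sup>* \<Rightarrow> p\<^sub>2\<^sup>* (F p\<^sub>2)\<^sub>* G\<^sup>* = p\<^sub>2\<^sup>* p\<^sub>2\<^sub>* F\<^sub>* G\<^sup>* \<Rightarrow> F\<^sub>* G\<^sup>*\<close>
  of the tautological \<open>G p\<^sub>1 \<Rightarrow> F p\<^sub>2\<close>.\<close>

definition beck_chevalley ::
  "('x, 'xm) cat \<Rightarrow> ('y, 'ym) cat \<Rightarrow> ('b, 'bm) cat \<Rightarrow>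
   ('x, 'xm, 'b, 'bm) fctr \<Rightarrow> ('y, 'ym, 'b, 'bm) fctr \<Rightarrow>
   (('x, 'xm) rep, ('x, 'xm) intw, ('y, 'ym) rep, ('y, 'ym) intw) ntr" where
  "beck_chevalley X Y B G F = (let
     Z = iso_comma X Y B G F; RX = Rep X;
     p1 = (com_p1 :: (('x, 'y, 'bm) com_obj, ('x, 'xm, 'y, 'ym, 'bm) com_arr, 'x, 'xm) fctr);
     p2 = (com_p2 :: (('x, 'y, 'bm) com_obj, ('x, 'xm, 'y, 'ym, 'bm) com_arr, 'y, 'ym) fctr);
     taut = \<lparr>nsrc = fcmp G p1, ntgt = fcmp F p2, nt = (\<lambda>z\<in>Obj Z. case z of (x, y, \<alpha>) \<Rightarrow> \<alpha>)\<rparr>;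
     step1 = whisk_l RX (fcmp (Ind Z Y p2) (Res Z p1)) (unit_left X B G);
     step2 = whisk_l RX (Ind Z Y p2) (whisk_r RX (res_cong Z B taut) (Ind X B G));
     step3 = whisk_r RX (counit_left Z Y p2) (fcmp (Res Y F) (Ind X B G))
   in vcomp RX (Rep Y) step3 (vcomp RX (Rep Y) step2 step1))"

text \<open>\<open>\<Lambda>(Q \<circ> P) \<Rightarrow> \<Lambda>(Q) \<Lambda>(P)\<close>; with \<open>P = (B \<leftarrow>\<^sub>G X \<rightarrow>\<^sub>F A)\<close> and \<open>Q = (C \<leftarrow>\<^sub>J Y \<rightarrow>\<^sub>K B)\<close> this is
  \<open>(J p\<^sub>2)\<^sup>* (F p\<^sub>1)\<^sub>* \<Rightarrow> J\<^sup>* p\<^sub>2\<^sup>* p\<^sub>1\<^sub>* F\<^sub>* \<Rightarrow> J\<^sup>* K\<^sub>* G\<^sup>* F\<^sub>*\<close>.\<close>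

definition Lam_comp ::
  "('y, 'ym, 'c, 'cm, 'b, 'bm) gspan \<Rightarrow> ('x, 'xm, 'b, 'bm, 'a, 'am) gspan \<Rightarrow>
   (('a, 'am) rep, ('a, 'am) intw, ('c, 'cm) rep, ('c, 'cm) intw) ntr" where
  "Lam_comp Q P = (let
     Z = pb Q P; RA = Rep (rbase P);
     p2 = (com_p2 :: (('x, 'y, 'bm) com_obj, ('x, 'xm, 'y, 'ym, 'bm) com_arr, 'y, 'ym) fctr);
     step1 = whisk_r RA (ind_comp Z (apex Q) (lbase Q) p2 (lleg Q)) (Res Z (fcmp (rleg P) com_p1));
     step2 = whisk_l RA (Ind (apex Q) (lbase Q) (lleg Q))
               (whisk_r RA (beck_chevalley (apex P) (apex Q) (lbase P) (lleg P) (rleg Q))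
                  (Res (apex P) (rleg P)))
   in vcomp RA (Rep (lbase Q)) step2 step1)"

section \<open>The groupoid of finite sets and the spans assigned to the generators\<close>

text \<open>The groupoid \<open>S\<close> of finite sets (of natural numbers) and bijections; a bijection from \<open>s\<close> to
  \<open>t\<close> is an injective partial function with domain \<open>s\<close> and range \<open>t\<close>.\<close>

type_synonym fset_obj = "nat set"
type_synonym fset_bij = "nat \<rightharpoonup> nat"

definition SS :: "(fset_obj, fset_bij) cat" where
  "SS = \<lparr>
     Obj = {s. finite s},
     Arr = {f. finite (dom f) \<and> inj_on f (dom f)},
     Dom = dom,
     Cod = ran,
     Idn = (\<lambda>s. Some |` s),
     Cmp = (\<circ>\<^sub>m)\<rparr>"

text \<open>Disjoint union with a one-element set: the added element is \<open>0\<close>, old elements are shifted.\<close>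

definition plus1 :: "(fset_obj, fset_bij, fset_obj, fset_bij) fctr" where
  "plus1 = \<lparr>
     fo = (\<lambda>s. insert 0 (Suc ` s)),
     fm = (\<lambda>f n. case n of 0 \<Rightarrow> Some 0 | Suc k \<Rightarrow> map_option Suc (f k))\<rparr>"

definition plus2 :: "(fset_obj, fset_bij, fset_obj, fset_bij) fctr" where
  "plus2 = fcmp plus1 plus1"

text \<open>The swap of the two added elements (\<open>0\<close> and \<open>1\<close>) of \<open>s + 2\<close>.\<close>

definition swap2 :: "fset_obj \<Rightarrow> fset_bij" where
  "swap2 s = (\<lambda>n. Some ((id(0 := 1, 1 := 0)) n)) |` fo plus2 s"

definition swap_nat :: "(fset_obj, fset_bij, fset_obj, fset_bij) ntr" where
  "swap_nat = \<lparr>nsrc = plus2, ntgt = plus2, nt = (\<lambda>s\<in>Obj SS. swap2 s)\<rparr>"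

type_synonym S_rep = "(fset_obj, fset_bij) rep"
type_synonym S_intw = "(fset_obj, fset_bij) intw"
type_synonym ('x, 'xm) S_span = "('x, 'xm, fset_obj, fset_bij, fset_obj, fset_bij) gspan"
type_synonym ('w, 'wm, 'x, 'xm, 'y, 'ym) S_sspan =
  "('w, 'wm, 'x, 'xm, 'y, 'ym, fset_obj, fset_bij, fset_obj, fset_bij) sspan"
type_synonym SC_obj = "(fset_obj, fset_obj, fset_bij) com_obj"
type_synonym SC_arr = "(fset_obj, fset_bij, fset_obj, fset_bij, fset_bij) com_arr"

definition spA :: "(fset_obj, fset_bij) S_span" where
  "spA = \<lparr>apex = SS, lbase = SS, rbase = SS, lleg = idF, rleg = plus1\<rparr>"

definition spAd :: "(fset_obj, fset_bij) S_span" where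
  "spAd = conv_span spA"

text \<open>The reduced forms of \<open>A\<^sup>\<dagger> \<circ> A\<close>, \<open>A \<circ> A\<close> and \<open>A\<^sup>\<dagger> \<circ> A\<^sup>\<dagger>\<close>.\<close>

definition spAdA :: "(fset_obj, fset_bij) S_span" where
  "spAdA = \<lparr>apex = SS, lbase = SS, rbase = SS, lleg = plus1, rleg = plus1\<rparr>"

definition spAA :: "(fset_obj, fset_bij) S_span" where
  "spAA = \<lparr>apex = SS, lbase = SS, rbase = SS, lleg = idF, rleg = plus2\<rparr>"

definition spAdAd :: "(fset_obj, fset_bij) S_span" where
  "spAdAd = \<lparr>apex = SS, lbase = SS, rbase = SS, lleg = plus2, rleg = idF\<rparr>"

text \<open>The functor from \<open>S\<close> to an iso-comma groupoid with components \<open>P\<close> and \<open>Q\<close> and the comparison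
  arrow \<open>\<theta>\<close>.\<close>

definition com_pair ::
  "(fset_obj, fset_bij, fset_obj, fset_bij) fctr \<Rightarrow> (fset_obj, fset_bij, fset_obj, fset_bij) fctr \<Rightarrow>
   (fset_obj \<Rightarrow> fset_bij) \<Rightarrow> (fset_obj, fset_bij, SC_obj, SC_arr) fctr" where
  "com_pair P Q \<theta> = \<lparr>
     fo = (\<lambda>s. (fo P s, fo Q s, \<theta> s)),
     fm = (\<lambda>f. ((fo P (Dom SS f), fo Q (Dom SS f), \<theta> (Dom SS f)),
                (fo P (Cod SS f), fo Q (Cod SS f), \<theta> (Cod SS f)), fm P f, fm Q f))\<rparr>"

text \<open>The canonical equivalences from the reduced composites to the iso-comma composites:
  \<open>s \<mapsto> (s, s, 1)\<close>, \<open>s \<mapsto> (s + 1, s, 1)\<close> and \<open>s \<mapsto> (s, s + 1, 1)\<close>.\<close>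

definition can_AdA ::
  "(fset_obj, fset_bij, fset_obj, fset_bij, SC_obj, SC_arr) S_sspan" where
  "can_AdA = strict_sspan spAdA (comp_span spAd spA) SS idF (com_pair idF idF (Idn SS))"

definition can_AA ::
  "(fset_obj, fset_bij, fset_obj, fset_bij, SC_obj, SC_arr) S_sspan" where
  "can_AA = strict_sspan spAA (comp_span spA spA) SS idF
     (com_pair plus1 idF (\<lambda>s. Idn SS (fo plus1 s)))"

definition can_AdAd ::
  "(fset_obj, fset_bij, fset_obj, fset_bij, SC_obj, SC_arr) S_sspan" where
  "can_AdAd = strict_sspan spAdAd (comp_span spAd spAd) SS idF
     (com_pair idF plus1 (\<lambda>s. Idn SS (fo plus1 s)))"

text \<open>The 2-morphisms assigned to the generators \<open>c, d, c', d', x, y, u, v\<close>.\<close>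

definition i_id :: "(fset_obj, fset_bij, fset_obj, fset_bij, SC_obj, SC_arr) S_sspan" where
  "i_id = strict_sspan (id_span SS) (comp_span spA spAd) SS idF
     (com_pair idF idF (\<lambda>s. Idn SS (fo plus1 s)))"

definition i_AdA :: "(fset_obj, fset_bij, fset_obj, fset_bij, SC_obj, SC_arr) S_sspan" where
  "i_AdA = strict_sspan spAdA (comp_span spA spAd) SS idF (com_pair plus1 plus1 swap2)"

definition eta :: "(fset_obj, fset_bij, fset_obj, fset_bij, fset_obj, fset_bij) S_sspan" where
  "eta = strict_sspan (id_span SS) spAdA SS plus1 idF"

definition sigma_A :: "(fset_obj, fset_bij, fset_obj, fset_bij, fset_obj, fset_bij) S_sspan" where
  "sigma_A = \<lparr>sdom = spAA, scod = spAA, smid = SS, sS = idF, sT = idF,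
     smu = nt_id SS SS idF, snu = swap_nat\<rparr>"

definition sigma_Ad :: "(fset_obj, fset_bij, fset_obj, fset_bij, fset_obj, fset_bij) S_sspan" where
  "sigma_Ad = \<lparr>sdom = spAdAd, scod = spAdAd, smid = SS, sS = idF, sT = idF,
     smu = swap_nat, snu = nt_id SS SS idF\<rparr>"

subsection \<open>The images of the generators under \<open>\<Lambda> \<circ> C\<close>\<close>

text \<open>The images under \<open>\<Lambda>\<close> of the above spans of spans are natural transformations between the
  functors \<open>\<Lambda>(1)\<close>, \<open>\<Lambda>(A \<circ> A\<^sup>\<dagger>)\<close>, ...  The \<open>coh\<close> isomorphisms identify these with \<open>1\<close>,
  \<open>\<Lambda>(A) \<Lambda>(A\<^sup>\<dagger>)\<close>, ...\<close>

type_synonym S_end_ntr = "(S_rep, S_intw, S_rep, S_intw) ntr"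

abbreviation RepS :: "(S_rep, S_intw) lincat" where
  "RepS \<equiv> Rep SS"

definition coh_1 :: S_end_ntr where
  "coh_1 = Lam_unit SS"

definition coh_mp :: S_end_ntr where
  "coh_mp = Lam_comp spA spAd"

definition coh_pm :: S_end_ntr where
  "coh_pm = vcomp RepS RepS (Lam_comp spAd spA) (Lam2 can_AdA)"

definition coh_mm :: S_end_ntr where
  "coh_mm = vcomp RepS RepS (Lam_comp spA spA) (Lam2 can_AA)"

definition coh_pp :: S_end_ntr where
  "coh_pp = vcomp RepS RepS (Lam_comp spAd spAd) (Lam2 can_AdAd)"

definition transport :: "S_end_ntr \<Rightarrow> S_end_ntr \<Rightarrow> S_end_ntr \<Rightarrow> S_end_ntr" where
  "transport \<theta>' \<theta> \<alpha> = vcomp RepS RepS \<theta>' (vcomp RepS RepS \<alpha> (nt_inv RepS RepS \<theta>))"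

fun LamC_gen :: "hgen \<Rightarrow> S_end_ntr" where
  "LamC_gen gen_c = transport coh_mp coh_1 (Lam2 i_id)"
| "LamC_gen gen_d = transport coh_1 coh_mp (Lam2 (conv_sspan i_id))"
| "LamC_gen gen_c' = transport coh_pm coh_1 (Lam2 eta)"
| "LamC_gen gen_d' = transport coh_1 coh_pm (Lam2 (conv_sspan eta))"
| "LamC_gen gen_u = transport coh_pp coh_pp (Lam2 sigma_Ad)"
| "LamC_gen gen_v = transport coh_mm coh_mm (Lam2 sigma_A)"
| "LamC_gen gen_x = transport coh_mp coh_pm (Lam2 i_AdA)"
| "LamC_gen gen_y = transport coh_pm coh_mp (Lam2 (conv_sspan i_AdA))"

text \<open>For a strong monoidal functor with structure maps \<open>\<phi>\<close>, \<open>\<phi>0\<close>: the comparison from the tensor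
  product of the images of the generating objects to the image of the source or target of a
  generating morphism.\<close>

fun word_comparison :: "(hobj \<Rightarrow> hobj \<Rightarrow> 'd) \<Rightarrow> 'd \<Rightarrow> hobj \<Rightarrow> 'd" where
  "word_comparison \<phi> \<phi>0 HI = \<phi>0"
| "word_comparison \<phi> \<phi>0 (X \<otimes>\<^sub>h Y) = \<phi> X Y"
| "word_comparison \<phi> \<phi>0 _ = undefined"

section \<open>The direct sum of the categories of representations of the symmetric groups\<close>

definition deloop :: "'g monoid \<Rightarrow> (unit, 'g) cat" where
  "deloop G = \<lparr>
     Obj = UNIV,
     Arr = carrier G,
     Dom = (\<lambda>_. ()),
     Cod = (\<lambda>_. ()),
     Idn = (\<lambda>_. \<one>\<^bsub>G\<^esub>),
     Cmp = (\<lambda>g f. g \<otimes>\<^bsub>G\<^esub> f)\<rparr>"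

text \<open>The coproduct of a sequence of additive categories: families of objects almost all of which
  are zero.\<close>

definition coprod_cat :: "(nat \<Rightarrow> ('o, 'm, 'z) cat_scheme) \<Rightarrow> (nat \<Rightarrow> 'o, nat \<Rightarrow> 'm) cat" where
  "coprod_cat C = (let ob = {V. (\<forall>n. V n \<in> Obj (C n)) \<and> finite {n. \<not> is_zero_obj (C n) (V n)}} in \<lparr>
     Obj = ob,
     Arr = {\<phi>. (\<forall>n. \<phi> n \<in> Arr (C n)) \<and>
              (\<lambda>n. Dom (C n) (\<phi> n)) \<in> ob \<and> (\<lambda>n. Cod (C n) (\<phi> n)) \<in> ob},
     Dom = (\<lambda>\<phi> n. Dom (C n) (\<phi> n)),
     Cod = (\<lambda>\<phi> n. Cod (C n) (\<phi> n)),
     Idn = (\<lambda>V n. Idn (C n) (V n)),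
     Cmp = (\<lambda>\<psi> \<phi> n. Cmp (C n) (\<psi> n) (\<phi> n))\<rparr>)"

definition sym_incl :: "nat \<Rightarrow> (unit, nat \<Rightarrow> nat, fset_obj, fset_bij) fctr" where
  "sym_incl n = \<lparr>fo = (\<lambda>_. {1..n}), fm = (\<lambda>p. (\<lambda>i. Some (p i)) |` {1..n})\<rparr>"

definition sym_reps ::
  "(nat \<Rightarrow> (unit, nat \<Rightarrow> nat) rep, nat \<Rightarrow> (unit, nat \<Rightarrow> nat) intw) cat" where
  "sym_reps = coprod_cat (\<lambda>n. Rep (deloop (sym_group n)))"

definition sym_restriction ::
  "(S_rep, S_intw, nat \<Rightarrow> (unit, nat \<Rightarrow> nat) rep, nat \<Rightarrow> (unit, nat \<Rightarrow> nat) intw) fctr" where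
  "sym_restriction = \<lparr>
     fo = (\<lambda>V n. fo (Res (deloop (sym_group n)) (sym_incl n)) V),
     fm = (\<lambda>\<tau> n. fm (Res (deloop (sym_group n)) (sym_incl n)) \<tau>)\<rparr>"

end

theory Submission
 imports Defs
begin

text \<open>Let \<open>G : X \<rightarrow> B\<close> be a faithful functor of groupoids whose comma groupoids \<open>G \<down> b\<close> have finitely many
  isomorphism classes. Then \<open>(G\<^sup>* V) b\<close> is the direct sum of the \<open>V r\<close> over representatives \<open>(r, h : G r \<rightarrow> b)\<close> of these classes,
  so a map out of an induced representation is determined by its composites with the injections
  \<open>V x \<rightarrow> (G\<^sup>* V) b\<close> belonging to the arrows \<open>g : G x \<rightarrow> b\<close>. Units, counits and Beck-Chevalley maps, hence
  all of \<open>\<Lambda>\<close>, are evaluated on injections. Writing \<open>a\<^sub>g\<close> and \<open>p\<^sub>g\<close> for the injections of \<open>\<Lambda>(A)\<close> and \<open>\<Lambda>(A\<^sup>\<dagger>)\<close>,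
  the generators act by formulas such as \<open>c = a\<^sub>1 p\<^sub>1\<close> and \<open>x (p\<^sub>g a\<^sub>1) = a\<^sub>g p\<^sub>s\<close> with \<open>s\<close> the swap, while
  \<open>d (a\<^sub>g p\<^sub>\<alpha>)\<close> is \<open>V (g \<beta>)\<close> if \<open>\<alpha> = \<beta> + 1\<close> and \<open>0\<close> otherwise. The relations of \<open>H'\<close> thereby become statements about bijections of finite
  sets: \<open>cd + xy = 1\<close>, for example, says that a bijection \<open>\<alpha> : s + 1 \<rightarrow> t + 1\<close> either fixes the added element,
  and then comes from \<open>1\<close>, or does not, and then comes from \<open>A\<^sup>\<dagger> A\<close>. As the endofunctors of \<open>Rep(S)\<close> form a
  monoidal category with biproducts, the relations suffice by the universal property of \<open>H'\<close>.\<close>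

text \<open>The general 2-functoriality of \<open>\<Lambda>\<close> and C is never proved; only the
  values of eight natural transformations on injections are needed. The delicate ingredient is the
  unit of the adjunction in which induction is the right adjoint: it is specified through the
  inverse of the norm map, whose entries for a general functor sum over the automorphisms that the
  functor kills. Faithfulness removes the sum. At most one arrow \<open>k\<close> satisfies
  \<open>h (G k) = g\<close>, so between representatives the norm is an identity matrix and no group
  order is ever divided out. All functors of the construction share this property, which is closed
  under composition, base change and cancellation. Only \<open>c'\<close>, \<open>d\<close> and
  \<open>y\<close> use the unit along a functor other than an identity. For \<open>d\<close> and
  \<open>y\<close> the resulting sum has at most one term; for \<open>c'\<close> it runs over the
  elements of a finite set, and the zigzag relations with \<open>c'\<close> hold because
  \<open>d\<close> selects one term of it. The equivalence with families of representations of the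
  symmetric groups is independent of all this; its quasi-inverse comes from a choice of enumeration
  for every finite set.\<close>

abbreviation "Hom \<equiv> homset"
notation carrier_mat ("\<M>") and map_comp (infixl "oo" 55)
abbreviation "sc \<equiv> fo plus1"
abbreviation "scm \<equiv> fm plus1"

section \<open>Functor categories\<close>

lemma HomD:
 assumes "f : Hom C a b"
 shows "f : Arr C" "Dom C f = a" "Cod C f = b"
 using assms by (auto simp: homset_def)

lemma Arr_homset: "f : Arr C ==> f : Hom C (Dom C f) (Cod C f)"
 by (simp add: homset_def)

lemma categoryI:
 assumes "!!f a b. f : Hom C a b ==> a : Obj C & b : Obj C"
  and "!!a. a : Obj C ==> Idn C a : Hom C a a"
  and "!!f g a b c. f : Hom C a b ==> g : Hom C b c ==> Cmp C g f : Hom C a c"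
  and "!!f a b. f : Hom C a b ==> Cmp C f (Idn C a) = f"
  and "!!f a b. f : Hom C a b ==> Cmp C (Idn C b) f = f"
  and "!!f g h a b c d. f : Hom C a b ==> g : Hom C b c ==> h : Hom C c d ==>
   Cmp C h (Cmp C g f) = Cmp C (Cmp C h g) f"
 shows "category C"
 unfolding category_def
 using assms by (auto simp: homset_def)

lemma
 assumes "category C"
 shows cat_obj: "f : Hom C a b ==> a : Obj C & b : Obj C"
  and cat_idn: "a : Obj C ==> Idn C a : Hom C a a"
  and cat_cmp: "f : Hom C a b ==> g : Hom C b c ==> Cmp C g f : Hom C a c"
  and cat_idr: "f : Hom C a b ==> Cmp C f (Idn C a) = f"
  and cat_idl: "f : Hom C a b ==> Cmp C (Idn C b) f = f"
  and cat_assoc: "f : Hom C a b ==> g : Hom C b c ==> h : Hom C c d ==>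
   Cmp C (Cmp C h g) f = Cmp C h (Cmp C g f)"
 using assms by (auto simp: category_def homset_def)

lemma inverse_arrows_hom:
 "inverse_arrows C f g ==> f : Hom C a b ==>
  g : Hom C b a & Cmp C g f = Idn C a & Cmp C f g = Idn C b"
 by (auto simp: inverse_arrows_def homset_def)

lemma inv_arrowsI:
 "f : Hom C a b ==> g : Hom C b a ==> Cmp C g f = Idn C a ==> Cmp C f g = Idn C b ==>
  inverse_arrows C f g"
 by (auto simp: inverse_arrows_def homset_def)

lemma inverse_arrows_unique:
 assumes "category C" "inverse_arrows C f g" "inverse_arrows C f h"
 shows "g = h"
proof -
 have f: "f : Hom C (Dom C f) (Cod C f)" using assms by (simp add: inverse_arrows_def homset_def)
 note g = inverse_arrows_hom[OF assms(2) f] and h = inverse_arrows_hom[OF assms(3) f]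
 have "g = Cmp C g (Cmp C f h)" using g h cat_idr[OF assms(1)] by metis
 also have "\<dots> = h" using g h cat_idl[OF assms(1)] cat_assoc[OF assms(1)] f by metis
 finally show ?thesis .
qed

lemma cat_inv_eq: "category C ==> inverse_arrows C f g ==> cat_inv C f = g"
 unfolding cat_inv_def by (rule the_equality) (auto intro: inverse_arrows_unique)

lemma
 assumes "category C" "is_iso C f" "f : Hom C a b"
 shows cat_inv_hom: "cat_inv C f : Hom C b a"
  and cat_inv_left: "Cmp C (cat_inv C f) f = Idn C a"
  and cat_inv_right: "Cmp C f (cat_inv C f) = Idn C b"
proof -
 obtain g where g: "inverse_arrows C f g" using assms by (auto simp: is_iso_def)
 note e = cat_inv_eq[OF assms(1) g] and h = inverse_arrows_hom[OF g assms(3)]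
 show "cat_inv C f : Hom C b a" "Cmp C (cat_inv C f) f = Idn C a"
  "Cmp C f (cat_inv C f) = Idn C b" unfolding e using h by auto
qed

lemma is_iso_Idn: "category C ==> a : Obj C ==> is_iso C (Idn C a)"
 unfolding is_iso_def
 by (metis cat_idl cat_idn inv_arrowsI)

lemma cat_inv_Idn: "category C ==> a : Obj C ==> cat_inv C (Idn C a) = Idn C a"
 by (metis cat_idl cat_idn cat_inv_eq inv_arrowsI)

lemma full_sub_simps [simp]:
 "Obj (full_sub C P) = {a \<in> Obj C. P a}"
 "Arr (full_sub C P) = {f \<in> Arr C. P (Dom C f) & P (Cod C f)}"
 "Dom (full_sub C P) = Dom C" "Cod (full_sub C P) = Cod C"
 "Idn (full_sub C P) = Idn C" "Cmp (full_sub C P) = Cmp C"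
 by (simp_all add: full_sub_def)

lemma full_sub_lin_simps [simp]:
 fixes C :: "('o, 'm, 'z) lincat_scheme"
 shows "Add (full_sub C P) = Add C" "Zer (full_sub C P) = Zer C" "Scl (full_sub C P) = Scl C"
 by (simp_all add: full_sub_def)

lemma Hom_full_sub: "f : Hom (full_sub C P) a b \<longleftrightarrow> f : Hom C a b & P a & P b"
 by (auto simp: homset_def)

lemma category_full_sub: "category C ==> category (full_sub C P)"
 by (rule categoryI)
  (auto simp: Hom_full_sub dest: cat_obj intro: cat_idn cat_cmp cat_idr cat_idl cat_assoc[symmetric])

lemma is_functorI:
 assumes "!!a. a : Obj C ==> fo F a : Obj D"
  and "!!a. a : Obj C ==> fm F (Idn C a) = Idn D (fo F a)"
  and "!!f a b. f : Hom C a b ==> fm F f : Hom D (fo F a) (fo F b)"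
  and "!!f g a b c. f : Hom C a b ==> g : Hom C b c ==>
   fm F (Cmp C g f) = Cmp D (fm F g) (fm F f)"
 shows "is_functor C D F"
 unfolding is_functor_def using assms by (auto simp: homset_def)

lemma
 assumes "is_functor C D F"
 shows fct_obj: "a : Obj C ==> fo F a : Obj D"
  and fct_idn: "a : Obj C ==> fm F (Idn C a) = Idn D (fo F a)"
  and fct_hom: "f : Hom C a b ==> fm F f : Hom D (fo F a) (fo F b)"
  and fct_cmp: "f : Hom C a b ==> g : Hom C b c ==>
   fm F (Cmp C g f) = Cmp D (fm F g) (fm F f)"
 using assms by (auto simp: is_functor_def homset_def)

lemma fcmp_simps [simp]: "fo (fcmp G F) a = fo G (fo F a)" "fm (fcmp G F) f = fm G (fm F f)"
 by (simp_all add: fcmp_def)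

lemma idF_simps [simp]: "fo idF a = a" "fm idF f = f"
 by (simp_all add: idF_def)

lemma fcmp_assoc: "fcmp H (fcmp G F) = fcmp (fcmp H G) F"
 by (simp add: fcmp_def)

lemma fcmp_idF [simp]: "fcmp F idF = F" "fcmp idF F = F"
 by (simp_all add: fcmp_def idF_def)

lemma is_functor_idF: "category C ==> is_functor C C idF"
 by (rule is_functorI) auto

lemma is_functor_fcmp: "is_functor C D F ==> is_functor D E G ==> is_functor C E (fcmp G F)"
 by (rule is_functorI) (auto simp: fct_obj fct_idn fct_hom fct_cmp intro!: fct_hom fct_cmp)

lemma functor_inverse_arrows:
 assumes "is_functor C D F" "category C" "inverse_arrows C f g"
 shows "inverse_arrows D (fm F f) (fm F g)"
proof -
 have f: "f : Hom C (Dom C f) (Cod C f)" using assms by (simp add: inverse_arrows_def homset_def)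
 note g = inverse_arrows_hom[OF assms(3) f]
 note o = cat_obj[OF assms(2) f]
 show ?thesis
  by (rule inv_arrowsI[OF fct_hom[OF assms(1) f] fct_hom[OF assms(1) conjunct1[OF g]]])
   (use assms g f o fct_cmp fct_idn in metis)+
qed

lemma functor_iso: "is_functor C D F ==> category C ==> is_iso C f ==> is_iso D (fm F f)"
 by (metis functor_inverse_arrows is_iso_def)

lemma functor_inv:
 "is_functor C D F ==> category C ==> category D ==> is_iso C f ==>
  fm F (cat_inv C f) = cat_inv D (fm F f)"
 by (metis cat_inv_eq functor_inverse_arrows is_iso_def)

lemma is_natI:
 assumes "is_functor C D (nsrc \<tau>)" "is_functor C D (ntgt \<tau>)" "nt \<tau> : extensional (Obj C)"
  and "!!a. a : Obj C ==> nt \<tau> a : Hom D (fo (nsrc \<tau>) a) (fo (ntgt \<tau>) a)"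
  and "!!f a b. f : Hom C a b ==> Cmp D (nt \<tau> b) (fm (nsrc \<tau>) f) = Cmp D (fm (ntgt \<tau>) f) (nt \<tau> a)"
 shows "is_nat C D \<tau>"
 unfolding is_nat_def using assms by (auto simp: homset_def)

lemma
 assumes "is_nat C D \<tau>"
 shows nat_src: "is_functor C D (nsrc \<tau>)"
  and nat_tgt: "is_functor C D (ntgt \<tau>)"
  and nat_ext: "nt \<tau> : extensional (Obj C)"
  and nat_hom: "a : Obj C ==> nt \<tau> a : Hom D (fo (nsrc \<tau>) a) (fo (ntgt \<tau>) a)"
  and nat_nat: "f : Hom C a b ==> Cmp D (nt \<tau> b) (fm (nsrc \<tau>) f) = Cmp D (fm (ntgt \<tau>) f) (nt \<tau> a)"
 using assms by (auto simp: is_nat_def homset_def)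

lemma ntr_eqI:
 fixes \<tau> \<sigma> :: "('a, 'b, 'c, 'd) ntr"
 assumes "nt \<tau> : extensional (Obj C)" "nt \<sigma> : extensional (Obj C)" "nsrc \<tau> = nsrc \<sigma>" "ntgt \<tau> = ntgt \<sigma>"
  and "!!a. a : Obj C ==> nt \<tau> a = nt \<sigma> a"
 shows "\<tau> = \<sigma>"
 using extensionalityI[OF assms(1,2,5)] assms(3,4) by (simp add: ntr.equality)

lemma nt_id_simps [simp]:
 "nsrc (nt_id C D F) = F" "ntgt (nt_id C D F) = F" "a : Obj C ==> nt (nt_id C D F) a = Idn D (fo F a)"
 "nt (nt_id C D F) : extensional (Obj C)"
 by (simp_all add: nt_id_def)

lemma vcomp_simps [simp]:
 "nsrc (vcomp C D \<tau> \<sigma>) = nsrc \<sigma>" "ntgt (vcomp C D \<tau> \<sigma>) = ntgt \<tau>"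
 "a : Obj C ==> nt (vcomp C D \<tau> \<sigma>) a = Cmp D (nt \<tau> a) (nt \<sigma> a)"
 "nt (vcomp C D \<tau> \<sigma>) : extensional (Obj C)"
 by (simp_all add: vcomp_def)

lemma nt_inv_simps [simp]:
 "nsrc (nt_inv C D \<tau>) = ntgt \<tau>" "ntgt (nt_inv C D \<tau>) = nsrc \<tau>"
 "a : Obj C ==> nt (nt_inv C D \<tau>) a = cat_inv D (nt \<tau> a)"
 "nt (nt_inv C D \<tau>) : extensional (Obj C)"
 by (simp_all add: nt_inv_def)

lemma whisk_l_simps [simp]:
 "nsrc (whisk_l C H \<tau>) = fcmp H (nsrc \<tau>)" "ntgt (whisk_l C H \<tau>) = fcmp H (ntgt \<tau>)"
 "a : Obj C ==> nt (whisk_l C H \<tau>) a = fm H (nt \<tau> a)"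
 "nt (whisk_l C H \<tau>) : extensional (Obj C)"
 by (simp_all add: whisk_l_def)

lemma whisk_r_simps [simp]:
 "nsrc (whisk_r C \<tau> K) = fcmp (nsrc \<tau>) K" "ntgt (whisk_r C \<tau> K) = fcmp (ntgt \<tau>) K"
 "a : Obj C ==> nt (whisk_r C \<tau> K) a = nt \<tau> (fo K a)"
 "nt (whisk_r C \<tau> K) : extensional (Obj C)"
 by (simp_all add: whisk_r_def)

lemma dom_obj:
 assumes "f : Hom C a b" "category C"
 shows "a : Obj C" "b : Obj C"
 using cat_obj[OF assms(2,1)] by auto

lemma is_nat_id:
 assumes "category C" "category D" "is_functor C D F"
 shows "is_nat C D (nt_id C D F)"
proof (rule is_natI)
 fix f a b assume f: "f : Hom C a b"
 show "Cmp D (nt (nt_id C D F) b) (fm (nsrc (nt_id C D F)) f) =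
   Cmp D (fm (ntgt (nt_id C D F)) f) (nt (nt_id C D F) a)"
  using dom_obj[OF f assms(1)] fct_hom[OF assms(3) f] cat_idl[OF assms(2)] cat_idr[OF assms(2)]
  by auto
qed (use assms in \<open>auto intro: cat_idn fct_obj\<close>)

lemma is_nat_vcomp:
 assumes "category C" "category D" "is_nat C D \<sigma>" "is_nat C D \<tau>" "nsrc \<tau> = ntgt \<sigma>"
 shows "is_nat C D (vcomp C D \<tau> \<sigma>)"
proof (rule is_natI)
 fix a assume a: "a : Obj C"
 show "nt (vcomp C D \<tau> \<sigma>) a : Hom D (fo (nsrc (vcomp C D \<tau> \<sigma>)) a) (fo (ntgt (vcomp C D \<tau> \<sigma>)) a)"
  using a cat_cmp[OF assms(2) nat_hom[OF assms(3) a]] nat_hom[OF assms(4) a] assms(5) by auto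
next
 fix f a b assume f: "f : Hom C a b"
 note o = dom_obj[OF f assms(1)]
 note h = fct_hom[OF nat_src[OF assms(3)] f] fct_hom[OF nat_tgt[OF assms(3)] f]
  fct_hom[OF nat_tgt[OF assms(4)] f]
 note n = nat_hom[OF assms(3) o(1)] nat_hom[OF assms(3) o(2)] nat_hom[OF assms(4) o(1), unfolded assms(5)]
   nat_hom[OF assms(4) o(2), unfolded assms(5)]
 show "Cmp D (nt (vcomp C D \<tau> \<sigma>) b) (fm (nsrc (vcomp C D \<tau> \<sigma>)) f) =
    Cmp D (fm (ntgt (vcomp C D \<tau> \<sigma>)) f) (nt (vcomp C D \<tau> \<sigma>) a)"
  apply (simp add: o cat_assoc[OF assms(2) h(1) n(2) n(4)] nat_nat[OF assms(3) f])
  apply (simp add: cat_assoc[OF assms(2) n(1) h(2) n(4), symmetric] nat_nat[OF assms(4) f, unfolded assms(5)])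
  apply (rule cat_assoc[OF assms(2) n(1) n(3) h(3)])
  done
qed (use assms in \<open>auto simp: nat_src nat_tgt\<close>)

lemma is_nat_whisk_l:
 assumes "category C" "is_nat C D \<tau>" "is_functor D E H"
 shows "is_nat C E (whisk_l C H \<tau>)"
proof (rule is_natI)
 fix f a b assume f: "f : Hom C a b"
 note o = dom_obj[OF f assms(1)]
 show "Cmp E (nt (whisk_l C H \<tau>) b) (fm (nsrc (whisk_l C H \<tau>)) f) =
    Cmp E (fm (ntgt (whisk_l C H \<tau>)) f) (nt (whisk_l C H \<tau>) a)"
  using o nat_nat[OF assms(2) f]
  by (simp add: fct_cmp[OF assms(3) fct_hom[OF nat_src[OF assms(2)] f] nat_hom[OF assms(2) o(2)], symmetric]
    fct_cmp[OF assms(3) nat_hom[OF assms(2) o(1)] fct_hom[OF nat_tgt[OF assms(2)] f], symmetric])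
qed (use assms in \<open>auto simp: nat_src[OF assms(2)] nat_tgt[OF assms(2)] intro: is_functor_fcmp[OF nat_src[OF assms(2)]]
  is_functor_fcmp[OF nat_tgt[OF assms(2)]] fct_hom nat_hom\<close>)

lemma is_nat_whisk_r:
 assumes "category B" "is_functor B C K" "is_nat C D \<tau>"
 shows "is_nat B D (whisk_r B \<tau> K)"
proof (rule is_natI)
 fix f a b assume f: "f : Hom B a b"
 note o = dom_obj[OF f assms(1)]
 show "Cmp D (nt (whisk_r B \<tau> K) b) (fm (nsrc (whisk_r B \<tau> K)) f) =
    Cmp D (fm (ntgt (whisk_r B \<tau> K)) f) (nt (whisk_r B \<tau> K) a)"
  using o nat_nat[OF assms(3) fct_hom[OF assms(2) f]] by simp
qed (use assms in \<open>auto simp: nat_src nat_tgt intro: is_functor_fcmp fct_obj nat_hom\<close>)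

lemma is_nat_inv:
 assumes "category C" "category D" "is_nat C D \<tau>" "!!a. a : Obj C ==> is_iso D (nt \<tau> a)"
 shows "is_nat C D (nt_inv C D \<tau>)"
proof (rule is_natI)
 fix f a b assume f: "f : Hom C a b"
 note o = dom_obj[OF f assms(1)]
 note h = fct_hom[OF nat_src[OF assms(3)] f] fct_hom[OF nat_tgt[OF assms(3)] f]
 note n = nat_hom[OF assms(3) o(1)] nat_hom[OF assms(3) o(2)]
 note i = cat_inv_hom[OF assms(2) assms(4) n(1), OF o(1)] cat_inv_hom[OF assms(2) assms(4) n(2), OF o(2)]
 let ?F = "fm (nsrc \<tau>) f" and ?G = "fm (ntgt \<tau>) f"
 let ?a = "nt \<tau> a" and ?b = "nt \<tau> b"
 have "Cmp D (cat_inv D ?b) ?G = Cmp D (cat_inv D ?b) (Cmp D ?G (Cmp D ?a (cat_inv D ?a)))"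
  using cat_inv_right[OF assms(2) assms(4) n(1), OF o(1)] cat_idr[OF assms(2) h(2)] by simp
 also have "\<dots> = Cmp D (cat_inv D ?b) (Cmp D ?b (Cmp D ?F (cat_inv D ?a)))"
  using nat_nat[OF assms(3) f] cat_assoc[OF assms(2) i(1) n(1) h(2)] cat_assoc[OF assms(2) i(1) h(1) n(2)]
  by simp
 also have "\<dots> = Cmp D ?F (cat_inv D ?a)"
  using cat_assoc[OF assms(2) cat_cmp[OF assms(2) i(1) h(1)] n(2) i(2)]
   cat_inv_left[OF assms(2) assms(4) n(2), OF o(2)] cat_idl[OF assms(2) cat_cmp[OF assms(2) i(1) h(1)]] by simp
 finally show "Cmp D (nt (nt_inv C D \<tau>) b) (fm (nsrc (nt_inv C D \<tau>)) f) =
   Cmp D (fm (ntgt (nt_inv C D \<tau>)) f) (nt (nt_inv C D \<tau>) a)" using o by simp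
qed (use assms in \<open>auto simp: nat_src nat_tgt intro: cat_inv_hom nat_hom\<close>)

lemma fun_cat_simps [simp]:
 "Obj (fun_cat C D) = {F. is_functor C D F}" "Arr (fun_cat C D) = {\<tau>. is_nat C D \<tau>}"
 "Dom (fun_cat C D) = nsrc" "Cod (fun_cat C D) = ntgt" "Idn (fun_cat C D) = nt_id C D"
 "Cmp (fun_cat C D) = vcomp C D"
 by (simp_all add: fun_cat_def)

lemma fun_cat_lin_simps [simp]:
 "nsrc (Add (fun_cat C D) \<tau> \<sigma>) = nsrc \<tau>" "ntgt (Add (fun_cat C D) \<tau> \<sigma>) = ntgt \<tau>"
 "a : Obj C ==> nt (Add (fun_cat C D) \<tau> \<sigma>) a = Add D (nt \<tau> a) (nt \<sigma> a)"
 "nt (Add (fun_cat C D) \<tau> \<sigma>) : extensional (Obj C)"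
 "nsrc (Zer (fun_cat C D) F G) = F" "ntgt (Zer (fun_cat C D) F G) = G"
 "a : Obj C ==> nt (Zer (fun_cat C D) F G) a = Zer D (fo F a) (fo G a)"
 "nt (Zer (fun_cat C D) F G) : extensional (Obj C)"
 "nsrc (Scl (fun_cat C D) r \<tau>) = nsrc \<tau>" "ntgt (Scl (fun_cat C D) r \<tau>) = ntgt \<tau>"
 "a : Obj C ==> nt (Scl (fun_cat C D) r \<tau>) a = Scl D r (nt \<tau> a)"
 "nt (Scl (fun_cat C D) r \<tau>) : extensional (Obj C)"
 by (simp_all add: fun_cat_def)

lemma Hom_fun_cat: "\<tau> : Hom (fun_cat C D) F G \<longleftrightarrow> is_nat C D \<tau> & nsrc \<tau> = F & ntgt \<tau> = G"
 by (auto simp: homset_def)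

lemma fun_component:
 "\<tau> : Hom (fun_cat C D) F G ==> a : Obj C ==> nt \<tau> a : Hom D (fo F a) (fo G a)"
 by (auto simp: Hom_fun_cat dest: nat_hom)

lemma category_fun_cat:
 assumes "category C" "category D"
 shows "category (fun_cat C D)" (is "category ?F")
proof (rule categoryI)
 fix \<tau> F G assume t: "\<tau> : Hom ?F F G"
 note c = fun_component[OF t]
 show "F : Obj ?F & G : Obj ?F"
  using t by (auto simp: Hom_fun_cat dest: nat_src nat_tgt)
 show "Cmp ?F \<tau> (Idn ?F F) = \<tau>"
  by (rule ntr_eqI[where C = C])
   (use t c cat_idr[OF assms(2)] in \<open>auto simp: Hom_fun_cat dest: nat_ext\<close>)
 show "Cmp ?F (Idn ?F G) \<tau> = \<tau>"
  by (rule ntr_eqI[where C = C])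
   (use t c cat_idl[OF assms(2)] in \<open>auto simp: Hom_fun_cat dest: nat_ext\<close>)
next
 fix \<tau> \<sigma> \<rho> F G H K
 assume t: "\<tau> : Hom ?F F G" "\<sigma> : Hom ?F G H" "\<rho> : Hom ?F H K"
 show "Cmp ?F \<rho> (Cmp ?F \<sigma> \<tau>) = Cmp ?F (Cmp ?F \<rho> \<sigma>) \<tau>"
  by (rule ntr_eqI[where C = C])
   (use cat_assoc[OF assms(2) fun_component[OF t(1)] fun_component[OF t(2)]
     fun_component[OF t(3)]] in auto)
qed (use assms in \<open>auto simp: Hom_fun_cat is_nat_id is_nat_vcomp\<close>)

lemma fun_cat_inverse_arrows:
 assumes "category C" "category D" "\<tau> : Arr (fun_cat C D)"
  and "!!a. a : Obj C ==> is_iso D (nt \<tau> a)"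
 shows "inverse_arrows (fun_cat C D) \<tau> (nt_inv C D \<tau>)"
proof -
 have t: "is_nat C D \<tau>" using assms(3) by simp
 note h = nat_hom[OF t] and f = nat_src[OF t] nat_tgt[OF t]
 have l: "Cmp (fun_cat C D) (nt_inv C D \<tau>) \<tau> = Idn (fun_cat C D) (nsrc \<tau>)"
  by (rule ntr_eqI[where C = C]) (use h cat_inv_left[OF assms(2) assms(4)] in auto)
 have r: "Cmp (fun_cat C D) \<tau> (nt_inv C D \<tau>) = Idn (fun_cat C D) (ntgt \<tau>)"
  by (rule ntr_eqI[where C = C]) (use h cat_inv_right[OF assms(2) assms(4)] in auto)
 show ?thesis
  unfolding inverse_arrows_def using l r assms is_nat_inv[OF assms(1,2) t assms(4)]
  by (auto simp: Hom_fun_cat)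
qed

lemma full_sub_inverse_arrows:
 "inverse_arrows C f g ==> f : Arr (full_sub C P) ==> inverse_arrows (full_sub C P) f g"
 by (auto simp: inverse_arrows_def homset_def)

section \<open>Linear categories\<close>

text \<open>This is the structure shared by matrices, representations and endofunctors. Hom-sets are
  commutative monoids, as in \<open>H'\<close>, so the arguments about biproducts never
  subtract.\<close>

locale lin_category =
 fixes C :: "('o, 'm, 'z) lincat_scheme"
 assumes cat: "category C"
  and zer_hom: "a : Obj C ==> b : Obj C ==> Zer C a b : Hom C a b"
  and add_hom: "f : Hom C a b ==> g : Hom C a b ==> Add C f g : Hom C a b"
  and add_assoc: "f : Hom C a b ==> g : Hom C a b ==> h : Hom C a b ==>
   Add C (Add C f g) h = Add C f (Add C g h)"
  and add_comm: "f : Hom C a b ==> g : Hom C a b ==> Add C f g = Add C g f"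
  and add_zer: "f : Hom C a b ==> Add C f (Zer C a b) = f"
  and cmp_add_right: "f : Hom C a b ==> g : Hom C a b ==> h : Hom C b c ==>
   Cmp C h (Add C f g) = Add C (Cmp C h f) (Cmp C h g)"
  and cmp_add_left: "f : Hom C b c ==> g : Hom C b c ==> h : Hom C a b ==>
   Cmp C (Add C f g) h = Add C (Cmp C f h) (Cmp C g h)"
  and cmp_zer_right: "f : Hom C b c ==> a : Obj C ==> Cmp C f (Zer C a b) = Zer C a c"
  and cmp_zer_left: "f : Hom C a b ==> c : Obj C ==> Cmp C (Zer C b c) f = Zer C a c"
  and scl_hom: "f : Hom C a b ==> Scl C r f : Hom C a b"
  and scl_cmp_left: "f : Hom C a b ==> g : Hom C b c ==>
   Scl C r (Cmp C g f) = Cmp C (Scl C r g) f"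
  and scl_cmp_right: "f : Hom C a b ==> g : Hom C b c ==>
   Scl C r (Cmp C g f) = Cmp C g (Scl C r f)"
  and scl_add: "f : Hom C a b ==> g : Hom C a b ==>
   Scl C r (Add C f g) = Add C (Scl C r f) (Scl C r g)"
  and scl_zer: "a : Obj C ==> b : Obj C ==> Scl C r (Zer C a b) = Zer C a b"

lemma lin_category_full_sub:
 assumes "lin_category C"
 shows "lin_category (full_sub C P)"
proof -
 interpret lin_category C by fact
 show ?thesis
  by standard
   (auto simp: Hom_full_sub category_full_sub[OF cat] intro: zer_hom add_hom add_assoc add_comm add_zer
    cmp_add_right cmp_add_left cmp_zer_right cmp_zer_left scl_hom scl_cmp_left scl_cmp_right scl_add scl_zer)
qed

lemma lin_category_fun_cat:
 assumes "category C" "lin_category D"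
 shows "lin_category (fun_cat C D)" (is "lin_category ?F")
proof -
 interpret D: lin_category D by fact
 note c = fun_component
 have nz: "is_nat C D (Zer ?F F G)" if "is_functor C D F" "is_functor C D G" for F G
 proof (rule is_natI)
  fix f a b assume f: "f : Hom C a b"
  show "Cmp D (nt (Zer ?F F G) b) (fm (nsrc (Zer ?F F G)) f) =
    Cmp D (fm (ntgt (Zer ?F F G)) f) (nt (Zer ?F F G) a)"
   using dom_obj[OF f assms(1)] fct_hom[OF that(1) f] fct_hom[OF that(2) f] that
   by (simp add: D.cmp_zer_left D.cmp_zer_right fct_obj)
 qed (use that in \<open>auto simp: fct_obj D.zer_hom\<close>)
 have na: "is_nat C D (Add ?F \<tau> \<sigma>)" if "is_nat C D \<tau>" "is_nat C D \<sigma>" "nsrc \<sigma> = nsrc \<tau>" "ntgt \<sigma> = ntgt \<tau>" for \<tau> \<sigma>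
 proof (rule is_natI)
  fix f a b assume f: "f : Hom C a b"
  note o = dom_obj[OF f assms(1)]
  note h = fct_hom[OF nat_src[OF that(1)] f] fct_hom[OF nat_tgt[OF that(1)] f]
  show "Cmp D (nt (Add ?F \<tau> \<sigma>) b) (fm (nsrc (Add ?F \<tau> \<sigma>)) f) =
    Cmp D (fm (ntgt (Add ?F \<tau> \<sigma>)) f) (nt (Add ?F \<tau> \<sigma>) a)"
   using o nat_nat[OF that(1) f] nat_nat[OF that(2) f] that(3,4)
    D.cmp_add_left[OF nat_hom[OF that(1) o(2)] nat_hom[OF that(2) o(2), unfolded that(3,4)] h(1)]
    D.cmp_add_right[OF nat_hom[OF that(1) o(1)] nat_hom[OF that(2) o(1), unfolded that(3,4)] h(2)]
   by simp
 next
  fix a assume a: "a : Obj C"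
  show "nt (Add ?F \<tau> \<sigma>) a : Hom D (fo (nsrc (Add ?F \<tau> \<sigma>)) a) (fo (ntgt (Add ?F \<tau> \<sigma>)) a)"
   using D.add_hom[OF nat_hom[OF that(1) a] nat_hom[OF that(2) a, unfolded that(3,4)]] a by simp
 qed (use that in \<open>auto simp: nat_src nat_tgt\<close>)
 have ns: "is_nat C D (Scl ?F r \<tau>)" if t: "is_nat C D \<tau>" for \<tau> r
 proof (rule is_natI)
  fix f a b assume f: "f : Hom C a b"
  note o = dom_obj[OF f assms(1)]
  note h = fct_hom[OF nat_src[OF t] f] fct_hom[OF nat_tgt[OF t] f]
  show "Cmp D (nt (Scl ?F r \<tau>) b) (fm (nsrc (Scl ?F r \<tau>)) f) =
    Cmp D (fm (ntgt (Scl ?F r \<tau>)) f) (nt (Scl ?F r \<tau>) a)"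
   using o nat_nat[OF t f] D.scl_cmp_left[OF h(1) nat_hom[OF t o(2)], symmetric]
    D.scl_cmp_right[OF nat_hom[OF t o(1)] h(2), symmetric] by simp
 qed (use t in \<open>auto simp: nat_src nat_tgt intro!: D.scl_hom nat_hom\<close>)
 show ?thesis
 proof
  show "category ?F" using category_fun_cat assms D.cat by blast
 next
  fix \<tau> \<sigma> \<rho> and F G :: "('a, 'b, 'd, 'e) fctr"
  assume t: "\<tau> : Hom ?F F G" and s: "\<sigma> : Hom ?F F G"
  show "Add ?F \<tau> \<sigma> : Hom ?F F G"
   using t s na by (auto simp: Hom_fun_cat)
  show "Add ?F \<tau> \<sigma> = Add ?F \<sigma> \<tau>"
   by (rule ntr_eqI[where C = C]) (use t s D.add_comm[OF c[OF t] c[OF s]] in \<open>auto simp: Hom_fun_cat\<close>)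
  show "Scl ?F r (Add ?F \<tau> \<sigma>) = Add ?F (Scl ?F r \<tau>) (Scl ?F r \<sigma>)" for r
   by (rule ntr_eqI[where C = C]) (use t s D.scl_add[OF c[OF t] c[OF s]] in \<open>auto simp: Hom_fun_cat\<close>)
  show "Add ?F (Add ?F \<tau> \<sigma>) \<rho> = Add ?F \<tau> (Add ?F \<sigma> \<rho>)"
   if r: "\<rho> : Hom ?F F G"
   by (rule ntr_eqI[where C = C]) (use t s D.add_assoc[OF c[OF t] c[OF s] c[OF r]] in \<open>auto simp: Hom_fun_cat\<close>)
  show "Add ?F \<tau> (Zer ?F F G) = \<tau>"
   by (rule ntr_eqI[where C = C]) (use t D.add_zer[OF c[OF t]] in \<open>auto simp: Hom_fun_cat nat_ext\<close>)
  show "Cmp ?F \<rho> (Add ?F \<tau> \<sigma>) = Add ?F (Cmp ?F \<rho> \<tau>) (Cmp ?F \<rho> \<sigma>)"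
   if r: "\<rho> : Hom ?F G H" for H
   by (rule ntr_eqI[where C = C]) (use t s D.cmp_add_right[OF c[OF t] c[OF s] c[OF r]] in \<open>auto simp: Hom_fun_cat\<close>)
  show "Cmp ?F (Add ?F \<tau> \<sigma>) \<rho> = Add ?F (Cmp ?F \<tau> \<rho>) (Cmp ?F \<sigma> \<rho>)"
   if r: "\<rho> : Hom ?F H F" for H
   by (rule ntr_eqI[where C = C]) (use t s D.cmp_add_left[OF c[OF t] c[OF s] c[OF r]] in \<open>auto simp: Hom_fun_cat\<close>)
  show "Cmp ?F \<tau> (Zer ?F H F) = Zer ?F H G" if "H : Obj ?F" for H
   by (rule ntr_eqI[where C = C]) (use t that D.cmp_zer_right[OF c[OF t]] in \<open>auto simp: Hom_fun_cat fct_obj\<close>)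
  show "Cmp ?F (Zer ?F G H) \<tau> = Zer ?F F H" if "H : Obj ?F" for H
   by (rule ntr_eqI[where C = C]) (use t that D.cmp_zer_left[OF c[OF t]] in \<open>auto simp: Hom_fun_cat fct_obj\<close>)
  show "Scl ?F r \<tau> : Hom ?F F G" for r
   using t ns by (auto simp: Hom_fun_cat)
  show "Scl ?F r (Cmp ?F \<rho> \<tau>) = Cmp ?F (Scl ?F r \<rho>) \<tau>"
   if r: "\<rho> : Hom ?F G H" for H r
   by (rule ntr_eqI[where C = C]) (use t D.scl_cmp_left[OF c[OF t] c[OF r]] in \<open>auto simp: Hom_fun_cat\<close>)
  show "Scl ?F r (Cmp ?F \<rho> \<tau>) = Cmp ?F \<rho> (Scl ?F r \<tau>)"
   if r: "\<rho> : Hom ?F G H" for H r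
   by (rule ntr_eqI[where C = C]) (use t D.scl_cmp_right[OF c[OF t] c[OF r]] in \<open>auto simp: Hom_fun_cat\<close>)
 next
  fix F G assume "F : Obj ?F" "G : Obj ?F"
  hence F: "is_functor C D F" "is_functor C D G" by auto
  show "Zer ?F F G : Hom ?F F G"
   using nz[OF F] by (auto simp: Hom_fun_cat)
  show "Scl ?F r (Zer ?F F G) = Zer ?F F G" for r
   by (rule ntr_eqI[where C = C]) (use F D.scl_zer in \<open>auto simp: fct_obj\<close>)
 qed
qed


section \<open>Biproducts and zero objects\<close>

definition is_biprod :: "('o, 'm, 'z) lincat_scheme => 'o => 'o => 'o => 'm => 'm => 'm => 'm => bool" where
 "is_biprod C X Y Z i1 i2 q1 q2 \<longleftrightarrow>
   i1 : Hom C X Z & i2 : Hom C Y Z & q1 : Hom C Z X & q2 : Hom C Z Y &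
   Cmp C q1 i1 = Idn C X & Cmp C q2 i2 = Idn C Y & Cmp C q1 i2 = Zer C Y X &
   Cmp C q2 i1 = Zer C X Y & Add C (Cmp C i1 q1) (Cmp C i2 q2) = Idn C Z"

definition has_biprods :: "('o, 'm, 'z) lincat_scheme => bool" where
 "has_biprods C \<longleftrightarrow> (\<forall>X\<in>Obj C. \<forall>Y\<in>Obj C. EX Z i1 i2 q1 q2. is_biprod C X Y Z i1 i2 q1 q2)"

definition has_zero :: "('o, 'm, 'z) lincat_scheme => bool" where
 "has_zero C \<longleftrightarrow> (\<exists>Z\<in>Obj C. Idn C Z = Zer C Z Z)"

context lin_category begin

lemma zer_add: "f : Hom C a b ==> Add C (Zer C a b) f = f"
 using add_comm add_zer zer_hom cat_obj[OF cat] by metis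

text \<open>The equation \<open>i1 q1 + i2 q2 = 1\<close> writes \<open>f\<close> as
  \<open>f i1 q1 + f i2 q2\<close>, so the injections are jointly epic. Biproducts are given by
  equations and not by a universal property because equations pass to functor categories component
  by component and are exactly the biproduct axioms of \<open>H'\<close>.\<close>

lemma biprod_eqI:
 assumes b: "is_biprod C X Y Z i1 i2 q1 q2" and f: "f : Hom C Z W" and g: "g : Hom C Z W"
  and e: "Cmp C f i1 = Cmp C g i1" "Cmp C f i2 = Cmp C g i2"
 shows "f = g"
proof -
 have i: "i1 : Hom C X Z" "i2 : Hom C Y Z" "q1 : Hom C Z X" "q2 : Hom C Z Y"
  and s: "Add C (Cmp C i1 q1) (Cmp C i2 q2) = Idn C Z"
  using b by (auto simp: is_biprod_def)
 have "h = Add C (Cmp C (Cmp C h i1) q1) (Cmp C (Cmp C h i2) q2)" if h: "h : Hom C Z W" for h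
  using cmp_add_right[OF cat_cmp[OF cat i(3,1)] cat_cmp[OF cat i(4,2)] h] s cat_idr[OF cat h]
   cat_assoc[OF cat i(3,1) h] cat_assoc[OF cat i(4,2) h] by simp
 from this[OF f] this[OF g] show ?thesis using e by simp
qed

text \<open>\<open>h\<close> is the diagonal matrix with entries \<open>f\<close> and
  \<open>g\<close>. Its compatibility with injections and projections supplies, when used pointwise,
  both the functoriality of a direct sum of functors and the naturality of the four structure
  maps.\<close>

lemma biprod_map:
 assumes b: "is_biprod C X Y Z i1 i2 q1 q2" and b': "is_biprod C X' Y' Z' i1' i2' q1' q2'"
  and f: "f : Hom C X X'" and g: "g : Hom C Y Y'"
 defines "h \<equiv> Add C (Cmp C i1' (Cmp C f q1)) (Cmp C i2' (Cmp C g q2))"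
 shows "h : Hom C Z Z'" "Cmp C h i1 = Cmp C i1' f" "Cmp C h i2 = Cmp C i2' g"
  "Cmp C q1' h = Cmp C f q1" "Cmp C q2' h = Cmp C g q2"
proof -
 have i: "i1 : Hom C X Z" "i2 : Hom C Y Z" "q1 : Hom C Z X" "q2 : Hom C Z Y"
  and s: "Cmp C q1 i1 = Idn C X" "Cmp C q2 i2 = Idn C Y" "Cmp C q1 i2 = Zer C Y X" "Cmp C q2 i1 = Zer C X Y"
  using b by (auto simp: is_biprod_def)
 have i': "i1' : Hom C X' Z'" "i2' : Hom C Y' Z'" "q1' : Hom C Z' X'" "q2' : Hom C Z' Y'"
  and s': "Cmp C q1' i1' = Idn C X'" "Cmp C q2' i2' = Idn C Y'" "Cmp C q1' i2' = Zer C Y' X'" "Cmp C q2' i1' = Zer C X' Y'"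
  using b' by (auto simp: is_biprod_def)
 note fq = cat_cmp[OF cat i(3) f] and gq = cat_cmp[OF cat i(4) g]
 note l = cat_cmp[OF cat fq i'(1)] and r = cat_cmp[OF cat gq i'(2)]
 note i1f = cat_cmp[OF cat f i'(1)] and i2g = cat_cmp[OF cat g i'(2)]
 note oXYZ = dom_obj[OF i(1) cat] dom_obj[OF i(2) cat] dom_obj[OF i'(1) cat] dom_obj[OF i'(2) cat]
 show "h : Hom C Z Z'" unfolding h_def by (rule add_hom[OF l r])
 have "Cmp C h i1 = Add C (Cmp C i1' (Cmp C f (Cmp C q1 i1))) (Cmp C i2' (Cmp C g (Cmp C q2 i1)))"
  unfolding h_def cmp_add_left[OF l r i(1)]
  by (simp add: cat_assoc[OF cat i(1) fq i'(1)] cat_assoc[OF cat i(1) gq i'(2)]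
    cat_assoc[OF cat i(1,3) f] cat_assoc[OF cat i(1,4) g])
 thus "Cmp C h i1 = Cmp C i1' f"
  using s cat_idr[OF cat f] cmp_zer_right[OF g] cmp_zer_right[OF i'(2)] add_zer[OF i1f] oXYZ by simp
 have "Cmp C h i2 = Add C (Cmp C i1' (Cmp C f (Cmp C q1 i2))) (Cmp C i2' (Cmp C g (Cmp C q2 i2)))"
  unfolding h_def cmp_add_left[OF l r i(2)]
  by (simp add: cat_assoc[OF cat i(2) fq i'(1)] cat_assoc[OF cat i(2) gq i'(2)]
    cat_assoc[OF cat i(2,3) f] cat_assoc[OF cat i(2,4) g])
 thus "Cmp C h i2 = Cmp C i2' g"
  using s cat_idr[OF cat g] cmp_zer_right[OF f] cmp_zer_right[OF i'(1)] zer_add[OF i2g] oXYZ by simp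
 have "Cmp C q1' h = Add C (Cmp C (Cmp C q1' i1') (Cmp C f q1)) (Cmp C (Cmp C q1' i2') (Cmp C g q2))"
  unfolding h_def cmp_add_right[OF l r i'(3)]
  by (simp add: cat_assoc[OF cat fq i'(1) i'(3)] cat_assoc[OF cat gq i'(2) i'(3)])
 thus "Cmp C q1' h = Cmp C f q1"
  using s' cat_idl[OF cat fq] cmp_zer_left[OF gq] add_zer[OF fq] oXYZ by simp
 have "Cmp C q2' h = Add C (Cmp C (Cmp C q2' i1') (Cmp C f q1)) (Cmp C (Cmp C q2' i2') (Cmp C g q2))"
  unfolding h_def cmp_add_right[OF l r i'(4)]
  by (simp add: cat_assoc[OF cat fq i'(1) i'(4)] cat_assoc[OF cat gq i'(2) i'(4)])
 thus "Cmp C q2' h = Cmp C g q2"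
  using s' cat_idl[OF cat gq] cmp_zer_left[OF fq] zer_add[OF gq] oXYZ by simp
qed

end

lemma has_biprods_full_sub:
 assumes "category C" "has_biprods C"
  and "!!X Y Z i1 i2 q1 q2. is_biprod C X Y Z i1 i2 q1 q2 ==> P X ==> P Y ==> P Z"
 shows "has_biprods (full_sub C P)"
 unfolding has_biprods_def
proof (intro ballI)
 fix X Y assume XY: "X : Obj (full_sub C P)" "Y : Obj (full_sub C P)"
 then obtain Z i1 i2 q1 q2 where b: "is_biprod C X Y Z i1 i2 q1 q2"
  using assms(2) by (fastforce simp: has_biprods_def)
 have "P Z" using assms(3)[OF b] XY by simp
 hence "is_biprod (full_sub C P) X Y Z i1 i2 q1 q2"
  using b XY by (simp add: is_biprod_def Hom_full_sub)
 thus "EX Z i1 i2 q1 q2. is_biprod (full_sub C P) X Y Z i1 i2 q1 q2" by blast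
qed

lemma fun_cat_biprod_component:
 assumes "is_biprod (fun_cat C D) F G H i1 i2 q1 q2" "a : Obj C"
 shows "is_biprod D (fo F a) (fo G a) (fo H a) (nt i1 a) (nt i2 a) (nt q1 a) (nt q2 a)"
proof -
 have e: "Cmp (fun_cat C D) q1 i1 = Idn (fun_cat C D) F" "Cmp (fun_cat C D) q2 i2 = Idn (fun_cat C D) G"
  "Cmp (fun_cat C D) q1 i2 = Zer (fun_cat C D) G F" "Cmp (fun_cat C D) q2 i1 = Zer (fun_cat C D) F G"
  "Add (fun_cat C D) (Cmp (fun_cat C D) i1 q1) (Cmp (fun_cat C D) i2 q2) = Idn (fun_cat C D) H"
  and h: "i1 : Hom (fun_cat C D) F H" "i2 : Hom (fun_cat C D) G H" "q1 : Hom (fun_cat C D) H F"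
  "q2 : Hom (fun_cat C D) H G"
  using assms(1) by (simp_all only: is_biprod_def)
 note e' = e[THEN arg_cong, of "\<lambda>\<tau>. nt \<tau> a"]
 show ?thesis
  using e' assms(2) h[THEN fun_component, OF assms(2)] by (simp add: is_biprod_def)
qed

lemma has_biprods_fun_cat:
 assumes "category C" "lin_category D" "has_biprods D"
 shows "has_biprods (fun_cat C D)"
 unfolding has_biprods_def
proof (intro ballI)
 interpret D: lin_category D by fact
 fix F G assume "F : Obj (fun_cat C D)" "G : Obj (fun_cat C D)"
 hence F: "is_functor C D F" and G: "is_functor C D G" by auto
 \<comment> \<open>One biproduct is chosen at every object. The choices need no mutual
   compatibility: the action of \<open>H\<close> on arrows is defined as the diagonal matrix between
   the chosen biproducts.\<close>
 define w where "w a = (SOME (Z, i1, i2, q1, q2). is_biprod D (fo F a) (fo G a) Z i1 i2 q1 q2)" for a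
 have w: "case w a of (Z, i1, i2, q1, q2) => is_biprod D (fo F a) (fo G a) Z i1 i2 q1 q2" if "a : Obj C" for a
 proof -
  have "EX w. case w of (Z, i1, i2, q1, q2) => is_biprod D (fo F a) (fo G a) Z i1 i2 q1 q2"
   using assms(3) fct_obj[OF F that] fct_obj[OF G that] unfolding has_biprods_def
   by (simp add: split_paired_Ex)
  from someI_ex[OF this] show ?thesis by (simp add: w_def)
 qed
 define Z where "Z a = fst (w a)" for a
 define i1 where "i1 a = fst (snd (w a))" for a
 define i2 where "i2 a = fst (snd (snd (w a)))" for a
 define q1 where "q1 a = fst (snd (snd (snd (w a))))" for a
 define q2 where "q2 a = snd (snd (snd (snd (w a))))" for a
 have b: "is_biprod D (fo F a) (fo G a) (Z a) (i1 a) (i2 a) (q1 a) (q2 a)" if "a : Obj C" for a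
  using w[OF that] by (simp add: Z_def i1_def i2_def q1_def q2_def split: prod.splits)
 have h: "i1 a : Hom D (fo F a) (Z a)" "i2 a : Hom D (fo G a) (Z a)"
  "q1 a : Hom D (Z a) (fo F a)" "q2 a : Hom D (Z a) (fo G a)" if "a : Obj C" for a
  using b[OF that] by (auto simp: is_biprod_def)
 have e: "Cmp D (q1 a) (i1 a) = Idn D (fo F a)" "Cmp D (q2 a) (i2 a) = Idn D (fo G a)"
  "Cmp D (q1 a) (i2 a) = Zer D (fo G a) (fo F a)" "Cmp D (q2 a) (i1 a) = Zer D (fo F a) (fo G a)"
  "Add D (Cmp D (i1 a) (q1 a)) (Cmp D (i2 a) (q2 a)) = Idn D (Z a)" if "a : Obj C" for a
  using b[OF that] by (simp_all add: is_biprod_def)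
 define H where "H = \<lparr>fo = Z, fm = (%f. Add D
  (Cmp D (i1 (Cod C f)) (Cmp D (fm F f) (q1 (Dom C f))))
  (Cmp D (i2 (Cod C f)) (Cmp D (fm G f) (q2 (Dom C f)))))\<rparr>"
 have Hm: "fm H f = Add D (Cmp D (i1 b) (Cmp D (fm F f) (q1 a))) (Cmp D (i2 b) (Cmp D (fm G f) (q2 a)))"
  if "f : Hom C a b" for f a b using that by (simp add: H_def homset_def)
 have m: "fm H f : Hom D (Z a) (Z b')" "Cmp D (fm H f) (i1 a) = Cmp D (i1 b') (fm F f)"
  "Cmp D (fm H f) (i2 a) = Cmp D (i2 b') (fm G f)" "Cmp D (q1 b') (fm H f) = Cmp D (fm F f) (q1 a)"
  "Cmp D (q2 b') (fm H f) = Cmp D (fm G f) (q2 a)" if f: "f : Hom C a b'" for f a b'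
  using D.biprod_map[OF b[OF dom_obj(1)[OF f assms(1)]] b[OF dom_obj(2)[OF f assms(1)]]
    fct_hom[OF F f] fct_hom[OF G f]] by (simp_all add: Hm[OF f])
 have Ho: "fo H = Z" by (simp add: H_def)
 have HH: "is_functor C D H"
 proof (rule is_functorI)
  fix a assume a: "a : Obj C"
  show "fo H a : Obj D" using h[OF a] cat_obj[OF D.cat] by (auto simp: Ho)
  have ia: "Idn C a : Hom C a a" using a assms(1) cat_idn by metis
  show "fm H (Idn C a) = Idn D (fo H a)"
   unfolding Ho
  proof (rule D.biprod_eqI[OF b[OF a]])
   show "fm H (Idn C a) : Hom D (Z a) (Z a)" using m(1)[OF ia] .
   show "Idn D (Z a) : Hom D (Z a) (Z a)" using h[OF a] cat_obj[OF D.cat] cat_idn[OF D.cat] by blast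
   show "Cmp D (fm H (Idn C a)) (i1 a) = Cmp D (Idn D (Z a)) (i1 a)"
    by (simp add: m(2)[OF ia] fct_idn[OF F a] cat_idl[OF D.cat h(1)[OF a]] cat_idr[OF D.cat h(1)[OF a]])
   show "Cmp D (fm H (Idn C a)) (i2 a) = Cmp D (Idn D (Z a)) (i2 a)"
    by (simp add: m(3)[OF ia] fct_idn[OF G a] cat_idl[OF D.cat h(2)[OF a]] cat_idr[OF D.cat h(2)[OF a]])
  qed
 next
  fix f a b' assume f: "f : Hom C a b'"
  note o = dom_obj[OF f assms(1)]
  show "fm H f : Hom D (fo H a) (fo H b')" unfolding Ho using m(1)[OF f] .
 next
  fix f g a b' c assume f: "f : Hom C a b'" and g: "g : Hom C b' c"
  note o = dom_obj[OF f assms(1)] dom_obj[OF g assms(1)]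
  note gf = cat_cmp[OF assms(1) f g]
  note H1 = m(1)[OF f] and H2 = m(1)[OF g]
  note Ff = fct_hom[OF F f] fct_hom[OF F g] fct_hom[OF G f] fct_hom[OF G g]
  show "fm H (Cmp C g f) = Cmp D (fm H g) (fm H f)"
  proof (rule D.biprod_eqI[OF b[OF o(1)]])
   show "fm H (Cmp C g f) : Hom D (Z a) (Z c)" using m(1)[OF gf] .
   show "Cmp D (fm H g) (fm H f) : Hom D (Z a) (Z c)" using cat_cmp[OF D.cat H1 H2] .
   show "Cmp D (fm H (Cmp C g f)) (i1 a) = Cmp D (Cmp D (fm H g) (fm H f)) (i1 a)"
    using m(2)[OF gf] m(2)[OF f] m(2)[OF g]
    by (simp add: cat_assoc[OF D.cat h(1)[OF o(1)] H1 H2] cat_assoc[OF D.cat Ff(1) h(1)[OF o(2)] H2, symmetric]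
      fct_cmp[OF F f g] cat_assoc[OF D.cat Ff(1,2) h(1)[OF o(4)]])
   show "Cmp D (fm H (Cmp C g f)) (i2 a) = Cmp D (Cmp D (fm H g) (fm H f)) (i2 a)"
    using m(3)[OF gf] m(3)[OF f] m(3)[OF g]
    by (simp add: cat_assoc[OF D.cat h(2)[OF o(1)] H1 H2] cat_assoc[OF D.cat Ff(3) h(2)[OF o(2)] H2, symmetric]
      fct_cmp[OF G f g] cat_assoc[OF D.cat Ff(3,4) h(2)[OF o(4)]])
  qed
 qed
 let ?I1 = "\<lparr>nsrc = F, ntgt = H, nt = restrict i1 (Obj C)\<rparr>" and ?I2 = "\<lparr>nsrc = G, ntgt = H, nt = restrict i2 (Obj C)\<rparr>"
 let ?Q1 = "\<lparr>nsrc = H, ntgt = F, nt = restrict q1 (Obj C)\<rparr>" and ?Q2 = "\<lparr>nsrc = H, ntgt = G, nt = restrict q2 (Obj C)\<rparr>"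
 have nn: "is_nat C D \<lparr>nsrc = K, ntgt = L, nt = restrict j (Obj C)\<rparr>"
  if "is_functor C D K" "is_functor C D L" "!!a. a : Obj C ==> j a : Hom D (fo K a) (fo L a)"
   "!!f a b'. f : Hom C a b' ==> Cmp D (j b') (fm K f) = Cmp D (fm L f) (j a)" for K L j
  by (rule is_natI) (use that dom_obj[OF _ assms(1)] in auto)
 have n: "is_nat C D ?I1" "is_nat C D ?I2" "is_nat C D ?Q1" "is_nat C D ?Q2"
  by (rule nn; simp add: F G HH Ho h m)+
 have "is_biprod (fun_cat C D) F G H ?I1 ?I2 ?Q1 ?Q2"
  unfolding is_biprod_def
  apply (intro conjI)
  subgoal using n by (simp add: Hom_fun_cat)
  subgoal using n by (simp add: Hom_fun_cat)
  subgoal using n by (simp add: Hom_fun_cat)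
  subgoal using n by (simp add: Hom_fun_cat)
  by (rule ntr_eqI[where C = C]; simp add: e Ho)+
 thus "EX Z i1 i2 q1 q2. is_biprod (fun_cat C D) F G Z i1 i2 q1 q2" by blast
qed

text \<open>The constant functor at a zero object is returned with its action spelled out, so that
  its linearity can be read off when a zero object is needed among linear endofunctors.\<close>

lemma has_zero_fun_cat:
 assumes "category C" "lin_category D" "has_zero D"
 shows "\<exists>z\<in>Obj D. EX F. is_functor C D F & Idn D z = Zer D z z & (ALL a. fo F a = z) & (ALL f. fm F f = Zer D z z)"
proof -
 interpret D: lin_category D by fact
 obtain z where z: "z : Obj D" "Idn D z = Zer D z z" using assms(3) by (auto simp: has_zero_def)
 have "is_functor C D \<lparr>fo = %_. z, fm = %_. Zer D z z\<rparr>"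
  by (rule is_functorI) (use z D.zer_hom D.cmp_zer_left[OF D.zer_hom] in auto)
 thus ?thesis using z by (intro bexI[of _ z] exI[of _ "\<lparr>fo = %_. z, fm = %_. Zer D z z\<rparr>"]) auto
qed

section \<open>Additive and linear functors\<close>

lemma
 assumes "additive_functor C D F"
 shows additive_fct: "is_functor C D F"
  and additive_functor_add: "f : Hom C a b ==> g : Hom C a b ==> fm F (Add C f g) = Add D (fm F f) (fm F g)"
  and additive_functor_zer: "a : Obj C ==> b : Obj C ==> fm F (Zer C a b) = Zer D (fo F a) (fo F b)"
 using assms by (auto simp: additive_functor_def parallel_arrows_def homset_def)

lemma lin_additive: "linear_functor C D F ==> additive_functor C D F"
 and linear_functor_scl: "linear_functor C D F ==> f : Hom C a b ==> fm F (Scl C r f) = Scl D r (fm F f)"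
 by (auto simp: linear_functor_def homset_def)

lemma linear_functorI:
 assumes "is_functor C D F"
  and "!!a b f g. f : Hom C a b ==> g : Hom C a b ==> fm F (Add C f g) = Add D (fm F f) (fm F g)"
  and "!!a b. a : Obj C ==> b : Obj C ==> fm F (Zer C a b) = Zer D (fo F a) (fo F b)"
  and "!!a b f r. f : Hom C a b ==> fm F (Scl C r f) = Scl D r (fm F f)"
 shows "linear_functor C D F"
 using assms by (auto simp: linear_functor_def additive_functor_def parallel_arrows_def homset_def)

lemma linear_functor_idF: "category C ==> linear_functor C C idF"
 by (rule linear_functorI) (auto simp: is_functor_idF)

lemma lin_fcmp:
 assumes "linear_functor C D F" "linear_functor D E G"
 shows "linear_functor C E (fcmp G F)"
proof -
 note a = lin_additive[OF assms(1)] lin_additive[OF assms(2)]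
 note f = additive_fct[OF a(1)] additive_fct[OF a(2)]
 show ?thesis
  by (rule linear_functorI[OF is_functor_fcmp[OF f]])
   (auto simp: additive_functor_add[OF a(1)] additive_functor_add[OF a(2) fct_hom[OF f(1)] fct_hom[OF f(1)]]
    additive_functor_zer[OF a(1)] additive_functor_zer[OF a(2)] fct_obj[OF f(1)]
    linear_functor_scl[OF assms(1)] linear_functor_scl[OF assms(2) fct_hom[OF f(1)]])
qed

text \<open>Both sides of a linearity equation for \<open>H\<close> are compared after the
  injections of the biproduct. Naturality moves \<open>H\<close> past them, which turns the equation
  into the one for \<open>F\<close> or for \<open>G\<close>.\<close>

lemma linear_functor_biprod:
 assumes C: "lin_category C" and D: "lin_category D" and b: "is_biprod (fun_cat C D) F G H i1 i2 q1 q2"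
  and F: "linear_functor C D F" and G: "linear_functor C D G"
 shows "linear_functor C D H"
proof -
 interpret C: lin_category C by fact
 interpret D: lin_category D by fact
 note bc = fun_cat_biprod_component[OF b]
 note aF = lin_additive[OF F] and aG = lin_additive[OF G]
 have n: "is_nat C D i1" "nsrc i1 = F" "ntgt i1 = H" "is_nat C D i2" "nsrc i2 = G" "ntgt i2 = H"
  using b by (auto simp: is_biprod_def Hom_fun_cat)
 have H: "is_functor C D H" and FF: "is_functor C D F" and GG: "is_functor C D G"
  using nat_tgt[OF n(1)] nat_src[OF n(1)] nat_src[OF n(4)] n by auto
 note h1 = nat_hom[OF n(1), unfolded n] and h2 = nat_hom[OF n(4), unfolded n]
 note n1 = nat_nat[OF n(1), unfolded n] and n2 = nat_nat[OF n(4), unfolded n]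
 show ?thesis
 proof (rule linear_functorI[OF H])
  fix a b f g assume f: "f : Hom C a b" and g: "g : Hom C a b"
  note o = dom_obj[OF f C.cat] and fg = C.add_hom[OF f g]
  note Hh = fct_hom[OF H f] fct_hom[OF H g]
  note Fh = fct_hom[OF FF f] fct_hom[OF FF g] fct_hom[OF GG f] fct_hom[OF GG g]
  show "fm H (Add C f g) = Add D (fm H f) (fm H g)"
  proof (rule D.biprod_eqI[OF bc[OF o(1)]])
   show "fm H (Add C f g) : Hom D (fo H a) (fo H b)" by (rule fct_hom[OF H fg])
   show "Add D (fm H f) (fm H g) : Hom D (fo H a) (fo H b)" by (rule D.add_hom[OF Hh])
   show "Cmp D (fm H (Add C f g)) (nt i1 a) = Cmp D (Add D (fm H f) (fm H g)) (nt i1 a)"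
    by (simp add: D.cmp_add_left[OF Hh h1[OF o(1)]] n1[OF fg, symmetric] n1[OF f, symmetric] n1[OF g, symmetric]
      additive_functor_add[OF aF f g] D.cmp_add_right[OF Fh(1,2) h1[OF o(2)]])
   show "Cmp D (fm H (Add C f g)) (nt i2 a) = Cmp D (Add D (fm H f) (fm H g)) (nt i2 a)"
    by (simp add: D.cmp_add_left[OF Hh h2[OF o(1)]] n2[OF fg, symmetric] n2[OF f, symmetric] n2[OF g, symmetric]
      additive_functor_add[OF aG f g] D.cmp_add_right[OF Fh(3,4) h2[OF o(2)]])
  qed
 next
  fix a b f r assume f: "f : Hom C a b"
  note o = dom_obj[OF f C.cat]
  note Hh = fct_hom[OF H f] and Fh = fct_hom[OF FF f] fct_hom[OF GG f]
  note rf = C.scl_hom[OF f, of r]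
  show "fm H (Scl C r f) = Scl D r (fm H f)"
  proof (rule D.biprod_eqI[OF bc[OF o(1)]])
   show "fm H (Scl C r f) : Hom D (fo H a) (fo H b)" by (rule fct_hom[OF H rf])
   show "Scl D r (fm H f) : Hom D (fo H a) (fo H b)" by (rule D.scl_hom[OF Hh])
   show "Cmp D (fm H (Scl C r f)) (nt i1 a) = Cmp D (Scl D r (fm H f)) (nt i1 a)"
    by (simp add: D.scl_cmp_left[OF h1[OF o(1)] Hh, symmetric] n1[OF rf, symmetric] n1[OF f, symmetric]
      linear_functor_scl[OF F f] D.scl_cmp_right[OF Fh(1) h1[OF o(2)]])
   show "Cmp D (fm H (Scl C r f)) (nt i2 a) = Cmp D (Scl D r (fm H f)) (nt i2 a)"
    by (simp add: D.scl_cmp_left[OF h2[OF o(1)] Hh, symmetric] n2[OF rf, symmetric] n2[OF f, symmetric]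
      linear_functor_scl[OF G f] D.scl_cmp_right[OF Fh(2) h2[OF o(2)]])
  qed
 next
  fix a b assume o: "a : Obj C" "b : Obj C"
  note z = C.zer_hom[OF o]
  note Ho = fct_obj[OF H o(1)] fct_obj[OF H o(2)]
  show "fm H (Zer C a b) = Zer D (fo H a) (fo H b)"
  proof (rule D.biprod_eqI[OF bc[OF o(1)]])
   show "fm H (Zer C a b) : Hom D (fo H a) (fo H b)" by (rule fct_hom[OF H z])
   show "Zer D (fo H a) (fo H b) : Hom D (fo H a) (fo H b)" by (rule D.zer_hom[OF Ho])
   show "Cmp D (fm H (Zer C a b)) (nt i1 a) = Cmp D (Zer D (fo H a) (fo H b)) (nt i1 a)"
    using h1[OF o(1)] h1[OF o(2)] o Ho by (simp add: n1[OF z, symmetric] additive_functor_zer[OF aF] D.cmp_zer_left D.cmp_zer_right fct_obj[OF FF])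
   show "Cmp D (fm H (Zer C a b)) (nt i2 a) = Cmp D (Zer D (fo H a) (fo H b)) (nt i2 a)"
    using h2[OF o(1)] h2[OF o(2)] o Ho by (simp add: n2[OF z, symmetric] additive_functor_zer[OF aG] D.cmp_zer_left D.cmp_zer_right fct_obj[OF GG])
  qed
 qed
qed

section \<open>Linear endofunctors\<close>

lemma End_cat_simps [simp]:
 "Obj (End_cat C) = {F. linear_functor C C F}"
 "Dom (End_cat C) = nsrc" "Cod (End_cat C) = ntgt" "Idn (End_cat C) = nt_id C C" "Cmp (End_cat C) = vcomp C C"
 "Add (End_cat C) = Add (fun_cat C C)" "Zer (End_cat C) = Zer (fun_cat C C)"
 by (auto simp: End_cat_def linear_functor_def additive_functor_def)

lemma Hom_End_cat:
 "\<tau> : Hom (End_cat C) F G \<longleftrightarrow> is_nat C C \<tau> & nsrc \<tau> = F & ntgt \<tau> = G & linear_functor C C F & linear_functor C C G"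
 by (auto simp: End_cat_def Hom_full_sub Hom_fun_cat)

lemma End_tens_simps [simp]:
 "tob (End_tens C) = fcmp" "tun (End_tens C) = idF"
 "asc (End_tens C) F G H = nt_id C C (fcmp F (fcmp G H))" "lun (End_tens C) = nt_id C C" "run (End_tens C) = nt_id C C"
 "nsrc (tar (End_tens C) \<sigma> \<tau>) = fcmp (nsrc \<sigma>) (nsrc \<tau>)"
 "ntgt (tar (End_tens C) \<sigma> \<tau>) = fcmp (ntgt \<sigma>) (ntgt \<tau>)"
 "nt (tar (End_tens C) \<sigma> \<tau>) : extensional (Obj C)"
 "a : Obj C ==> nt (tar (End_tens C) \<sigma> \<tau>) a = Cmp C (nt \<sigma> (fo (ntgt \<tau>) a)) (fm (nsrc \<sigma>) (nt \<tau> a))"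
 by (simp_all add: End_tens_def)

lemma lin_fct: "linear_functor C D F ==> is_functor C D F"
 by (rule additive_fct[OF lin_additive])

lemma category_End_cat: "category C ==> category (End_cat C)"
 unfolding End_cat_def by (intro category_full_sub category_fun_cat)

lemma lin_category_End_cat: "lin_category C ==> lin_category (End_cat C)"
 unfolding End_cat_def by (intro lin_category_full_sub lin_category_fun_cat lin_category.cat)

lemma has_biprods_End_cat:
 assumes "lin_category C" "has_biprods C"
 shows "has_biprods (End_cat C)"
 unfolding End_cat_def
proof (rule has_biprods_full_sub)
 show "category (fun_cat C C)" using lin_category.cat[OF assms(1)] category_fun_cat by blast
 show "has_biprods (fun_cat C C)" using has_biprods_fun_cat[OF lin_category.cat[OF assms(1)] assms] .
qed (rule linear_functor_biprod[OF assms(1,1)])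

lemma has_zero_End_cat:
 assumes "lin_category C" "has_zero C"
 shows "has_zero (End_cat C)"
proof -
 interpret C: lin_category C by fact
 obtain z F where z: "z : Obj C" "is_functor C C F" "Idn C z = Zer C z z" "!!a. fo F a = z" "!!f. fm F f = Zer C z z"
  using has_zero_fun_cat[OF C.cat assms] by blast
 have "linear_functor C C F"
  by (rule linear_functorI[OF z(2)]) (use z C.add_zer[OF C.zer_hom] C.scl_zer in auto)
 moreover have "nt_id C C F = Zer (fun_cat C C) F F"
  by (rule ntr_eqI[where C = C]) (simp_all add: z)
 ultimately show ?thesis unfolding has_zero_def by (intro bexI[of _ F]) simp_all
qed

lemma is_nat_tar:
 assumes "category C" "is_nat C C \<sigma>" "is_nat C C \<tau>"
 shows "is_nat C C (tar (End_tens C) \<sigma> \<tau>)"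
 unfolding End_tens_def tens.select_convs
 by (intro is_nat_vcomp is_nat_whisk_l[where D = C] is_nat_whisk_r[where C = C] assms nat_src nat_tgt) simp

lemma tar_hom:
 assumes "category C" "\<sigma> : Hom (End_cat C) F G" "\<tau> : Hom (End_cat C) H K"
 shows "tar (End_tens C) \<sigma> \<tau> : Hom (End_cat C) (fcmp F H) (fcmp G K)"
 using assms by (auto simp: Hom_End_cat is_nat_tar intro: lin_fcmp)

text \<open>The two ways of evaluating a horizontal composite agree by naturality of
  \<open>\<sigma>\<close> at the component of \<open>\<tau>\<close>.\<close>

lemma tar_component:
 assumes "category C" "\<sigma> : Hom (End_cat C) F G" "\<tau> : Hom (End_cat C) H K" "a : Obj C"
 shows "nt (tar (End_tens C) \<sigma> \<tau>) a = Cmp C (nt \<sigma> (fo K a)) (fm F (nt \<tau> a))"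
  and "nt (tar (End_tens C) \<sigma> \<tau>) a = Cmp C (fm G (nt \<tau> a)) (nt \<sigma> (fo H a))"
proof -
 have s: "is_nat C C \<sigma>" "nsrc \<sigma> = F" "ntgt \<sigma> = G" and t: "is_nat C C \<tau>" "nsrc \<tau> = H" "ntgt \<tau> = K"
  using assms by (auto simp: Hom_End_cat)
 show "nt (tar (End_tens C) \<sigma> \<tau>) a = Cmp C (nt \<sigma> (fo K a)) (fm F (nt \<tau> a))" using s t assms(4) by simp
 thus "nt (tar (End_tens C) \<sigma> \<tau>) a = Cmp C (fm G (nt \<tau> a)) (nt \<sigma> (fo H a))"
  using nat_nat[OF s(1) nat_hom[OF t(1) assms(4)]] s t by simp
qed

lemma End_cat_eqI:
 assumes "\<tau> : Hom (End_cat C) F G" "\<sigma> : Hom (End_cat C) F G" "!!a. a : Obj C ==> nt \<tau> a = nt \<sigma> a"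
 shows "\<tau> = \<sigma>"
 by (rule ntr_eqI[where C = C]) (use assms in \<open>auto simp: Hom_End_cat dest: nat_ext\<close>)

lemma End_component:
 "\<tau> : Hom (End_cat C) F G ==> a : Obj C ==> nt \<tau> a : Hom C (fo F a) (fo G a)"
 by (auto simp: Hom_End_cat dest: nat_hom)

lemma nt_id_hom: "category C ==> linear_functor C C F ==> nt_id C C F : Hom (End_cat C) F F"
 by (auto simp: Hom_End_cat is_nat_id lin_fct)

lemma tar_cmp:
 assumes C: "category C" and t: "\<tau> : Hom (End_cat C) F G" "\<tau>' : Hom (End_cat C) G H"
  and s: "\<sigma> : Hom (End_cat C) K L" "\<sigma>' : Hom (End_cat C) L M"
 shows "tar (End_tens C) (vcomp C C \<tau>' \<tau>) (vcomp C C \<sigma>' \<sigma>) =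
  vcomp C C (tar (End_tens C) \<tau>' \<sigma>') (tar (End_tens C) \<tau> \<sigma>)"
proof (rule End_cat_eqI)
 note E = category_End_cat[OF C]
 note tt = cat_cmp[OF E t] and ss = cat_cmp[OF E s]
 show "tar (End_tens C) (vcomp C C \<tau>' \<tau>) (vcomp C C \<sigma>' \<sigma>) : Hom (End_cat C) (fcmp F K) (fcmp H M)"
  using tar_hom[OF C tt ss] by simp
 show "vcomp C C (tar (End_tens C) \<tau>' \<sigma>') (tar (End_tens C) \<tau> \<sigma>) : Hom (End_cat C) (fcmp F K) (fcmp H M)"
  using cat_cmp[OF E tar_hom[OF C t(1) s(1)] tar_hom[OF C t(2) s(2)]] by simp
 fix a assume a: "a : Obj C"
 have lin: "is_functor C C F" "is_functor C C G" "is_functor C C M" "is_functor C C L"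
  using t s by (auto simp: Hom_End_cat lin_fct)
 note sa = End_component[OF s(1) a] End_component[OF s(2) a]
 note Ma = fct_obj[OF lin(3) a] and La = fct_obj[OF lin(4) a]
 note ta = End_component[OF t(1) Ma] End_component[OF t(2) Ma] End_component[OF t(1) La]
 note F1 = fct_hom[OF lin(1) sa(1)] fct_hom[OF lin(1) sa(2)] fct_hom[OF lin(2) sa(2)]
 \<comment> \<open>Naturality of \<open>\<tau>\<close> exchanges the two middle factors; the rest of
   the interchange law is reassociation.\<close>
 have nn: "Cmp C (nt \<tau> (fo M a)) (fm F (nt \<sigma>' a)) = Cmp C (fm G (nt \<sigma>' a)) (nt \<tau> (fo L a))"
  using t(1) nat_nat[OF _ sa(2), of C \<tau>] by (auto simp: Hom_End_cat)
 have "Cmp C (Cmp C (nt \<tau>' (fo M a)) (nt \<tau> (fo M a))) (Cmp C (fm F (nt \<sigma>' a)) (fm F (nt \<sigma> a))) =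
   Cmp C (Cmp C (nt \<tau>' (fo M a)) (fm G (nt \<sigma>' a))) (Cmp C (nt \<tau> (fo L a)) (fm F (nt \<sigma> a)))"
  by (simp add: cat_assoc[OF C cat_cmp[OF C F1(1) F1(2)] ta(1) ta(2)] cat_assoc[OF C F1(1) F1(2) ta(1), symmetric] nn
    cat_assoc[OF C cat_cmp[OF C F1(1) ta(3)] F1(3) ta(2)] cat_assoc[OF C F1(1) ta(3) F1(3)])
 thus "nt (tar (End_tens C) (vcomp C C \<tau>' \<tau>) (vcomp C C \<sigma>' \<sigma>)) a =
  nt (vcomp C C (tar (End_tens C) \<tau>' \<sigma>') (tar (End_tens C) \<tau> \<sigma>)) a"
  using a Ma La t s by (simp add: Hom_End_cat fct_cmp[OF lin(1) sa])
qed

text \<open>Composition of functors is strictly associative and unital here, so all associators and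
  unitors are identity transformations. Besides the interchange law, the axioms reduce to three
  facts: the tensor product of identities is an identity, the tensor product of transformations is
  strictly associative, and tensoring with the identity of the unit object changes nothing.\<close>

lemma monoidal_End_cat:
 assumes C: "category C"
 shows "monoidal_cat (End_cat C) (End_tens C)"
proof -
 note E = category_End_cat[OF C]
 note id = nt_id_hom[OF C]
 have iso: "is_iso (End_cat C) (nt_id C C F)" if "linear_functor C C F" for F
  using is_iso_Idn[OF E, of F] that by simp
 have idid: "tar (End_tens C) (nt_id C C F) (nt_id C C G) = nt_id C C (fcmp F G)"
  if "linear_functor C C F" "linear_functor C C G" for F G
 proof (rule ntr_eqI[where C = C])
  fix a assume a: "a : Obj C"
  have f: "is_functor C C F" "is_functor C C G" using that by (auto simp: lin_fct)
  note o = fct_obj[OF f(2) a]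
  show "nt (tar (End_tens C) (nt_id C C F) (nt_id C C G)) a = nt (nt_id C C (fcmp F G)) a"
   using a o by (simp add: fct_idn[OF f(1)] cat_idl[OF C cat_idn[OF C fct_obj[OF f(1) o]]])
 qed simp_all
 have assoc: "tar (End_tens C) (tar (End_tens C) \<tau> \<sigma>) \<rho> = tar (End_tens C) \<tau> (tar (End_tens C) \<sigma> \<rho>)"
  if t: "\<tau> : Hom (End_cat C) F F'" and s: "\<sigma> : Hom (End_cat C) G G'" and r: "\<rho> : Hom (End_cat C) H H'"
  for \<tau> \<sigma> \<rho> F F' G G' H H'
 proof (rule ntr_eqI[where C = C])
  fix a assume a: "a : Obj C"
  have lin: "is_functor C C F" "is_functor C C G" "is_functor C C H'" "is_functor C C G'"
   using t s r by (auto simp: Hom_End_cat lin_fct)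
  note Ha = fct_obj[OF lin(3) a] and ra = End_component[OF r a]
  note GHa = fct_obj[OF lin(4) Ha]
  note sa = End_component[OF s Ha]
  note Gr = fct_hom[OF lin(2) ra]
  note ta = End_component[OF t GHa]
  show "nt (tar (End_tens C) (tar (End_tens C) \<tau> \<sigma>) \<rho>) a = nt (tar (End_tens C) \<tau> (tar (End_tens C) \<sigma> \<rho>)) a"
   using a t s r Ha GHa fct_cmp[OF lin(1) Gr sa]
    cat_assoc[OF C fct_hom[OF lin(1) Gr] fct_hom[OF lin(1) sa] ta]
   by (simp add: Hom_End_cat)
 qed (simp_all add: fcmp_assoc)
 have unitl: "tar (End_tens C) (nt_id C C idF) \<tau> = \<tau>" and unitr: "tar (End_tens C) \<tau> (nt_id C C idF) = \<tau>"
  if t: "\<tau> : Hom (End_cat C) F F'" for \<tau> F F'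
 proof -
  have lin: "is_functor C C F" "is_functor C C F'" "nt \<tau> : extensional (Obj C)"
   using t by (auto simp: Hom_End_cat lin_fct nat_ext)
  show "tar (End_tens C) (nt_id C C idF) \<tau> = \<tau>"
   by (rule ntr_eqI[where C = C])
    (use t lin End_component[OF t] cat_idl[OF C] in \<open>auto simp: fct_obj Hom_End_cat\<close>)
  show "tar (End_tens C) \<tau> (nt_id C C idF) = \<tau>"
   by (rule ntr_eqI[where C = C])
    (use t lin End_component[OF t] cat_idr[OF C] in \<open>auto simp: fct_idn Hom_End_cat\<close>)
 qed
 have hom: "f : Arr (End_cat C) \<longleftrightarrow> f : Hom (End_cat C) (nsrc f) (ntgt f)" for f
  by (simp add: homset_def)
 note th = tar_hom[OF C]
 note il = cat_idl[OF E, simplified] and ir = cat_idr[OF E, simplified]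
 show ?thesis
  unfolding monoidal_cat_def
  apply (intro conjI ballI impI)
  subgoal by (rule E)
  subgoal by (simp add: linear_functor_idF C)
  subgoal by (simp add: lin_fcmp)
  subgoal by (simp add: idid)
  subgoal by (simp add: hom th del: tar_hom)
  subgoal for f f' g g' using tar_cmp[OF C, of f "nsrc f" "ntgt f" f' "ntgt f'" g "nsrc g" "ntgt g" g' "ntgt g'"]
   by (simp add: hom)
  subgoal for X Y Z using id[OF lin_fcmp[OF lin_fcmp[of C C Z C Y], of C X]]
   by (simp add: fcmp_assoc)
  subgoal by (simp add: iso lin_fcmp[where D = C])
  subgoal by (simp add: id)
  subgoal by (simp add: iso)
  subgoal by (simp add: id)
  subgoal by (simp add: iso)
  subgoal for f g h
   using assoc[of f "nsrc f" "ntgt f" g "nsrc g" "ntgt g" h "nsrc h" "ntgt h"]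
    il[OF th[OF th[of f "nsrc f" "ntgt f" g "nsrc g" "ntgt g"], of h "nsrc h" "ntgt h"]]
    ir[OF th[of f "nsrc f" "ntgt f", OF _ th[of g "nsrc g" "ntgt g" h "nsrc h" "ntgt h"]]]
   by (simp add: hom fcmp_assoc)
  subgoal for f using unitl[of f "nsrc f" "ntgt f"] il[of f "nsrc f" "ntgt f"] ir[of f "nsrc f" "ntgt f"]
   by (simp add: hom)
  subgoal for f using unitr[of f "nsrc f" "ntgt f"] il[of f "nsrc f" "ntgt f"] ir[of f "nsrc f" "ntgt f"]
   by (simp add: hom)
  subgoal for W X Y Z
   using idid[of W "fcmp X (fcmp Y Z)"] idid[of "fcmp W (fcmp X Y)" Z] il[OF id[of "fcmp W (fcmp X (fcmp Y Z))"]]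
   by (simp add: lin_fcmp fcmp_assoc)
  subgoal for X Y
   using idid[of X Y] il[OF id[of "fcmp X Y"]] by (simp add: lin_fcmp)
  done
qed

text \<open>Whiskering on this side applies the functor \<open>F\<close> to a sum, which is where
  additivity of the endofunctors enters. In the other variable sums are formed pointwise and only
  distributivity in \<open>C\<close> is used.\<close>

lemma tar_add_right:
 assumes "lin_category C" "\<rho> : Hom (End_cat C) F G" "\<sigma> : Hom (End_cat C) H K" "\<tau> : Hom (End_cat C) H K"
 shows "tar (End_tens C) \<rho> (Add (fun_cat C C) \<sigma> \<tau>) =
  Add (fun_cat C C) (tar (End_tens C) \<rho> \<sigma>) (tar (End_tens C) \<rho> \<tau>)"
proof (rule ntr_eqI[where C = C])
 interpret lin_category C by fact
 fix a assume a: "a : Obj C"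
 have F: "additive_functor C C F" "is_functor C C K"
  using assms by (auto simp: Hom_End_cat lin_additive lin_fct)
 note s = End_component[OF assms(3) a] and t = End_component[OF assms(4) a]
 note r = End_component[OF assms(2) fct_obj[OF F(2) a]]
 note f = fct_hom[OF additive_fct[OF F(1)]]
 show "nt (tar (End_tens C) \<rho> (Add (fun_cat C C) \<sigma> \<tau>)) a =
   nt (Add (fun_cat C C) (tar (End_tens C) \<rho> \<sigma>) (tar (End_tens C) \<rho> \<tau>)) a"
  using a assms cmp_add_right[OF f[OF s] f[OF t] r]
  by (simp add: Hom_End_cat additive_functor_add[OF F(1) s t])
qed (use assms in \<open>simp_all add: Hom_End_cat\<close>)

lemma tar_add_left:
 assumes "lin_category C" "\<rho> : Hom (End_cat C) F G" "\<sigma> : Hom (End_cat C) H K" "\<tau> : Hom (End_cat C) H K"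
 shows "tar (End_tens C) (Add (fun_cat C C) \<sigma> \<tau>) \<rho> =
  Add (fun_cat C C) (tar (End_tens C) \<sigma> \<rho>) (tar (End_tens C) \<tau> \<rho>)"
proof (rule ntr_eqI[where C = C])
 interpret lin_category C by fact
 fix a assume a: "a : Obj C"
 have F: "is_functor C C G" "is_functor C C H"
  using assms by (auto simp: Hom_End_cat lin_fct)
 note o = fct_obj[OF F(1) a]
 show "nt (tar (End_tens C) (Add (fun_cat C C) \<sigma> \<tau>) \<rho>) a =
   nt (Add (fun_cat C C) (tar (End_tens C) \<sigma> \<rho>) (tar (End_tens C) \<tau> \<rho>)) a"
  using a assms o cmp_add_left[OF End_component[OF assms(3) o] End_component[OF assms(4) o]
    fct_hom[OF F(2) End_component[OF assms(2) a]]]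
  by (simp add: Hom_End_cat)
qed (use assms in \<open>simp_all add: Hom_End_cat\<close>)

lemma tar_zer_right:
 assumes "lin_category C" "\<rho> : Hom (End_cat C) F G" "linear_functor C C H" "linear_functor C C K"
 shows "tar (End_tens C) \<rho> (Zer (fun_cat C C) H K) = Zer (fun_cat C C) (fcmp F H) (fcmp G K)"
proof (rule ntr_eqI[where C = C])
 interpret lin_category C by fact
 fix a assume a: "a : Obj C"
 have F: "additive_functor C C F" "is_functor C C H" "is_functor C C K" "is_functor C C F"
  using assms by (auto simp: Hom_End_cat lin_additive lin_fct)
 note o = fct_obj[OF F(2) a] fct_obj[OF F(3) a]
 show "nt (tar (End_tens C) \<rho> (Zer (fun_cat C C) H K)) a = nt (Zer (fun_cat C C) (fcmp F H) (fcmp G K)) a"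
  using a assms o cmp_zer_right[OF End_component[OF assms(2) o(2)]]
  by (simp add: Hom_End_cat additive_functor_zer[OF F(1)] fct_obj[OF F(4)])
qed (use assms in \<open>simp_all add: Hom_End_cat\<close>)

lemma tar_zer_left:
 assumes "lin_category C" "\<rho> : Hom (End_cat C) F G" "linear_functor C C H" "linear_functor C C K"
 shows "tar (End_tens C) (Zer (fun_cat C C) H K) \<rho> = Zer (fun_cat C C) (fcmp H F) (fcmp K G)"
proof (rule ntr_eqI[where C = C])
 interpret lin_category C by fact
 fix a assume a: "a : Obj C"
 have F: "is_functor C C H" "is_functor C C K" "is_functor C C G" "is_functor C C F"
  using assms by (auto simp: Hom_End_cat lin_additive lin_fct)
 note o = fct_obj[OF F(3) a]
 show "nt (tar (End_tens C) (Zer (fun_cat C C) H K) \<rho>) a = nt (Zer (fun_cat C C) (fcmp H F) (fcmp K G)) a"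
  using a assms o cmp_zer_left[OF fct_hom[OF F(1) End_component[OF assms(2) a]]]
  by (simp add: Hom_End_cat fct_obj[OF F(2)])
qed (use assms in \<open>simp_all add: Hom_End_cat\<close>)


section \<open>The universal property of \<open>H'\<close>\<close>

text \<open>Typing is invariant under the congruence, so source and target of a class may be read
  off any of its terms, in particular off the one picked by \<open>hrep\<close>.\<close>

lemma heq_wf: "f \<approx>\<^sub>h g ==> hwf f & hwf g & hdom f = hdom g & hcod f = hcod g"
 by (induction rule: heq.induct) auto

lemma hcls_eq_iff: "hwf f ==> hcls f = hcls g \<longleftrightarrow> f \<approx>\<^sub>h g"
 unfolding hcls_def by (auto intro: heq.intros(1-3))

lemma hrep_hcls: "hwf f ==> f \<approx>\<^sub>h hrep (hcls f)"
 unfolding hrep_def hcls_def by (rule someI2[of _ f]) (auto intro: heq.refl)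

lemma Arr_HpE:
 assumes "A : Arr Hp"
 obtains f where "A = hcls f" "hwf f"
 using assms by (auto simp: Hp_def)

lemma Hp_simps:
 "Obj Hp = UNIV" "hcls f : Arr Hp \<longleftrightarrow> (EX g. hwf g & hcls f = hcls g)" "Idn Hp X = hcls (HId X)" "Zer Hp X Y = hcls (HZer X Y)"
 "hwf f ==> Dom Hp (hcls f) = hdom f" "hwf f ==> Cod Hp (hcls f) = hcod f"
 using heq_wf[OF hrep_hcls, of f] by (auto simp: Hp_def)

text \<open>The operations of \<open>Hp\<close> act on chosen representatives. The congruence rules
  make the choice invisible, here and in the next two lemmas, so classes are henceforth composed,
  added and tensored by operating on arbitrary terms.\<close>

lemma Cmp_Hp: "hwf (g \<cdot>\<^sub>h f) ==> Cmp Hp (hcls g) (hcls f) = hcls (g \<cdot>\<^sub>h f)"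
 using hrep_hcls[of g] hrep_hcls[of f] heq_wf[OF hrep_hcls, of f] heq_wf[OF hrep_hcls, of g]
 by (simp add: Hp_def hcls_eq_iff heq.sym heq.cong_cmp)

lemma Add_Hp: "hwf (g +\<^sub>h f) ==> Add Hp (hcls g) (hcls f) = hcls (g +\<^sub>h f)"
 using hrep_hcls[of g] hrep_hcls[of f] heq_wf[OF hrep_hcls, of f] heq_wf[OF hrep_hcls, of g]
 by (simp add: Hp_def hcls_eq_iff heq.sym heq.cong_add)

lemma tar_Hp: "hwf g ==> hwf f ==> tar Hp_tens (hcls g) (hcls f) = hcls (g \<otimes>\<^sub>a f)"
 using hrep_hcls[of g] hrep_hcls[of f] heq_wf[OF hrep_hcls, of f] heq_wf[OF hrep_hcls, of g]
 by (simp add: Hp_tens_def hcls_eq_iff heq.sym heq.cong_tar)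

lemma Hp_tens_simps:
 "tob Hp_tens = HTen" "tun Hp_tens = HI" "asc Hp_tens X Y Z = hcls (HAsc X Y Z)"
 "lun Hp_tens X = hcls (HLun X)" "run Hp_tens X = hcls (HRun X)"
 by (simp_all add: Hp_tens_def)

lemma Hom_Hp: "hwf f ==> hcls f : Hom Hp X Y \<longleftrightarrow> hdom f = X & hcod f = Y"
 by (auto simp: homset_def Hp_simps)

lemma Hom_HpE:
 assumes "A : Hom Hp X Y"
 obtains f where "A = hcls f" "hwf f" "hdom f = X" "hcod f = Y"
 using assms by (auto simp: homset_def Hp_simps elim!: Arr_HpE)

lemma category_Hp: "category Hp"
proof (rule categoryI)
 fix f g h a b c d assume "f : Hom Hp a b" "g : Hom Hp b c" "h : Hom Hp c d"
 thus "Cmp Hp h (Cmp Hp g f) = Cmp Hp (Cmp Hp h g) f"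
  by (elim Hom_HpE) (simp add: Cmp_Hp hcls_eq_iff heq.cmp_assoc)
next
 fix f g a b c assume "f : Hom Hp a b" "g : Hom Hp b c"
 thus "Cmp Hp g f : Hom Hp a c"
  by (elim Hom_HpE) (simp add: Cmp_Hp Hom_Hp)
next
 fix f a b assume "f : Hom Hp a b"
 thus "Cmp Hp f (Idn Hp a) = f" "Cmp Hp (Idn Hp b) f = f"
  by (elim Hom_HpE; hypsubst; simp add: Hp_simps Cmp_Hp hcls_eq_iff heq.cmp_id_right heq.cmp_id_left)+
qed (auto simp: Hp_simps Hom_Hp)

lemma Hp_isoI: "hwf (g \<cdot>\<^sub>h f) ==> hwf (f \<cdot>\<^sub>h g) ==> g \<cdot>\<^sub>h f \<approx>\<^sub>h HId (hdom f) ==>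
  f \<cdot>\<^sub>h g \<approx>\<^sub>h HId (hdom g) ==> is_iso Hp (hcls f)"
 unfolding is_iso_def
 by (rule exI[of _ "hcls g"], rule inv_arrowsI[where a = "hdom f" and b = "hcod f"])
  (auto simp: Hom_Hp Cmp_Hp Hp_simps hcls_eq_iff)

lemma monoidal_Hp: "monoidal_cat Hp Hp_tens"
 unfolding monoidal_cat_def Hp_tens_simps
 apply (intro conjI ballI impI)
 subgoal by (rule category_Hp)
 subgoal by (simp add: Hp_simps)
 subgoal by (simp add: Hp_simps)
 subgoal by (simp add: Hp_simps tar_Hp hcls_eq_iff heq.tar_id)
 subgoal by (auto elim!: Arr_HpE simp: tar_Hp Hom_Hp Hp_simps)
 subgoal by (elim Arr_HpE) (simp add: tar_Hp Cmp_Hp Hp_simps hcls_eq_iff heq.tar_cmp)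
 subgoal by (simp add: Hom_Hp)
 subgoal for X Y Z by (rule Hp_isoI[of "HAscI X Y Z"]) (simp_all add: heq.asc_inv1 heq.asc_inv2)
 subgoal by (simp add: Hom_Hp)
 subgoal for X by (rule Hp_isoI[of "HLunI X"]) (simp_all add: heq.lun_inv1 heq.lun_inv2)
 subgoal by (simp add: Hom_Hp)
 subgoal for X by (rule Hp_isoI[of "HRunI X"]) (simp_all add: heq.run_inv1 heq.run_inv2)
 subgoal by (elim Arr_HpE) (simp add: tar_Hp Cmp_Hp Hp_simps hcls_eq_iff heq.asc_nat)
 subgoal by (elim Arr_HpE) (simp add: tar_Hp Cmp_Hp Hp_simps hcls_eq_iff heq.lun_nat)
 subgoal by (elim Arr_HpE) (simp add: tar_Hp Cmp_Hp Hp_simps hcls_eq_iff heq.run_nat)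
 subgoal by (simp add: tar_Hp Cmp_Hp Hp_simps hcls_eq_iff heq.pentagon)
 subgoal by (simp add: tar_Hp Cmp_Hp Hp_simps hcls_eq_iff heq.triangle)
 done

lemma
 assumes "monoidal_cat C T"
 shows mon_cat: "category C"
  and mon_tun: "tun T : Obj C"
  and mon_tob: "X : Obj C ==> Y : Obj C ==> tob T X Y : Obj C"
  and mon_tar_id: "X : Obj C ==> Y : Obj C ==> tar T (Idn C X) (Idn C Y) = Idn C (tob T X Y)"
  and mon_tar: "f : Hom C X X' ==> g : Hom C Y Y' ==> tar T f g : Hom C (tob T X Y) (tob T X' Y')"
  and mon_tar_cmp: "f : Hom C X X' ==> f' : Hom C X' X'' ==> g : Hom C Y Y' ==> g' : Hom C Y' Y'' ==>
   tar T (Cmp C f' f) (Cmp C g' g) = Cmp C (tar T f' g') (tar T f g)"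
 subgoal using assms unfolding monoidal_cat_def by (elim conjE) blast
 subgoal using assms unfolding monoidal_cat_def by (elim conjE) blast
 subgoal using assms unfolding monoidal_cat_def by (elim conjE) blast
 subgoal using assms unfolding monoidal_cat_def by (elim conjE) blast
 subgoal using assms unfolding monoidal_cat_def by (auto simp: homset_def)
 subgoal using assms unfolding monoidal_cat_def by (auto simp: homset_def)
 done

lemma
 assumes "monoidal_cat C T"
 shows mon_asc: "X : Obj C ==> Y : Obj C ==> Z : Obj C ==>
    asc T X Y Z : Hom C (tob T (tob T X Y) Z) (tob T X (tob T Y Z)) & is_iso C (asc T X Y Z)"
  and mon_lun: "X : Obj C ==> lun T X : Hom C (tob T (tun T) X) X & is_iso C (lun T X)"
  and mon_run: "X : Obj C ==> run T X : Hom C (tob T X (tun T)) X & is_iso C (run T X)"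
  and mon_asc_nat: "f : Hom C X X' ==> g : Hom C Y Y' ==> h : Hom C Z Z' ==>
    Cmp C (asc T X' Y' Z') (tar T (tar T f g) h) = Cmp C (tar T f (tar T g h)) (asc T X Y Z)"
  and mon_lun_nat: "f : Hom C X X' ==> Cmp C (lun T X') (tar T (Idn C (tun T)) f) = Cmp C f (lun T X)"
  and mon_run_nat: "f : Hom C X X' ==> Cmp C (run T X') (tar T f (Idn C (tun T))) = Cmp C f (run T X)"
  and mon_pentagon: "W : Obj C ==> X : Obj C ==> Y : Obj C ==> Z : Obj C ==>
    Cmp C (tar T (Idn C W) (asc T X Y Z))
     (Cmp C (asc T W (tob T X Y) Z) (tar T (asc T W X Y) (Idn C Z))) =
    Cmp C (asc T W X (tob T Y Z)) (asc T (tob T W X) Y Z)"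
  and mon_triangle: "X : Obj C ==> Y : Obj C ==>
    Cmp C (tar T (Idn C X) (lun T Y)) (asc T X (tun T) Y) = tar T (run T X) (Idn C Y)"
 using assms unfolding monoidal_cat_def by (auto simp: homset_def)

text \<open>No condition on \<open>gen\<close> is imposed at this stage: the relations that contain
  associators are stated through the interpretation \<open>im\<close>, which has to be defined
  before them.\<close>

locale hp_interpretation = lin_category D
 for D :: "('o, 'm) lincat" +
 fixes U :: "('o, 'm) tens" and p m :: 'o and gen :: "hgen => 'm"
 assumes monoidal: "monoidal_cat D U"
  and biprods: "has_biprods D"
  and zero: "has_zero D"
  and tar_add_r: "!!f g h a b c d. f : Hom D a b ==> g : Hom D a b ==> h : Hom D c d ==>
   tar U h (Add D f g) = Add D (tar U h f) (tar U h g)"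
  and tar_add_l: "!!f g h a b c d. f : Hom D a b ==> g : Hom D a b ==> h : Hom D c d ==>
   tar U (Add D f g) h = Add D (tar U f h) (tar U g h)"
  and tar_zer_r: "!!f a b c d. f : Hom D a b ==> c : Obj D ==> d : Obj D ==>
   tar U f (Zer D c d) = Zer D (tob U a c) (tob U b d)"
  and tar_zer_l: "!!f a b c d. f : Hom D a b ==> c : Obj D ==> d : Obj D ==>
   tar U (Zer D c d) f = Zer D (tob U c a) (tob U d b)"
  and p_obj: "p : Obj D" and m_obj: "m : Obj D"
begin

definition zer_obj :: 'o where "zer_obj = (SOME Z. Z : Obj D & Idn D Z = Zer D Z Z)"

definition bipr :: "'o => 'o => 'o \<times> 'm \<times> 'm \<times> 'm \<times> 'm" where
 "bipr X Y = (SOME (Z, i1, i2, q1, q2). is_biprod D X Y Z i1 i2 q1 q2)"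

primrec io :: "hobj => 'o" where
 "io HI = tun U"
| "io HQp = p"
| "io HQm = m"
| "io (X \<otimes>\<^sub>h Y) = tob U (io X) (io Y)"
| "io HZero = zer_obj"
| "io (X \<oplus>\<^sub>h Y) = fst (bipr (io X) (io Y))"

primrec im :: "hterm => 'm" where
 "im (HId X) = Idn D (io X)"
| "im (g \<cdot>\<^sub>h f) = Cmp D (im g) (im f)"
| "im (f \<otimes>\<^sub>a g) = tar U (im f) (im g)"
| "im (HAsc X Y Z) = asc U (io X) (io Y) (io Z)"
| "im (HAscI X Y Z) = cat_inv D (asc U (io X) (io Y) (io Z))"
| "im (HLun X) = lun U (io X)"
| "im (HLunI X) = cat_inv D (lun U (io X))"
| "im (HRun X) = run U (io X)"
| "im (HRunI X) = cat_inv D (run U (io X))"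
| "im (HZer X Y) = Zer D (io X) (io Y)"
| "im (f +\<^sub>h g) = Add D (im f) (im g)"
| "im (HIn1 X Y) = fst (snd (bipr (io X) (io Y)))"
| "im (HIn2 X Y) = fst (snd (snd (bipr (io X) (io Y))))"
| "im (HPr1 X Y) = fst (snd (snd (snd (bipr (io X) (io Y)))))"
| "im (HPr2 X Y) = snd (snd (snd (snd (bipr (io X) (io Y)))))"
| "im (HGen k) = gen k"

lemma zer_obj: "zer_obj : Obj D" "Idn D zer_obj = Zer D zer_obj zer_obj"
 using zero unfolding has_zero_def zer_obj_def
 by (metis (mono_tags, lifting) someI_ex)+

lemma bipr:
 assumes "X : Obj D" "Y : Obj D"
 shows "is_biprod D X Y (fst (bipr X Y)) (fst (snd (bipr X Y))) (fst (snd (snd (bipr X Y))))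
  (fst (snd (snd (snd (bipr X Y))))) (snd (snd (snd (snd (bipr X Y)))))"
proof -
 have "EX w. case w of (Z, i1, i2, q1, q2) => is_biprod D X Y Z i1 i2 q1 q2"
  using assms biprods by (auto simp: has_biprods_def split_paired_Ex)
 from someI_ex[OF this] show ?thesis unfolding bipr_def by (auto split: prod.splits)
qed

lemma io_obj: "io X : Obj D"
proof (induction X)
 case (HSum X Y)
 thus ?case using bipr[of "io X" "io Y"] cat_obj[OF cat] by (auto simp: is_biprod_def)
qed (use p_obj m_obj zer_obj monoidal in \<open>auto intro: mon_tun mon_tob\<close>)

end

abbreviation "duc_term \<equiv> HLun HQp \<cdot>\<^sub>h (hgd \<otimes>\<^sub>a h1p) \<cdot>\<^sub>h HAscI HQm HQp HQp \<cdot>\<^sub>h (h1m \<otimes>\<^sub>a hgu) \<cdot>\<^sub>h HAsc HQm HQp HQp \<cdot>\<^sub>h (hgc \<otimes>\<^sub>a h1p) \<cdot>\<^sub>h HLunI HQp"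
abbreviation "zigzag1_term \<equiv> HLun HQp \<cdot>\<^sub>h (hgd' \<otimes>\<^sub>a h1p) \<cdot>\<^sub>h HAscI HQp HQm HQp \<cdot>\<^sub>h (h1p \<otimes>\<^sub>a hgc) \<cdot>\<^sub>h HRunI HQp"
abbreviation "zigzag2_term \<equiv> HRun HQm \<cdot>\<^sub>h (h1m \<otimes>\<^sub>a hgd') \<cdot>\<^sub>h HAsc HQm HQp HQm \<cdot>\<^sub>h (hgc \<otimes>\<^sub>a h1m) \<cdot>\<^sub>h HLunI HQm"
abbreviation "zigzag3_term \<equiv> HLun HQm \<cdot>\<^sub>h (hgd \<otimes>\<^sub>a h1m) \<cdot>\<^sub>h HAscI HQm HQp HQm \<cdot>\<^sub>h (h1m \<otimes>\<^sub>a hgc') \<cdot>\<^sub>h HRunI HQm"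
abbreviation "zigzag4_term \<equiv> HRun HQp \<cdot>\<^sub>h (h1p \<otimes>\<^sub>a hgd) \<cdot>\<^sub>h HAsc HQp HQm HQp \<cdot>\<^sub>h (hgc' \<otimes>\<^sub>a h1p) \<cdot>\<^sub>h HLunI HQp"

text \<open>Relations free of associators are equations between the arrows \<open>gen k\<close>; the
  others are equations between interpreted terms. In this form each clause is what the corresponding
  case of the induction over derivations asks for.\<close>

locale hp_representation = hp_interpretation +
 assumes gen_hom: "gen k : Hom D (io (gen_dom k)) (io (gen_cod k))"
  and cd_xy: "Add D (Cmp D (gen gen_c) (gen gen_d)) (Cmp D (gen gen_x) (gen gen_y)) = Idn D (tob U m p)"
  and yx: "Cmp D (gen gen_y) (gen gen_x) = Idn D (tob U p m)"
  and dc: "Cmp D (gen gen_d) (gen gen_c) = Idn D (tun U)"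
  and duc: "im duc_term = Zer D p p"
  and uu: "Cmp D (gen gen_u) (gen gen_u) = Idn D (tob U p p)"
  and vv: "Cmp D (gen gen_v) (gen gen_v) = Idn D (tob U m m)"
  and braid: "im (hu1 \<cdot>\<^sub>h hu2 \<cdot>\<^sub>h hu1) = im (hu2 \<cdot>\<^sub>h hu1 \<cdot>\<^sub>h hu2)"
  and zigzag1: "im zigzag1_term = Idn D p"
  and zigzag2: "im zigzag2_term = Idn D m"
  and zigzag3: "im zigzag3_term = Idn D m"
  and zigzag4: "im zigzag4_term = Idn D p"
begin

lemma im_hom: "hwf f ==> im f : Hom D (io (hdom f)) (io (hcod f))"
proof (induction f)
 case (HCmp g f)
 thus ?case using cat_cmp[OF cat] by auto
next
 case (HTar f g)
 thus ?case using mon_tar[OF monoidal] by auto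
next
 case (HAsc X Y Z)
 thus ?case using mon_asc[OF monoidal io_obj io_obj io_obj] by auto
next
 case (HAscI X Y Z)
 thus ?case using mon_asc[OF monoidal io_obj io_obj io_obj] cat_inv_hom[OF cat] by auto
next
 case (HLunI X)
 thus ?case using mon_lun[OF monoidal io_obj] cat_inv_hom[OF cat] by auto
next
 case (HRunI X)
 thus ?case using mon_run[OF monoidal io_obj] cat_inv_hom[OF cat] by auto
next
 case (HIn1 X Y)
 thus ?case using bipr[OF io_obj io_obj] by (auto simp: is_biprod_def)
next
 case (HIn2 X Y)
 thus ?case using bipr[OF io_obj io_obj] by (auto simp: is_biprod_def)
next
 case (HPr1 X Y)
 thus ?case using bipr[OF io_obj io_obj] by (auto simp: is_biprod_def)
next
 case (HPr2 X Y)
 thus ?case using bipr[OF io_obj io_obj] by (auto simp: is_biprod_def)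
qed (use mon_lun[OF monoidal io_obj] mon_run[OF monoidal io_obj] in
  \<open>auto simp: io_obj cat_idn[OF cat] zer_hom add_hom gen_hom\<close>)

text \<open>Induction over derivations: each axiom of the congruence is a law of the target. This is
  the universal property of a category presented by generators and relations.\<close>

lemma im_sound: "f \<approx>\<^sub>h g ==> im f = im g"
proof (induction rule: heq.induct)
 case (cmp_id_right f)
 thus ?case using im_hom cat_idr[OF cat] by auto
next
 case (cmp_id_left f)
 thus ?case using im_hom cat_idl[OF cat] by auto
next
 case (cmp_assoc h g f)
 thus ?case using im_hom[of f] im_hom[of g] im_hom[of h] cat_assoc[OF cat] by auto
next
 case (tar_id X Y)
 thus ?case using mon_tar_id[OF monoidal io_obj io_obj] by simp
next
 case (tar_cmp f' f g' g)
 thus ?case using im_hom[of f] im_hom[of g] im_hom[of f'] im_hom[of g'] mon_tar_cmp[OF monoidal] by auto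
next
 case (asc_inv1 X Y Z)
 thus ?case using mon_asc[OF monoidal io_obj[of X] io_obj[of Y] io_obj[of Z]] by (auto intro: cat_inv_left[OF cat])
next
 case (asc_inv2 X Y Z)
 thus ?case using mon_asc[OF monoidal io_obj[of X] io_obj[of Y] io_obj[of Z]] by (auto intro: cat_inv_right[OF cat])
next
 case (lun_inv1 X)
 thus ?case using mon_lun[OF monoidal io_obj] cat_inv_left[OF cat] by auto
next
 case (lun_inv2 X)
 thus ?case using mon_lun[OF monoidal io_obj] cat_inv_right[OF cat] by auto
next
 case (run_inv1 X)
 thus ?case using mon_run[OF monoidal io_obj] cat_inv_left[OF cat] by auto
next
 case (run_inv2 X)
 thus ?case using mon_run[OF monoidal io_obj] cat_inv_right[OF cat] by auto
next
 case (asc_nat f g h)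
 thus ?case using im_hom[of f] im_hom[of g] im_hom[of h] mon_asc_nat[OF monoidal] by auto
next
 case (lun_nat f)
 thus ?case using im_hom[of f] mon_lun_nat[OF monoidal] by auto
next
 case (run_nat f)
 thus ?case using im_hom[of f] mon_run_nat[OF monoidal] by auto
next
 case (pentagon W X Y Z)
 thus ?case using mon_pentagon[OF monoidal io_obj io_obj io_obj io_obj] by simp
next
 case (triangle X Y)
 thus ?case using mon_triangle[OF monoidal io_obj io_obj] by simp
next
 case (add_assoc f g h)
 thus ?case using im_hom[of f] im_hom[of g] im_hom[of h] by (auto intro: lin_category.add_assoc[OF lin_category_axioms])
next
 case (add_comm f g)
 thus ?case using im_hom[of f] im_hom[of g] by (auto intro: lin_category.add_comm[OF lin_category_axioms])
next
 case (add_zero f)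
 thus ?case using im_hom[of f] add_zer by auto
next
 case (cmp_add_right h f g)
 thus ?case using im_hom[of f] im_hom[of g] im_hom[of h] by (auto intro: lin_category.cmp_add_right[OF lin_category_axioms])
next
 case (cmp_add_left f g h)
 thus ?case using im_hom[of f] im_hom[of g] im_hom[of h] by (auto intro: lin_category.cmp_add_left[OF lin_category_axioms])
next
 case (cmp_zero_right f X)
 thus ?case using im_hom[of f] cmp_zer_right io_obj by auto
next
 case (cmp_zero_left f Y)
 thus ?case using im_hom[of f] cmp_zer_left io_obj by auto
next
 case (tar_add_right h f g)
 thus ?case using im_hom[of f] im_hom[of g] im_hom[of h] tar_add_r by auto
next
 case (tar_add_left f g h)
 thus ?case using im_hom[of f] im_hom[of g] im_hom[of h] tar_add_l by auto
next
 case (tar_zero_right f X Y)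
 thus ?case using im_hom[of f] tar_zer_r io_obj by auto
next
 case (tar_zero_left f X Y)
 thus ?case using im_hom[of f] tar_zer_l io_obj by auto
qed (use bipr[OF io_obj io_obj] zer_obj cd_xy yx dc duc uu vv braid zigzag1 zigzag2 zigzag3 zigzag4 in
 \<open>simp_all add: is_biprod_def\<close>)

definition HpF :: "(hobj, hterm set, 'a, 'b) fctr" where
 "HpF = \<lparr>fo = io, fm = (%A. im (hrep A))\<rparr>"

lemma HpF_simps: "fo HpF = io" "hwf f ==> fm HpF (hcls f) = im f"
 using im_sound[OF hrep_hcls, of f] by (simp_all add: HpF_def)

lemma HpF_hom: "f : Hom Hp X Y ==> fm HpF f : Hom D (io X) (io Y)"
 using im_hom by (auto elim!: Hom_HpE simp: HpF_simps)

lemma additive_HpF: "additive_functor Hp D HpF"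
proof -
 have "is_functor Hp D HpF"
 proof (rule is_functorI)
  fix f g a b c assume "f : Hom Hp a b" "g : Hom Hp b c"
  thus "fm HpF (Cmp Hp g f) = Cmp D (fm HpF g) (fm HpF f)"
   by (elim Hom_HpE) (simp add: Cmp_Hp HpF_simps)
 qed (auto simp: HpF_simps Hp_simps io_obj HpF_hom)
 moreover have "fm HpF (Add Hp f g) = Add D (fm HpF f) (fm HpF g)" if "parallel_arrows Hp f g" for f g
  using that by (auto simp: parallel_arrows_def Hp_simps HpF_simps Add_Hp elim!: Arr_HpE)
 ultimately show ?thesis
  by (simp add: additive_functor_def Hp_simps HpF_simps)
qed

text \<open>The interpretation commutes with tensor products of objects and of terms on the nose, so
  identities serve as structure maps.\<close>

lemma strong_monoidal_HpF:
 "strong_monoidal_functor Hp Hp_tens D U HpF (%X Y. Idn D (tob U (io X) (io Y))) (Idn D (tun U))"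
proof -
 note o = io_obj and M = mon_tob[OF monoidal io_obj io_obj] mon_tob[OF monoidal mon_tob[OF monoidal io_obj io_obj] io_obj]
  mon_tob[OF monoidal io_obj mon_tob[OF monoidal io_obj io_obj]]
 note a = mon_asc[OF monoidal io_obj io_obj io_obj, THEN conjunct1]
 have ii: "Cmp D f (Cmp D (Idn D X) (Idn D X)) = f" if "f : Hom D X Y" for f X Y
  using that cat_idl[OF cat cat_idn[OF cat]] cat_idr[OF cat] cat_obj[OF cat] by metis
 show ?thesis
  unfolding strong_monoidal_functor_def Hp_tens_simps HpF_simps
  apply (intro conjI ballI)
  subgoal by (rule monoidal_Hp)
  subgoal by (rule monoidal)
  subgoal using additive_HpF by (simp add: additive_functor_def)
  subgoal using cat_idn[OF cat mon_tun[OF monoidal]] by simp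
  subgoal using is_iso_Idn[OF cat mon_tun[OF monoidal]] .
  subgoal using cat_idn[OF cat M(1)] by simp
  subgoal using is_iso_Idn[OF cat M(1)] .
  subgoal for f g
   by (elim Arr_HpE) (simp add: tar_Hp HpF_simps Hp_simps cat_idl[OF cat mon_tar[OF monoidal im_hom im_hom]]
     cat_idr[OF cat mon_tar[OF monoidal im_hom im_hom]])
  subgoal for X Y Z
   using ii[OF a[of X Y Z]] cat_idl[OF cat a[of X Y Z]] by (simp add: HpF_simps mon_tar_id[OF monoidal] M o)
  subgoal for X
   using ii[OF mon_lun[OF monoidal io_obj, of X, THEN conjunct1]] by (simp add: HpF_simps mon_tar_id[OF monoidal] mon_tun[OF monoidal] o)
  subgoal for X
   using ii[OF mon_run[OF monoidal io_obj, of X, THEN conjunct1]] by (simp add: HpF_simps mon_tar_id[OF monoidal] mon_tun[OF monoidal] o)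
  done
qed

lemma word_comparison_gen:
 "word_comparison (%X Y. Idn D (tob U (io X) (io Y))) (Idn D (tun U)) (gen_dom k) = Idn D (io (gen_dom k))"
 "word_comparison (%X Y. Idn D (tob U (io X) (io Y))) (Idn D (tun U)) (gen_cod k) = Idn D (io (gen_cod k))"
 by (cases k; simp)+

theorem representation_exists:
 "\<exists>F \<phi> \<phi>0. strong_monoidal_functor Hp Hp_tens D U F \<phi> \<phi>0 & additive_functor Hp D F &
   fo F HQp = p & fo F HQm = m &
   (ALL k. Cmp D (fm F (hcls (HGen k))) (word_comparison \<phi> \<phi>0 (gen_dom k)) =
     Cmp D (word_comparison \<phi> \<phi>0 (gen_cod k)) (gen k))"
proof (intro exI conjI allI)
 show "Cmp D (fm HpF (hcls (HGen k))) (word_comparison (%X Y. Idn D (tob U (io X) (io Y))) (Idn D (tun U)) (gen_dom k)) =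
     Cmp D (word_comparison (%X Y. Idn D (tob U (io X) (io Y))) (Idn D (tun U)) (gen_cod k)) (gen k)" for k
  unfolding word_comparison_gen using cat_idl[OF cat gen_hom] cat_idr[OF cat gen_hom] by (simp add: HpF_simps)
qed (use strong_monoidal_HpF additive_HpF in \<open>simp_all add: HpF_simps\<close>)

end


section \<open>The category of matrices\<close>

lemma Hom_matcat: "Hom matcat n m = \<M> m n"
 by (auto simp: homset_def matcat_def)

lemma matcat_simps [simp]:
 "Obj matcat = UNIV" "Arr matcat = UNIV" "Dom matcat = dim_col" "Cod matcat = dim_row" "Idn matcat = 1\<^sub>m"
 "Cmp matcat = (*)" "Add matcat = (+)" "Zer matcat n m = 0\<^sub>m m n" "Scl matcat = (\<cdot>\<^sub>m)"
 by (auto simp: matcat_def)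

lemma mat_assoc:
 fixes A B C :: "complex mat"
 assumes "dim_col A = dim_row B" "dim_col B = dim_row C"
 shows "A * B * C = A * (B * C)"
 by (rule assoc_mult_mat[of A "dim_row A" "dim_col A" B "dim_col B" C "dim_col C"]) (use assms in auto)

lemma category_matcat: "category matcat"
 by (rule categoryI) (auto simp: Hom_matcat mat_assoc)

lemma lin_category_matcat: "lin_category matcat"
 by standard
  (auto simp: Hom_matcat category_matcat mult_smult_distrib mult_smult_assoc_mat 
   mult_add_distrib_mat add_mult_distrib_mat add_smult_distrib_left_mat comm_add_mat)

text \<open>The product counts intermediate indices \<open>k\<close>. For the block matrices of a
  direct sum the sets counted have at most one element, so the biproduct equations become case
  distinctions on indices.\<close>

lemma mult_01_mat:
 "mat n N (%(i, k). if P i k then 1 else 0) * mat N m (%(k, j). if Q k j then 1 else 0) =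
  mat n m (%(i, j). of_nat (card {k. k < N & P i k & Q k j}) :: complex)"
proof (rule eq_matI)
 fix i j assume ij: "i < dim_row (mat n m (%(i, j). of_nat (card {k. k < N & P i k & Q k j}) :: complex))"
  "j < dim_col (mat n m (%(i, j). of_nat (card {k. k < N & P i k & Q k j}) :: complex))"
 have "(\<Sum>k = 0..<N. (if P i k then 1 else 0) * (if Q k j then 1 else (0::complex))) =
   (\<Sum>k = 0..<N. if k : {k. k < N & P i k & Q k j} then 1 else 0)"
  by (rule sum.cong) auto
 also have "\<dots> = of_nat (card ({0..<N} \<inter> {k. k < N & P i k & Q k j}))"
  by (subst sum.inter_restrict[symmetric]) auto
 also have "{0..<N} \<inter> {k. k < N & P i k & Q k j} = {k. k < N & P i k & Q k j}" by auto
 finally show "(mat n N (%(i, k). if P i k then 1 else 0) * mat N m (%(k, j). if Q k j then 1 else 0)) $$ (i, j) =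
   mat n m (%(i, j). of_nat (card {k. k < N & P i k & Q k j}) :: complex) $$ (i, j)"
  using ij by (simp add: scalar_prod_def)
qed auto

lemma biprod_matcat:
 "is_biprod matcat a b (a + b)
   (mat (a + b) a (%(i, j). if i = j then 1 else 0)) (mat (a + b) b (%(i, j). if i = j + a then 1 else 0))
   (mat a (a + b) (%(i, j). if i = j then 1 else 0)) (mat b (a + b) (%(i, j). if j = i + a then 1 else 0))"
proof -
 have card1: "{k. k < N & i = k & Q k} = (if i < N & Q i then {i} else {})"
  and card2: "{k. k < N & k = i & Q k} = (if i < N & Q i then {i} else {})"
  and card3: "{k. k < N & i = k + a & Q k} = (if a \<le> i & i < N + a & Q (i - a) then {i - a} else {})"
  for N i :: nat and Q by auto
 show ?thesis
  unfolding is_biprod_def Hom_matcat matcat_simps mult_01_mat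
  by (intro conjI; (simp; fail)?; rule eq_matI; auto simp: card1 card2 card3)
qed

lemma has_biprods_matcat: "has_biprods matcat"
 unfolding has_biprods_def using biprod_matcat by blast

subsection \<open>Finite sums of matrices\<close>

lemma mat_sum_carrier [simp]: "mat_sum r c M K : \<M> r c"
 by (simp add: mat_sum_def)

lemma mat_sum_dim [simp]: "dim_row (mat_sum r c M K) = r" "dim_col (mat_sum r c M K) = c"
 by (simp_all add: mat_sum_def)

lemma mat_sum_cong: "K = L ==> (!!k. k : L ==> M k = N k) ==> mat_sum r c M K = mat_sum r c N L"
 unfolding mat_sum_def by (auto intro!: eq_matI sum.cong)

lemma mat_sum_empty [simp]: "mat_sum r c M {} = 0\<^sub>m r c"
 by (auto simp: mat_sum_def)

lemma mat_sum_insert: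
 assumes "finite K" "k \<notin> K" "M k : \<M> r c"
 shows "mat_sum r c M (insert k K) = M k + mat_sum r c M K"
 using assms by (auto intro!: eq_matI simp: mat_sum_def)

lemma mat_sum_singleton [simp]: "M k : \<M> r c ==> mat_sum r c M {k} = M k"
 using mat_sum_insert[of "{}" k M r c] by simp

lemma mat_sum_delta:
 assumes "finite K" "k : K" "M k : \<M> r c" "!!l. l : K ==> l ~= k ==> M l = 0\<^sub>m r c"
 shows "mat_sum r c M K = M k"
proof (rule eq_matI)
 fix i j assume ij: "i < dim_row (M k)" "j < dim_col (M k)"
 hence "(\<Sum>l\<in>K. M l $$ (i, j)) = (\<Sum>l\<in>K. if l = k then M k $$ (i, j) else 0)"
  using assms(3,4) by (intro sum.cong) auto
 thus "mat_sum r c M K $$ (i, j) = M k $$ (i, j)"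
  using assms ij by (simp add: mat_sum_def)
qed (use assms in auto)

lemma mult_mat_sum:
 assumes "A : \<M> m r" "!!k. k : K ==> M k : \<M> r c"
 shows "A * mat_sum r c M K = mat_sum m c (%k. A * M k) K"
proof (rule eq_matI)
 fix i j assume ij: "i < dim_row (mat_sum m c (%k. A * M k) K)" "j < dim_col (mat_sum m c (%k. A * M k) K)"
 hence "(A * mat_sum r c M K) $$ (i, j) = (\<Sum>l = 0..<r. \<Sum>k\<in>K. A $$ (i, l) * M k $$ (l, j))"
  using assms(1) by (simp add: scalar_prod_def mat_sum_def sum_distrib_left)
 also have "\<dots> = (\<Sum>k\<in>K. \<Sum>l = 0..<r. A $$ (i, l) * M k $$ (l, j))" by (rule sum.swap)
 also have "\<dots> = (\<Sum>k\<in>K. (A * M k) $$ (i, j))"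
 proof (rule sum.cong)
  fix k assume "k : K"
  from assms(2)[OF this] show "(\<Sum>l = 0..<r. A $$ (i, l) * M k $$ (l, j)) = (A * M k) $$ (i, j)"
   using ij assms(1) by (auto simp: scalar_prod_def)
 qed simp
 finally show "(A * mat_sum r c M K) $$ (i, j) = mat_sum m c (%k. A * M k) K $$ (i, j)"
  using ij by (simp add: mat_sum_def)
qed (use assms in auto)

lemma mat_sum_mult:
 assumes "A : \<M> c m" "!!k. k : K ==> M k : \<M> r c"
 shows "mat_sum r c M K * A = mat_sum r m (%k. M k * A) K"
proof (rule eq_matI)
 fix i j assume ij: "i < dim_row (mat_sum r m (%k. M k * A) K)" "j < dim_col (mat_sum r m (%k. M k * A) K)"
 hence "(mat_sum r c M K * A) $$ (i, j) = (\<Sum>l = 0..<c. \<Sum>k\<in>K. M k $$ (i, l) * A $$ (l, j))"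
  using assms(1) by (simp add: scalar_prod_def mat_sum_def sum_distrib_right)
 also have "\<dots> = (\<Sum>k\<in>K. \<Sum>l = 0..<c. M k $$ (i, l) * A $$ (l, j))" by (rule sum.swap)
 also have "\<dots> = (\<Sum>k\<in>K. (M k * A) $$ (i, j))"
 proof (rule sum.cong)
  fix k assume "k : K"
  from assms(2)[OF this] show "(\<Sum>l = 0..<c. M k $$ (i, l) * A $$ (l, j)) = (M k * A) $$ (i, j)"
   using ij assms(1) by (auto simp: scalar_prod_def)
 qed simp
 finally show "(mat_sum r c M K * A) $$ (i, j) = mat_sum r m (%k. M k * A) K $$ (i, j)"
  using ij by (simp add: mat_sum_def)
qed (use assms in auto)

text \<open>The direct sum of spaces of dimensions \<open>d r\<close>, built by adding one summand
  at a time. It is presented by injections, projections and a resolution of the identity, the data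
  from which the colimits defining induction are built.\<close>

lemma finite_biprod:
 assumes "finite R"
 shows "\<exists>n (ii :: 'r => complex mat) pp. (\<forall>r\<in>R. ii r : \<M> n (d r) & pp r : \<M> (d r) n) &
  (\<forall>r\<in>R. pp r * ii r = 1\<^sub>m (d r)) & (\<forall>r\<in>R. \<forall>s\<in>R. r ~= s --> pp r * ii s = 0\<^sub>m (d r) (d s)) &
  mat_sum n n (%r. ii r * pp r) R = 1\<^sub>m n"
 using assms
proof (induction R)
 case empty
 show ?case by (rule exI[of _ 0]) (auto intro!: eq_matI)
next
 case (insert a R)
 then obtain n and ii pp :: "'r => complex mat" where
  c: "\<forall>r\<in>R. ii r : \<M> n (d r) & pp r : \<M> (d r) n"
  and e: "\<forall>r\<in>R. pp r * ii r = 1\<^sub>m (d r)" "\<forall>r\<in>R. \<forall>s\<in>R. r ~= s --> pp r * ii s = 0\<^sub>m (d r) (d s)"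
  and s: "mat_sum n n (%r. ii r * pp r) R = 1\<^sub>m n" by blast
 obtain N i1 i2 q1 q2 where "is_biprod matcat (d a) n N i1 i2 q1 q2"
  using biprod_matcat by blast
 hence h: "i1 : \<M> N (d a)" "i2 : \<M> N n" "q1 : \<M> (d a) N" "q2 : \<M> n N"
  and b: "q1 * i1 = 1\<^sub>m (d a)" "q2 * i2 = 1\<^sub>m n" "q1 * i2 = 0\<^sub>m (d a) n" "q2 * i1 = 0\<^sub>m n (d a)" "i1 * q1 + i2 * q2 = 1\<^sub>m N"
  by (auto simp: is_biprod_def Hom_matcat)
 have cd: "dim_row (ii r) = n" "dim_col (ii r) = d r" "dim_row (pp r) = d r" "dim_col (pp r) = n" if "r : R" for r
  using c that by auto
 note hd = h[THEN carrier_matD(1)] h[THEN carrier_matD(2)]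
 define ii' where "ii' r = (if r = a then i1 else i2 * ii r)" for r
 define pp' where "pp' r = (if r = a then q1 else pp r * q2)" for r
 have ne: "r ~= a" if "r : R" for r using that insert by auto
 have 1: "\<forall>r\<in>insert a R. ii' r : \<M> N (d r) & pp' r : \<M> (d r) N"
  using h c by (auto simp: ii'_def pp'_def)
 have x: "pp r * q2 * (i2 * ii s) = pp r * ii s" if "r : R" "s : R" for r s
 proof -
  have "pp r * q2 * (i2 * ii s) = pp r * ((q2 * i2) * ii s)"
   using that by (simp add: mat_assoc cd hd)
  thus ?thesis using that b by (simp add: cd hd)
 qed
 have y: "q1 * (i2 * ii s) = 0\<^sub>m (d a) (d s)" if "s : R" for s
 proof -
  have "q1 * (i2 * ii s) = (q1 * i2) * ii s" using that by (simp add: mat_assoc cd hd)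
  thus ?thesis using that b by (simp add: cd hd)
 qed
 have z: "pp r * q2 * i1 = 0\<^sub>m (d r) (d a)" if "r : R" for r
 proof -
  have "pp r * q2 * i1 = pp r * (q2 * i1)" using that by (simp add: mat_assoc cd hd)
  thus ?thesis using that b by (simp add: cd hd)
 qed
 have 2: "\<forall>r\<in>insert a R. pp' r * ii' r = 1\<^sub>m (d r)"
  using x e b ne by (auto simp: ii'_def pp'_def)
 have 3: "\<forall>r\<in>insert a R. \<forall>s\<in>insert a R. r ~= s --> pp' r * ii' s = 0\<^sub>m (d r) (d s)"
  using x y z e ne by (auto simp: ii'_def pp'_def)
 \<comment> \<open>The new summand contributes \<open>i1 q1\<close>. Factoring \<open>i2\<close> and
   \<open>q2\<close> out of the remaining terms leaves the resolution of the identity for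
   \<open>R\<close>.\<close>
 have "mat_sum N N (%r. ii' r * pp' r) (insert a R) = i1 * q1 + mat_sum N N (%r. ii' r * pp' r) R"
  using insert h by (subst mat_sum_insert) (auto simp: ii'_def pp'_def)
 also have "mat_sum N N (%r. ii' r * pp' r) R = mat_sum N N (%r. (i2 * (ii r * pp r)) * q2) R"
  using ne by (intro mat_sum_cong) (auto simp: ii'_def pp'_def mat_assoc cd hd)
 also have "\<dots> = mat_sum N n (%r. i2 * (ii r * pp r)) R * q2"
  using h c by (intro mat_sum_mult[symmetric]) auto
 also have "mat_sum N n (%r. i2 * (ii r * pp r)) R = i2 * mat_sum n n (%r. ii r * pp r) R"
  using h c by (intro mult_mat_sum[symmetric]) auto
 finally have 4: "mat_sum N N (%r. ii' r * pp' r) (insert a R) = 1\<^sub>m N"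
  using s b h by simp
 show ?case using 1 2 3 4 by blast
qed

lemma matcat_iso:
 assumes "A * B = 1\<^sub>m n" "B * A = 1\<^sub>m m" "A : \<M> n m" "B : \<M> m n"
 shows "inverse_arrows matcat A B"
 by (rule inv_arrowsI) (use assms in \<open>auto simp: Hom_matcat\<close>)

section \<open>Representations of groupoids and induction along finite coverings\<close>

lemma Rep_simps [simp]:
 "Obj (Rep X) = {V. is_functor X matcat V & fin_supp X V}"
 "Dom (Rep X) = nsrc" "Cod (Rep X) = ntgt" "Idn (Rep X) = nt_id X matcat" "Cmp (Rep X) = vcomp X matcat"
 "Add (Rep X) = Add (fun_cat X matcat)" "Zer (Rep X) = Zer (fun_cat X matcat)" "Scl (Rep X) = Scl (fun_cat X matcat)"
 by (auto simp: Rep_def)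

lemma Hom_Rep: "\<tau> : Hom (Rep X) V W \<longleftrightarrow> is_nat X matcat \<tau> & nsrc \<tau> = V & ntgt \<tau> = W & fin_supp X V & fin_supp X W"
 by (auto simp: Rep_def Hom_full_sub Hom_fun_cat)

lemma lin_category_Rep: "category X ==> lin_category (Rep X)"
 unfolding Rep_def by (intro lin_category_full_sub lin_category_fun_cat lin_category_matcat)

lemma category_Rep: "category X ==> category (Rep X)"
 using lin_category_Rep lin_category.cat by blast

lemma fin_supp_biprod:
 assumes b: "is_biprod (fun_cat X matcat) V W U i1 i2 q1 q2" and V: "fin_supp X V" and W: "fin_supp X W"
 shows "fin_supp X U"
proof -
 obtain K where K: "finite K" "K \<subseteq> Obj X" "\<forall>x\<in>Obj X. fo V x ~= 0 --> (\<exists>k\<in>K. isomorphic_obj X k x)"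
  using V by (auto simp: fin_supp_def)
 obtain L where L: "finite L" "L \<subseteq> Obj X" "\<forall>x\<in>Obj X. fo W x ~= 0 --> (\<exists>k\<in>L. isomorphic_obj X k x)"
  using W by (auto simp: fin_supp_def)
 \<comment> \<open>If both summands vanish at \<open>x\<close>, the identity of the sum factors
   through 0-dimensional spaces, so its entry at (0, 0) would be 0.\<close>
 have "fo V x ~= 0 \<or> fo W x ~= 0" if x: "x : Obj X" and U: "fo U x ~= 0" for x
 proof (rule ccontr)
  assume "\<not> (fo V x ~= 0 \<or> fo W x ~= 0)"
  hence c: "nt i1 x : \<M> (fo U x) 0" "nt i2 x : \<M> (fo U x) 0"
   "nt q1 x : \<M> 0 (fo U x)" "nt q2 x : \<M> 0 (fo U x)"
   and e: "nt i1 x * nt q1 x + nt i2 x * nt q2 x = 1\<^sub>m (fo U x)"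
   using fun_cat_biprod_component[OF b x] by (auto simp: is_biprod_def Hom_matcat)
  have "(nt i1 x * nt q1 x + nt i2 x * nt q2 x) $$ (0, 0) = 0"
   using c U by (auto simp: scalar_prod_def)
  thus False using e U by simp
 qed
 thus ?thesis unfolding fin_supp_def
  by (intro exI[of _ "K \<union> L"]) (use K L in blast)
qed

lemma has_biprods_Rep: "category X ==> has_biprods (Rep X)"
 unfolding Rep_def
 by (rule has_biprods_full_sub[OF category_fun_cat[OF _ category_matcat]
    has_biprods_fun_cat[OF _ lin_category_matcat has_biprods_matcat]])
   (simp, simp, rule fin_supp_biprod)

lemma has_zero_Rep:
 fixes X :: "('a, 'b, 'z) cat_scheme"
 assumes "category X"
 shows "has_zero (Rep X)"
proof -
 define F :: "('a, 'b) rep" where "F = \<lparr>fo = (%_. 0), fm = (%_. 0\<^sub>m 0 0)\<rparr>"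
 have F: "is_functor X matcat F" by (rule is_functorI) (auto simp: F_def Hom_matcat intro: eq_matI)
 have "nt_id X matcat F = Zer (fun_cat X matcat) F F"
  by (rule ntr_eqI[where C = X]) (auto simp: F_def intro: eq_matI)
 moreover have "fin_supp X F" by (auto simp: fin_supp_def F_def)
 ultimately show ?thesis unfolding has_zero_def by (intro bexI[of _ F]) (simp_all add: F)
qed

lemma
 assumes "is_functor X matcat V"
 shows rep_cm: "k : Hom X x y ==> fm V k : \<M> (fo V y) (fo V x)"
  and rep_cmp: "k : Hom X x y ==> l : Hom X y z ==> fm V (Cmp X l k) = fm V l * fm V k"
  and rep_idn: "x : Obj X ==> fm V (Idn X x) = 1\<^sub>m (fo V x)"
 using fct_hom[OF assms] fct_cmp[OF assms] fct_idn[OF assms] by (auto simp: Hom_matcat)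

lemma
 assumes "is_nat X matcat \<tau>"
 shows intw_cm: "x : Obj X ==> nt \<tau> x : \<M> (fo (ntgt \<tau>) x) (fo (nsrc \<tau>) x)"
  and intw_nat: "k : Hom X x y ==> nt \<tau> y * fm (nsrc \<tau>) k = fm (ntgt \<tau>) k * nt \<tau> x"
 using nat_hom[OF assms] nat_nat[OF assms] by (auto simp: Hom_matcat)

lemma Rep_iso:
 assumes "category X" "\<tau> : Arr (Rep X)" "!!x. x : Obj X ==> is_iso matcat (nt \<tau> x)"
 shows "is_iso (Rep X) \<tau>"
  and "x : Obj X ==> nt (cat_inv (Rep X) \<tau>) x = cat_inv matcat (nt \<tau> x)"
proof -
 have "inverse_arrows (fun_cat X matcat) \<tau> (nt_inv X matcat \<tau>)"
  by (rule fun_cat_inverse_arrows[OF assms(1) category_matcat _ assms(3)]) (use assms(2) in \<open>simp add: Rep_def\<close>)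
 hence i: "inverse_arrows (Rep X) \<tau> (nt_inv X matcat \<tau>)"
  unfolding Rep_def by (rule full_sub_inverse_arrows) (use assms(2) in \<open>simp add: Rep_def\<close>)
 thus "is_iso (Rep X) \<tau>" by (auto simp: is_iso_def)
 show "x : Obj X ==> nt (cat_inv (Rep X) \<tau>) x = cat_inv matcat (nt \<tau> x)"
  using cat_inv_eq[OF category_Rep[OF assms(1)] i] by simp
qed

section \<open>Groupoids and finite coverings\<close>

definition groupoid :: "('o, 'm, 'z) cat_scheme => bool" where
 "groupoid X \<longleftrightarrow> category X & (\<forall>f\<in>Arr X. is_iso X f)"

lemma groupoid_cat: "groupoid X ==> category X"
 by (simp add: groupoid_def)

lemma
 assumes "groupoid X" "f : Hom X a b"
 shows grp_iso: "is_iso X f"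
  and grp_inv: "cat_inv X f : Hom X b a"
  and grp_inv_left: "Cmp X (cat_inv X f) f = Idn X a"
  and grp_inv_right: "Cmp X f (cat_inv X f) = Idn X b"
proof -
 show i: "is_iso X f" using assms by (auto simp: groupoid_def homset_def)
 note c = groupoid_cat[OF assms(1)]
 show "cat_inv X f : Hom X b a" "Cmp X (cat_inv X f) f = Idn X a" "Cmp X f (cat_inv X f) = Idn X b"
  using cat_inv_hom[OF c i assms(2)] cat_inv_left[OF c i assms(2)] cat_inv_right[OF c i assms(2)] by auto
qed

text \<open>\<open>R\<close> represents every object \<open>(x, g : G x \<rightarrow> b)\<close> of the comma groupoid exactly once, by a unique
 arrow; so that groupoid is equivalent to the finite discrete one on \<open>R\<close>.\<close>

definition reps ::
 "('x, 'xm) cat => ('b, 'bm) cat => ('x, 'xm, 'b, 'bm) fctr => 'b => ('x \<times> 'bm) set => bool" where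
 "reps X B G b R \<longleftrightarrow> finite R & (\<forall>(x, g)\<in>R. x : Obj X & g : Hom B (fo G x) b) &
   (\<forall>x\<in>Obj X. \<forall>g\<in>Hom B (fo G x) b.
    EX! t. case t of (r, h, k) => (r, h) : R & k : Hom X x r & Cmp B h (fm G k) = g)"

text \<open>Equivalently, \<open>G\<close> is faithful and each of its comma groupoids has finitely
  many isomorphism classes. Packing both properties into representatives with unique connecting
  arrows reduces later arguments to the choice of a triple \<open>(r, h, k)\<close>.\<close>

definition finite_cover :: "('x, 'xm) cat => ('b, 'bm) cat => ('x, 'xm, 'b, 'bm) fctr => bool" where
 "finite_cover X B G \<longleftrightarrow> groupoid X & groupoid B & is_functor X B G & (\<forall>b\<in>Obj B. EX R. reps X B G b R)"

lemma
 assumes "reps X B G b R"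
 shows reps_finite: "finite R"
  and reps_in: "(x, g) : R ==> x : Obj X" "(x, g) : R ==> g : Hom B (fo G x) b"
  and reps_ex: "x : Obj X ==> g : Hom B (fo G x) b ==>
   EX r h k. (r, h) : R & k : Hom X x r & Cmp B h (fm G k) = g"
  and reps_unique: "x : Obj X ==> g : Hom B (fo G x) b ==>
   (r, h) : R ==> k : Hom X x r ==> Cmp B h (fm G k) = g ==>
   (r', h') : R ==> k' : Hom X x r' ==> Cmp B h' (fm G k') = g ==> r = r' & h = h' & k = k'"
 subgoal using assms by (simp add: reps_def)
 subgoal using assms by (auto simp: reps_def)
 subgoal using assms by (auto simp: reps_def)
 subgoal using assms unfolding reps_def by fast
 subgoal premises p
 proof -
  have "EX! t. case t of (r, h, k) => (r, h) : R & k : Hom X x r & Cmp B h (fm G k) = g"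
   using assms p(1,2) unfolding reps_def by blast
  hence "(r, h, k) = (r', h', k')" by (rule ex1E) (use p in \<open>metis (mono_tags, lifting) case_prodI\<close>)
  thus ?thesis by simp
 qed
 done

lemma repsI:
 assumes "finite R" "!!x g. (x, g) : R ==> x : Obj X & g : Hom B (fo G x) b"
  and "!!x g. x : Obj X ==> g : Hom B (fo G x) b ==>
   EX r h k. (r, h) : R & k : Hom X x r & Cmp B h (fm G k) = g"
  and "!!x r h k r' h' k'. x : Obj X ==> (r, h) : R ==> k : Hom X x r ==> (r', h') : R ==> k' : Hom X x r' ==>
   Cmp B h (fm G k) = Cmp B h' (fm G k') ==> r = r' & h = h' & k = k'"
 shows "reps X B G b R"
 unfolding reps_def
proof (intro conjI ballI)
 fix x g assume x: "x : Obj X" and g: "g : Hom B (fo G x) b"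
 obtain r h k where t: "(r, h) : R" "k : Hom X x r" "Cmp B h (fm G k) = g" using assms(3)[OF x g] by blast
 show "EX! t. case t of (r, h, k) => (r, h) : R & k : Hom X x r & Cmp B h (fm G k) = g"
 proof (rule ex1I[of _ "(r, h, k)"])
  fix t' assume "case t' of (r, h, k) => (r, h) : R & k : Hom X x r & Cmp B h (fm G k) = g"
  thus "t' = (r, h, k)" using t assms(4)[OF x, of "fst t'" "fst (snd t')" "snd (snd t')" r h k]
   by (auto split: prod.splits)
 qed (use t in simp)
qed (use assms(1,2) in auto)


section \<open>Induction as a chosen colimit\<close>

lemma ind_coconeI:
 assumes "!!x g. x : Obj X ==> g : Hom B (fo G x) b ==> \<theta> x g : \<M> m (fo V x)"
  and "!!x y k g. k : Hom X x y ==> g : Hom B (fo G y) b ==> \<theta> y g * fm V k = \<theta> x (Cmp B g (fm G k))"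
 shows "ind_cocone X B G V b m \<theta>"
 unfolding ind_cocone_def using assms by (auto simp: homset_def)

lemma
 assumes "ind_cocone X B G V b m \<theta>"
 shows cocone_carrier: "x : Obj X ==> g : Hom B (fo G x) b ==> \<theta> x g : \<M> m (fo V x)"
  and cocone_nat: "k : Hom X x y ==> g : Hom B (fo G y) b ==> \<theta> y g * fm V k = \<theta> x (Cmp B g (fm G k))"
 using assms unfolding ind_cocone_def by (auto simp: homset_def)

locale cover =
 fixes X :: "('x, 'xm) cat" and B :: "('b, 'bm) cat" and G :: "('x, 'xm, 'b, 'bm) fctr"
 assumes finite_cover: "finite_cover X B G"
begin

lemma groupoids: "groupoid X" "groupoid B"
 and fctG: "is_functor X B G"
 and ex_reps: "b : Obj B ==> EX R. reps X B G b R"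
 using finite_cover by (auto simp: finite_cover_def)

lemma catX: "category X" and catB: "category B"
 using groupoids by (auto intro: groupoid_cat)

lemma cmp_G: "k : Hom X x y ==> g : Hom B (fo G y) b ==> Cmp B g (fm G k) : Hom B (fo G x) b"
 using cat_cmp[OF catB fct_hom[OF fctG]] by blast

lemma colimit_exists:
 assumes V: "is_functor X matcat V" and b: "b : Obj B"
 shows "\<exists>n \<iota>. ind_colimit X B G V b n \<iota>"
proof -
 obtain R where R: "reps X B G b R" using ex_reps[OF b] by blast
 obtain n and ii pp :: "'x \<times> 'bm => complex mat" where
  c: "\<forall>r\<in>R. ii r : \<M> n (fo V (fst r)) & pp r : \<M> (fo V (fst r)) n"
  and e: "\<forall>r\<in>R. pp r * ii r = 1\<^sub>m (fo V (fst r))"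
   "\<forall>r\<in>R. \<forall>s\<in>R. r ~= s --> pp r * ii s = 0\<^sub>m (fo V (fst r)) (fo V (fst s))"
  and s: "mat_sum n n (%r. ii r * pp r) R = 1\<^sub>m n"
  using finite_biprod[OF reps_finite[OF R], of "%r. fo V (fst r)"] by blast
 have cd: "dim_row (ii r) = n" "dim_col (ii r) = fo V (fst r)" "dim_row (pp r) = fo V (fst r)" "dim_col (pp r) = n"
  if "r : R" for r using c that by auto
 define t where "t x g = (THE t. case t of (r, h, k) => (r, h) : R & k : Hom X x r & Cmp B h (fm G k) = g)" for x g
 \<comment> \<open>The injection at an arbitrary \<open>(x, g)\<close>: pass to the representative
   along the connecting arrow, then enter the summand of that representative.\<close>
 define \<iota> where "\<iota> x g = ii (fst (t x g), fst (snd (t x g))) * fm V (snd (snd (t x g)))" for x g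
 have \<iota>: "\<iota> x g = ii (r, h) * fm V k"
  if "x : Obj X" "g : Hom B (fo G x) b" "(r, h) : R" "k : Hom X x r" "Cmp B h (fm G k) = g" for x g r h k
 proof -
  have "t x g = (r, h, k)" unfolding t_def
   by (rule the_equality) (use that reps_unique[OF R] in auto)
  thus ?thesis by (simp add: \<iota>_def)
 qed
 have coc: "ind_cocone X B G V b n \<iota>"
 proof (rule ind_coconeI)
  fix x g assume x: "x : Obj X" "g : Hom B (fo G x) b"
  obtain r h k where r: "(r, h) : R" "k : Hom X x r" "Cmp B h (fm G k) = g" using reps_ex[OF R x] by blast
  show "\<iota> x g : \<M> n (fo V x)" using \<iota>[OF x r] c r rep_cm[OF V r(2)] by auto
 next
  fix x y k g assume k: "k : Hom X x y" and g: "g : Hom B (fo G y) b"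
  note o = dom_obj[OF k catX]
  obtain r h l where r: "(r, h) : R" "l : Hom X y r" "Cmp B h (fm G l) = g" using reps_ex[OF R o(2) g] by blast
  note lk = cat_cmp[OF catX k r(2)]
  have "Cmp B h (fm G (Cmp X l k)) = Cmp B g (fm G k)"
   using fct_cmp[OF fctG k r(2)] r reps_in(2)[OF R r(1)]
    cat_assoc[OF catB fct_hom[OF fctG k] fct_hom[OF fctG r(2)]] by auto
  from \<iota>[OF o(1) cmp_G[OF k g] r(1) lk this]
  show "\<iota> y g * fm V k = \<iota> x (Cmp B g (fm G k))"
   using \<iota>[OF o(2) g r] cd[OF r(1)] rep_cm[OF V k] rep_cm[OF V r(2)] rep_cmp[OF V k r(2)]
   by (simp add: mat_assoc)
 qed
 have id: "\<iota> r h = ii (r, h)" if r: "(r, h) : R" for r h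
  using \<iota>[OF reps_in[OF R r] r cat_idn[OF catX reps_in(1)[OF R r]]] reps_in[OF R r] rep_idn[OF V] cd[OF r]
   fct_idn[OF fctG] cat_idr[OF catB] by auto
 have "EX! h. h : \<M> m n & (\<forall>x\<in>Obj X. \<forall>g\<in>Hom B (fo G x) b. h * \<iota> x g = \<theta> x g)"
  if th: "ind_cocone X B G V b m \<theta>" for m \<theta>
 proof (rule ex1I)
  \<comment> \<open>The mediating map projects to each summand and applies the cocone at its
    representative.\<close>
  let ?h = "mat_sum m n (%r. \<theta> (fst r) (snd r) * pp r) R"
  have tc: "\<theta> (fst r) (snd r) : \<M> m (fo V (fst r))" if "r : R" for r
   using cocone_carrier[OF th] reps_in[OF R, of "fst r" "snd r"] that by simp
  have tp: "\<theta> (fst r) (snd r) * pp r : \<M> m n" if "r : R" for r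
   using tc[OF that] c that by auto
  have ta: "\<theta> (fst s) (snd s) * pp s * ii r = \<theta> (fst s) (snd s) * (pp s * ii r)" if "s : R" "r : R" for s r
   using tc[OF that(1)] cd[OF that(1)] cd[OF that(2)] by (simp add: mat_assoc)
  have hi: "?h * ii r = \<theta> (fst r) (snd r)" if r: "r : R" for r
  proof -
   have "?h * ii r = mat_sum m (fo V (fst r)) (%s. \<theta> (fst s) (snd s) * pp s * ii r) R"
    using c r tp by (intro mat_sum_mult) simp_all
   also have "\<dots> = mat_sum m (fo V (fst r)) (%s. \<theta> (fst s) (snd s) * (pp s * ii r)) R"
    by (rule mat_sum_cong) (simp_all add: ta r)
   also have "\<dots> = \<theta> (fst r) (snd r) * (pp r * ii r)"
   proof (rule mat_sum_delta[OF reps_finite[OF R] r])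
    show "\<theta> (fst r) (snd r) * (pp r * ii r) : \<M> m (fo V (fst r))" using e r tc[OF r] by simp
    show "\<theta> (fst s) (snd s) * (pp s * ii r) = 0\<^sub>m m (fo V (fst r))" if "s : R" "s ~= r" for s
     using e r that tc[OF that(1)] by simp
   qed
   finally show ?thesis using e r tc[OF r] by simp
  qed
  show "?h : \<M> m n & (\<forall>x\<in>Obj X. \<forall>g\<in>Hom B (fo G x) b. ?h * \<iota> x g = \<theta> x g)"
  proof (intro conjI ballI)
   fix x g assume x: "x : Obj X" "g : Hom B (fo G x) b"
   obtain r h k where r: "(r, h) : R" "k : Hom X x r" "Cmp B h (fm G k) = g" using reps_ex[OF R x] by blast
   have "?h * \<iota> x g = (?h * ii (r, h)) * fm V k"
    using cd[OF r(1)] rep_cm[OF V r(2)] by (simp add: \<iota>[OF x r] mat_assoc)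
   also have "\<dots> = \<theta> x g" using hi[OF r(1)] cocone_nat[OF th r(2) reps_in(2)[OF R r(1)]] r(3) by simp
   finally show "?h * \<iota> x g = \<theta> x g" .
  qed simp
  fix h assume h: "h : \<M> m n & (\<forall>x\<in>Obj X. \<forall>g\<in>Hom B (fo G x) b. h * \<iota> x g = \<theta> x g)"
  \<comment> \<open>For uniqueness, the resolution of the identity is inserted after
    \<open>h\<close>, which expresses \<open>h\<close> through its values on the summands.\<close>
  have "h = h * mat_sum n n (%r. ii r * pp r) R" using conjunct1[OF h] s by simp
  also have "\<dots> = mat_sum m n (%r. h * (ii r * pp r)) R"
   using h c by (intro mult_mat_sum) auto
  also have "\<dots> = ?h"
  proof (rule mat_sum_cong)
   fix r assume r: "r : R"
   obtain x g where xg: "r = (x, g)" by force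
   have "h * ii r = \<theta> x g" using h id reps_in[OF R] r xg by metis
   thus "h * (ii r * pp r) = \<theta> (fst r) (snd r) * pp r" using h cd[OF r] xg mat_assoc[of h "ii r" "pp r"] by auto
  qed simp
  finally show "h = ?h" .
 qed
 hence "ind_colimit X B G V b n \<iota>" unfolding ind_colimit_def using coc by blast
 thus ?thesis by blast
qed

abbreviation "dI \<equiv> ind_dim X B G"
abbreviation "\<iota> \<equiv> ind_inj X B G"

lemma colimit:
 assumes "is_functor X matcat V" "b : Obj B"
 shows "ind_colimit X B G V b (dI V b) (\<iota> V b)"
proof -
 have "EX p. case p of (n, i) => ind_colimit X B G V b n i" using colimit_exists[OF assms] by auto
 from someI_ex[OF this] show ?thesis
  unfolding ind_dim_def ind_inj_def ind_choice_def by (auto split: prod.splits)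
qed

context
 fixes V b assumes V: "is_functor X matcat V" and b: "b : Obj B"
begin

lemma inj_cm: "x : Obj X ==> g : Hom B (fo G x) b ==> \<iota> V b x g : \<M> (dI V b) (fo V x)"
 using colimit[OF V b] by (auto simp: ind_colimit_def intro: cocone_carrier)

lemma inj_dim:
 assumes "x : Obj X" "g : Hom B (fo G x) b"
 shows "dim_row (\<iota> V b x g) = dI V b" "dim_col (\<iota> V b x g) = fo V x"
 using inj_cm[OF assms] by auto

lemma inj_nat: "k : Hom X x y ==> g : Hom B (fo G y) b ==> \<iota> V b y g * fm V k = \<iota> V b x (Cmp B g (fm G k))"
 using colimit[OF V b] by (auto simp: ind_colimit_def intro: cocone_nat)

text \<open>Composing \<open>h\<close> with the injections gives a cocone for which both
  \<open>h\<close> and \<open>h'\<close> are mediating maps. This joint epimorphy is the standard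
  way below to compare two maps out of an induced representation.\<close>

lemma ind_eqI:
 assumes "h : \<M> m (dI V b)" "h' : \<M> m (dI V b)"
  and "!!x g. x : Obj X ==> g : Hom B (fo G x) b ==> h * \<iota> V b x g = h' * \<iota> V b x g"
 shows "h = h'"
proof -
 have "ind_cocone X B G V b m (%x g. h * \<iota> V b x g)"
 proof (rule ind_coconeI)
  fix x y k g assume k: "k : Hom X x y" and g: "g : Hom B (fo G y) b"
  show "h * \<iota> V b y g * fm V k = h * \<iota> V b x (Cmp B g (fm G k))"
   using assms(1) inj_cm[OF dom_obj(2)[OF k catX] g] rep_cm[OF V k]
   by (simp add: inj_nat[OF k g, symmetric] mat_assoc)
 qed (use assms(1) inj_cm in auto)
 hence "EX! h'. h' : \<M> m (dI V b) & (\<forall>x\<in>Obj X. \<forall>g\<in>Hom B (fo G x) b. h' * \<iota> V b x g = h * \<iota> V b x g)"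
  using colimit[OF V b] unfolding ind_colimit_def by blast
 thus ?thesis by (rule ex1E) (metis assms)
qed

context
 fixes m \<theta> assumes \<theta>: "ind_cocone X B G V b m \<theta>"
begin

lemma desc_ex1: "EX! h. h : \<M> m (dI V b) & (\<forall>x\<in>Obj X. \<forall>g\<in>Hom B (fo G x) b. h * \<iota> V b x g = \<theta> x g)"
 using colimit[OF V b] \<theta> unfolding ind_colimit_def by blast

lemma desc_carrier: "ind_desc X B G V b m \<theta> : \<M> m (dI V b)"
 and desc_inj: "x : Obj X ==> g : Hom B (fo G x) b ==> ind_desc X B G V b m \<theta> * \<iota> V b x g = \<theta> x g"
 using theI'[OF desc_ex1] unfolding ind_desc_def by auto

end

end

lemma Ind_obj_fo [simp]: "fo (Ind_obj X B G V) = dI V"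
 by (simp add: Ind_obj_def)

context
 fixes V assumes V: "is_functor X matcat V"
begin

lemma Ind_obj_cocone:
 assumes h: "h : Hom B b c"
 shows "ind_cocone X B G V b (dI V c) (%x g. \<iota> V c x (Cmp B h g))"
proof (rule ind_coconeI)
 note o = dom_obj[OF h catB]
 show "\<iota> V c x (Cmp B h g) : \<M> (dI V c) (fo V x)" if "x : Obj X" "g : Hom B (fo G x) b" for x g
  using inj_cm[OF V o(2) that(1) cat_cmp[OF catB that(2) h]] .
 show "\<iota> V c y (Cmp B h g) * fm V k = \<iota> V c x (Cmp B h (Cmp B g (fm G k)))"
  if k: "k : Hom X x y" and g: "g : Hom B (fo G y) b" for x y k g
  using inj_nat[OF V o(2) k cat_cmp[OF catB g h]] cat_assoc[OF catB fct_hom[OF fctG k] g h] by simp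
qed

lemma Ind_obj_cm: "h : Hom B b c ==> fm (Ind_obj X B G V) h : \<M> (dI V c) (dI V b)"
 and Ind_obj_inj: "h : Hom B b c ==> x : Obj X ==> g : Hom B (fo G x) b ==>
  fm (Ind_obj X B G V) h * \<iota> V b x g = \<iota> V c x (Cmp B h g)"
proof -
 assume h: "h : Hom B b c"
 have e: "fm (Ind_obj X B G V) h = ind_desc X B G V b (dI V c) (%x g. \<iota> V c x (Cmp B h g))"
  using h by (simp add: Ind_obj_def homset_def)
 note d = desc_carrier[OF V dom_obj(1)[OF h catB] Ind_obj_cocone[OF h]]
  desc_inj[OF V dom_obj(1)[OF h catB] Ind_obj_cocone[OF h]]
 show "fm (Ind_obj X B G V) h : \<M> (dI V c) (dI V b)" using d(1) e by simp
 show "fm (Ind_obj X B G V) h * \<iota> V b x g = \<iota> V c x (Cmp B h g)" if "x : Obj X" "g : Hom B (fo G x) b"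
  using d(2)[OF that] e by simp
qed

lemma Ind_obj_functor: "is_functor B matcat (Ind_obj X B G V)"
proof (rule is_functorI)
 fix b assume b: "b : Obj B"
 note id = cat_idn[OF catB b]
 have "fm (Ind_obj X B G V) (Idn B b) = 1\<^sub>m (dI V b)"
  by (rule ind_eqI[OF V b Ind_obj_cm[OF id]])
   (simp_all add: Ind_obj_inj[OF id] cat_idl[OF catB] inj_dim[OF V b])
 thus "fm (Ind_obj X B G V) (Idn B b) = Idn matcat (fo (Ind_obj X B G V) b)" by simp
next
 fix h k b c d assume h: "h : Hom B b c" and k: "k : Hom B c d"
 note hk = cat_cmp[OF catB h k] and o = dom_obj[OF h catB]
 note cc = Ind_obj_cm[OF h] Ind_obj_cm[OF k]
 have "fm (Ind_obj X B G V) (Cmp B k h) = fm (Ind_obj X B G V) k * fm (Ind_obj X B G V) h"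
 proof (rule ind_eqI[OF V o(1) Ind_obj_cm[OF hk]])
  fix x g assume x: "x : Obj X" "g : Hom B (fo G x) b"
  show "fm (Ind_obj X B G V) (Cmp B k h) * \<iota> V b x g = fm (Ind_obj X B G V) k * fm (Ind_obj X B G V) h * \<iota> V b x g"
   using cc inj_cm[OF V o(1) x] Ind_obj_inj[OF hk x] Ind_obj_inj[OF h x] Ind_obj_inj[OF k x(1) cat_cmp[OF catB x(2) h]]
    cat_assoc[OF catB x(2) h k] by (simp add: mat_assoc)
 qed (use cc in auto)
 thus "fm (Ind_obj X B G V) (Cmp B k h) = Cmp matcat (fm (Ind_obj X B G V) k) (fm (Ind_obj X B G V) h)" by simp
qed (auto simp: Hom_matcat Ind_obj_cm)

lemma fin_supp_Ind:
 assumes "fin_supp X V"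
 shows "fin_supp B (Ind_obj X B G V)"
proof -
 obtain K where K: "finite K" "K \<subseteq> Obj X" "\<forall>x\<in>Obj X. fo V x ~= 0 --> (\<exists>k\<in>K. isomorphic_obj X k x)"
  using assms by (auto simp: fin_supp_def)
 have "\<exists>k\<in>fo G ` K. isomorphic_obj B k b" if b: "b : Obj B" and n: "dI V b ~= 0" for b
 proof -
  \<comment> \<open>Otherwise every injection into the space over \<open>b\<close> starts at a
    0-dimensional space, and by joint epimorphy the identity would equal zero.\<close>
  have "\<exists>x\<in>Obj X. \<exists>g\<in>Hom B (fo G x) b. fo V x ~= 0"
  proof (rule ccontr)
   assume "\<not> ?thesis"
   hence z: "fo V x = 0" if "x : Obj X" "g : Hom B (fo G x) b" for x g using that by blast
   have "(1\<^sub>m (dI V b) :: complex mat) = 0\<^sub>m (dI V b) (dI V b)"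
   proof (rule ind_eqI[OF V b, where m = "dI V b"])
    fix x g assume x: "x : Obj X" "g : Hom B (fo G x) b"
    note d = inj_dim[OF V b x]
    show "(1\<^sub>m (dI V b) :: complex mat) * \<iota> V b x g = 0\<^sub>m (dI V b) (dI V b) * \<iota> V b x g"
     by (rule eq_matI) (auto simp: d z[OF x])
   qed simp_all
   hence "1\<^sub>m (dI V b) $$ (0, 0) = (0\<^sub>m (dI V b) (dI V b) $$ (0, 0) :: complex)" by simp
   thus False using n by simp
  qed
  then obtain x g where x: "x : Obj X" "g : Hom B (fo G x) b" "fo V x ~= 0" by blast
  then obtain k f where k: "k : K" "f : Hom X k x" using K(3) by (auto simp: isomorphic_obj_def)
  have "Cmp B g (fm G f) : Hom B (fo G k) b" using cmp_G[OF k(2) x(2)] .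
  thus ?thesis using grp_iso[OF groupoids(2)] k(1) by (auto simp: isomorphic_obj_def)
 qed
 thus ?thesis unfolding fin_supp_def using K fct_obj[OF fctG]
  by (intro exI[of _ "fo G ` K"]) auto
qed

end

text \<open>If \<open>W\<close> is nonzero at \<open>G x\<close>, some \<open>b\<close> of the
  finite set supporting \<open>W\<close> has an arrow to \<open>G x\<close>. The inverse arrow makes
  \<open>x\<close> an object of the comma groupoid over \<open>b\<close>, so \<open>x\<close> is
  isomorphic to one of finitely many representatives.\<close>

lemma fin_supp_Res:
 assumes "fin_supp B W"
 shows "fin_supp X (fcmp W G)"
proof -
 obtain K where K: "finite K" "K \<subseteq> Obj B" "\<forall>b\<in>Obj B. fo W b ~= 0 --> (\<exists>k\<in>K. isomorphic_obj B k b)"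
  using assms by (auto simp: fin_supp_def)
 have "\<forall>b\<in>K. EX R. reps X B G b R" using K(2) ex_reps by blast
 then obtain R where R: "!!b. b : K ==> reps X B G b (R b)" by metis
 define L where "L = (\<Union>b\<in>K. fst ` R b)"
 have "\<exists>k\<in>L. isomorphic_obj X k x" if x: "x : Obj X" "fo W (fo G x) ~= 0" for x
 proof -
  obtain b f where b: "b : K" "f : Hom B b (fo G x)"
   using K(3) fct_obj[OF fctG x(1)] x(2) by (auto simp: isomorphic_obj_def)
  obtain r h l where r: "(r, h) : R b" "l : Hom X x r"
   using reps_ex[OF R[OF b(1)] x(1) grp_inv[OF groupoids(2) b(2)]] by blast
  have "r : L" using r(1) b(1) by (force simp: L_def)
  moreover have "isomorphic_obj X r x"
   using grp_inv[OF groupoids(1) r(2)] grp_iso[OF groupoids(1)] by (auto simp: isomorphic_obj_def)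
  ultimately show ?thesis by blast
 qed
 moreover have "finite L" using K(1) reps_finite[OF R] by (auto simp: L_def)
 moreover have "L \<subseteq> Obj X" using reps_in(1)[OF R] by (force simp: L_def)
 ultimately show ?thesis unfolding fin_supp_def by auto
qed

lemma Res_obj: "W : Obj (Rep B) ==> fcmp W G : Obj (Rep X)"
 using fin_supp_Res is_functor_fcmp[OF fctG] by auto

lemma Ind_obj_Rep: "V : Obj (Rep X) ==> Ind_obj X B G V : Obj (Rep B)"
 using fin_supp_Ind Ind_obj_functor by auto

lemma Ind_fo [simp]: "fo (Ind X B G) = Ind_obj X B G"
 by (simp add: Ind_def)

lemma Ind_fm [simp]: "nsrc (fm (Ind X B G) \<tau>) = Ind_obj X B G (nsrc \<tau>)" "ntgt (fm (Ind X B G) \<tau>) = Ind_obj X B G (ntgt \<tau>)"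
 "nt (fm (Ind X B G) \<tau>) : extensional (Obj B)"
 by (simp_all add: Ind_def)

context
 fixes \<tau> V W assumes \<tau>: "is_nat X matcat \<tau>" "nsrc \<tau> = V" "ntgt \<tau> = W"
begin

lemma Ind_map_cocone:
 assumes b: "b : Obj B"
 shows "ind_cocone X B G V b (dI W b) (%x g. \<iota> W b x g * nt \<tau> x)"
proof (rule ind_coconeI)
 have W: "is_functor X matcat W" and V: "is_functor X matcat V" using \<tau> nat_src nat_tgt by auto
 note c = intw_cm[OF \<tau>(1), unfolded \<tau>]
 show "\<iota> W b x g * nt \<tau> x : \<M> (dI W b) (fo V x)" if "x : Obj X" "g : Hom B (fo G x) b" for x g
  using inj_cm[OF W b that] c[OF that(1)] by auto
 show "\<iota> W b y g * nt \<tau> y * fm V k = \<iota> W b x (Cmp B g (fm G k)) * nt \<tau> x"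
  if k: "k : Hom X x y" and g: "g : Hom B (fo G y) b" for x y k g
  using inj_cm[OF W b dom_obj(2)[OF k catX] g] c[OF dom_obj(2)[OF k catX]] c[OF dom_obj(1)[OF k catX]]
   rep_cm[OF V k] rep_cm[OF W k] intw_nat[OF \<tau>(1) k, unfolded \<tau>]
  by (simp add: inj_nat[OF W b k g, symmetric] mat_assoc)
qed

lemma Ind_map_cm: "b : Obj B ==> nt (fm (Ind X B G) \<tau>) b : \<M> (dI W b) (dI V b)"
 and Ind_map_inj: "b : Obj B ==> x : Obj X ==> g : Hom B (fo G x) b ==>
  nt (fm (Ind X B G) \<tau>) b * \<iota> V b x g = \<iota> W b x g * nt \<tau> x"
proof -
 have V: "is_functor X matcat V" using \<tau> nat_src by auto
 assume b: "b : Obj B"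
 note d = desc_carrier[OF V b Ind_map_cocone[OF b]] desc_inj[OF V b Ind_map_cocone[OF b]]
 show "nt (fm (Ind X B G) \<tau>) b : \<M> (dI W b) (dI V b)" using d(1) b \<tau> by (simp add: Ind_def)
 show "nt (fm (Ind X B G) \<tau>) b * \<iota> V b x g = \<iota> W b x g * nt \<tau> x" if "x : Obj X" "g : Hom B (fo G x) b"
  using d(2)[OF that] b \<tau> by (simp add: Ind_def)
qed

lemma Ind_map_nat: "is_nat B matcat (fm (Ind X B G) \<tau>)"
proof (rule is_natI)
 have W: "is_functor X matcat W" and V: "is_functor X matcat V" using \<tau> nat_src nat_tgt by auto
 show "is_functor B matcat (nsrc (fm (Ind X B G) \<tau>))" "is_functor B matcat (ntgt (fm (Ind X B G) \<tau>))"
  using Ind_obj_functor V W \<tau> by auto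
 show "nt (fm (Ind X B G) \<tau>) b : Hom matcat (fo (nsrc (fm (Ind X B G) \<tau>)) b) (fo (ntgt (fm (Ind X B G) \<tau>)) b)"
  if "b : Obj B" for b using Ind_map_cm[OF that] \<tau> by (simp add: Hom_matcat)
 fix h b c assume h: "h : Hom B b c"
 note o = dom_obj[OF h catB]
 note cc = Ind_map_cm[OF o(1)] Ind_map_cm[OF o(2)] Ind_obj_cm[OF V h] Ind_obj_cm[OF W h]
 have "nt (fm (Ind X B G) \<tau>) c * fm (Ind_obj X B G V) h = fm (Ind_obj X B G W) h * nt (fm (Ind X B G) \<tau>) b"
 proof (rule ind_eqI[OF V o(1), of _ "dI W c"])
  fix x g assume x: "x : Obj X" "g : Hom B (fo G x) b"
  note hg = cat_cmp[OF catB x(2) h]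
  show "nt (fm (Ind X B G) \<tau>) c * fm (Ind_obj X B G V) h * \<iota> V b x g =
    fm (Ind_obj X B G W) h * nt (fm (Ind X B G) \<tau>) b * \<iota> V b x g"
   using cc inj_cm[OF V o(1) x] inj_cm[OF W o(1) x] intw_cm[OF \<tau>(1) x(1)] \<tau>(2,3)
   by (simp add: mat_assoc Ind_obj_inj[OF V h x] Ind_map_inj[OF o(1) x] Ind_map_inj[OF o(2) x(1) hg]
     Ind_obj_inj[OF W h x, symmetric])
 qed (use cc in auto)
 thus "Cmp matcat (nt (fm (Ind X B G) \<tau>) c) (fm (nsrc (fm (Ind X B G) \<tau>)) h) =
  Cmp matcat (fm (ntgt (fm (Ind X B G) \<tau>)) h) (nt (fm (Ind X B G) \<tau>) b)" using \<tau> by simp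
qed simp

end

text \<open>The functor laws and the linearity of induction are all instances of this rule: the
  candidate on the right only has to act correctly on injections.\<close>

lemma Ind_map_eqI:
 assumes t: "is_nat X matcat \<tau>" "nsrc \<tau> = V" "ntgt \<tau> = W"
  and s: "nsrc \<sigma> = Ind_obj X B G V" "ntgt \<sigma> = Ind_obj X B G W" "nt \<sigma> : extensional (Obj B)"
  and c: "!!b. b : Obj B ==> nt \<sigma> b : \<M> (dI W b) (dI V b)"
  and e: "!!b x g. b : Obj B ==> x : Obj X ==> g : Hom B (fo G x) b ==> nt \<sigma> b * \<iota> V b x g = \<iota> W b x g * nt \<tau> x"
 shows "fm (Ind X B G) \<tau> = \<sigma>"
proof (rule ntr_eqI[where C = B])
 fix b assume b: "b : Obj B"
 have V: "is_functor X matcat V" using t nat_src by auto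
 show "nt (fm (Ind X B G) \<tau>) b = nt \<sigma> b"
  by (rule ind_eqI[OF V b Ind_map_cm[OF t b] c[OF b]]) (simp add: e[OF b] Ind_map_inj[OF t b])
qed (use t s in auto)

lemma linear_Ind: "linear_functor (Rep X) (Rep B) (Ind X B G)"
proof (rule linear_functorI)
 show "is_functor (Rep X) (Rep B) (Ind X B G)"
 proof (rule is_functorI)
  fix V assume V: "V : Obj (Rep X)"
  thus "fo (Ind X B G) V : Obj (Rep B)" using Ind_obj_Rep by simp
  have VF: "is_functor X matcat V" using V by simp
  show "fm (Ind X B G) (Idn (Rep X) V) = Idn (Rep B) (fo (Ind X B G) V)"
   unfolding Rep_simps Ind_fo
   by (rule Ind_map_eqI[OF is_nat_id[OF catX category_matcat VF] nt_id_simps(1,2)]) (simp_all add: inj_dim[OF VF])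
 next
  fix \<tau> V W assume "\<tau> : Hom (Rep X) V W"
  hence t: "is_nat X matcat \<tau>" "nsrc \<tau> = V" "ntgt \<tau> = W" "fin_supp X V" "fin_supp X W" by (auto simp: Hom_Rep)
  thus "fm (Ind X B G) \<tau> : Hom (Rep B) (fo (Ind X B G) V) (fo (Ind X B G) W)"
   using Ind_map_nat[OF t(1-3)] fin_supp_Ind[of V] fin_supp_Ind[of W] nat_src[OF t(1)] nat_tgt[OF t(1)]
   by (simp add: Hom_Rep)
 next
  fix \<tau> \<sigma> U V W assume t: "\<tau> : Hom (Rep X) U V" and s: "\<sigma> : Hom (Rep X) V W"
  hence tt: "is_nat X matcat \<tau>" "nsrc \<tau> = U" "ntgt \<tau> = V" and ss: "is_nat X matcat \<sigma>" "nsrc \<sigma> = V" "ntgt \<sigma> = W"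
   by (auto simp: Hom_Rep)
  have U: "is_functor X matcat U" and W: "is_functor X matcat W" and V: "is_functor X matcat V"
   using tt ss nat_src nat_tgt by auto
  have ts: "is_nat X matcat (vcomp X matcat \<sigma> \<tau>)"
   using is_nat_vcomp[OF catX category_matcat tt(1) ss(1)] tt ss by simp
  show "fm (Ind X B G) (Cmp (Rep X) \<sigma> \<tau>) = Cmp (Rep B) (fm (Ind X B G) \<sigma>) (fm (Ind X B G) \<tau>)"
   unfolding Rep_simps
  proof (rule Ind_map_eqI[OF ts])
   fix b x g assume b: "b : Obj B" and x: "x : Obj X" "g : Hom B (fo G x) b"
   show "nt (vcomp B matcat (fm (Ind X B G) \<sigma>) (fm (Ind X B G) \<tau>)) b * \<iota> U b x g =
    \<iota> W b x g * nt (vcomp X matcat \<sigma> \<tau>) x"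
    using b x Ind_map_cm[OF tt b] Ind_map_cm[OF ss b] inj_cm[OF U b x] inj_cm[OF V b x]
     inj_cm[OF W b x] intw_cm[OF tt(1) x(1)] intw_cm[OF ss(1) x(1)]
     tt ss mat_assoc[of "nt (fm (Ind X B G) \<sigma>) b" "\<iota> V b x g" "nt \<tau> x"]
    by (simp add: mat_assoc Ind_map_inj[OF tt b x] Ind_map_inj[OF ss b x] flip: mat_assoc[of _ "\<iota> V b x g"])
  next
   fix b assume b: "b : Obj B"
   show "nt (vcomp B matcat (fm (Ind X B G) \<sigma>) (fm (Ind X B G) \<tau>)) b : \<M> (dI W b) (dI U b)"
    using b Ind_map_cm[OF tt b] Ind_map_cm[OF ss b] by simp
  qed (use tt ss in auto)
 qed
next
 fix V W :: "('x, 'xm) rep"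
 assume VW: "V : Obj (Rep X)" "W : Obj (Rep X)"
 hence V: "is_functor X matcat V" and W: "is_functor X matcat W" by auto
 interpret L: lin_category "fun_cat X matcat" using lin_category_fun_cat[OF catX lin_category_matcat] .
 have z: "is_nat X matcat (Zer (fun_cat X matcat) V W)" using L.zer_hom V W by (simp add: Hom_fun_cat)
 show "fm (Ind X B G) (Zer (Rep X) V W) = Zer (Rep B) (fo (Ind X B G) V) (fo (Ind X B G) W)"
  unfolding Rep_simps Ind_fo by (rule Ind_map_eqI[OF z fun_cat_lin_simps(5,6)]) (simp_all add: inj_dim[OF V] inj_dim[OF W] fct_obj[OF fctG])
next
 interpret L: lin_category "fun_cat X matcat" using lin_category_fun_cat[OF catX lin_category_matcat] .
 fix V W \<tau> \<sigma>
 assume t: "\<tau> : Hom (Rep X) V W" and s: "\<sigma> : Hom (Rep X) V W"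
 hence tt: "is_nat X matcat \<tau>" "nsrc \<tau> = V" "ntgt \<tau> = W" and ss: "is_nat X matcat \<sigma>" "nsrc \<sigma> = V" "ntgt \<sigma> = W"
  by (auto simp: Hom_Rep)
 have W: "is_functor X matcat W" and V: "is_functor X matcat V" using tt nat_src nat_tgt by auto
 have a: "is_nat X matcat (Add (fun_cat X matcat) \<tau> \<sigma>)" using L.add_hom[of \<tau> V W \<sigma>] tt ss by (simp add: Hom_fun_cat)
 show "fm (Ind X B G) (Add (Rep X) \<tau> \<sigma>) = Add (Rep B) (fm (Ind X B G) \<tau>) (fm (Ind X B G) \<sigma>)"
  unfolding Rep_simps
 proof (rule Ind_map_eqI[OF a])
  fix b x g assume b: "b : Obj B" and x: "x : Obj X" "g : Hom B (fo G x) b"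
  show "nt (Add (fun_cat B matcat) (fm (Ind X B G) \<tau>) (fm (Ind X B G) \<sigma>)) b * \<iota> V b x g =
    \<iota> W b x g * nt (Add (fun_cat X matcat) \<tau> \<sigma>) x"
   using b x mult_add_distrib_mat[OF inj_cm[OF W b x] intw_cm[OF tt(1) x(1), unfolded tt] intw_cm[OF ss(1) x(1), unfolded ss]]
    add_mult_distrib_mat[OF Ind_map_cm[OF tt b] Ind_map_cm[OF ss b] inj_cm[OF V b x]]
   by (simp add: Ind_map_inj[OF tt b x] Ind_map_inj[OF ss b x])
 next
  fix b assume b: "b : Obj B"
  show "nt (Add (fun_cat B matcat) (fm (Ind X B G) \<tau>) (fm (Ind X B G) \<sigma>)) b : \<M> (dI W b) (dI V b)"
   using b Ind_map_cm[OF tt b] Ind_map_cm[OF ss b] by simp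
 qed (use tt ss in auto)
next
 interpret L: lin_category "fun_cat X matcat" using lin_category_fun_cat[OF catX lin_category_matcat] .
 fix V W and \<tau> and r :: complex
 assume t: "\<tau> : Hom (Rep X) V W"
 hence tt: "is_nat X matcat \<tau>" "nsrc \<tau> = V" "ntgt \<tau> = W" by (auto simp: Hom_Rep)
 have W: "is_functor X matcat W" and V: "is_functor X matcat V" using tt nat_src nat_tgt by auto
 have a: "is_nat X matcat (Scl (fun_cat X matcat) r \<tau>)" using L.scl_hom[of \<tau> V W r] tt by (simp add: Hom_fun_cat)
 show "fm (Ind X B G) (Scl (Rep X) r \<tau>) = Scl (Rep B) r (fm (Ind X B G) \<tau>)"
  unfolding Rep_simps
 proof (rule Ind_map_eqI[OF a])
  fix b x g assume b: "b : Obj B" and x: "x : Obj X" "g : Hom B (fo G x) b"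
  show "nt (Scl (fun_cat B matcat) r (fm (Ind X B G) \<tau>)) b * \<iota> V b x g =
    \<iota> W b x g * nt (Scl (fun_cat X matcat) r \<tau>) x"
   using b x mult_smult_distrib[OF inj_cm[OF W b x] intw_cm[OF tt(1) x(1), unfolded tt]]
    mult_smult_assoc_mat[OF Ind_map_cm[OF tt b] inj_cm[OF V b x]]
   by (simp add: Ind_map_inj[OF tt b x])
 next
  fix b assume b: "b : Obj B"
  show "nt (Scl (fun_cat B matcat) r (fm (Ind X B G) \<tau>)) b : \<M> (dI W b) (dI V b)"
   using b Ind_map_cm[OF tt b] by simp
 qed (use tt in auto)
qed

lemma Res_simps [simp]: "fo (Res X F) W = fcmp W F" "fm (Res X F) \<tau> = whisk_r X \<tau> F"
 by (simp_all add: Res_def)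

lemma linear_Res: "linear_functor (Rep B) (Rep X) (Res X G)"
proof (rule linear_functorI)
 note o = fct_obj[OF fctG]
 show "is_functor (Rep B) (Rep X) (Res X G)"
 proof (rule is_functorI)
  fix W assume "W : Obj (Rep B)"
  thus "fo (Res X G) W : Obj (Rep X)" using Res_obj by auto
  show "fm (Res X G) (Idn (Rep B) W) = Idn (Rep X) (fo (Res X G) W)"
   by (rule ntr_eqI[where C = X]) (auto simp: o)
 next
  fix \<tau> V W assume "\<tau> : Hom (Rep B) V W"
  thus "fm (Res X G) \<tau> : Hom (Rep X) (fo (Res X G) V) (fo (Res X G) W)"
   using is_nat_whisk_r[OF catX fctG] fin_supp_Res by (auto simp: Hom_Rep)
 next
  fix \<tau> \<sigma> show "fm (Res X G) (Cmp (Rep B) \<sigma> \<tau>) = Cmp (Rep X) (fm (Res X G) \<sigma>) (fm (Res X G) \<tau>)"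
   by (rule ntr_eqI[where C = X]) (auto simp: o)
 qed
qed (rule ntr_eqI[where C = X]; auto simp: fct_obj[OF fctG])+

end


subsection \<open>Units, counits and canonical isomorphisms\<close>

text \<open>A transformation between functors on representations carries two naturality conditions:
  in the groupoid \<open>B\<close> for a fixed representation (\<open>n\<close>) and in the
  representation itself (\<open>N\<close>). Both are phrased for matrices, where they can be tested
  on injections.\<close>

lemma Rep_ntI:
 assumes "category A" "category B"
  and "is_functor (Rep A) (Rep B) (nsrc \<tau>)" "is_functor (Rep A) (Rep B) (ntgt \<tau>)"
  and "nt \<tau> : extensional (Obj (Rep A))"
  and s: "!!V. V : Obj (Rep A) ==> nsrc (nt \<tau> V) = fo (nsrc \<tau>) V & ntgt (nt \<tau> V) = fo (ntgt \<tau>) V &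
   nt (nt \<tau> V) : extensional (Obj B)"
  and c: "!!V b. V : Obj (Rep A) ==> b : Obj B ==>
   nt (nt \<tau> V) b : \<M> (fo (fo (ntgt \<tau>) V) b) (fo (fo (nsrc \<tau>) V) b)"
  and n: "!!V h b c. V : Obj (Rep A) ==> h : Hom B b c ==>
   nt (nt \<tau> V) c * fm (fo (nsrc \<tau>) V) h = fm (fo (ntgt \<tau>) V) h * nt (nt \<tau> V) b"
  and N: "!!\<sigma> V W b. \<sigma> : Hom (Rep A) V W ==> b : Obj B ==>
   nt (nt \<tau> W) b * nt (fm (nsrc \<tau>) \<sigma>) b = nt (fm (ntgt \<tau>) \<sigma>) b * nt (nt \<tau> V) b"
 shows "is_nat (Rep A) (Rep B) \<tau>"
proof (rule is_natI)
 fix V assume V: "V : Obj (Rep A)"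
 have o: "fo (nsrc \<tau>) V : Obj (Rep B)" "fo (ntgt \<tau>) V : Obj (Rep B)"
  using fct_obj[OF assms(3) V] fct_obj[OF assms(4) V] by auto
 have "is_nat B matcat (nt \<tau> V)"
  by (rule is_natI) (use s[OF V] c[OF V] n[OF V] o in \<open>auto simp: Hom_matcat\<close>)
 thus "nt \<tau> V : Hom (Rep B) (fo (nsrc \<tau>) V) (fo (ntgt \<tau>) V)"
  using s[OF V] o by (simp add: Hom_Rep)
next
 fix \<sigma> V W assume \<sigma>: "\<sigma> : Hom (Rep A) V W"
 have V: "V : Obj (Rep A)" "W : Obj (Rep A)" using \<sigma> nat_src nat_tgt by (auto simp: Hom_Rep)
 have F: "fm (nsrc \<tau>) \<sigma> : Hom (Rep B) (fo (nsrc \<tau>) V) (fo (nsrc \<tau>) W)"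
  "fm (ntgt \<tau>) \<sigma> : Hom (Rep B) (fo (ntgt \<tau>) V) (fo (ntgt \<tau>) W)"
  using fct_hom[OF assms(3) \<sigma>] fct_hom[OF assms(4) \<sigma>] by auto
 show "Cmp (Rep B) (nt \<tau> W) (fm (nsrc \<tau>) \<sigma>) = Cmp (Rep B) (fm (ntgt \<tau>) \<sigma>) (nt \<tau> V)"
  by (rule ntr_eqI[where C = B]) (use s[OF V(1)] s[OF V(2)] F N[OF \<sigma>] in \<open>auto simp: Hom_Rep\<close>)
qed (use assms in auto)

lemma Rep_objD: "V : Obj (Rep X) ==> is_functor X matcat V" "V : Obj (Rep X) ==> fin_supp X V"
 by auto

lemma Hom_RepD:
 assumes "\<sigma> : Hom (Rep A) V W"
 shows "is_nat A matcat \<sigma>" "nsrc \<sigma> = V" "ntgt \<sigma> = W" "V : Obj (Rep A)" "W : Obj (Rep A)"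
 using assms nat_src nat_tgt by (auto simp: Hom_Rep)

context cover begin

lemma functor_Ind: "is_functor (Rep X) (Rep B) (Ind X B G)"
 and functor_Res: "is_functor (Rep B) (Rep X) (Res X G)"
 using linear_Ind linear_Res by (auto intro: lin_fct)

lemma functor_Ind_Res: "is_functor (Rep B) (Rep B) (fcmp (Ind X B G) (Res X G))"
 and functor_Res_Ind: "is_functor (Rep X) (Rep X) (fcmp (Res X G) (Ind X B G))"
 using is_functor_fcmp[OF functor_Ind functor_Res] is_functor_fcmp[OF functor_Res functor_Ind] by auto

lemma counit_simps [simp]:
 "nsrc (counit_left X B G) = fcmp (Ind X B G) (Res X G)" "ntgt (counit_left X B G) = idF"
 "nt (counit_left X B G) : extensional (Obj (Rep B))"
 by (simp_all add: counit_left_def del: Rep_simps)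

lemma unit_left_simps [simp]:
 "nsrc (unit_left X B G) = idF" "ntgt (unit_left X B G) = fcmp (Res X G) (Ind X B G)"
 "nt (unit_left X B G) : extensional (Obj (Rep X))"
 by (simp_all add: unit_left_def del: Rep_simps)

lemma unit_right_simps [simp]:
 "nsrc (unit_right X B G) = idF" "ntgt (unit_right X B G) = fcmp (Ind X B G) (Res X G)"
 "nt (unit_right X B G) : extensional (Obj (Rep B))"
 by (simp_all add: unit_right_def del: Rep_simps)

context
 fixes W assumes W: "W : Obj (Rep B)"
begin

lemma WG: "is_functor X matcat (fcmp W G)"
 using Rep_objD(1)[OF Res_obj[OF W]] .

lemma counit_cocone:
 assumes "b : Obj B"
 shows "ind_cocone X B G (fcmp W G) b (fo W b) (%x g. fm W g)"
 by (rule ind_coconeI)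
  (auto simp: rep_cm[OF Rep_objD(1)[OF W]] rep_cmp[OF Rep_objD(1)[OF W] fct_hom[OF fctG]])

lemma counit_carrier: "b : Obj B ==> nt (nt (counit_left X B G) W) b : \<M> (fo W b) (dI (fcmp W G) b)"
 and counit_inj: "b : Obj B ==> x : Obj X ==> g : Hom B (fo G x) b ==>
  nt (nt (counit_left X B G) W) b * \<iota> (fcmp W G) b x g = fm W g"
 using desc_carrier[OF WG _ counit_cocone] desc_inj[OF WG _ counit_cocone] W
 by (simp_all add: counit_left_def del: Rep_simps)

end

lemma counit_nat: "is_nat (Rep B) (Rep B) (counit_left X B G)"
proof (rule Rep_ntI[OF catB catB])
 fix V h b c assume V: "V : Obj (Rep B)" and h: "h : Hom B b c"
 note o = dom_obj[OF h catB] and F = Rep_objD(1)[OF V]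
 note cc = counit_carrier[OF V o(1)] counit_carrier[OF V o(2)] Ind_obj_cm[OF WG[OF V] h] rep_cm[OF F h]
 have "nt (nt (counit_left X B G) V) c * fm (Ind_obj X B G (fcmp V G)) h = fm V h * nt (nt (counit_left X B G) V) b"
 proof (rule ind_eqI[OF WG[OF V] o(1)])
  fix x g assume x: "x : Obj X" "g : Hom B (fo G x) b"
  show "nt (nt (counit_left X B G) V) c * fm (Ind_obj X B G (fcmp V G)) h * \<iota> (fcmp V G) b x g =
    fm V h * nt (nt (counit_left X B G) V) b * \<iota> (fcmp V G) b x g"
   using cc inj_cm[OF WG[OF V] o(1) x]
   by (simp add: mat_assoc Ind_obj_inj[OF WG[OF V] h x] counit_inj[OF V o(2) x(1) cat_cmp[OF catB x(2) h]]
     counit_inj[OF V o(1) x] rep_cmp[OF F x(2) h])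
 qed (use cc in auto)
 thus "nt (nt (counit_left X B G) V) c * fm (fo (nsrc (counit_left X B G)) V) h =
    fm (fo (ntgt (counit_left X B G)) V) h * nt (nt (counit_left X B G) V) b" by simp
next
 fix \<sigma> V W b assume \<sigma>: "\<sigma> : Hom (Rep B) V W" and b: "b : Obj B"
 note s = Hom_RepD[OF \<sigma>]
 have t: "is_nat X matcat (whisk_r X \<sigma> G)" "nsrc (whisk_r X \<sigma> G) = fcmp V G" "ntgt (whisk_r X \<sigma> G) = fcmp W G"
  using is_nat_whisk_r[OF catX fctG s(1)] s by auto
 note cc = counit_carrier[OF s(4) b] counit_carrier[OF s(5) b] Ind_map_cm[OF t b] intw_cm[OF s(1) b]
 have "nt (nt (counit_left X B G) W) b * nt (fm (Ind X B G) (whisk_r X \<sigma> G)) b = nt \<sigma> b * nt (nt (counit_left X B G) V) b"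
 proof (rule ind_eqI[OF WG[OF s(4)] b])
  fix x g assume x: "x : Obj X" "g : Hom B (fo G x) b"
  have sx: "nt \<sigma> (fo G x) : \<M> (fo W (fo G x)) (fo V (fo G x))"
   using intw_cm[OF s(1) fct_obj[OF fctG x(1)]] s by simp
  show "nt (nt (counit_left X B G) W) b * nt (fm (Ind X B G) (whisk_r X \<sigma> G)) b * \<iota> (fcmp V G) b x g =
    nt \<sigma> b * nt (nt (counit_left X B G) V) b * \<iota> (fcmp V G) b x g"
   using cc sx s x inj_cm[OF WG[OF s(4)] b x] inj_cm[OF WG[OF s(5)] b x] intw_nat[OF s(1) x(2)]
   by (simp add: mat_assoc Ind_map_inj[OF t b x] counit_inj[OF s(4) b x])
    (simp add: counit_inj[OF s(5) b x] flip: mat_assoc)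
 qed (use cc s in auto)
 thus "nt (nt (counit_left X B G) W) b * nt (fm (nsrc (counit_left X B G)) \<sigma>) b =
    nt (fm (ntgt (counit_left X B G)) \<sigma>) b * nt (nt (counit_left X B G) V) b" by simp
qed (use counit_carrier in \<open>auto simp: functor_Ind_Res is_functor_idF category_Rep catB counit_left_def\<close>)

lemma unit_left_component: "V : Obj (Rep X) ==> x : Obj X ==>
  nt (nt (unit_left X B G) V) x = \<iota> V (fo G x) x (Idn B (fo G x))"
 by (simp add: unit_left_def del: Rep_simps)

lemma unit_left_nat: "is_nat (Rep X) (Rep X) (unit_left X B G)"
proof (rule Rep_ntI[OF catX catX])
 fix V x assume V: "V : Obj (Rep X)" and x: "x : Obj X"
 show "nt (nt (unit_left X B G) V) x : \<M> (fo (fo (ntgt (unit_left X B G)) V) x) (fo (fo (nsrc (unit_left X B G)) V) x)"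
  using inj_cm[OF Rep_objD(1)[OF V] fct_obj[OF fctG x] x cat_idn[OF catB fct_obj[OF fctG x]]]
  by (simp add: unit_left_component[OF V x] del: Rep_simps)
next
 fix V h x y assume V: "V : Obj (Rep X)" and h: "h : Hom X x y"
 note o = dom_obj[OF h catX] and Gh = fct_hom[OF fctG h] and F = Rep_objD(1)[OF V]
 note Go = fct_obj[OF fctG o(1)] fct_obj[OF fctG o(2)]
 show "nt (nt (unit_left X B G) V) y * fm (fo (nsrc (unit_left X B G)) V) h =
    fm (fo (ntgt (unit_left X B G)) V) h * nt (nt (unit_left X B G) V) x"
  by (simp add: unit_left_component[OF V] o Go inj_nat[OF F Go(2) h cat_idn[OF catB Go(2)]]
    Ind_obj_inj[OF F Gh o(1) cat_idn[OF catB Go(1)]] cat_idl[OF catB Gh] cat_idr[OF catB Gh] del: Rep_simps)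
next
 fix \<sigma> V W x assume \<sigma>: "\<sigma> : Hom (Rep X) V W" and x: "x : Obj X"
 note s = Hom_RepD[OF \<sigma>] and Go = fct_obj[OF fctG x]
 show "nt (nt (unit_left X B G) W) x * nt (fm (nsrc (unit_left X B G)) \<sigma>) x =
    nt (fm (ntgt (unit_left X B G)) \<sigma>) x * nt (nt (unit_left X B G) V) x"
  using x by (simp add: unit_left_component s(4,5) Ind_map_inj[OF s(1-3) Go x cat_idn[OF catB Go]] del: Rep_simps)
qed (auto simp: functor_Res_Ind is_functor_idF category_Rep catX unit_left_def)

text \<open>Followed by the connecting arrow \<open>l\<close> of \<open>(y, h)\<close>, both
  \<open>k\<close> and \<open>k'\<close> connect the same object \<open>(x, h (G k))\<close> to its
  representative. They agree there by uniqueness, and \<open>l\<close> is invertible.\<close>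

lemma lift_unique:
 assumes k: "k : Hom X x y" "k' : Hom X x y" and h: "h : Hom B (fo G y) b"
  and e: "Cmp B h (fm G k) = Cmp B h (fm G k')"
 shows "k = k'"
proof -
 note o = dom_obj[OF k(1) catX] and b = dom_obj(2)[OF h catB]
 obtain R where R: "reps X B G b R" using ex_reps[OF b] by blast
 obtain r h0 l where r: "(r, h0) : R" "l : Hom X y r" "Cmp B h0 (fm G l) = h" using reps_ex[OF R o(2) h] by blast
 note h0 = reps_in(2)[OF R r(1)]
 have a: "Cmp B h0 (fm G (Cmp X l q)) = Cmp B h (fm G q)" if "q : Hom X x y" for q
  using fct_cmp[OF fctG that r(2)] cat_assoc[OF catB fct_hom[OF fctG that] fct_hom[OF fctG r(2)] h0] r(3) by simp
 have "Cmp X l k = Cmp X l k'"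
  using reps_unique[OF R o(1) cmp_G[OF k(1) h] r(1) cat_cmp[OF catX k(1) r(2)] a[OF k(1)] r(1) cat_cmp[OF catX k(2) r(2)]]
   a[OF k(2)] e by simp
 hence "Cmp X (cat_inv X l) (Cmp X l k) = Cmp X (cat_inv X l) (Cmp X l k')" by simp
 thus ?thesis
  using cat_assoc[OF catX k(1) r(2) grp_inv[OF groupoids(1) r(2)]] cat_assoc[OF catX k(2) r(2) grp_inv[OF groupoids(1) r(2)]]
   grp_inv_left[OF groupoids(1) r(2)] cat_idl[OF catX k(1)] cat_idl[OF catX k(2)] by simp
qed

text \<open>The index set of the norm sum in \<open>ind_proj\<close>. By uniqueness of lifts it is
  empty or a singleton, so the norm sum has at most one term.\<close>

definition lifts :: "'x => 'x => 'bm => 'bm => 'xm set" where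
 "lifts x' x h g = {k \<in> Hom X x' x. Cmp B h (fm G k) = g}"

lemma lifts_single: "k : Hom X x' x ==> h : Hom B (fo G x) b ==> Cmp B h (fm G k) = g ==> lifts x' x h g = {k}"
 using lift_unique by (auto simp: lifts_def)

text \<open>A lift of the composite, precomposed with the inverse of \<open>l\<close>, would be a
  lift of \<open>g\<close>.\<close>

lemma lifts_cmp:
 assumes l: "l : Hom X y x'" and h: "h : Hom B (fo G x) b"
  and g: "g : Hom B (fo G x') b" and e: "lifts x' x h g = {}"
 shows "lifts y x h (Cmp B g (fm G l)) = {}"
proof (rule ccontr)
 assume "lifts y x h (Cmp B g (fm G l)) ~= {}"
 then obtain k where k: "k : Hom X y x" "Cmp B h (fm G k) = Cmp B g (fm G l)" by (auto simp: lifts_def)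
 note li = grp_inv[OF groupoids(1) l]
 note Gli = fct_hom[OF fctG li] and Gl = fct_hom[OF fctG l] and Gk = fct_hom[OF fctG k(1)]
 have "Cmp B h (fm G (Cmp X k (cat_inv X l))) = Cmp B (Cmp B g (fm G l)) (fm G (cat_inv X l))"
  using fct_cmp[OF fctG li k(1)] cat_assoc[OF catB Gli Gk h] k(2) by simp
 also have "\<dots> = g"
  using cat_assoc[OF catB Gli Gl g] fct_cmp[OF fctG li l] grp_inv_right[OF groupoids(1) l]
   fct_idn[OF fctG dom_obj(2)[OF l catX]] cat_idr[OF catB g] by simp
 finally have "Cmp X k (cat_inv X l) : lifts x' x h g" using cat_cmp[OF catX li k(1)] by (simp add: lifts_def)
 thus False using e by simp
qed

context
 fixes V b assumes V: "is_functor X matcat V" and b: "b : Obj B"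
begin

lemma proj_cocone:
 assumes x: "x : Obj X" and h: "h : Hom B (fo G x) b"
 shows "ind_cocone X B G V b (fo V x) (%x' g. mat_sum (fo V x) (fo V x') (fm V) (lifts x' x h g))"
proof (rule ind_coconeI)
 fix x' y l g assume l: "l : Hom X x' y" and g: "g : Hom B (fo G y) b"
 note lc = rep_cm[OF V l]
 show "mat_sum (fo V x) (fo V y) (fm V) (lifts y x h g) * fm V l =
    mat_sum (fo V x) (fo V x') (fm V) (lifts x' x h (Cmp B g (fm G l)))"
 proof (cases "lifts y x h g = {}")
  case True
  thus ?thesis using lifts_cmp[OF l h g] lc by simp
 next
  case False
  then obtain k where k: "k : Hom X y x" "Cmp B h (fm G k) = g" by (auto simp: lifts_def)
  note kl = cat_cmp[OF catX l k(1)]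
  have "Cmp B h (fm G (Cmp X k l)) = Cmp B g (fm G l)"
   using fct_cmp[OF fctG l k(1)] cat_assoc[OF catB fct_hom[OF fctG l] fct_hom[OF fctG k(1)] h] k(2) by simp
  from lifts_single[OF kl h this] lifts_single[OF k(1) h k(2)] show ?thesis
   using rep_cmp[OF V l k(1)] rep_cm[OF V k(1)] rep_cm[OF V kl] by simp
 qed
qed simp

lemma proj_carrier: "x : Obj X ==> h : Hom B (fo G x) b ==> ind_proj X B G V b x h : \<M> (fo V x) (dI V b)"
 and proj_inj: "x : Obj X ==> h : Hom B (fo G x) b ==> x' : Obj X ==> g : Hom B (fo G x') b ==>
  ind_proj X B G V b x h * \<iota> V b x' g = mat_sum (fo V x) (fo V x') (fm V) (lifts x' x h g)"
 using desc_carrier[OF V b proj_cocone] desc_inj[OF V b proj_cocone]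
 by (auto simp: ind_proj_def lifts_def)

text \<open>On the injection at \<open>(x, g)\<close> the term of a representative survives only if
  it represents \<open>(x, g)\<close>, and then it reproduces the injection.\<close>

lemma sum_inj_proj:
 assumes R: "reps X B G b R"
 shows "mat_sum (dI V b) (dI V b) (%(r, h). \<iota> V b r h * ind_proj X B G V b r h) R = 1\<^sub>m (dI V b)"
proof (rule ind_eqI[OF V b])
 fix x g assume x: "x : Obj X" "g : Hom B (fo G x) b"
 obtain r h k where r: "(r, h) : R" "k : Hom X x r" "Cmp B h (fm G k) = g" using reps_ex[OF R x] by blast
 let ?t = "%p. \<iota> V b (fst p) (snd p) * mat_sum (fo V (fst p)) (fo V x) (fm V) (lifts x (fst p) (snd p) g)"
 have c: "\<iota> V b y l : \<M> (dI V b) (fo V y)" "ind_proj X B G V b y l : \<M> (fo V y) (dI V b)" if "(y, l) : R" for y l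
  using inj_cm[OF V b reps_in[OF R that]] proj_carrier[OF reps_in[OF R that]] by auto
 have "mat_sum (dI V b) (dI V b) (%(r, h). \<iota> V b r h * ind_proj X B G V b r h) R * \<iota> V b x g =
   mat_sum (dI V b) (fo V x) (%p. (case p of (r, h) => \<iota> V b r h * ind_proj X B G V b r h) * \<iota> V b x g) R"
  by (rule mat_sum_mult[OF inj_cm[OF V b x]]) (use c in fastforce)
 also have "\<dots> = mat_sum (dI V b) (fo V x) ?t R"
 proof (rule mat_sum_cong)
  fix p assume p: "p : R"
  obtain y l where yl: "p = (y, l)" by force
  note i = reps_in[OF R p[unfolded yl]]
  show "(case p of (r, h) => \<iota> V b r h * ind_proj X B G V b r h) * \<iota> V b x g = ?t p"
   using c[OF p[unfolded yl]] inj_cm[OF V b x] by (simp add: yl mat_assoc proj_inj[OF i x])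
 qed simp
 also have "\<dots> = ?t (r, h)"
 proof (rule mat_sum_delta[OF reps_finite[OF R] r(1)])
  show "?t (r, h) : \<M> (dI V b) (fo V x)" using c(1)[OF r(1)] by simp
  fix p assume p: "p : R" "p ~= (r, h)"
  obtain y l where yl: "p = (y, l)" by force
  have "lifts x y l g = {}" using reps_unique[OF R x r p(1)[unfolded yl]] p(2) yl by (auto simp: lifts_def)
  thus "?t p = 0\<^sub>m (dI V b) (fo V x)" using c(1)[OF p(1)[unfolded yl]] yl by simp
 qed
 also have "\<dots> = 1\<^sub>m (dI V b) * \<iota> V b x g"
  using lifts_single[OF r(2) reps_in(2)[OF R r(1)] r(3)] rep_cm[OF V r(2)] inj_nat[OF V b r(2) reps_in(2)[OF R r(1)]] r(3)
   inj_cm[OF V b x] by simp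
 finally show "mat_sum (dI V b) (dI V b) (%(r, h). \<iota> V b r h * ind_proj X B G V b r h) R * \<iota> V b x g =
   1\<^sub>m (dI V b) * \<iota> V b x g" .
qed auto

text \<open>The projections are jointly monic, which is the injectivity of the norm map. They serve
  for maps into an induced representation as the injections do for maps out of it.\<close>

lemma proj_eqI:
 assumes m: "m : \<M> (dI V b) n" "m' : \<M> (dI V b) n"
  and e: "!!x h. x : Obj X ==> h : Hom B (fo G x) b ==> ind_proj X B G V b x h * m = ind_proj X B G V b x h * m'"
 shows "m = m'"
proof -
 obtain R where R: "reps X B G b R" using ex_reps[OF b] by blast
 have c: "\<iota> V b y l : \<M> (dI V b) (fo V y)" "ind_proj X B G V b y l : \<M> (fo V y) (dI V b)" if "(y, l) : R" for y l
  using inj_cm[OF V b reps_in[OF R that]] proj_carrier[OF reps_in[OF R that]] by auto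
 have "q = mat_sum (dI V b) n (%(r, h). \<iota> V b r h * (ind_proj X B G V b r h * q)) R" if q: "q : \<M> (dI V b) n" for q
 proof -
  have "q = mat_sum (dI V b) (dI V b) (%(r, h). \<iota> V b r h * ind_proj X B G V b r h) R * q"
   using sum_inj_proj[OF R] q by simp
  also have "\<dots> = mat_sum (dI V b) n (%p. (case p of (r, h) => \<iota> V b r h * ind_proj X B G V b r h) * q) R"
   by (rule mat_sum_mult[OF q]) (use c in fastforce)
  also have "\<dots> = mat_sum (dI V b) n (%(r, h). \<iota> V b r h * (ind_proj X B G V b r h * q)) R"
  proof (rule mat_sum_cong)
   fix p assume p: "p : R"
   obtain y l where yl: "p = (y, l)" by force
   show "(case p of (r, h) => \<iota> V b r h * ind_proj X B G V b r h) * q = (case p of (r, h) => \<iota> V b r h * (ind_proj X B G V b r h * q))"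
    using c[OF p[unfolded yl]] q by (simp add: yl mat_assoc)
  qed simp
  finally show ?thesis .
 qed
 from this[OF m(1)] this[OF m(2)] show ?thesis
  using mat_sum_cong[OF HOL.refl, of R "%(r, h). \<iota> V b r h * (ind_proj X B G V b r h * m)" "%(r, h). \<iota> V b r h * (ind_proj X B G V b r h * m')"]
   e reps_in[OF R] by auto
qed

end

lemma inv_cmp:
 assumes "groupoid B" "k : Hom B a b" "l : Hom B c a" "Cmp B k l = h"
 shows "Cmp B l (cat_inv B h) = cat_inv B k"
proof -
 note c = groupoid_cat[OF assms(1)]
 have h: "h : Hom B c b" using cat_cmp[OF c assms(3,2)] assms(4) by simp
 note ki = grp_inv[OF assms(1,2)] and hi = grp_inv[OF assms(1) h]
 have "Cmp B (cat_inv B k) h = l"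
  using cat_assoc[OF c assms(3,2) ki] grp_inv_left[OF assms(1,2)] cat_idl[OF c assms(3)] assms(4) by simp
 thus ?thesis
  using cat_assoc[OF c hi h ki] grp_inv_right[OF assms(1) h] cat_idr[OF c ki] by simp
qed

context
 fixes W b assumes W: "W : Obj (Rep B)" and b: "b : Obj B"
begin

text \<open>An explicit candidate for the unit. After projection to \<open>(x, g)\<close> only the
  representative \<open>(r, h)\<close> of \<open>(x, g)\<close> contributes, and \<open>G l\<close>
  after the inverse of \<open>h\<close> is the inverse of \<open>g\<close>.\<close>

lemma unit_right_sum:
 assumes R: "reps X B G b R"
 defines "m \<equiv> mat_sum (dI (fcmp W G) b) (fo W b) (%(r, h). \<iota> (fcmp W G) b r h * fm W (cat_inv B h)) R"
 shows "m : \<M> (dI (fcmp W G) b) (fo W b)"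
  and "x : Obj X ==> g : Hom B (fo G x) b ==> ind_proj X B G (fcmp W G) b x g * m = fm W (cat_inv B g)"
proof -
 note WF = Rep_objD(1)[OF W] and V = WG[OF W]
 show "m : \<M> (dI (fcmp W G) b) (fo W b)" by (simp add: m_def)
 assume x: "x : Obj X" and g: "g : Hom B (fo G x) b"
 obtain r h k where r: "(r, h) : R" "k : Hom X x r" "Cmp B h (fm G k) = g" using reps_ex[OF R x g] by blast
 \<comment> \<open>The norm sum runs over arrows from the representative to \<open>x\<close>,
   opposite in direction to the connecting arrow.\<close>
 define l where "l = cat_inv X k"
 have l: "l : Hom X r x" using grp_inv[OF groupoids(1) r(2)] by (simp add: l_def)
 note hh = reps_in[OF R r(1)]
 have gl: "Cmp B g (fm G l) = h"
  using cat_assoc[OF catB fct_hom[OF fctG l] fct_hom[OF fctG r(2)] hh(2)] fct_cmp[OF fctG l r(2)]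
   grp_inv_right[OF groupoids(1) r(2)] fct_idn[OF fctG hh(1)] cat_idr[OF catB hh(2)] r(3) by (simp add: l_def)
 let ?P = "ind_proj X B G (fcmp W G) b x g"
 let ?t = "%p. mat_sum (fo W (fo G x)) (fo W (fo G (fst p))) (fm (fcmp W G)) (lifts (fst p) x g (snd p)) * fm W (cat_inv B (snd p))"
 have c: "\<iota> (fcmp W G) b y q : \<M> (dI (fcmp W G) b) (fo W (fo G y))" "fm W (cat_inv B q) : \<M> (fo W (fo G y)) (fo W b)"
  if "(y, q) : R" for y q
  using inj_cm[OF V b reps_in[OF R that]] rep_cm[OF WF grp_inv[OF groupoids(2) reps_in(2)[OF R that]]] by auto
 have P: "?P : \<M> (fo W (fo G x)) (dI (fcmp W G) b)" using proj_carrier[OF V b x g] by simp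
 have "?P * m = mat_sum (fo W (fo G x)) (fo W b) (%p. ?P * (case p of (r, h) => \<iota> (fcmp W G) b r h * fm W (cat_inv B h))) R"
  unfolding m_def by (rule mult_mat_sum[OF P]) (use c in fastforce)
 also have "\<dots> = mat_sum (fo W (fo G x)) (fo W b) ?t R"
 proof (rule mat_sum_cong)
  fix p assume p: "p : R"
  obtain y q where yq: "p = (y, q)" by force
  note i = reps_in[OF R p[unfolded yq]]
  show "?P * (case p of (r, h) => \<iota> (fcmp W G) b r h * fm W (cat_inv B h)) = ?t p"
   using c[OF p[unfolded yq]] P proj_inj[OF V b x g i] by (simp add: yq flip: mat_assoc)
 qed simp
 also have "\<dots> = ?t (r, h)"
 proof (rule mat_sum_delta[OF reps_finite[OF R] r(1)])
  show "?t (r, h) : \<M> (fo W (fo G x)) (fo W b)"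
   using c(2)[OF r(1)] mult_carrier_mat[OF mat_sum_carrier] by simp
  fix p assume p: "p : R" "p ~= (r, h)"
  obtain y q where yq: "p = (y, q)" by force
  have "lifts y x g q = {}"
  proof (rule ccontr)
   assume "lifts y x g q ~= {}"
   then obtain j where j: "j : Hom X y x" "Cmp B g (fm G j) = q" by (auto simp: lifts_def)
   note ji = grp_inv[OF groupoids(1) j(1)]
   have "Cmp B q (fm G (cat_inv X j)) = g"
    using cat_assoc[OF catB fct_hom[OF fctG ji] fct_hom[OF fctG j(1)] g] fct_cmp[OF fctG ji j(1)]
     grp_inv_right[OF groupoids(1) j(1)] fct_idn[OF fctG x] cat_idr[OF catB g] j(2) by simp
   from reps_unique[OF R x g r p(1)[unfolded yq] ji this] show False using p(2) yq by simp
  qed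
  thus "?t p = 0\<^sub>m (fo W (fo G x)) (fo W b)" using c(2)[OF p(1)[unfolded yq]] yq by simp
 qed
 also have "\<dots> = fm W (cat_inv B g)"
  using lifts_single[OF l g gl] rep_cm[OF V l] inv_cmp[OF groupoids(2) g fct_hom[OF fctG l] gl]
   rep_cmp[OF WF grp_inv[OF groupoids(2) hh(2)] fct_hom[OF fctG l]] by simp
 finally show "?P * m = fm W (cat_inv B g)" .
qed

text \<open>\<open>unit_right\<close> is given by a definite description: the explicit sum proves
  existence and the jointly monic projections prove uniqueness. The last fact makes the unit
  computable from any system of representatives.\<close>

lemma unit_right_char:
 "nt (nt (unit_right X B G) W) b : \<M> (dI (fcmp W G) b) (fo W b)"
 "x : Obj X ==> g : Hom B (fo G x) b ==>
  ind_proj X B G (fcmp W G) b x g * nt (nt (unit_right X B G) W) b = fm W (cat_inv B g)"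
 and unit_right_eq: "reps X B G b R ==> nt (nt (unit_right X B G) W) b =
  mat_sum (dI (fcmp W G) b) (fo W b) (%(r, h). \<iota> (fcmp W G) b r h * fm W (cat_inv B h)) R"
proof -
 let ?m = "nt (nt (unit_right X B G) W) b"
 define P where "P m \<longleftrightarrow> m : \<M> (dI (fcmp W G) b) (fo W b) & (\<forall>x\<in>Obj X. \<forall>h\<in>Hom B (fo G x) b.
   ind_proj X B G (fcmp W G) b x h * m = fm W (cat_inv B h))" for m
 have u: "m = m'" if m: "P m" "P m'" for m m'
 proof (rule proj_eqI[OF WG[OF W] b])
  show "m : \<M> (dI (fcmp W G) b) (fo W b)" "m' : \<M> (dI (fcmp W G) b) (fo W b)"
   using m by (simp_all add: P_def)
  show "ind_proj X B G (fcmp W G) b x h * m = ind_proj X B G (fcmp W G) b x h * m'"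
   if "x : Obj X" "h : Hom B (fo G x) b" for x h using m that by (simp add: P_def)
 qed
 have S: "P (mat_sum (dI (fcmp W G) b) (fo W b) (%(r, h). \<iota> (fcmp W G) b r h * fm W (cat_inv B h)) R)"
  if "reps X B G b R" for R
  unfolding P_def using unit_right_sum[OF that] by blast
 obtain R0 where R0: "reps X B G b R0" using ex_reps[OF b] by blast
 have e: "?m = (THE m. P m)" using W b by (simp add: unit_right_def P_def del: Rep_simps)
 obtain m0 where m0: "P m0" using S[OF R0] by blast
 have Pm: "P ?m" unfolding e
 proof (rule theI[where P = P])
  show "P m0" by (rule m0)
  show "m = m0" if "P m" for m by (rule u[OF that m0])
 qed
 show "?m : \<M> (dI (fcmp W G) b) (fo W b)"
  and "x : Obj X ==> g : Hom B (fo G x) b ==> ind_proj X B G (fcmp W G) b x g * ?m = fm W (cat_inv B g)"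
  using Pm by (simp_all add: P_def)
 show "?m = mat_sum (dI (fcmp W G) b) (fo W b) (%(r, h). \<iota> (fcmp W G) b r h * fm W (cat_inv B h)) R"
  if "reps X B G b R" by (rule u[OF Pm S[OF that]])
qed

end

end


lemma inv_cmp_inv:
 assumes B: "groupoid B" and k: "k : Hom B a c" and h: "h : Hom B b c"
 shows "cat_inv B (Cmp B (cat_inv B h) k) = Cmp B (cat_inv B k) h"
proof (rule cat_inv_eq[OF groupoid_cat[OF B]], rule inv_arrowsI)
 note c = groupoid_cat[OF B] and hi = grp_inv[OF B h] and ki = grp_inv[OF B k]
 show hk: "Cmp B (cat_inv B h) k : Hom B a b" and kh: "Cmp B (cat_inv B k) h : Hom B b a"
  using cat_cmp[OF c k hi] cat_cmp[OF c h ki] .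
 show "Cmp B (Cmp B (cat_inv B k) h) (Cmp B (cat_inv B h) k) = Idn B a"
  unfolding cat_assoc[OF c hk h ki] cat_assoc[OF c k hi h, symmetric] grp_inv_right[OF B h] cat_idl[OF c k]
  by (rule grp_inv_left[OF B k])
 show "Cmp B (Cmp B (cat_inv B h) k) (Cmp B (cat_inv B k) h) = Idn B b"
  unfolding cat_assoc[OF c kh k hi] cat_assoc[OF c h ki k, symmetric] grp_inv_right[OF B k] cat_idl[OF c h]
  by (rule grp_inv_left[OF B h])
qed

context cover begin

text \<open>The norm is natural in the base object: lifts of \<open>h g\<close> along
  \<open>k\<close> are the same as lifts of \<open>g\<close> along the inverse of \<open>h\<close>
  followed after \<open>k\<close>.\<close>

lemma proj_Ind:
 assumes V: "is_functor X matcat V" and h: "h : Hom B b c" and x: "x : Obj X" and k: "k : Hom B (fo G x) c"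
 shows "ind_proj X B G V c x k * fm (Ind_obj X B G V) h = ind_proj X B G V b x (Cmp B (cat_inv B h) k)"
proof (rule ind_eqI[OF V dom_obj(1)[OF h catB]])
 note o = dom_obj[OF h catB] and hi = grp_inv[OF groupoids(2) h]
 note hk = cat_cmp[OF catB k hi]
 note cc = proj_carrier[OF V o(2) x k] proj_carrier[OF V o(1) x hk] Ind_obj_cm[OF V h]
 show "ind_proj X B G V c x k * fm (Ind_obj X B G V) h : \<M> (fo V x) (dI V b)"
  "ind_proj X B G V b x (Cmp B (cat_inv B h) k) : \<M> (fo V x) (dI V b)" using cc by auto
 fix x' g assume g: "x' : Obj X" "g : Hom B (fo G x') b"
 have "Cmp B k q = Cmp B h g \<longleftrightarrow> Cmp B (Cmp B (cat_inv B h) k) q = g" if q: "q : Hom B (fo G x') (fo G x)" for q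
  using cat_assoc[OF catB q k hi] cat_assoc[OF catB cat_cmp[OF catB q k] hi h] cat_assoc[OF catB g(2) h hi]
   grp_inv_left[OF groupoids(2) h] grp_inv_right[OF groupoids(2) h] cat_idl[OF catB g(2)] cat_idl[OF catB cat_cmp[OF catB q k]]
  by metis
 hence "lifts x' x k (Cmp B h g) = lifts x' x (Cmp B (cat_inv B h) k) g"
  using fct_hom[OF fctG] by (auto simp: lifts_def)
 thus "ind_proj X B G V c x k * fm (Ind_obj X B G V) h * \<iota> V b x' g = ind_proj X B G V b x (Cmp B (cat_inv B h) k) * \<iota> V b x' g"
  using cc inj_cm[OF V o(1) g] proj_inj[OF V o(2) x k g(1) cat_cmp[OF catB g(2) h]] proj_inj[OF V o(1) x hk g]
  by (simp add: mat_assoc Ind_obj_inj[OF V h g])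
qed

text \<open>On an injection without a lift both sides vanish. If there is a lift \<open>j\<close>,
  the equation is naturality of \<open>\<tau>\<close> at \<open>j\<close>.\<close>

lemma proj_map:
 assumes t: "is_nat X matcat \<tau>" "nsrc \<tau> = V" "ntgt \<tau> = W" and b: "b : Obj B" and x: "x : Obj X" and k: "k : Hom B (fo G x) b"
 shows "ind_proj X B G W b x k * nt (fm (Ind X B G) \<tau>) b = nt \<tau> x * ind_proj X B G V b x k"
proof -
 have V: "is_functor X matcat V" and W: "is_functor X matcat W" using t nat_src nat_tgt by auto
 note cc = proj_carrier[OF V b x k] proj_carrier[OF W b x k] Ind_map_cm[OF t b] intw_cm[OF t(1) x, unfolded t]
 show ?thesis
 proof (rule ind_eqI[OF V b])
  fix x' g assume g: "x' : Obj X" "g : Hom B (fo G x') b"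
  note tx = intw_cm[OF t(1) g(1), unfolded t]
  note i = inj_cm[OF V b g] inj_cm[OF W b g]
  have "ind_proj X B G W b x k * nt (fm (Ind X B G) \<tau>) b * \<iota> V b x' g = ind_proj X B G W b x k * \<iota> W b x' g * nt \<tau> x'"
   using cc i tx by (simp add: mat_assoc Ind_map_inj[OF t b g])
  also have "\<dots> = nt \<tau> x * (ind_proj X B G V b x k * \<iota> V b x' g)"
  proof (cases "lifts x' x k g = {}")
   case True
   thus ?thesis using cc tx proj_inj[OF V b x k g] proj_inj[OF W b x k g] by simp
  next
   case False
   then obtain j where j: "j : Hom X x' x" "Cmp B k (fm G j) = g" by (auto simp: lifts_def)
   show ?thesis using lifts_single[OF j(1) k j(2)] rep_cm[OF V j(1)] rep_cm[OF W j(1)]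
     proj_inj[OF V b x k g] proj_inj[OF W b x k g] intw_nat[OF t(1) j(1)] t by simp
  qed
  finally show "ind_proj X B G W b x k * nt (fm (Ind X B G) \<tau>) b * \<iota> V b x' g = nt \<tau> x * ind_proj X B G V b x k * \<iota> V b x' g"
   using cc i by (simp add: mat_assoc)
 qed (use cc in auto)
qed

text \<open>The equations are tested against projections and not on injections, since the unit is
  characterised by its projections.\<close>

lemma unit_right_nat: "is_nat (Rep B) (Rep B) (unit_right X B G)"
proof (rule Rep_ntI[OF catB catB])
 fix V h b c assume V: "V : Obj (Rep B)" and h: "h : Hom B b c"
 note o = dom_obj[OF h catB] and F = Rep_objD(1)[OF V] and VG = WG[OF V] and hi = grp_inv[OF groupoids(2) h]
 note cc = unit_right_char(1)[OF V o(1)] unit_right_char(1)[OF V o(2)] Ind_obj_cm[OF VG h] rep_cm[OF F h]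
 have "nt (nt (unit_right X B G) V) c * fm V h = fm (Ind_obj X B G (fcmp V G)) h * nt (nt (unit_right X B G) V) b"
 proof (rule proj_eqI[OF VG o(2)])
  fix x k assume x: "x : Obj X" and k: "k : Hom B (fo G x) c"
  note hk = cat_cmp[OF catB k hi] and ki = grp_inv[OF groupoids(2) k]
  have e: "Cmp B (cat_inv B k) h = cat_inv B (Cmp B (cat_inv B h) k)"
   using inv_cmp_inv[OF groupoids(2) k h] by simp
  show "ind_proj X B G (fcmp V G) c x k * (nt (nt (unit_right X B G) V) c * fm V h) =
    ind_proj X B G (fcmp V G) c x k * (fm (Ind_obj X B G (fcmp V G)) h * nt (nt (unit_right X B G) V) b)"
   using cc proj_carrier[OF VG o(2) x k] rep_cmp[OF F h ki] unit_right_char(2)[OF V o(2) x k]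
    unit_right_char(2)[OF V o(1) x hk] proj_Ind[OF VG h x k] e
   by (simp flip: mat_assoc)
 qed (use cc in auto)
 thus "nt (nt (unit_right X B G) V) c * fm (fo (nsrc (unit_right X B G)) V) h =
    fm (fo (ntgt (unit_right X B G)) V) h * nt (nt (unit_right X B G) V) b" by simp
next
 fix \<sigma> V W b assume \<sigma>: "\<sigma> : Hom (Rep B) V W" and b: "b : Obj B"
 note s = Hom_RepD[OF \<sigma>]
 have t: "is_nat X matcat (whisk_r X \<sigma> G)" "nsrc (whisk_r X \<sigma> G) = fcmp V G" "ntgt (whisk_r X \<sigma> G) = fcmp W G"
  using is_nat_whisk_r[OF catX fctG s(1)] s by auto
 note cc = unit_right_char(1)[OF s(4) b] unit_right_char(1)[OF s(5) b] Ind_map_cm[OF t b] intw_cm[OF s(1) b]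
 have "nt (nt (unit_right X B G) W) b * nt \<sigma> b = nt (fm (Ind X B G) (whisk_r X \<sigma> G)) b * nt (nt (unit_right X B G) V) b"
 proof (rule proj_eqI[OF WG[OF s(5)] b])
  fix x k assume x: "x : Obj X" and k: "k : Hom B (fo G x) b"
  note sx = intw_cm[OF s(1) fct_obj[OF fctG x]]
  show "ind_proj X B G (fcmp W G) b x k * (nt (nt (unit_right X B G) W) b * nt \<sigma> b) =
   ind_proj X B G (fcmp W G) b x k * (nt (fm (Ind X B G) (whisk_r X \<sigma> G)) b * nt (nt (unit_right X B G) V) b)"
   using cc s sx x proj_carrier[OF WG[OF s(4)] b x k] proj_carrier[OF WG[OF s(5)] b x k] proj_map[OF t b x k]
    unit_right_char(2)[OF s(4) b x k] unit_right_char(2)[OF s(5) b x k] intw_nat[OF s(1) grp_inv[OF groupoids(2) k]]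
   by (simp add: mat_assoc flip: mat_assoc[of "ind_proj X B G (fcmp W G) b x k"])
 qed (use cc s in auto)
 thus "nt (nt (unit_right X B G) W) b * nt (fm (nsrc (unit_right X B G)) \<sigma>) b =
    nt (fm (ntgt (unit_right X B G)) \<sigma>) b * nt (nt (unit_right X B G) V) b" by simp
qed (use unit_right_char(1) in \<open>auto simp: functor_Ind_Res is_functor_idF category_Rep catB unit_right_def\<close>)

lemma faithful_G: "k : Hom X x y ==> k' : Hom X x y ==> fm G k = fm G k' ==> k = k'"
 using lift_unique[of k x y k' "Idn B (fo G y)" "fo G y"] dom_obj[of k X x y] catX
  cat_idn[OF catB fct_obj[OF fctG]] by auto

end

text \<open>A covering may be exhibited by a finite set that meets every class, with repetitions
  allowed. One element is then selected from each class, and faithfulness makes the connecting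
  arrows unique.\<close>

lemma finite_coverI:
 assumes gX: "groupoid X" and gB: "groupoid B" and G: "is_functor X B G"
  and faithful: "!!x y k k'. k : Hom X x y ==> k' : Hom X x y ==> fm G k = fm G k' ==> k = k'"
  and cover: "!!b. b : Obj B ==> EX R. finite R & (\<forall>x\<in>Obj X. \<forall>g\<in>Hom B (fo G x) b. \<exists>(r, h)\<in>R.
   r : Obj X & h : Hom B (fo G r) b & (\<exists>k\<in>Hom X x r. Cmp B h (fm G k) = g))"
 shows "finite_cover X B G"
 unfolding finite_cover_def
proof (intro conjI ballI gX gB G)
 note cX = groupoid_cat[OF gX] and cB = groupoid_cat[OF gB]
 fix b assume b: "b : Obj B"
 obtain R where R: "finite R" "\<forall>x\<in>Obj X. \<forall>g\<in>Hom B (fo G x) b. \<exists>(r, h)\<in>R.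
   r : Obj X & h : Hom B (fo G r) b & (\<exists>k\<in>Hom X x r. Cmp B h (fm G k) = g)" using cover[OF b] by blast
 define ok where "ok p \<longleftrightarrow> fst p : Obj X & snd p : Hom B (fo G (fst p)) b" for p
 define rel where "rel p q \<longleftrightarrow> (\<exists>k\<in>Hom X (fst p) (fst q). Cmp B (snd q) (fm G k) = snd p)" for p q
 have cmpG: "Cmp B q (fm G (Cmp X l k)) = Cmp B (Cmp B q (fm G l)) (fm G k)"
  if "k : Hom X x y" "l : Hom X y z" "q : Hom B (fo G z) b" for x y z k l q
  using fct_cmp[OF G that(1,2)] cat_assoc[OF cB fct_hom[OF G that(1)] fct_hom[OF G that(2)] that(3)] by simp
 have sym: "rel q p" if "rel p q" "ok p" "ok q" for p q
 proof -
  obtain k where k: "k : Hom X (fst p) (fst q)" "Cmp B (snd q) (fm G k) = snd p" using \<open>rel p q\<close> by (auto simp: rel_def)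
  note ki = grp_inv[OF gX k(1)]
  have "Cmp B (snd p) (fm G (cat_inv X k)) = Cmp B (snd q) (fm G (Cmp X k (cat_inv X k)))"
   using cmpG[OF ki k(1)] that k(2) by (simp add: ok_def)
  also have "\<dots> = snd q" using that grp_inv_right[OF gX k(1)] fct_idn[OF G] cat_idr[OF cB] by (auto simp: ok_def)
  finally show ?thesis using ki by (auto simp: rel_def)
 qed
 have trans: "rel p r" if pqr: "rel p q" "rel q r" "ok r" for p q r
 proof -
  obtain k l where k: "k : Hom X (fst p) (fst q)" "Cmp B (snd q) (fm G k) = snd p"
   and l: "l : Hom X (fst q) (fst r)" "Cmp B (snd r) (fm G l) = snd q" using pqr by (auto simp: rel_def)
  have "Cmp B (snd r) (fm G (Cmp X l k)) = snd p" using cmpG[OF k(1) l(1)] k(2) l(2) pqr(3) by (simp add: ok_def)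
  thus ?thesis using cat_cmp[OF cX k(1) l(1)] by (auto simp: rel_def)
 qed
 \<comment> \<open>\<open>E p\<close> collects the members of \<open>R\<close> isomorphic to
   \<open>p\<close>. The selected representative depends on this set alone, so isomorphic objects
   receive the same one.\<close>
 define E where "E p = {q \<in> R. ok q & rel p q}" for p
 define c where "c p = (SOME q. q : E p)" for p
 have c: "c p : E p" if "ok p" for p
 proof -
  have "\<exists>(r, h)\<in>R. r : Obj X & h : Hom B (fo G r) b & (\<exists>k\<in>Hom X (fst p) r. Cmp B h (fm G k) = snd p)"
   using bspec[OF bspec[OF R(2)]] that by (simp add: ok_def)
  then obtain r h where "(r, h) : R" "r : Obj X" "h : Hom B (fo G r) b"
   "\<exists>k\<in>Hom X (fst p) r. Cmp B h (fm G k) = snd p" by blast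
  hence "(r, h) : E p" by (simp add: E_def ok_def rel_def)
  thus ?thesis unfolding c_def by (rule someI)
 qed
 have E: "E p = E q" if "rel p q" "ok p" "ok q" for p q
 proof
  show "E p \<subseteq> E q" using trans[OF sym[OF that]] by (auto simp: E_def)
  show "E q \<subseteq> E p" using trans[OF that(1)] by (auto simp: E_def)
 qed
 have cE: "c p = c q" if "rel p (c q)" "ok p" "ok q" for p q
 proof -
  have "rel q (c q)" "ok (c q)" using c[OF that(3)] by (auto simp: E_def)
  hence "E p = E q" using E[OF that(1,2)] E[OF _ that(3)] by simp
  thus ?thesis by (simp add: c_def)
 qed
 have "reps X B G b (c ` {p. ok p})"
 proof (rule repsI)
  show "finite (c ` {p. ok p})" by (rule finite_subset[OF _ R(1)]) (use c in \<open>auto simp: E_def\<close>)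
  show "x : Obj X & g : Hom B (fo G x) b" if xg: "(x, g) : c ` {p. ok p}" for x g
  proof -
   obtain p where "ok p" "c p = (x, g)" using xg by auto
   thus ?thesis using c[of p] by (simp add: E_def ok_def)
  qed
  show "EX r h k. (r, h) : c ` {p. ok p} & k : Hom X x r & Cmp B h (fm G k) = g"
   if "x : Obj X" "g : Hom B (fo G x) b" for x g
  proof -
   have ok: "ok (x, g)" using that by (simp add: ok_def)
   hence "rel (x, g) (c (x, g))" using c by (simp add: E_def)
   then obtain k where "k : Hom X x (fst (c (x, g)))" "Cmp B (snd (c (x, g))) (fm G k) = g" by (auto simp: rel_def)
   thus ?thesis using ok by (intro exI[of _ "fst (c (x, g))"] exI[of _ "snd (c (x, g))"] exI[of _ k]) auto
  qed
  fix x r h k r' h' k' assume x: "x : Obj X" and r: "(r, h) : c ` {p. ok p}" "k : Hom X x r"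
   and r': "(r', h') : c ` {p. ok p}" "k' : Hom X x r'" and e: "Cmp B h (fm G k) = Cmp B h' (fm G k')"
  obtain p p' where p: "ok p" "(r, h) = c p" "ok p'" "(r', h') = c p'" using r r' by auto
  have h: "h : Hom B (fo G r) b" using c[OF p(1)] p(2)[symmetric] by (simp add: E_def ok_def)
  have ok: "ok (x, Cmp B h (fm G k))" using x cat_cmp[OF cB fct_hom[OF G r(2)] h] by (simp add: ok_def)
  have "rel (x, Cmp B h (fm G k)) (c p)" "rel (x, Cmp B h (fm G k)) (c p')"
   using r(2) r'(2) e p(2)[symmetric] p(4)[symmetric] by (auto simp: rel_def)
  from cE[OF this(1) ok p(1)] cE[OF this(2) ok p(3)] have eq: "r = r'" "h = h'" using p(2,4)[symmetric] by simp_all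
  have "fm G k = Cmp B (cat_inv B h) (Cmp B h (fm G k))"
   using cat_assoc[OF cB fct_hom[OF G r(2)] h grp_inv[OF gB h]] grp_inv_left[OF gB h] cat_idl[OF cB fct_hom[OF G r(2)]] by simp
  also have "\<dots> = fm G k'"
   using cat_assoc[OF cB fct_hom[OF G r'(2)] h[unfolded eq] grp_inv[OF gB h[unfolded eq]]] grp_inv_left[OF gB h[unfolded eq]]
    cat_idl[OF cB fct_hom[OF G r'(2)]] e eq by simp
  finally show "r = r' & h = h' & k = k'" using eq faithful[OF r(2)] r'(2) by simp
 qed
 thus "EX R. reps X B G b R" by blast
qed

lemma finite_cover_fcmp:
 assumes S: "finite_cover Z X S" and G: "finite_cover X B G"
 shows "finite_cover Z B (fcmp G S)"
proof -
 interpret S: cover Z X S by standard (rule S)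
 interpret G: cover X B G by standard (rule G)
 show ?thesis
 proof (rule finite_coverI[OF S.groupoids(1) G.groupoids(2) is_functor_fcmp[OF S.fctG G.fctG]])
  fix x y k k' assume "k : Hom Z x y" "k' : Hom Z x y" "fm (fcmp G S) k = fm (fcmp G S) k'"
  thus "k = k'"
   using S.faithful_G[of k x y k'] G.faithful_G[OF fct_hom[OF S.fctG, of k x y] fct_hom[OF S.fctG, of k' x y]]
   by simp
 next
  fix b assume b: "b : Obj B"
  obtain R where R: "reps X B G b R" using G.ex_reps[OF b] by blast
  define Q where "Q x = (SOME Q. reps Z X S x Q)" for x
  have Q: "reps Z X S x (Q x)" if "(x, h) : R" for x h
   using S.ex_reps[OF reps_in(1)[OF R that]] unfolding Q_def by (rule someI_ex)
  \<comment> \<open>Each representative \<open>(x, h)\<close> over \<open>b\<close> is refined by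
    the representatives over \<open>x\<close>. The resulting set may hit a class several times,
    which the criterion permits.\<close>
  let ?R = "\<Union>p\<in>R. (%q. (fst q, Cmp B (snd p) (fm G (snd q)))) ` Q (fst p)"
  have fin: "finite ?R"
  proof (rule finite_UN_I[OF reps_finite[OF R]])
   show "finite ((%q. (fst q, Cmp B (snd p) (fm G (snd q)))) ` Q (fst p))" if "p : R" for p
    using reps_finite[OF Q[of "fst p" "snd p"]] that by simp
  qed
  have cov: "\<exists>(r, h)\<in>?R. r : Obj Z & h : Hom B (fo (fcmp G S) r) b & (\<exists>k\<in>Hom Z z r. Cmp B h (fm (fcmp G S) k) = g)"
   if z: "z : Obj Z" "g : Hom B (fo (fcmp G S) z) b" for z g
  proof -
   obtain x h k where x: "(x, h) : R" "k : Hom X (fo S z) x" "Cmp B h (fm G k) = g"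
    using reps_ex[OF R fct_obj[OF S.fctG z(1)] z(2)[unfolded fcmp_simps]] by blast
   obtain r l j where r: "(r, l) : Q x" "j : Hom Z z r" "Cmp X l (fm S j) = k"
    using reps_ex[OF Q[OF x(1)] z(1) x(2)] by blast
   note hh = reps_in(2)[OF R x(1)] and ll = reps_in[OF Q[OF x(1)] r(1)]
   have "Cmp B (Cmp B h (fm G l)) (fm G (fm S j)) = g"
    using fct_cmp[OF G.fctG fct_hom[OF S.fctG r(2)] ll(2)] r(3) x(3)
     cat_assoc[OF G.catB fct_hom[OF G.fctG fct_hom[OF S.fctG r(2)]] fct_hom[OF G.fctG ll(2)] hh] by simp
   moreover have "(r, Cmp B h (fm G l)) : ?R"
    by (rule UN_I[OF x(1)], rule image_eqI[of _ _ "(r, l)"]) (simp_all add: r(1))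
   moreover have "Cmp B h (fm G l) : Hom B (fo G (fo S r)) b" using G.cmp_G[OF ll(2) hh] .
   ultimately show ?thesis using r(2) ll(1)
    by (intro bexI[of _ "(r, Cmp B h (fm G l))"] case_prodI conjI bexI[of _ j]) simp_all
  qed
  show "EX R. finite R & (\<forall>x\<in>Obj Z. \<forall>g\<in>Hom B (fo (fcmp G S) x) b. \<exists>(r, h)\<in>R.
   r : Obj Z & h : Hom B (fo (fcmp G S) r) b & (\<exists>k\<in>Hom Z x r. Cmp B h (fm (fcmp G S) k) = g))"
   by (rule exI[of _ ?R], rule conjI[OF fin], intro ballI, rule cov)
 qed
qed

text \<open>Intended for functors into an iso-comma groupoid, whose composite with a projection is a
  known covering. Representatives of the composite are lifted through \<open>p\<close> to arrows
  into \<open>w\<close>.\<close>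

lemma finite_cover_cancel:
 assumes gX: "groupoid X" and T: "is_functor X Y T" and p: "finite_cover Y B p" and pT: "finite_cover X B (fcmp p T)"
 shows "finite_cover X Y T"
proof -
 interpret p: cover Y B p by standard (rule p)
 interpret pT: cover X B "fcmp p T" by standard (rule pT)
 show ?thesis
 proof (rule finite_coverI[OF gX p.groupoids(1) T])
  show "k = k'" if "k : Hom X x y" "k' : Hom X x y" "fm T k = fm T k'" for x y k k'
   by (rule pT.faithful_G[OF that(1,2)]) (simp add: that(3))
  fix w assume w: "w : Obj Y"
  obtain R where R: "reps X B (fcmp p T) (fo p w) R" using pT.ex_reps[OF fct_obj[OF p.fctG w]] by blast
  define c where "c q = (SOME t. t : Hom Y (fo T (fst q)) w & fm p t = snd q)" for q
  have "\<exists>(r, h)\<in>(%q. (fst q, c q)) ` R. r : Obj X & h : Hom Y (fo T r) w & (\<exists>k\<in>Hom X x r. Cmp Y h (fm T k) = g)"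
   if x: "x : Obj X" and g: "g : Hom Y (fo T x) w" for x g
  proof -
   have pg: "fm p g : Hom B (fo (fcmp p T) x) (fo p w)" using fct_hom[OF p.fctG g] by simp
   obtain r h k where r: "(r, h) : R" "k : Hom X x r" "Cmp B h (fm (fcmp p T) k) = fm p g" using reps_ex[OF R x pg] by blast
   note hh = reps_in[OF R r(1)] and Tk = fct_hom[OF T r(2)]
   note ki = grp_inv[OF gX r(2)]
   \<comment> \<open>\<open>g\<close> after the inverse of \<open>T k\<close> is an arrow into
     \<open>w\<close> lying over \<open>h\<close>; hence the choice \<open>c (r, h)\<close> really
     is a lift.\<close>
   have "Cmp B (fm p g) (fm p (fm T (cat_inv X k))) = h"
    using r(3) cat_assoc[OF p.catB fct_hom[OF p.fctG fct_hom[OF T ki]] fct_hom[OF p.fctG Tk] hh(2)[unfolded fcmp_simps]]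
     fct_cmp[OF p.fctG fct_hom[OF T ki] Tk] fct_cmp[OF T ki r(2)] grp_inv_right[OF gX r(2)]
     fct_idn[OF T hh(1)] fct_idn[OF p.fctG fct_obj[OF T hh(1)]] cat_idr[OF p.catB hh(2)]
    by simp
   hence "Cmp Y g (fm T (cat_inv X k)) : Hom Y (fo T r) w & fm p (Cmp Y g (fm T (cat_inv X k))) = h"
    using fct_cmp[OF p.fctG fct_hom[OF T ki] g] cat_cmp[OF p.catX fct_hom[OF T ki] g] by simp
   hence c: "c (r, h) : Hom Y (fo T r) w" "fm p (c (r, h)) = h"
    using someI[of "%t. t : Hom Y (fo T r) w & fm p t = h"] by (simp_all add: c_def)
   have "Cmp Y (c (r, h)) (fm T k) = g"
    by (rule p.faithful_G[OF cat_cmp[OF p.catX Tk c(1)] g])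
     (use fct_cmp[OF p.fctG Tk c(1)] c(2) r(3) in simp)
   moreover have "(r, c (r, h)) : (%q. (fst q, c q)) ` R" by (rule image_eqI[OF _ r(1)]) simp
   ultimately show ?thesis using r(2) c(1) hh(1)
    by (intro bexI[of _ "(r, c (r, h))"] case_prodI conjI bexI[of _ k]) simp_all
  qed
  thus "EX R. finite R & (\<forall>x\<in>Obj X. \<forall>g\<in>Hom Y (fo T x) w. \<exists>(r, h)\<in>R.
   r : Obj X & h : Hom Y (fo T r) w & (\<exists>k\<in>Hom X x r. Cmp Y h (fm T k) = g))"
   using reps_finite[OF R] by (intro exI[of _ "(%q. (fst q, c q)) ` R"]) blast
 qed
qed

lemma finite_cover_idF:
 assumes "groupoid X"
 shows "finite_cover X X idF"
proof (rule finite_coverI[OF assms assms is_functor_idF[OF groupoid_cat[OF assms]]])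
 note c = groupoid_cat[OF assms]
 fix b assume b: "b : Obj X"
 have "\<exists>k\<in>Hom X x b. Cmp X (Idn X b) (fm idF k) = g" if "g : Hom X x b" for x g
  using cat_idl[OF c that] that by (intro bexI[of _ g]) simp_all
 thus "EX R. finite R & (\<forall>x\<in>Obj X. \<forall>g\<in>Hom X (fo idF x) b. \<exists>(r, h)\<in>R.
   r : Obj X & h : Hom X (fo idF r) b & (\<exists>k\<in>Hom X x r. Cmp X h (fm idF k) = g))"
  using b cat_idn[OF c b] by (intro exI[of _ "{(b, Idn X b)}"]) simp
qed simp


lemma iso_cmp:
 assumes C: "category C" and f: "f : Hom C a b" "is_iso C f" and g: "g : Hom C b c" "is_iso C g"
 shows "is_iso C (Cmp C g f)"
 unfolding is_iso_def
proof (rule exI[of _ "Cmp C (cat_inv C f) (cat_inv C g)"], rule inv_arrowsI)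
 note fi = cat_inv_hom[OF C f(2,1)] and gi = cat_inv_hom[OF C g(2,1)]
 note gf = cat_cmp[OF C f(1) g(1)] and fg = cat_cmp[OF C gi fi]
 show "Cmp C g f : Hom C a c" "Cmp C (cat_inv C f) (cat_inv C g) : Hom C c a" by (rule gf, rule fg)
 show "Cmp C (Cmp C (cat_inv C f) (cat_inv C g)) (Cmp C g f) = Idn C a"
  unfolding cat_assoc[OF C gf gi fi] cat_assoc[OF C f(1) g(1) gi, symmetric] cat_inv_left[OF C g(2,1)] cat_idl[OF C f(1)]
  by (rule cat_inv_left[OF C f(2,1)])
 show "Cmp C (Cmp C g f) (Cmp C (cat_inv C f) (cat_inv C g)) = Idn C c"
  unfolding cat_assoc[OF C fg f(1) g(1)] cat_assoc[OF C gi fi f(1), symmetric] cat_inv_right[OF C f(2,1)] cat_idl[OF C gi]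
  by (rule cat_inv_right[OF C g(2,1)])
qed

lemma Rep_iso_component:
 assumes "is_iso (Rep X) \<tau>" "x : Obj X"
 shows "is_iso matcat (nt \<tau> x)"
proof -
 obtain \<sigma> where i: "inverse_arrows (Rep X) \<tau> \<sigma>" using assms by (auto simp: is_iso_def)
 hence t: "\<tau> : Hom (Rep X) (nsrc \<tau>) (ntgt \<tau>)" by (auto simp: inverse_arrows_def homset_def)
 note s = inverse_arrows_hom[OF i t]
 have e: "nt \<sigma> x * nt \<tau> x = 1\<^sub>m (fo (nsrc \<tau>) x)" "nt \<tau> x * nt \<sigma> x = 1\<^sub>m (fo (ntgt \<tau>) x)"
  using arg_cong[OF conjunct1[OF conjunct2[OF s]], of "\<lambda>\<rho>. nt \<rho> x"] arg_cong[OF conjunct2[OF conjunct2[OF s]], of "\<lambda>\<rho>. nt \<rho> x"]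
   assms(2) by simp_all
 have "nt \<tau> x : \<M> (fo (ntgt \<tau>) x) (fo (nsrc \<tau>) x)" "nt \<sigma> x : \<M> (fo (nsrc \<tau>) x) (fo (ntgt \<tau>) x)"
  using intw_cm[OF Hom_RepD(1)[OF t] assms(2)] intw_cm[OF Hom_RepD(1)[OF conjunct1[OF s]] assms(2)]
   Hom_RepD(2,3)[OF conjunct1[OF s]] by simp_all
 thus ?thesis using matcat_iso[OF e(2,1)] by (auto simp: is_iso_def)
qed

lemma matcat_isoI:
 assumes "A : \<M> n m" "B : \<M> m n" "A * B = 1\<^sub>m n" "B * A = 1\<^sub>m m"
 shows "is_iso matcat A" "cat_inv matcat A = B"
 using matcat_iso[OF assms(3,4,1,2)] cat_inv_eq[OF category_matcat] by (auto simp: is_iso_def)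

lemma matcat_inv:
 assumes "is_iso matcat A" "A : \<M> n m"
 shows "cat_inv matcat A : \<M> m n" "cat_inv matcat A * A = 1\<^sub>m m" "A * cat_inv matcat A = 1\<^sub>m n"
 using cat_inv_hom[OF category_matcat assms(1), of m n] cat_inv_left[OF category_matcat assms(1), of m n]
  cat_inv_right[OF category_matcat assms(1), of m n] assms(2) by (auto simp: Hom_matcat)

text \<open>Restriction is strictly functorial, so consecutive steps of \<open>Lam2\<close> and of
  the Beck-Chevalley map match without further isomorphisms.\<close>

lemma Res_fcmp:
 fixes F :: "('x, 'xm, 'a, 'am) fctr"
 assumes "is_functor Z X S"
 shows "fcmp (Res Z S) (Res X F) = Res Z (fcmp F S)"
proof -
 have "whisk_r Z (whisk_r X \<tau> F) S = whisk_r Z \<tau> (fcmp F S)" for \<tau> :: "('a, 'am) intw"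
  by (rule ntr_eqI[where C = Z]) (auto simp: fct_obj[OF assms] fcmp_assoc)
 thus ?thesis by (simp add: Res_def fcmp_def fcmp_assoc[unfolded fcmp_def])
qed

locale cover2 = S: cover Z X S + G: cover X B G
 for Z :: "('w, 'wm) cat" and X :: "('x, 'xm) cat" and B :: "('b, 'bm) cat" and S G
begin

sublocale GS: cover Z B "fcmp G S"
 by standard (rule finite_cover_fcmp[OF S.finite_cover G.finite_cover])

context
 fixes V assumes V: "is_functor Z matcat V"
begin

lemma IV: "is_functor X matcat (Ind_obj Z X S V)"
 by (rule S.Ind_obj_functor[OF V])

text \<open>Naturality of the outer injection moves \<open>h\<close> from the inner index to the
  outer one. Every double injection thus has a form with identity inner index, the form in which
  \<open>ind_comp\<close> is defined.\<close>

lemma inj_inj_shift: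
 assumes b: "b : Obj B" and x: "x : Obj X" and g: "g : Hom B (fo G x) b" and z: "z : Obj Z" and h: "h : Hom X (fo S z) x"
 shows "G.\<iota> (Ind_obj Z X S V) b (fo S z) (Cmp B g (fm G h)) * S.\<iota> V (fo S z) z (Idn X (fo S z)) =
  G.\<iota> (Ind_obj Z X S V) b x g * S.\<iota> V x z h"
proof -
 note Sz = fct_obj[OF S.fctG z] and id = cat_idn[OF S.catB fct_obj[OF S.fctG z]]
 have "G.\<iota> (Ind_obj Z X S V) b (fo S z) (Cmp B g (fm G h)) * S.\<iota> V (fo S z) z (Idn X (fo S z)) =
   G.\<iota> (Ind_obj Z X S V) b x g * (fm (Ind_obj Z X S V) h * S.\<iota> V (fo S z) z (Idn X (fo S z)))"
  using G.inj_cm[OF IV b x g] rep_cm[OF IV h] S.inj_cm[OF V Sz z id]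
  by (simp add: G.inj_nat[OF IV b h g, symmetric] mat_assoc)
 thus ?thesis by (simp add: S.Ind_obj_inj[OF V h z id] cat_idr[OF S.catB h])
qed

lemma ind_comp_cocone:
 assumes b: "b : Obj B"
 shows "ind_cocone Z B (fcmp G S) V b (G.dI (Ind_obj Z X S V) b)
  (%z g. G.\<iota> (Ind_obj Z X S V) b (fo S z) g * S.\<iota> V (fo S z) z (Idn X (fo S z)))"
proof (rule ind_coconeI)
 fix z g assume z: "z : Obj Z" "g : Hom B (fo (fcmp G S) z) b"
 note Sz = fct_obj[OF S.fctG z(1)] and id = cat_idn[OF S.catB fct_obj[OF S.fctG z(1)]]
 show "G.\<iota> (Ind_obj Z X S V) b (fo S z) g * S.\<iota> V (fo S z) z (Idn X (fo S z)) : \<M> (G.dI (Ind_obj Z X S V) b) (fo V z)"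
  using G.inj_cm[OF IV b Sz, of g] S.inj_cm[OF V Sz z(1) id] z by simp
next
 fix z w k g assume k: "k : Hom Z z w" and g: "g : Hom B (fo (fcmp G S) w) b"
 note o = dom_obj[OF k S.catX] and Sk = fct_hom[OF S.fctG k]
 note So = fct_obj[OF S.fctG o(1)] fct_obj[OF S.fctG o(2)]
 show "G.\<iota> (Ind_obj Z X S V) b (fo S w) g * S.\<iota> V (fo S w) w (Idn X (fo S w)) * fm V k =
  G.\<iota> (Ind_obj Z X S V) b (fo S z) (Cmp B g (fm (fcmp G S) k)) * S.\<iota> V (fo S z) z (Idn X (fo S z))"
  using inj_inj_shift[OF b So(2) _ o(1) Sk, of g] g G.inj_cm[OF IV b So(2), of g]
   S.inj_cm[OF V So(2) o(2) cat_idn[OF S.catB So(2)]] rep_cm[OF V k]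
   S.inj_nat[OF V So(2) k cat_idn[OF S.catB So(2)]] cat_idl[OF S.catB Sk]
  by (simp add: mat_assoc)
qed

end

context
 fixes V b assumes V: "V : Obj (Rep Z)" and b: "b : Obj B"
begin

lemma ind_comp_cm: "nt (nt (ind_comp Z X B S G) V) b : \<M> (G.dI (Ind_obj Z X S V) b) (GS.dI V b)"
 and ind_comp_inj: "z : Obj Z ==> g : Hom B (fo G (fo S z)) b ==>
  nt (nt (ind_comp Z X B S G) V) b * GS.\<iota> V b z g =
  G.\<iota> (Ind_obj Z X S V) b (fo S z) g * S.\<iota> V (fo S z) z (Idn X (fo S z))"
 using GS.desc_carrier[OF Rep_objD(1)[OF V] b ind_comp_cocone[OF Rep_objD(1)[OF V] b]]
  GS.desc_inj[OF Rep_objD(1)[OF V] b ind_comp_cocone[OF Rep_objD(1)[OF V] b]] V b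
 by (simp_all add: ind_comp_def del: Rep_simps)

text \<open>The inverse uses two universal properties in turn: for fixed \<open>(x, g)\<close> the
  inner colimit yields \<open>\<theta> x g\<close>, and these maps form a cocone for the outer
  colimit. It merges the double injection at \<open>g\<close> and \<open>h\<close> into the single
  one at \<open>g (G h)\<close>.\<close>

lemma ind_comp_iso: "is_iso matcat (nt (nt (ind_comp Z X B S G) V) b)"
 and ind_comp_inv_inj: "x : Obj X ==> g : Hom B (fo G x) b ==> z : Obj Z ==> h : Hom X (fo S z) x ==>
  cat_inv matcat (nt (nt (ind_comp Z X B S G) V) b) * (G.\<iota> (Ind_obj Z X S V) b x g * S.\<iota> V x z h) =
  GS.\<iota> V b z (Cmp B g (fm G h))"
proof -
 note VF = Rep_objD(1)[OF V]
 note IVF = IV[OF VF]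
 let ?C = "nt (nt (ind_comp Z X B S G) V) b"
 define \<theta> where "\<theta> x g = ind_desc Z X S V x (GS.dI V b) (%z h. GS.\<iota> V b z (Cmp B g (fm G h)))" for x g
 have in_coc: "ind_cocone Z X S V x (GS.dI V b) (%z h. GS.\<iota> V b z (Cmp B g (fm G h)))"
  if x: "x : Obj X" and g: "g : Hom B (fo G x) b" for x g
 proof (rule ind_coconeI)
  show "GS.\<iota> V b z (Cmp B g (fm G h)) : \<M> (GS.dI V b) (fo V z)" if "z : Obj Z" "h : Hom X (fo S z) x" for z h
   using GS.inj_cm[OF VF b that(1)] G.cmp_G[OF that(2) g] by simp
  show "GS.\<iota> V b w (Cmp B g (fm G h)) * fm V k = GS.\<iota> V b z (Cmp B g (fm G (Cmp X h (fm S k))))"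
   if k: "k : Hom Z z w" and h: "h : Hom X (fo S w) x" for z w k h
   using GS.inj_nat[OF VF b k, of "Cmp B g (fm G h)"] G.cmp_G[OF h g] fct_cmp[OF G.fctG fct_hom[OF S.fctG k] h]
    cat_assoc[OF G.catB fct_hom[OF G.fctG fct_hom[OF S.fctG k]] fct_hom[OF G.fctG h] g] by simp
 qed
 have \<theta>c: "\<theta> x g : \<M> (GS.dI V b) (S.dI V x)" if "x : Obj X" "g : Hom B (fo G x) b" for x g
  unfolding \<theta>_def by (rule S.desc_carrier[OF VF that(1) in_coc[OF that]])
 have \<theta>i: "\<theta> x g * S.\<iota> V x z h = GS.\<iota> V b z (Cmp B g (fm G h))"
  if "x : Obj X" "g : Hom B (fo G x) b" "z : Obj Z" "h : Hom X (fo S z) x" for x g z h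
  unfolding \<theta>_def by (rule S.desc_inj[OF VF that(1) in_coc[OF that(1,2)] that(3,4)])
 have out_coc: "ind_cocone X B G (Ind_obj Z X S V) b (GS.dI V b) \<theta>"
 proof (rule ind_coconeI)
  show "\<theta> x g : \<M> (GS.dI V b) (fo (Ind_obj Z X S V) x)" if "x : Obj X" "g : Hom B (fo G x) b" for x g
   using \<theta>c[OF that] by simp
  fix x y k g assume k: "k : Hom X x y" and g: "g : Hom B (fo G y) b"
  note o = dom_obj[OF k S.catB]
  show "\<theta> y g * fm (Ind_obj Z X S V) k = \<theta> x (Cmp B g (fm G k))"
  proof (rule S.ind_eqI[OF VF o(1)])
   fix z h assume z: "z : Obj Z" and h: "h : Hom X (fo S z) x"
   show "\<theta> y g * fm (Ind_obj Z X S V) k * S.\<iota> V x z h = \<theta> x (Cmp B g (fm G k)) * S.\<iota> V x z h"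
    using \<theta>c[OF o(2) g] S.Ind_obj_cm[OF VF k] S.inj_cm[OF VF o(1) z h] fct_cmp[OF G.fctG h k]
     cat_assoc[OF G.catB fct_hom[OF G.fctG h] fct_hom[OF G.fctG k] g]
    by (simp add: mat_assoc S.Ind_obj_inj[OF VF k z h] \<theta>i[OF o(2) g z cat_cmp[OF S.catB h k]] \<theta>i[OF o(1) G.cmp_G[OF k g] z h])
  qed (use \<theta>c[OF o(2) g] \<theta>c[OF o(1) G.cmp_G[OF k g]] S.Ind_obj_cm[OF VF k] in auto)
 qed
 define N where "N = ind_desc X B G (Ind_obj Z X S V) b (GS.dI V b) \<theta>"
 have Nc: "N : \<M> (GS.dI V b) (G.dI (Ind_obj Z X S V) b)"
  unfolding N_def by (rule G.desc_carrier[OF IVF b out_coc])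
 have Ni: "N * (G.\<iota> (Ind_obj Z X S V) b x g * S.\<iota> V x z h) = GS.\<iota> V b z (Cmp B g (fm G h))"
  if x: "x : Obj X" "g : Hom B (fo G x) b" and z: "z : Obj Z" "h : Hom X (fo S z) x" for x g z h
  using Nc G.inj_cm[OF IVF b x] S.inj_cm[OF VF x(1) z] G.desc_inj[OF IVF b out_coc x] \<theta>i[OF x z]
  by (simp add: N_def flip: mat_assoc)
 have 1: "N * ?C = 1\<^sub>m (GS.dI V b)"
 proof (rule GS.ind_eqI[OF VF b])
  fix z g assume z: "z : Obj Z" "g : Hom B (fo (fcmp G S) z) b"
  note Sz = fct_obj[OF S.fctG z(1)] and g = z(2)[unfolded fcmp_simps]
  show "N * ?C * GS.\<iota> V b z g = 1\<^sub>m (GS.dI V b) * GS.\<iota> V b z g"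
   using Nc ind_comp_cm GS.inj_cm[OF VF b z] Ni[OF Sz g z(1) cat_idn[OF S.catB Sz]]
    fct_idn[OF G.fctG Sz] cat_idr[OF G.catB g]
   by (simp add: mat_assoc ind_comp_inj[OF z(1) g])
 qed (use Nc ind_comp_cm in auto)
 have 2: "?C * N = 1\<^sub>m (G.dI (Ind_obj Z X S V) b)"
 proof (rule G.ind_eqI[OF IVF b])
  fix x g assume x: "x : Obj X" "g : Hom B (fo G x) b"
  note gc = G.inj_cm[OF IVF b x]
  show "?C * N * G.\<iota> (Ind_obj Z X S V) b x g = 1\<^sub>m (G.dI (Ind_obj Z X S V) b) * G.\<iota> (Ind_obj Z X S V) b x g"
  proof (rule S.ind_eqI[OF VF x(1)])
   fix z h assume z: "z : Obj Z" and h: "h : Hom X (fo S z) x"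
   show "?C * N * G.\<iota> (Ind_obj Z X S V) b x g * S.\<iota> V x z h =
     1\<^sub>m (G.dI (Ind_obj Z X S V) b) * G.\<iota> (Ind_obj Z X S V) b x g * S.\<iota> V x z h"
    using Nc ind_comp_cm gc S.inj_cm[OF VF x(1) z h] Ni[OF x z h] ind_comp_inj[OF z G.cmp_G[OF h x(2)]]
     inj_inj_shift[OF VF b x z h] by (simp add: mat_assoc)
  qed (use Nc ind_comp_cm gc in auto)
 qed (use Nc ind_comp_cm in auto)
 show "is_iso matcat ?C" using matcat_isoI(1)[OF ind_comp_cm Nc 2 1] .
 show "cat_inv matcat ?C * (G.\<iota> (Ind_obj Z X S V) b x g * S.\<iota> V x z h) = GS.\<iota> V b z (Cmp B g (fm G h))"
  if "x : Obj X" "g : Hom B (fo G x) b" "z : Obj Z" "h : Hom X (fo S z) x"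
  using Ni[OF that] matcat_isoI(2)[OF ind_comp_cm Nc 2 1] by simp
qed

end

lemma ind_comp_simps [simp]:
 "nsrc (ind_comp Z X B S G) = Ind Z B (fcmp G S)" "ntgt (ind_comp Z X B S G) = fcmp (Ind X B G) (Ind Z X S)"
 "nt (ind_comp Z X B S G) : extensional (Obj (Rep Z))"
 by (simp_all add: ind_comp_def del: Rep_simps)

lemma ind_comp_nat: "is_nat (Rep Z) (Rep B) (ind_comp Z X B S G)"
proof (rule Rep_ntI[OF S.catX G.catB])
 fix V h b c assume V: "V : Obj (Rep Z)" and h: "h : Hom B b c"
 note o = dom_obj[OF h G.catB] and VF = Rep_objD(1)[OF V]
 note cc = ind_comp_cm[OF V o(1)] ind_comp_cm[OF V o(2)] GS.Ind_obj_cm[OF VF h] G.Ind_obj_cm[OF IV[OF VF] h]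
 have "nt (nt (ind_comp Z X B S G) V) c * fm (Ind_obj Z B (fcmp G S) V) h =
  fm (Ind_obj X B G (Ind_obj Z X S V)) h * nt (nt (ind_comp Z X B S G) V) b"
 proof (rule GS.ind_eqI[OF VF o(1)])
  fix z g assume z: "z : Obj Z" "g : Hom B (fo (fcmp G S) z) b"
  note g = z(2)[unfolded fcmp_simps] and Sz = fct_obj[OF S.fctG z(1)]
  show "nt (nt (ind_comp Z X B S G) V) c * fm (Ind_obj Z B (fcmp G S) V) h * GS.\<iota> V b z g =
   fm (Ind_obj X B G (Ind_obj Z X S V)) h * nt (nt (ind_comp Z X B S G) V) b * GS.\<iota> V b z g"
   using cc GS.inj_cm[OF VF o(1) z] G.inj_cm[OF IV[OF VF] o(1) Sz g] S.inj_cm[OF VF Sz z(1) cat_idn[OF S.catB Sz]]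
    G.Ind_obj_inj[OF IV[OF VF] h Sz g] ind_comp_inj[OF V o(2) z(1) cat_cmp[OF G.catB g h]]
   by (simp add: mat_assoc GS.Ind_obj_inj[OF VF h z] ind_comp_inj[OF V o(1) z(1) g] flip: mat_assoc[of "fm (Ind_obj X B G (Ind_obj Z X S V)) h" "G.\<iota> (Ind_obj Z X S V) b (fo S z) g"])
 qed (use cc in auto)
 thus "nt (nt (ind_comp Z X B S G) V) c * fm (fo (nsrc (ind_comp Z X B S G)) V) h =
    fm (fo (ntgt (ind_comp Z X B S G)) V) h * nt (nt (ind_comp Z X B S G) V) b" by simp
next
 fix \<sigma> V W b assume \<sigma>: "\<sigma> : Hom (Rep Z) V W" and b: "b : Obj B"
 note s = Hom_RepD[OF \<sigma>]
 note VF = Rep_objD(1)[OF s(4)] and WF = Rep_objD(1)[OF s(5)]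
 have t: "is_nat X matcat (fm (Ind Z X S) \<sigma>)" "nsrc (fm (Ind Z X S) \<sigma>) = Ind_obj Z X S V" "ntgt (fm (Ind Z X S) \<sigma>) = Ind_obj Z X S W"
  using S.Ind_map_nat[OF s(1-3)] s by simp_all
 note cc = ind_comp_cm[OF s(4) b] ind_comp_cm[OF s(5) b] GS.Ind_map_cm[OF s(1-3) b] G.Ind_map_cm[OF t b]
 have "nt (nt (ind_comp Z X B S G) W) b * nt (fm (Ind Z B (fcmp G S)) \<sigma>) b =
   nt (fm (Ind X B G) (fm (Ind Z X S) \<sigma>)) b * nt (nt (ind_comp Z X B S G) V) b"
 proof (rule GS.ind_eqI[OF VF b])
  fix z g assume z: "z : Obj Z" "g : Hom B (fo (fcmp G S) z) b"
  note g = z(2)[unfolded fcmp_simps] and Sz = fct_obj[OF S.fctG z(1)]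
  note id = cat_idn[OF S.catB Sz]
  note tc = intw_cm[OF s(1) z(1), unfolded s]
  note iV = G.inj_cm[OF IV[OF VF] b Sz g] S.inj_cm[OF VF Sz z(1) id]
  note iW = G.inj_cm[OF IV[OF WF] b Sz g] S.inj_cm[OF WF Sz z(1) id]
  note mc = S.Ind_map_cm[OF s(1-3) Sz]
  have "nt (nt (ind_comp Z X B S G) W) b * nt (fm (Ind Z B (fcmp G S)) \<sigma>) b * GS.\<iota> V b z g =
    nt (nt (ind_comp Z X B S G) W) b * GS.\<iota> W b z g * nt \<sigma> z"
   using cc GS.inj_cm[OF VF b z] GS.inj_cm[OF WF b z] tc by (simp add: mat_assoc GS.Ind_map_inj[OF s(1-3) b z])
  also have "\<dots> = G.\<iota> (Ind_obj Z X S W) b (fo S z) g * (S.\<iota> W (fo S z) z (Idn X (fo S z)) * nt \<sigma> z)"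
   using iW tc by (simp add: ind_comp_inj[OF s(5) b z(1) g] mat_assoc)
  also have "\<dots> = G.\<iota> (Ind_obj Z X S W) b (fo S z) g * nt (fm (Ind Z X S) \<sigma>) (fo S z) * S.\<iota> V (fo S z) z (Idn X (fo S z))"
   using iW iV mc by (simp add: S.Ind_map_inj[OF s(1-3) Sz z(1) id, symmetric] mat_assoc)
  also have "\<dots> = nt (fm (Ind X B G) (fm (Ind Z X S) \<sigma>)) b * (G.\<iota> (Ind_obj Z X S V) b (fo S z) g * S.\<iota> V (fo S z) z (Idn X (fo S z)))"
   using iV cc by (simp add: G.Ind_map_inj[OF t b Sz g, symmetric] mat_assoc)
  also have "\<dots> = nt (fm (Ind X B G) (fm (Ind Z X S) \<sigma>)) b * nt (nt (ind_comp Z X B S G) V) b * GS.\<iota> V b z g"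
   using cc GS.inj_cm[OF VF b z] by (simp add: ind_comp_inj[OF s(4) b z(1) g] mat_assoc)
  finally show "nt (nt (ind_comp Z X B S G) W) b * nt (fm (Ind Z B (fcmp G S)) \<sigma>) b * GS.\<iota> V b z g =
   nt (fm (Ind X B G) (fm (Ind Z X S) \<sigma>)) b * nt (nt (ind_comp Z X B S G) V) b * GS.\<iota> V b z g" .
 qed (use cc in auto)
 thus "nt (nt (ind_comp Z X B S G) W) b * nt (fm (nsrc (ind_comp Z X B S G)) \<sigma>) b =
    nt (fm (ntgt (ind_comp Z X B S G)) \<sigma>) b * nt (nt (ind_comp Z X B S G) V) b" by simp
qed (use ind_comp_cm GS.functor_Ind is_functor_fcmp[OF S.functor_Ind G.functor_Ind] in \<open>auto simp: ind_comp_def\<close>)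

lemma ind_comp_Rep_iso: "V : Obj (Rep Z) ==> is_iso (Rep B) (nt (ind_comp Z X B S G) V)"
 and ind_comp_Rep_inv: "V : Obj (Rep Z) ==> b : Obj B ==>
  nt (cat_inv (Rep B) (nt (ind_comp Z X B S G) V)) b = cat_inv matcat (nt (nt (ind_comp Z X B S G) V) b)"
 using Rep_iso[OF G.catB _ ind_comp_iso] nat_hom[OF ind_comp_nat] by (auto simp: homset_def simp del: Rep_simps)

end

locale cover_cong = G: cover X B G + H: cover X B H
 for X :: "('x, 'xm) cat" and B :: "('b, 'bm) cat" and G H +
 fixes \<mu> assumes \<mu>: "is_nat X B \<mu>" and \<mu>_src: "nsrc \<mu> = G" and \<mu>_tgt: "ntgt \<mu> = H"
begin

lemma \<mu>_hom: "x : Obj X ==> nt \<mu> x : Hom B (fo G x) (fo H x)"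
 using nat_hom[OF \<mu>] \<mu>_src \<mu>_tgt by simp

lemma \<mu>_inv: "x : Obj X ==> cat_inv B (nt \<mu> x) : Hom B (fo H x) (fo G x)"
 using grp_inv[OF G.groupoids(2) \<mu>_hom] .

lemma ind_cong_cocone:
 assumes V: "is_functor X matcat V" and b: "b : Obj B"
 shows "ind_cocone X B G V b (H.dI V b) (%x g. H.\<iota> V b x (Cmp B g (cat_inv B (nt \<mu> x))))"
proof (rule ind_coconeI)
 show "H.\<iota> V b x (Cmp B g (cat_inv B (nt \<mu> x))) : \<M> (H.dI V b) (fo V x)" if "x : Obj X" "g : Hom B (fo G x) b" for x g
  using H.inj_cm[OF V b that(1) cat_cmp[OF G.catB \<mu>_inv[OF that(1)] that(2)]] .
 fix x y k g assume k: "k : Hom X x y" and g: "g : Hom B (fo G y) b"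
 note o = dom_obj[OF k G.catX]
 note m = \<mu>_hom[OF o(1)] \<mu>_hom[OF o(2)] \<mu>_inv[OF o(1)] \<mu>_inv[OF o(2)]
 note Gk = fct_hom[OF G.fctG k] and Hk = fct_hom[OF H.fctG k]
 have nn: "Cmp B (nt \<mu> y) (fm G k) = Cmp B (fm H k) (nt \<mu> x)" using nat_nat[OF \<mu> k] \<mu>_src \<mu>_tgt by simp
 \<comment> \<open>This is naturality of the inverse of \<open>\<mu>\<close>.\<close>
 have "Cmp B (cat_inv B (nt \<mu> y)) (fm H k) = Cmp B (cat_inv B (nt \<mu> y)) (Cmp B (fm H k) (Cmp B (nt \<mu> x) (cat_inv B (nt \<mu> x))))"
  by (simp add: grp_inv_right[OF G.groupoids(2) m(1)] cat_idr[OF G.catB Hk])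
 also have "\<dots> = Cmp B (fm G k) (cat_inv B (nt \<mu> x))"
  by (simp add: nn[symmetric] cat_assoc[OF G.catB m(3) Gk m(2)] cat_assoc[OF G.catB cat_cmp[OF G.catB m(3) Gk] m(2) m(4), symmetric]
    grp_inv_left[OF G.groupoids(2) m(2)] cat_idl[OF G.catB cat_cmp[OF G.catB m(3) Gk]] flip: cat_assoc[OF G.catB m(3) m(1) Hk])
 finally have "Cmp B (Cmp B g (cat_inv B (nt \<mu> y))) (fm H k) = Cmp B (Cmp B g (fm G k)) (cat_inv B (nt \<mu> x))"
  by (simp add: cat_assoc[OF G.catB Hk m(4) g] cat_assoc[OF G.catB m(3) Gk g])
 thus "H.\<iota> V b y (Cmp B g (cat_inv B (nt \<mu> y))) * fm V k = H.\<iota> V b x (Cmp B (Cmp B g (fm G k)) (cat_inv B (nt \<mu> x)))"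
  using H.inj_nat[OF V b k cat_cmp[OF G.catB m(4) g]] by simp
qed

lemma ind_cong_carrier: "V : Obj (Rep X) ==> b : Obj B ==> nt (nt (ind_cong X B \<mu>) V) b : \<M> (H.dI V b) (G.dI V b)"
 and ind_cong_inj: "V : Obj (Rep X) ==> b : Obj B ==> x : Obj X ==> g : Hom B (fo G x) b ==>
  nt (nt (ind_cong X B \<mu>) V) b * G.\<iota> V b x g = H.\<iota> V b x (Cmp B g (cat_inv B (nt \<mu> x)))"
 using G.desc_carrier[OF Rep_objD(1) _ ind_cong_cocone[OF Rep_objD(1)]] G.desc_inj[OF Rep_objD(1) _ ind_cong_cocone[OF Rep_objD(1)]]
 by (simp_all add: ind_cong_def \<mu>_src \<mu>_tgt del: Rep_simps)

lemma ind_cong_simps [simp]: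
 "nsrc (ind_cong X B \<mu>) = Ind X B G" "ntgt (ind_cong X B \<mu>) = Ind X B H" "nt (ind_cong X B \<mu>) : extensional (Obj (Rep X))"
 by (simp_all add: ind_cong_def \<mu>_src \<mu>_tgt del: Rep_simps)

lemma ind_cong_nat: "is_nat (Rep X) (Rep B) (ind_cong X B \<mu>)"
proof (rule Rep_ntI[OF G.catX G.catB])
 fix V h b c assume V: "V : Obj (Rep X)" and h: "h : Hom B b c"
 note o = dom_obj[OF h G.catB] and VF = Rep_objD(1)[OF V]
 note cc = ind_cong_carrier[OF V o(1)] ind_cong_carrier[OF V o(2)] G.Ind_obj_cm[OF VF h] H.Ind_obj_cm[OF VF h]
 have "nt (nt (ind_cong X B \<mu>) V) c * fm (Ind_obj X B G V) h = fm (Ind_obj X B H V) h * nt (nt (ind_cong X B \<mu>) V) b"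
 proof (rule G.ind_eqI[OF VF o(1)])
  fix x g assume x: "x : Obj X" "g : Hom B (fo G x) b"
  show "nt (nt (ind_cong X B \<mu>) V) c * fm (Ind_obj X B G V) h * G.\<iota> V b x g =
    fm (Ind_obj X B H V) h * nt (nt (ind_cong X B \<mu>) V) b * G.\<iota> V b x g"
   using cc G.inj_cm[OF VF o(1) x]
   by (simp add: mat_assoc G.Ind_obj_inj[OF VF h x] ind_cong_inj[OF V o(1) x] ind_cong_inj[OF V o(2) x(1) cat_cmp[OF G.catB x(2) h]]
     H.Ind_obj_inj[OF VF h x(1) cat_cmp[OF G.catB \<mu>_inv[OF x(1)] x(2)]] cat_assoc[OF G.catB \<mu>_inv[OF x(1)] x(2) h])
 qed (use cc in auto)
 thus "nt (nt (ind_cong X B \<mu>) V) c * fm (fo (nsrc (ind_cong X B \<mu>)) V) h =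
   fm (fo (ntgt (ind_cong X B \<mu>)) V) h * nt (nt (ind_cong X B \<mu>) V) b" by simp
next
 fix \<sigma> V W b assume \<sigma>: "\<sigma> : Hom (Rep X) V W" and b: "b : Obj B"
 note s = Hom_RepD[OF \<sigma>]
 note VF = Rep_objD(1)[OF s(4)] and WF = Rep_objD(1)[OF s(5)]
 note cc = ind_cong_carrier[OF s(4) b] ind_cong_carrier[OF s(5) b] G.Ind_map_cm[OF s(1-3) b] H.Ind_map_cm[OF s(1-3) b]
 have "nt (nt (ind_cong X B \<mu>) W) b * nt (fm (Ind X B G) \<sigma>) b = nt (fm (Ind X B H) \<sigma>) b * nt (nt (ind_cong X B \<mu>) V) b"
 proof (rule G.ind_eqI[OF VF b])
  fix x g assume x: "x : Obj X" "g : Hom B (fo G x) b"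
  note gm = cat_cmp[OF G.catB \<mu>_inv[OF x(1)] x(2)] and tc = intw_cm[OF s(1) x(1), unfolded s]
  show "nt (nt (ind_cong X B \<mu>) W) b * nt (fm (Ind X B G) \<sigma>) b * G.\<iota> V b x g =
    nt (fm (Ind X B H) \<sigma>) b * nt (nt (ind_cong X B \<mu>) V) b * G.\<iota> V b x g"
   using cc G.inj_cm[OF VF b x] G.inj_cm[OF WF b x] H.inj_cm[OF VF b x(1) gm] tc
   by (simp add: mat_assoc G.Ind_map_inj[OF s(1-3) b x] ind_cong_inj[OF s(4) b x] H.Ind_map_inj[OF s(1-3) b x(1) gm])
    (simp add: ind_cong_inj[OF s(5) b x] flip: mat_assoc)
 qed (use cc in auto)
 thus "nt (nt (ind_cong X B \<mu>) W) b * nt (fm (nsrc (ind_cong X B \<mu>)) \<sigma>) b =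
   nt (fm (ntgt (ind_cong X B \<mu>)) \<sigma>) b * nt (nt (ind_cong X B \<mu>) V) b" by simp
qed (use ind_cong_carrier G.functor_Ind H.functor_Ind in \<open>auto simp: ind_cong_def \<mu>_src \<mu>_tgt\<close>)

lemma res_cong_simps [simp]:
 "nsrc (res_cong X B \<mu>) = Res X G" "ntgt (res_cong X B \<mu>) = Res X H" "nt (res_cong X B \<mu>) : extensional (Obj (Rep B))"
 by (simp_all add: res_cong_def \<mu>_src \<mu>_tgt del: Rep_simps)

lemma res_cong_component: "V : Obj (Rep B) ==> x : Obj X ==> nt (nt (res_cong X B \<mu>) V) x = fm V (nt \<mu> x)"
 by (simp add: res_cong_def del: Rep_simps)

lemma res_cong_nat: "is_nat (Rep B) (Rep X) (res_cong X B \<mu>)"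
proof (rule Rep_ntI[OF G.catB G.catX])
 fix V h x y assume V: "V : Obj (Rep B)" and h: "h : Hom X x y"
 note o = dom_obj[OF h G.catX] and VF = Rep_objD(1)[OF V]
 have nn: "Cmp B (nt \<mu> y) (fm G h) = Cmp B (fm H h) (nt \<mu> x)" using nat_nat[OF \<mu> h] \<mu>_src \<mu>_tgt by simp
 show "nt (nt (res_cong X B \<mu>) V) y * fm (fo (nsrc (res_cong X B \<mu>)) V) h =
   fm (fo (ntgt (res_cong X B \<mu>)) V) h * nt (nt (res_cong X B \<mu>) V) x"
  by (simp add: res_cong_component[OF V] o nn del: Rep_simps
    flip: rep_cmp[OF VF fct_hom[OF G.fctG h] \<mu>_hom[OF o(2)]] rep_cmp[OF VF \<mu>_hom[OF o(1)] fct_hom[OF H.fctG h]])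
next
 fix \<sigma> V W x assume \<sigma>: "\<sigma> : Hom (Rep B) V W" and x: "x : Obj X"
 note s = Hom_RepD[OF \<sigma>]
 show "nt (nt (res_cong X B \<mu>) W) x * nt (fm (nsrc (res_cong X B \<mu>)) \<sigma>) x =
   nt (fm (ntgt (res_cong X B \<mu>)) \<sigma>) x * nt (nt (res_cong X B \<mu>) V) x"
  using intw_nat[OF s(1) \<mu>_hom[OF x]] s(2,3) x by (simp add: res_cong_component[OF s(4) x] res_cong_component[OF s(5) x] del: Rep_simps)
next
 fix V x assume V: "V : Obj (Rep B)" and x: "x : Obj X"
 show "nt (nt (res_cong X B \<mu>) V) x : \<M> (fo (fo (ntgt (res_cong X B \<mu>)) V) x) (fo (fo (nsrc (res_cong X B \<mu>)) V) x)"
  using rep_cm[OF Rep_objD(1)[OF V] \<mu>_hom[OF x]] by (simp add: res_cong_component[OF V x] del: Rep_simps)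
qed (use G.functor_Res H.functor_Res in \<open>auto simp: res_cong_def \<mu>_src \<mu>_tgt\<close>)

end


subsection \<open>2-linearization on spans of spans\<close>

text \<open>All legs and both apex maps are finite coverings, so every induction, restriction, unit
  and counit in the definition of \<open>\<Lambda>\<close> on a span of spans is under
  control.\<close>

locale sspan_covers = SG: cover2 Z X B S G + TJ: cover2 Z Y B T J + SF: cover2 Z X A S F + TK: cover2 Z Y A T K
 for Z :: "('w, 'wm) cat" and X :: "('x, 'xm) cat" and Y :: "('y, 'ym) cat" and B :: "('b, 'bm) cat" and A :: "('a, 'am) cat"
  and S T G J F K +
 fixes \<mu> \<nu>
 assumes \<mu>: "is_nat Z B \<mu>" "nsrc \<mu> = fcmp G S" "ntgt \<mu> = fcmp J T"
  and \<nu>: "is_nat Z A \<nu>" "nsrc \<nu> = fcmp F S" "ntgt \<nu> = fcmp K T"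
begin

sublocale m: cover_cong Z B "fcmp G S" "fcmp J T" \<mu>
 by standard (use \<mu> in auto)

sublocale n: cover_cong Z A "fcmp F S" "fcmp K T" \<nu>
 by standard (use \<nu> in auto)

abbreviation "dom_span \<equiv> \<lparr>apex = X, lbase = B, rbase = A, lleg = G, rleg = F\<rparr>"
abbreviation "cod_span \<equiv> \<lparr>apex = Y, lbase = B, rbase = A, lleg = J, rleg = K\<rparr>"
abbreviation "ss \<equiv> \<lparr>sdom = dom_span, scod = cod_span, smid = Z, sS = S, sT = T, smu = \<mu>, snu = \<nu>\<rparr>"

definition "step1 = whisk_l (Rep A) (Ind X B G) (whisk_r (Rep A) (unit_right Z X S) (Res X F))"
definition "step2 = whisk_r (Rep A) (nt_inv (Rep Z) (Rep B) (ind_comp Z X B S G)) (Res Z (fcmp F S))"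
definition "step3 = whisk_r (Rep A) (ind_cong Z B \<mu>) (Res Z (fcmp F S))"
definition "step4 = whisk_l (Rep A) (Ind Z B (fcmp J T)) (res_cong Z A \<nu>)"
definition "step5 = whisk_r (Rep A) (ind_comp Z Y B T J) (Res Z (fcmp K T))"
definition "step6 = whisk_l (Rep A) (Ind Y B J) (whisk_r (Rep A) (counit_left Z Y T) (Res Y K))"

lemma Lam2_steps: "Lam2 ss = vcomp (Rep A) (Rep B) step6 (vcomp (Rep A) (Rep B) step5 (vcomp (Rep A) (Rep B) step4
    (vcomp (Rep A) (Rep B) step3 (vcomp (Rep A) (Rep B) step2 step1))))"
 by (simp add: Lam2_def Let_def step1_def step2_def step3_def step4_def step5_def step6_def)

lemmas cRA = category_Rep[OF SF.G.catB] and cRB = category_Rep[OF SG.G.catB] and cRZ = category_Rep[OF SG.S.catX]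

lemma step_nat:
 "is_nat (Rep A) (Rep B) step1" "is_nat (Rep A) (Rep B) step2" "is_nat (Rep A) (Rep B) step3"
 "is_nat (Rep A) (Rep B) step4" "is_nat (Rep A) (Rep B) step5" "is_nat (Rep A) (Rep B) step6"
 unfolding step1_def step2_def step3_def step4_def step5_def step6_def
 subgoal by (intro is_nat_whisk_l[OF cRA is_nat_whisk_r[OF cRA SF.G.functor_Res SG.S.unit_right_nat] SG.G.functor_Ind])
 subgoal by (intro is_nat_whisk_r[OF cRA SF.GS.functor_Res] is_nat_inv[OF cRZ cRB SG.ind_comp_nat SG.ind_comp_Rep_iso])
 subgoal by (intro is_nat_whisk_r[OF cRA SF.GS.functor_Res m.ind_cong_nat])
 subgoal by (intro is_nat_whisk_l[OF cRA n.res_cong_nat TJ.GS.functor_Ind])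
 subgoal by (intro is_nat_whisk_r[OF cRA TK.GS.functor_Res TJ.ind_comp_nat])
 subgoal by (intro is_nat_whisk_l[OF cRA is_nat_whisk_r[OF cRA TK.G.functor_Res TJ.S.counit_nat] TJ.G.functor_Ind])
 done

lemma step_ends:
 "nsrc step1 = Lam1 dom_span" "nsrc step2 = ntgt step1" "nsrc step3 = ntgt step2" "nsrc step4 = ntgt step3"
 "nsrc step5 = ntgt step4" "nsrc step6 = ntgt step5" "ntgt step6 = Lam1 cod_span"
 by (simp_all add: Lam1_def step1_def step2_def step3_def step4_def step5_def step6_def fcmp_assoc[symmetric]
   Res_fcmp[OF SG.S.fctG] Res_fcmp[OF TJ.S.fctG])

lemma Lam2_nat: "is_nat (Rep A) (Rep B) (Lam2 ss)"
 unfolding Lam2_steps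
 by (intro is_nat_vcomp[OF cRA cRB] step_nat) (simp_all add: step_ends)

lemma Lam2_ends: "nsrc (Lam2 ss) = Lam1 dom_span" "ntgt (Lam2 ss) = Lam1 cod_span"
 by (simp_all add: Lam2_steps step_ends)

context
 fixes V b assumes V: "V : Obj (Rep A)" and b: "b : Obj B"
begin

lemma VF: "is_functor A matcat V" and VX: "is_functor X matcat (fcmp V F)" "fcmp V F : Obj (Rep X)"
 and VY: "is_functor Y matcat (fcmp V K)" "fcmp V K : Obj (Rep Y)"
 and VZ: "is_functor Z matcat (fcmp V (fcmp F S))" "fcmp V (fcmp F S) : Obj (Rep Z)"
 and VZ': "is_functor Z matcat (fcmp V (fcmp K T))" "fcmp V (fcmp K T) : Obj (Rep Z)"
 using Rep_objD(1)[OF V] SF.G.Res_obj[OF V] TK.G.Res_obj[OF V] SF.GS.Res_obj[OF V] TK.GS.Res_obj[OF V] by auto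

lemma Lam2_carrier:
 "nt (nt (Lam2 ss) V) b : \<M> (ind_dim Y B J (fcmp V K) b) (ind_dim X B G (fcmp V F) b)"
proof -
 have "nt (Lam2 ss) V : Hom (Rep B) (fo (Lam1 dom_span) V) (fo (Lam1 cod_span) V)"
  using nat_hom[OF Lam2_nat V] by (simp only: Lam2_ends)
 from intw_cm[OF Hom_RepD(1)[OF this] b] Hom_RepD(2,3)[OF this] show ?thesis
  by (simp add: Lam1_def)
qed

text \<open>The pull-push formula, by which every generator is evaluated. The unit along
  \<open>S\<close> expands into a sum over the classes of lifts \<open>(z, h)\<close> of
  \<open>x\<close>, and each term is pushed forward along \<open>T\<close>; \<open>\<mu>\<close>
  changes the index of the injection while \<open>\<nu>\<close> acts on the coefficients.\<close>

lemma Lam2_inj: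
 assumes x: "x : Obj X" and g: "g : Hom B (fo G x) b" and R: "reps Z X S x R"
 shows "nt (nt (Lam2 ss) V) b * ind_inj X B G (fcmp V F) b x g =
  mat_sum (ind_dim Y B J (fcmp V K) b) (fo V (fo F x))
   (%(z, h). ind_inj Y B J (fcmp V K) b (fo T z) (Cmp B (Cmp B g (fm G h)) (cat_inv B (nt \<mu> z))) *
     (fm V (nt \<nu> z) * fm V (fm F (cat_inv X h)))) R"
proof -
 let ?IS = "Ind_obj Z X S (fcmp V (fcmp F S))" and ?IT = "Ind_obj Z Y T (fcmp V (fcmp K T))"
 let ?m = "nt (nt (unit_right Z X S) (fcmp V F)) x"
 have ass: "fcmp (fcmp V F) S = fcmp V (fcmp F S)" "fcmp (fcmp V K) T = fcmp V (fcmp K T)"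
  by (simp_all add: fcmp_assoc)
 have ur: "nt (unit_right Z X S) (fcmp V F) : Hom (Rep X) (fcmp V F) ?IS"
  using nat_hom[OF SG.S.unit_right_nat VX(2)] by (simp add: ass del: Rep_simps)
 have rc: "nt (res_cong Z A \<nu>) V : Hom (Rep Z) (fcmp V (fcmp F S)) (fcmp V (fcmp K T))"
  using nat_hom[OF n.res_cong_nat V] by (simp del: Rep_simps)
 have cl: "nt (counit_left Z Y T) (fcmp V K) : Hom (Rep Y) ?IT (fcmp V K)"
  using nat_hom[OF TJ.S.counit_nat VY(2)] by (simp add: ass del: Rep_simps)
 let ?s1 = "nt (fm (Ind X B G) (nt (unit_right Z X S) (fcmp V F))) b"
 let ?s2 = "cat_inv matcat (nt (nt (ind_comp Z X B S G) (fcmp V (fcmp F S))) b)"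
 let ?s3 = "nt (nt (ind_cong Z B \<mu>) (fcmp V (fcmp F S))) b"
 let ?s4 = "nt (fm (Ind Z B (fcmp J T)) (nt (res_cong Z A \<nu>) V)) b"
 let ?s5 = "nt (nt (ind_comp Z Y B T J) (fcmp V (fcmp K T))) b"
 let ?s6 = "nt (fm (Ind Y B J) (nt (counit_left Z Y T) (fcmp V K))) b"
 have L: "nt (nt (Lam2 ss) V) b = ?s6 * (?s5 * (?s4 * (?s3 * (?s2 * ?s1))))"
  using V b SG.ind_comp_Rep_inv[OF VZ(2) b] VZ
  by (simp add: Lam2_steps step1_def step2_def step3_def step4_def step5_def step6_def)
 note c2' = matcat_inv(1)[OF SG.ind_comp_iso[OF VZ(2) b] SG.ind_comp_cm[OF VZ(2) b]]
 note c = SG.G.Ind_map_cm[OF Hom_RepD(1-3)[OF ur] b] c2' m.ind_cong_carrier[OF VZ(2) b]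
  TJ.GS.Ind_map_cm[OF Hom_RepD(1-3)[OF rc] b] TJ.ind_comp_cm[OF VZ'(2) b]
  TJ.G.Ind_map_cm[OF Hom_RepD(1-3)[OF cl] b]
 note ix = SG.G.inj_cm[OF VX(1) b x g]
 \<comment> \<open>The value of the last four steps on the injection at \<open>(z, q)\<close>. The
   counit cancels the inner injection produced by \<open>ind_comp\<close>, because the latter has an
   identity as index.\<close>
 let ?E = "%z q. ind_inj Y B J (fcmp V K) b (fo T z) (Cmp B q (cat_inv B (nt \<mu> z))) * fm V (nt \<nu> z)"
 have E: "?s6 * (?s5 * (?s4 * (?s3 * SG.GS.\<iota> (fcmp V (fcmp F S)) b z q))) = ?E z q"
  if z: "z : Obj Z" and q: "q : Hom B (fo G (fo S z)) b" for z q
 proof -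
  note qm = cat_cmp[OF SG.G.catB m.\<mu>_inv[OF z], unfolded fcmp_simps, OF q]
  have qm': "Cmp B q (cat_inv B (nt \<mu> z)) : Hom B (fo (fcmp J T) z) b" using qm by simp
  note Tz = fct_obj[OF TJ.S.fctG z] and idT = cat_idn[OF TJ.S.catB fct_obj[OF TJ.S.fctG z]]
  note i3 = TJ.GS.inj_cm[OF VZ(1) b z qm'] and i4 = TJ.GS.inj_cm[OF VZ'(1) b z qm']
  note nc = rep_cm[OF VF n.\<mu>_hom[OF z], unfolded fcmp_simps]
  note i5 = TJ.G.inj_cm[OF TJ.IV[OF VZ'(1)] b Tz qm] and i5' = TJ.S.inj_cm[OF VZ'(1) Tz z idT]
  note cc = intw_cm[OF Hom_RepD(1)[OF cl] Tz, unfolded Hom_RepD(2,3)[OF cl]]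
  note i6 = TJ.G.inj_cm[OF VY(1) b Tz qm]
  have "?s3 * SG.GS.\<iota> (fcmp V (fcmp F S)) b z q = TJ.GS.\<iota> (fcmp V (fcmp F S)) b z (Cmp B q (cat_inv B (nt \<mu> z)))"
   using m.ind_cong_inj[OF VZ(2) b z] q by simp
  moreover have "?s4 * TJ.GS.\<iota> (fcmp V (fcmp F S)) b z (Cmp B q (cat_inv B (nt \<mu> z))) =
    TJ.GS.\<iota> (fcmp V (fcmp K T)) b z (Cmp B q (cat_inv B (nt \<mu> z))) * fm V (nt \<nu> z)"
   using TJ.GS.Ind_map_inj[OF Hom_RepD(1-3)[OF rc] b z qm'] n.res_cong_component[OF V z] by simp
  moreover have "?s5 * (TJ.GS.\<iota> (fcmp V (fcmp K T)) b z (Cmp B q (cat_inv B (nt \<mu> z))) * fm V (nt \<nu> z)) =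
    TJ.G.\<iota> ?IT b (fo T z) (Cmp B q (cat_inv B (nt \<mu> z))) * (TJ.S.\<iota> (fcmp V (fcmp K T)) (fo T z) z (Idn Y (fo T z)) * fm V (nt \<nu> z))"
   using c i4 nc i5 i5' TJ.ind_comp_inj[OF VZ'(2) b z qm] by (simp add: mat_assoc flip: mat_assoc[of ?s5])
  moreover have "?s6 * (TJ.G.\<iota> ?IT b (fo T z) (Cmp B q (cat_inv B (nt \<mu> z))) * (TJ.S.\<iota> (fcmp V (fcmp K T)) (fo T z) z (Idn Y (fo T z)) * fm V (nt \<nu> z))) =
    TJ.G.\<iota> (fcmp V K) b (fo T z) (Cmp B q (cat_inv B (nt \<mu> z))) *
    (nt (nt (counit_left Z Y T) (fcmp V K)) (fo T z) * TJ.S.\<iota> (fcmp V (fcmp K T)) (fo T z) z (Idn Y (fo T z)) * fm V (nt \<nu> z))"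
   using c i5 i5' nc cc i6 TJ.G.Ind_map_inj[OF Hom_RepD(1-3)[OF cl] b Tz qm] by (simp add: mat_assoc flip: mat_assoc[of ?s6])
  moreover have "nt (nt (counit_left Z Y T) (fcmp V K)) (fo T z) * TJ.S.\<iota> (fcmp V (fcmp K T)) (fo T z) z (Idn Y (fo T z)) = 1\<^sub>m (fo V (fo K (fo T z)))"
   using TJ.S.counit_inj[OF VY(2) Tz z idT] rep_idn[OF VY(1) Tz] ass by simp
  ultimately show ?thesis using nc by simp
 qed
 let ?M = "?s6 * (?s5 * (?s4 * ?s3))"
 have Mc: "?M : \<M> (ind_dim Y B J (fcmp V K) b) (SG.GS.dI (fcmp V (fcmp F S)) b)" using c by simp
 let ?f = "%(z, h). SG.S.\<iota> (fcmp V (fcmp F S)) x z h * fm V (fm F (cat_inv X h))"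
 have fc: "SG.S.\<iota> (fcmp V (fcmp F S)) x z h : \<M> (SG.S.dI (fcmp V (fcmp F S)) x) (fo V (fo F (fo S z)))"
  "fm V (fm F (cat_inv X h)) : \<M> (fo V (fo F (fo S z))) (fo V (fo F x))"
  if "(z, h) : R" for z h
  using SG.S.inj_cm[OF VZ(1) x reps_in[OF R that]] rep_cm[OF VX(1) grp_inv[OF SG.S.groupoids(2) reps_in(2)[OF R that]]] by simp_all
 have m: "?m = mat_sum (SG.S.dI (fcmp V (fcmp F S)) x) (fo V (fo F x)) ?f R"
  using SG.S.unit_right_eq[OF VX(2) x R] by (simp add: ass)
 note ig = SG.G.inj_cm[OF SG.IV[OF VZ(1)] b x g]
 have mc: "?m : \<M> (SG.S.dI (fcmp V (fcmp F S)) x) (fo V (fo F x))" by (simp add: m)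
 have "nt (nt (Lam2 ss) V) b * SG.G.\<iota> (fcmp V F) b x g = ?M * (?s2 * (?s1 * SG.G.\<iota> (fcmp V F) b x g))"
  using c[THEN carrier_matD(1)] c[THEN carrier_matD(2)] ix by (simp add: L mat_assoc)
 also have "?s1 * SG.G.\<iota> (fcmp V F) b x g = SG.G.\<iota> ?IS b x g * ?m"
  using SG.G.Ind_map_inj[OF Hom_RepD(1-3)[OF ur] b x g] .
 also have "?M * (?s2 * (SG.G.\<iota> ?IS b x g * ?m)) = (?M * (?s2 * SG.G.\<iota> ?IS b x g)) * ?m"
  using c ig mc by (simp add: mat_assoc)
 also have "\<dots> = mat_sum (ind_dim Y B J (fcmp V K) b) (fo V (fo F x)) (%p. (?M * (?s2 * SG.G.\<iota> ?IS b x g)) * ?f p) R"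
  unfolding m
 proof (rule mult_mat_sum)
  show "?M * (?s2 * SG.G.\<iota> ?IS b x g) : \<M> (ind_dim Y B J (fcmp V K) b) (SG.S.dI (fcmp V (fcmp F S)) x)"
   using mult_carrier_mat[OF Mc mult_carrier_mat[OF c2' ig]] by (simp only: SG.S.Ind_obj_fo)
  show "?f p : \<M> (SG.S.dI (fcmp V (fcmp F S)) x) (fo V (fo F x))" if "p : R" for p
   using fc[of "fst p" "snd p"] that by (cases p) simp
 qed
 also have "\<dots> = mat_sum (ind_dim Y B J (fcmp V K) b) (fo V (fo F x))
   (%(z, h). ind_inj Y B J (fcmp V K) b (fo T z) (Cmp B (Cmp B g (fm G h)) (cat_inv B (nt \<mu> z))) *
     (fm V (nt \<nu> z) * fm V (fm F (cat_inv X h)))) R"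
 proof (rule mat_sum_cong)
  fix p assume p: "p : R"
  obtain z h where zh: "p = (z, h)" by force
  note i = reps_in[OF R p[unfolded zh]] and fc' = fc[OF p[unfolded zh]]
  note gh = SG.G.cmp_G[OF i(2) g]
  have gh': "Cmp B g (fm G h) : Hom B (fo (fcmp G S) z) b" using gh by simp
  note iz = SG.GS.inj_cm[OF VZ(1) b i(1) gh']
  note qm = cat_cmp[OF SG.G.catB m.\<mu>_inv[OF i(1)], unfolded fcmp_simps, OF gh]
  note i6 = TJ.G.inj_cm[OF VY(1) b fct_obj[OF TJ.S.fctG i(1)] qm]
  note nc = rep_cm[OF VF n.\<mu>_hom[OF i(1)], unfolded fcmp_simps]
  have "(?M * (?s2 * SG.G.\<iota> ?IS b x g)) * ?f p = ?M * (?s2 * (SG.G.\<iota> ?IS b x g * SG.S.\<iota> (fcmp V (fcmp F S)) x z h)) * fm V (fm F (cat_inv X h))"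
   using c ig fc' by (simp add: zh mat_assoc)
  also have "\<dots> = ?E z (Cmp B g (fm G h)) * fm V (fm F (cat_inv X h))"
   using c iz by (simp add: SG.ind_comp_inv_inj[OF VZ(2) b x g i] mat_assoc E[OF i(1) gh])
  finally show "(?M * (?s2 * SG.G.\<iota> ?IS b x g)) * ?f p = (case p of (z, h) => ind_inj Y B J (fcmp V K) b (fo T z) (Cmp B (Cmp B g (fm G h)) (cat_inv B (nt \<mu> z))) *
     (fm V (nt \<nu> z) * fm V (fm F (cat_inv X h))))"
   using i6 nc fc' by (simp add: zh mat_assoc)
 qed simp
 finally show ?thesis .
qed

end

end

subsection \<open>Iso-comma groupoids and composition of spans\<close>

lemma iso_comma_simps [simp]:
 "Dom (iso_comma X Y B G F) (s, t, p, q) = s" "Cod (iso_comma X Y B G F) (s, t, p, q) = t"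
 "Idn (iso_comma X Y B G F) (x, y, \<alpha>) = ((x, y, \<alpha>), (x, y, \<alpha>), Idn X x, Idn Y y)"
 "Cmp (iso_comma X Y B G F) (s', t', p', q') (s, t, p, q) = (s, t', Cmp X p' p, Cmp Y q' q)"
 by (simp_all add: iso_comma_def Let_def)

lemma com_p_simps [simp]:
 "fo com_p1 (x, y, \<alpha>) = x" "fm com_p1 (s, t, p, q) = p" "fo com_p2 (x, y, \<alpha>) = y" "fm com_p2 (s, t, p, q) = q"
 by (simp_all add: com_p1_def com_p2_def)

locale cospan_covers = G: cover X B G + F: cover Y B F
 for X :: "('x, 'xm) cat" and Y :: "('y, 'ym) cat" and B :: "('b, 'bm) cat" and G F
begin

abbreviation "P \<equiv> iso_comma X Y B G F"
abbreviation p1 :: "(('x, 'y, 'bm) com_obj, ('x, 'xm, 'y, 'ym, 'bm) com_arr, 'x, 'xm) fctr" where "p1 \<equiv> com_p1"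
abbreviation p2 :: "(('x, 'y, 'bm) com_obj, ('x, 'xm, 'y, 'ym, 'bm) com_arr, 'y, 'ym) fctr" where "p2 \<equiv> com_p2"

lemma Obj_P: "(x, y, \<alpha>) : Obj P \<longleftrightarrow> x : Obj X & y : Obj Y & \<alpha> : Hom B (fo G x) (fo F y)"
 using grp_iso[OF G.groupoids(2)] by (auto simp: iso_comma_def Let_def)

lemma Hom_P: "(s', t', p, q) : Hom P s t \<longleftrightarrow> s' = s & t' = t & s : Obj P & t : Obj P &
  p : Hom X (fst s) (fst t) & q : Hom Y (fst (snd s)) (fst (snd t)) &
  Cmp B (snd (snd t)) (fm G p) = Cmp B (fm F q) (snd (snd s))"
 by (cases s; cases t) (auto simp: homset_def iso_comma_def Let_def)

lemma Hom_PE: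
 assumes "f : Hom P s t"
 obtains p q where "f = (s, t, p, q)" "s : Obj P" "t : Obj P" "p : Hom X (fst s) (fst t)" "q : Hom Y (fst (snd s)) (fst (snd t))"
  "Cmp B (snd (snd t)) (fm G p) = Cmp B (fm F q) (snd (snd s))"
 using assms Hom_P by (cases f) auto

lemma category_P: "category P"
proof (rule categoryI)
 fix f a b assume f: "f : Hom P a b"
 thus "a : Obj P & b : Obj P" by (auto elim!: Hom_PE)
 show "Cmp P f (Idn P a) = f" "Cmp P (Idn P b) f = f"
  using f by (auto elim!: Hom_PE simp: cat_idr[OF G.catX] cat_idr[OF F.catX] cat_idl[OF G.catX] cat_idl[OF F.catX]
    split: prod.splits)
    (cases a; cases b; auto simp: cat_idr[OF G.catX] cat_idr[OF F.catX] cat_idl[OF G.catX] cat_idl[OF F.catX])+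
next
 fix a assume "a : Obj P"
 thus "Idn P a : Hom P a a"
  by (cases a) (auto simp: Hom_P Obj_P cat_idn[OF G.catX] cat_idn[OF F.catX] fct_idn[OF G.fctG]
    fct_idn[OF F.fctG] cat_idr[OF G.catB] cat_idl[OF G.catB])
next
 fix f g a b c assume f: "f : Hom P a b" and g: "g : Hom P b c"
 obtain p q where pq: "f = (a, b, p, q)" "a : Obj P" "b : Obj P" "p : Hom X (fst a) (fst b)" "q : Hom Y (fst (snd a)) (fst (snd b))"
  "Cmp B (snd (snd b)) (fm G p) = Cmp B (fm F q) (snd (snd a))" using f by (rule Hom_PE)
 obtain p' q' where pq': "g = (b, c, p', q')" "c : Obj P" "p' : Hom X (fst b) (fst c)" "q' : Hom Y (fst (snd b)) (fst (snd c))"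
  "Cmp B (snd (snd c)) (fm G p') = Cmp B (fm F q') (snd (snd b))" using g by (rule Hom_PE)
 have al: "snd (snd s) : Hom B (fo G (fst s)) (fo F (fst (snd s)))" if "s : Obj P" for s
  using that Obj_P[of "fst s" "fst (snd s)" "snd (snd s)"] by simp
 note h = fct_hom[OF G.fctG pq(4)] fct_hom[OF G.fctG pq'(3)] fct_hom[OF F.fctG pq(5)]
  fct_hom[OF F.fctG pq'(4)]
 have "Cmp B (snd (snd c)) (fm G (Cmp X p' p)) = Cmp B (fm F (Cmp Y q' q)) (snd (snd a))"
  by (simp add: fct_cmp[OF G.fctG pq(4) pq'(3)] fct_cmp[OF F.fctG pq(5) pq'(4)]
    cat_assoc[OF G.catB h(1) h(2) al[OF pq'(2)], symmetric] pq'(5) cat_assoc[OF G.catB h(1) al[OF pq(3)] h(4)] pq(6)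
    cat_assoc[OF G.catB al[OF pq(2)] h(3) h(4)])
 thus "Cmp P g f : Hom P a c"
  using pq pq' cat_cmp[OF G.catX pq(4) pq'(3)] cat_cmp[OF F.catX pq(5) pq'(4)] by (simp add: Hom_P)
next
 fix f g h a b c d assume "f : Hom P a b" "g : Hom P b c" "h : Hom P c d"
 thus "Cmp P h (Cmp P g f) = Cmp P (Cmp P h g) f"
  by (elim Hom_PE) (simp add: cat_assoc[OF G.catX] cat_assoc[OF F.catX])
qed

lemma groupoid_P: "groupoid P"
 unfolding groupoid_def
proof (intro conjI ballI category_P)
 fix f assume "f : Arr P"
 hence f: "f : Hom P (Dom P f) (Cod P f)" by (rule Arr_homset)
 then obtain a b p q where pq: "f = (a, b, p, q)" "a : Obj P" "b : Obj P" "p : Hom X (fst a) (fst b)" "q : Hom Y (fst (snd a)) (fst (snd b))"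
  "Cmp B (snd (snd b)) (fm G p) = Cmp B (fm F q) (snd (snd a))" by (rule Hom_PE)
 have fab: "f : Hom P a b" using f pq(1) by simp
 have al: "snd (snd s) : Hom B (fo G (fst s)) (fo F (fst (snd s)))" if "s : Obj P" for s
  using that Obj_P[of "fst s" "fst (snd s)" "snd (snd s)"] by simp
 let ?p = "cat_inv X p" and ?q = "cat_inv Y q"
 note pi = grp_inv[OF G.groupoids(1) pq(4)] and qi = grp_inv[OF F.groupoids(1) pq(5)]
 note h = fct_hom[OF G.fctG pq(4)] fct_hom[OF G.fctG pi] fct_hom[OF F.fctG pq(5)] fct_hom[OF F.fctG qi]
 note gf = cat_cmp[OF G.catB h(2) al[OF pq(2)]]
 \<comment> \<open>The square defining an arrow of the iso-comma groupoid is inverted: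
   \<open>F q\<close> is cancelled on the left and \<open>G p\<close> on the right.\<close>
 have "Cmp B (snd (snd a)) (fm G ?p) = Cmp B (Cmp B (fm F ?q) (fm F q)) (Cmp B (snd (snd a)) (fm G ?p))"
  using fct_cmp[OF F.fctG pq(5) qi] grp_inv_left[OF F.groupoids(1) pq(5)] fct_idn[OF F.fctG]
   dom_obj[OF pq(5) F.catX] cat_idl[OF G.catB gf] by simp
 also have "\<dots> = Cmp B (fm F ?q) (Cmp B (Cmp B (snd (snd b)) (fm G p)) (fm G ?p))"
  by (simp add: pq(6) cat_assoc[OF G.catB gf h(3) h(4)] cat_assoc[OF G.catB h(2) al[OF pq(2)] h(3)])
 also have "\<dots> = Cmp B (fm F ?q) (snd (snd b))"
  using fct_cmp[OF G.fctG pi pq(4)] grp_inv_right[OF G.groupoids(1) pq(4)] fct_idn[OF G.fctG]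
   dom_obj[OF pq(4) G.catX] cat_idr[OF G.catB al[OF pq(3)]] by (simp add: cat_assoc[OF G.catB h(2) h(1) al[OF pq(3)]])
 finally have g: "(b, a, ?p, ?q) : Hom P b a" using pq pi qi by (simp add: Hom_P)
 have "inverse_arrows P f (b, a, ?p, ?q)"
  by (rule inv_arrowsI[OF fab g]; cases a; cases b)
   (use pq grp_inv_left[OF G.groupoids(1) pq(4)] grp_inv_left[OF F.groupoids(1) pq(5)]
    grp_inv_right[OF G.groupoids(1) pq(4)] grp_inv_right[OF F.groupoids(1) pq(5)] in simp_all)
 thus "is_iso P f" unfolding is_iso_def by (rule exI)
qed

lemma functor_p1: "is_functor P X p1"
 by (rule is_functorI) (auto simp: Obj_P elim!: Hom_PE)

lemma functor_p2: "is_functor P Y p2"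
 by (rule is_functorI) (auto simp: Obj_P elim!: Hom_PE)

text \<open>Coverings are stable under base change: the comma groupoid of \<open>p2\<close> over
  \<open>y0\<close> has the same classes as that of \<open>G\<close> over \<open>F y0\<close>,
  represented by \<open>(x, y0, h)\<close> with the identity of \<open>y0\<close>.\<close>

lemma cover_p2: "finite_cover P Y p2"
proof (rule finite_coverI[OF groupoid_P F.groupoids(1) functor_p2])
 fix s t k k' assume k: "k : Hom P s t" "k' : Hom P s t" "fm p2 k = fm p2 k'"
 obtain p q where pq: "k = (s, t, p, q)" "s : Obj P" "t : Obj P" "p : Hom X (fst s) (fst t)" "q : Hom Y (fst (snd s)) (fst (snd t))"
  "Cmp B (snd (snd t)) (fm G p) = Cmp B (fm F q) (snd (snd s))" using k(1) by (rule Hom_PE)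
 obtain p' q' where pq': "k' = (s, t, p', q')" "p' : Hom X (fst s) (fst t)"
  "Cmp B (snd (snd t)) (fm G p') = Cmp B (fm F q') (snd (snd s))" using k(2) by (rule Hom_PE)
 have "q = q'" using k(3) pq(1) pq'(1) by simp
 moreover have "snd (snd t) : Hom B (fo G (fst t)) (fo F (fst (snd t)))"
  using pq(3) Obj_P[of "fst t" "fst (snd t)" "snd (snd t)"] by simp
 ultimately have "p = p'" using G.lift_unique[OF pq(4) pq'(2)] pq(6) pq'(3) by metis
 thus "k = k'" using pq(1) pq'(1) \<open>q = q'\<close> by simp
next
 fix y0 assume y0: "y0 : Obj Y"
 obtain R where R: "reps X B G (fo F y0) R" using G.ex_reps[OF fct_obj[OF F.fctG y0]] by blast
 let ?R = "(%(x, h). ((x, y0, h), Idn Y y0)) ` R"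
 have "\<exists>(r, h)\<in>?R. r : Obj P & h : Hom Y (fo p2 r) y0 & (\<exists>k\<in>Hom P s r. Cmp Y h (fm p2 k) = q)"
  if s: "s : Obj P" and q: "q : Hom Y (fo p2 s) y0" for s q
 proof -
  obtain x y \<alpha> where xy: "s = (x, y, \<alpha>)" by (cases s)
  have x: "x : Obj X" "y : Obj Y" "\<alpha> : Hom B (fo G x) (fo F y)" using s by (auto simp: xy Obj_P)
  have q': "q : Hom Y y y0" using q by (simp add: xy)
  obtain r h k where r: "(r, h) : R" "k : Hom X x r" "Cmp B h (fm G k) = Cmp B (fm F q) \<alpha>"
   using reps_ex[OF R x(1) cat_cmp[OF G.catB x(3) fct_hom[OF F.fctG q']]] by blast
  note i = reps_in[OF R r(1)]
  have o: "(r, y0, h) : Obj P" using i y0 by (simp add: Obj_P)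
  have "(s, (r, y0, h), k, q) : Hom P s (r, y0, h)" using s o r q' by (simp add: Hom_P xy)
  moreover have "((r, y0, h), Idn Y y0) : ?R" by (rule image_eqI[OF _ r(1)]) simp
  ultimately show ?thesis using o cat_idn[OF F.catX y0] cat_idl[OF F.catX q']
   by (intro bexI[of _ "((r, y0, h), Idn Y y0)"] case_prodI conjI bexI[of _ "(s, (r, y0, h), k, q)"]) simp_all
 qed
 thus "EX R. finite R & (\<forall>x\<in>Obj P. \<forall>g\<in>Hom Y (fo p2 x) y0. \<exists>(r, h)\<in>R.
   r : Obj P & h : Hom Y (fo p2 r) y0 & (\<exists>k\<in>Hom P x r. Cmp Y h (fm p2 k) = g))"
  using reps_finite[OF R] by (intro exI[of _ ?R] conjI ballI) simp_all
qed

text \<open>The comparison arrow of an object points from \<open>G x\<close> to \<open>F y\<close>,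
  so the representatives of \<open>F\<close> over \<open>G x0\<close> enter this time with their
  inverses.\<close>

lemma cover_p1: "finite_cover P X p1"
proof (rule finite_coverI[OF groupoid_P G.groupoids(1) functor_p1])
 fix s t k k' assume k: "k : Hom P s t" "k' : Hom P s t" "fm p1 k = fm p1 k'"
 obtain p q where pq: "k = (s, t, p, q)" "s : Obj P" "t : Obj P" "q : Hom Y (fst (snd s)) (fst (snd t))"
  "Cmp B (snd (snd t)) (fm G p) = Cmp B (fm F q) (snd (snd s))" using k(1) by (rule Hom_PE)
 obtain p' q' where pq': "k' = (s, t, p', q')" "q' : Hom Y (fst (snd s)) (fst (snd t))"
  "Cmp B (snd (snd t)) (fm G p') = Cmp B (fm F q') (snd (snd s))" using k(2) by (rule Hom_PE)
 have "p = p'" using k(3) pq(1) pq'(1) by simp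
 have a: "snd (snd s) : Hom B (fo G (fst s)) (fo F (fst (snd s)))"
  using pq(2) Obj_P[of "fst s" "fst (snd s)" "snd (snd s)"] by simp
 note ai = grp_inv[OF G.groupoids(2) a]
 have "fm F r = Cmp B (Cmp B (fm F r) (snd (snd s))) (cat_inv B (snd (snd s)))" if "r : Hom Y (fst (snd s)) (fst (snd t))" for r
  using cat_assoc[OF G.catB ai a fct_hom[OF F.fctG that]] grp_inv_right[OF G.groupoids(2) a]
   cat_idr[OF G.catB fct_hom[OF F.fctG that]] by simp
 from this[OF pq(4)] this[OF pq'(2)] have "fm F q = fm F q'" using pq(5) pq'(3) \<open>p = p'\<close> by simp
 thus "k = k'" using pq(1) pq'(1) \<open>p = p'\<close> F.faithful_G[OF pq(4) pq'(2)] by simp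
next
 fix x0 assume x0: "x0 : Obj X"
 obtain R where R: "reps Y B F (fo G x0) R" using F.ex_reps[OF fct_obj[OF G.fctG x0]] by blast
 let ?R = "(%(y, h). ((x0, y, cat_inv B h), Idn X x0)) ` R"
 have "\<exists>(r, h)\<in>?R. r : Obj P & h : Hom X (fo p1 r) x0 & (\<exists>k\<in>Hom P s r. Cmp X h (fm p1 k) = q)"
  if s: "s : Obj P" and q: "q : Hom X (fo p1 s) x0" for s q
 proof -
  obtain x y \<alpha> where xy: "s = (x, y, \<alpha>)" by (cases s)
  have x: "x : Obj X" "y : Obj Y" "\<alpha> : Hom B (fo G x) (fo F y)" using s by (auto simp: xy Obj_P)
  have q': "q : Hom X x x0" using q by (simp add: xy)
  note Gq = fct_hom[OF G.fctG q'] and ai = grp_inv[OF G.groupoids(2) x(3)]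
  obtain r h k where r: "(r, h) : R" "k : Hom Y y r" "Cmp B h (fm F k) = Cmp B (fm G q) (cat_inv B \<alpha>)"
   using reps_ex[OF R x(2) cat_cmp[OF G.catB ai Gq]] by blast
  note i = reps_in[OF R r(1)]
  note hi = grp_inv[OF G.groupoids(2) i(2)] and Fk = fct_hom[OF F.fctG r(2)]
  have "Cmp B (cat_inv B h) (fm G q) = Cmp B (cat_inv B h) (Cmp B (Cmp B (fm G q) (cat_inv B \<alpha>)) \<alpha>)"
   by (simp add: cat_assoc[OF G.catB x(3) ai Gq] grp_inv_left[OF G.groupoids(2) x(3)] cat_idr[OF G.catB Gq])
  also have "\<dots> = Cmp B (fm F k) \<alpha>"
   by (simp add: r(3)[symmetric] cat_assoc[OF G.catB x(3) Fk i(2)] grp_inv_left[OF G.groupoids(2) i(2)]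
     cat_idl[OF G.catB cat_cmp[OF G.catB x(3) Fk]] flip: cat_assoc[OF G.catB cat_cmp[OF G.catB x(3) Fk] i(2) hi])
  finally have e: "Cmp B (cat_inv B h) (fm G q) = Cmp B (fm F k) \<alpha>" .
  have o: "(x0, r, cat_inv B h) : Obj P" using i x0 hi by (simp add: Obj_P)
  have "(s, (x0, r, cat_inv B h), q, k) : Hom P s (x0, r, cat_inv B h)" using s o r q' e by (simp add: Hom_P xy)
  moreover have "((x0, r, cat_inv B h), Idn X x0) : ?R" by (rule image_eqI[OF _ r(1)]) simp
  ultimately show ?thesis using o cat_idn[OF G.catX x0] cat_idl[OF G.catX q']
   by (intro bexI[of _ "((x0, r, cat_inv B h), Idn X x0)"] case_prodI conjI bexI[of _ "(s, (x0, r, cat_inv B h), q, k)"]) simp_all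
 qed
 thus "EX R. finite R & (\<forall>x\<in>Obj P. \<forall>g\<in>Hom X (fo p1 x) x0. \<exists>(r, h)\<in>R.
   r : Obj P & h : Hom X (fo p1 r) x0 & (\<exists>k\<in>Hom P x r. Cmp X h (fm p1 k) = g))"
  using reps_finite[OF R] by (intro exI[of _ ?R] conjI ballI) simp_all
qed

end


context cospan_covers begin

sublocale p1: cover P X p1 by standard (rule cover_p1)
sublocale p2: cover P Y p2 by standard (rule cover_p2)

abbreviation taut :: "(('x, 'y, 'bm) com_obj, ('x, 'xm, 'y, 'ym, 'bm) com_arr, 'b, 'bm) ntr" where
 "taut \<equiv> \<lparr>nsrc = fcmp G p1, ntgt = fcmp F p2, nt = (\<lambda>z\<in>Obj P. case z of (x, y, \<alpha>) => \<alpha>)\<rparr>"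

lemma taut_nat: "is_nat P B taut"
proof (rule is_natI)
 fix f s t assume f: "f : Hom P s t"
 thus "Cmp B (nt taut t) (fm (nsrc taut) f) = Cmp B (fm (ntgt taut) f) (nt taut s)"
  by (rule Hom_PE) (cases s; cases t; simp)
qed (use is_functor_fcmp[OF functor_p1 G.fctG] is_functor_fcmp[OF functor_p2 F.fctG] in \<open>auto simp: Obj_P\<close>)

sublocale Gp1: cover P B "fcmp G p1"
 by standard (rule finite_cover_fcmp[OF cover_p1 G.finite_cover])
sublocale Fp2: cover P B "fcmp F p2"
 by standard (rule finite_cover_fcmp[OF cover_p2 F.finite_cover])
sublocale taut: cover_cong P B "fcmp G p1" "fcmp F p2" taut
 by standard (use taut_nat in auto)

abbreviation "BC \<equiv> beck_chevalley X Y B G F"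

definition "bstep1 = whisk_l (Rep X) (fcmp (Ind P Y p2) (Res P p1)) (unit_left X B G)"
definition "bstep2 = whisk_l (Rep X) (Ind P Y p2) (whisk_r (Rep X) (res_cong P B taut) (Ind X B G))"
definition "bstep3 = whisk_r (Rep X) (counit_left P Y p2) (fcmp (Res Y F) (Ind X B G))"

lemma BC_steps: "BC = vcomp (Rep X) (Rep Y) bstep3 (vcomp (Rep X) (Rep Y) bstep2 bstep1)"
 by (simp add: beck_chevalley_def Let_def bstep1_def bstep2_def bstep3_def)

lemmas cRX = category_Rep[OF G.catX] and cRY = category_Rep[OF F.catX]

lemma BC_nat: "is_nat (Rep X) (Rep Y) BC"
 and BC_ends: "nsrc BC = fcmp (Ind P Y p2) (Res P p1)" "ntgt BC = fcmp (Res Y F) (Ind X B G)"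
proof -
 have n: "is_nat (Rep X) (Rep Y) bstep1" "is_nat (Rep X) (Rep Y) bstep2" "is_nat (Rep X) (Rep Y) bstep3"
  unfolding bstep1_def bstep2_def bstep3_def
  subgoal by (rule is_nat_whisk_l[OF cRX G.unit_left_nat is_functor_fcmp[OF p1.functor_Res p2.functor_Ind]])
  subgoal by (rule is_nat_whisk_l[OF cRX is_nat_whisk_r[OF cRX G.functor_Ind taut.res_cong_nat] p2.functor_Ind])
  subgoal by (rule is_nat_whisk_r[OF cRX is_functor_fcmp[OF G.functor_Ind F.functor_Res] p2.counit_nat])
  done
 have r: "fcmp (Res P p1) (fcmp (Res X G) H) = fcmp (Res P (fcmp G p1)) H" "fcmp (Res P p2) (fcmp (Res Y F) H) = fcmp (Res P (fcmp F p2)) H" for H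
  using Res_fcmp[OF functor_p1, where F = G] Res_fcmp[OF functor_p2, where F = F] by (simp_all add: fcmp_assoc)
 have e: "nsrc bstep2 = ntgt bstep1" "nsrc bstep3 = ntgt bstep2"
  by (simp_all add: bstep1_def bstep2_def bstep3_def fcmp_assoc[symmetric] r)
 show "is_nat (Rep X) (Rep Y) BC" unfolding BC_steps
  by (intro is_nat_vcomp[OF cRX cRY] n) (simp_all add: e)
 show "nsrc BC = fcmp (Ind P Y p2) (Res P p1)" "ntgt BC = fcmp (Res Y F) (Ind X B G)"
  by (simp_all add: BC_steps bstep1_def bstep3_def)
qed

context
 fixes V y0 assumes V: "V : Obj (Rep X)" and y0: "y0 : Obj Y"
begin

lemma BC_carrier: "nt (nt BC V) y0 : \<M> (G.dI V (fo F y0)) (p2.dI (fcmp V p1) y0)"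
 using intw_cm[OF Hom_RepD(1)[OF nat_hom[OF BC_nat V]] y0] Hom_RepD(2,3)[OF nat_hom[OF BC_nat V]]
 by (simp add: BC_ends)

text \<open>The unit inserts the identity of \<open>G x\<close>, the tautological 2-cell carries it
  along \<open>\<alpha>\<close>, and the counit carries it along \<open>F q\<close>.\<close>

lemma BC_inj:
 assumes z: "(x, y, \<alpha>) : Obj P" and q: "q : Hom Y y y0"
 shows "nt (nt BC V) y0 * p2.\<iota> (fcmp V p1) y0 (x, y, \<alpha>) q = G.\<iota> V (fo F y0) x (Cmp B (fm F q) \<alpha>)"
proof -
 let ?I = "Ind_obj X B G V"
 have z': "x : Obj X" "y : Obj Y" "\<alpha> : Hom B (fo G x) (fo F y)" using z by (simp_all add: Obj_P)
 note VF = Rep_objD(1)[OF V] and IR = G.Ind_obj_Rep[OF V]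
 have IV: "is_functor B matcat ?I" using G.Ind_obj_functor[OF VF] .
 note o = fct_obj[OF G.fctG z'(1)] fct_obj[OF F.fctG z'(2)] fct_obj[OF F.fctG y0]
 note id = cat_idn[OF G.catB o(1)] and Fq = fct_hom[OF F.fctG q]
 have ul: "is_nat P matcat (whisk_r P (nt (unit_left X B G) V) p1)"
  "nsrc (whisk_r P (nt (unit_left X B G) V) p1) = fcmp V p1"
  "ntgt (whisk_r P (nt (unit_left X B G) V) p1) = fcmp ?I (fcmp G p1)"
  using Hom_RepD(1-3)[OF nat_hom[OF G.unit_left_nat V]] is_nat_whisk_r[OF category_P functor_p1]
  by (simp_all add: fcmp_assoc)
 have rc: "nt (res_cong P B taut) ?I : Hom (Rep P) (fcmp ?I (fcmp G p1)) (fcmp ?I (fcmp F p2))"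
  using nat_hom[OF taut.res_cong_nat IR] by (simp del: Rep_simps)
 have FI: "fcmp ?I F : Obj (Rep Y)" using F.Res_obj[OF IR] .
 let ?s1 = "nt (fm (Ind P Y p2) (whisk_r P (nt (unit_left X B G) V) p1)) y0"
 let ?s2 = "nt (fm (Ind P Y p2) (nt (res_cong P B taut) ?I)) y0"
 let ?s3 = "nt (nt (counit_left P Y p2) (fcmp ?I F)) y0"
 have L: "nt (nt BC V) y0 = ?s3 * (?s2 * ?s1)"
  using V y0 IR FI by (simp add: BC_steps bstep1_def bstep2_def bstep3_def)
 have q': "q : Hom Y (fo p2 (x, y, \<alpha>)) y0" using q by simp
 have c3: "?s3 : \<M> (G.dI V (fo F y0)) (p2.dI (fcmp ?I (fcmp F p2)) y0)"
  using p2.counit_carrier[OF FI y0] by (simp add: fcmp_assoc)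
 note c1 = p2.Ind_map_cm[OF ul y0] and c2 = p2.Ind_map_cm[OF Hom_RepD(1-3)[OF rc] y0]
 have VP: "is_functor P matcat (fcmp V p1)" using p1.Res_obj[OF V] by simp
 have W1: "is_functor P matcat (fcmp ?I (fcmp G p1))" and W2: "is_functor P matcat (fcmp ?I (fcmp F p2))"
  using Hom_RepD(4,5)[OF rc] by auto
 note i = p2.inj_cm[OF VP y0 z q'] p2.inj_cm[OF W1 y0 z q'] p2.inj_cm[OF W2 y0 z q']
 note j = G.inj_cm[OF VF o(1) z'(1) id] and a = rep_cm[OF IV z'(3)]
 have "?s1 * p2.\<iota> (fcmp V p1) y0 (x, y, \<alpha>) q = p2.\<iota> (fcmp ?I (fcmp G p1)) y0 (x, y, \<alpha>) q * G.\<iota> V (fo G x) x (Idn B (fo G x))"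
  using p2.Ind_map_inj[OF ul y0 z q'] z G.unit_left_component[OF V z'(1)] by simp
 moreover have "?s2 * (p2.\<iota> (fcmp ?I (fcmp G p1)) y0 (x, y, \<alpha>) q * G.\<iota> V (fo G x) x (Idn B (fo G x))) =
   p2.\<iota> (fcmp ?I (fcmp F p2)) y0 (x, y, \<alpha>) q * (fm ?I \<alpha> * G.\<iota> V (fo G x) x (Idn B (fo G x)))"
  using p2.Ind_map_inj[OF Hom_RepD(1-3)[OF rc] y0 z q'] taut.res_cong_component[OF IR z] z c2 i j a
  by (simp add: mat_assoc flip: mat_assoc[of ?s2])
 moreover have "?s3 * (p2.\<iota> (fcmp ?I (fcmp F p2)) y0 (x, y, \<alpha>) q * (fm ?I \<alpha> * G.\<iota> V (fo G x) x (Idn B (fo G x)))) =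
   fm ?I (fm F q) * (fm ?I \<alpha> * G.\<iota> V (fo G x) x (Idn B (fo G x)))"
  using p2.counit_inj[OF FI y0 z q'] c3 i j a by (simp add: fcmp_assoc flip: mat_assoc[of ?s3])
 ultimately show ?thesis
  using c1 c2 c3 i G.Ind_obj_inj[OF VF z'(3,1) id] G.Ind_obj_inj[OF VF Fq z'(1,3)] cat_idr[OF G.catB z'(3)]
  by (simp add: L mat_assoc)
qed

text \<open>The inverse sends the injection at \<open>(x, h)\<close> to the injection at the object
  \<open>(x, y0, h)\<close> with the identity of \<open>y0\<close>.\<close>

lemma BC_iso: "is_iso matcat (nt (nt BC V) y0)"
proof -
 note VF = Rep_objD(1)[OF V] and Fy = fct_obj[OF F.fctG y0]
 have VP: "is_functor P matcat (fcmp V p1)" using p1.Res_obj[OF V] by simp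
 note idy = cat_idn[OF F.catX y0]
 let ?\<theta> = "%x h. p2.\<iota> (fcmp V p1) y0 (x, y0, h) (Idn Y y0)"
 have o: "(x, y0, h) : Obj P" if "x : Obj X" "h : Hom B (fo G x) (fo F y0)" for x h
  using that y0 by (simp add: Obj_P)
 have coc: "ind_cocone X B G V (fo F y0) (p2.dI (fcmp V p1) y0) ?\<theta>"
 proof (rule ind_coconeI)
  show "?\<theta> x h : \<M> (p2.dI (fcmp V p1) y0) (fo V x)" if "x : Obj X" "h : Hom B (fo G x) (fo F y0)" for x h
   using p2.inj_cm[OF VP y0 o[OF that], of "Idn Y y0"] idy by simp
  fix x x' k h assume k: "k : Hom X x x'" and h: "h : Hom B (fo G x') (fo F y0)"
  note ox = dom_obj[OF k G.catX] and hk = G.cmp_G[OF k h]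
  have "((x, y0, Cmp B h (fm G k)), (x', y0, h), k, Idn Y y0) : Hom P (x, y0, Cmp B h (fm G k)) (x', y0, h)"
   using o[OF ox(2) h] o[OF ox(1) hk] k idy by (simp add: Hom_P fct_idn[OF F.fctG y0] cat_idl[OF G.catB hk])
  from p2.inj_nat[OF VP y0 this, of "Idn Y y0"] show "?\<theta> x' h * fm V k = ?\<theta> x (Cmp B h (fm G k))"
   using idy cat_idl[OF F.catX idy] by simp
 qed
 define N where "N = ind_desc X B G V (fo F y0) (p2.dI (fcmp V p1) y0) ?\<theta>"
 have Nc: "N : \<M> (p2.dI (fcmp V p1) y0) (G.dI V (fo F y0))"
  unfolding N_def by (rule G.desc_carrier[OF VF Fy coc])
 have Ni: "N * G.\<iota> V (fo F y0) x h = ?\<theta> x h" if "x : Obj X" "h : Hom B (fo G x) (fo F y0)" for x h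
  unfolding N_def by (rule G.desc_inj[OF VF Fy coc that])
 have 1: "nt (nt BC V) y0 * N = 1\<^sub>m (G.dI V (fo F y0))"
 proof (rule G.ind_eqI[OF VF Fy])
  fix x h assume x: "x : Obj X" "h : Hom B (fo G x) (fo F y0)"
  show "nt (nt BC V) y0 * N * G.\<iota> V (fo F y0) x h = 1\<^sub>m (G.dI V (fo F y0)) * G.\<iota> V (fo F y0) x h"
   using BC_carrier Nc G.inj_cm[OF VF Fy x] BC_inj[OF o[OF x] idy] fct_idn[OF F.fctG y0] cat_idl[OF G.catB x(2)]
   by (simp add: mat_assoc Ni[OF x])
 qed (use BC_carrier Nc in auto)
 have 2: "N * nt (nt BC V) y0 = 1\<^sub>m (p2.dI (fcmp V p1) y0)"
 proof (rule p2.ind_eqI[OF VP y0])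
  fix z q assume z: "z : Obj P" and q: "q : Hom Y (fo p2 z) y0"
  obtain x y \<alpha> where xy: "z = (x, y, \<alpha>)" by (cases z)
  have z': "x : Obj X" "y : Obj Y" "\<alpha> : Hom B (fo G x) (fo F y)" using z by (simp_all add: Obj_P xy)
  have q': "q : Hom Y y y0" using q by (simp add: xy)
  note qa = cat_cmp[OF G.catB z'(3) fct_hom[OF F.fctG q']]
  \<comment> \<open>The arrow with components 1 and \<open>q\<close> replaces an arbitrary index by
    one lying over \<open>y0\<close> with identity arrow, where the candidate inverse is
    defined.\<close>
  have "((x, y, \<alpha>), (x, y0, Cmp B (fm F q) \<alpha>), Idn X x, q) : Hom P (x, y, \<alpha>) (x, y0, Cmp B (fm F q) \<alpha>)"
   using z o[OF z'(1) qa] q' cat_idn[OF G.catX z'(1)] cat_idr[OF G.catB qa] by (simp add: Hom_P xy fct_idn[OF G.fctG z'(1)])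
  from p2.inj_nat[OF VP y0 this, of "Idn Y y0"]
  have "?\<theta> x (Cmp B (fm F q) \<alpha>) = p2.\<iota> (fcmp V p1) y0 (x, y, \<alpha>) q"
   using idy cat_idl[OF F.catX q'] rep_idn[OF VF z'(1)] p2.inj_cm[OF VP y0 o[OF z'(1) qa], of "Idn Y y0"] by simp
  thus "N * nt (nt BC V) y0 * p2.\<iota> (fcmp V p1) y0 z q = 1\<^sub>m (p2.dI (fcmp V p1) y0) * p2.\<iota> (fcmp V p1) y0 z q"
   using BC_carrier Nc p2.inj_cm[OF VP y0 z q] BC_inj[OF z[unfolded xy] q'] Ni[OF z'(1) qa] by (simp add: mat_assoc xy)
 qed (use BC_carrier Nc in auto)
 show ?thesis using matcat_isoI(1)[OF BC_carrier Nc 1 2] .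
qed

end

lemma BC_Rep_iso: "V : Obj (Rep X) ==> is_iso (Rep Y) (nt BC V)"
 using Rep_iso(1)[OF F.catX _ BC_iso] nat_hom[OF BC_nat] by (auto simp: homset_def simp del: Rep_simps)

end

locale span_comp = cospan_covers X Y B G K + FA: cover X A F + JC: cover Y C J
 for X :: "('x, 'xm) cat" and Y :: "('y, 'ym) cat" and B :: "('b, 'bm) cat" and A :: "('a, 'am) cat" and C :: "('c, 'cm) cat"
  and G F J K
begin

sublocale p2J: cover2 P Y C p2 J by standard
sublocale Fp1: cover P A "fcmp F p1"
 by standard (rule finite_cover_fcmp[OF cover_p1 FA.finite_cover])

abbreviation "sp \<equiv> \<lparr>apex = X, lbase = B, rbase = A, lleg = G, rleg = F\<rparr>"
abbreviation "sq \<equiv> \<lparr>apex = Y, lbase = C, rbase = B, lleg = J, rleg = K\<rparr>"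
abbreviation "LC \<equiv> Lam_comp sq sp"

lemma comp_span_eq: "comp_span sq sp = \<lparr>apex = P, lbase = C, rbase = A, lleg = fcmp J p2, rleg = fcmp F p1\<rparr>"
 by (simp add: comp_span_def pb_def)

definition "lstep1 = whisk_r (Rep A) (ind_comp P Y C p2 J) (Res P (fcmp F p1))"
definition "lstep2 = whisk_l (Rep A) (Ind Y C J) (whisk_r (Rep A) BC (Res X F))"

lemma LC_steps: "LC = vcomp (Rep A) (Rep C) lstep2 lstep1"
 by (simp add: Lam_comp_def Let_def lstep1_def lstep2_def pb_def)

lemmas cRA = category_Rep[OF FA.catB] and cRC = category_Rep[OF JC.catB]

lemma LC_nat: "is_nat (Rep A) (Rep C) LC"
 and LC_ends: "nsrc LC = Lam1 (comp_span sq sp)" "ntgt LC = fcmp (Lam1 sq) (Lam1 sp)"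
proof -
 have n: "is_nat (Rep A) (Rep C) lstep1" "is_nat (Rep A) (Rep C) lstep2"
  unfolding lstep1_def lstep2_def
  subgoal by (rule is_nat_whisk_r[OF cRA Fp1.functor_Res p2J.ind_comp_nat])
  subgoal by (rule is_nat_whisk_l[OF cRA is_nat_whisk_r[OF cRA FA.functor_Res BC_nat] JC.functor_Ind])
  done
 have e: "nsrc lstep2 = ntgt lstep1"
  by (simp add: lstep1_def lstep2_def BC_ends fcmp_assoc[symmetric] Res_fcmp[OF functor_p1])
 show "is_nat (Rep A) (Rep C) LC" unfolding LC_steps by (intro is_nat_vcomp[OF cRA cRC] n e)
 show "nsrc LC = Lam1 (comp_span sq sp)" "ntgt LC = fcmp (Lam1 sq) (Lam1 sp)"
  by (simp_all add: LC_steps lstep1_def lstep2_def BC_ends Lam1_def comp_span_eq fcmp_assoc)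
qed

context
 fixes V assumes V: "V : Obj (Rep A)"
begin

lemma VX: "fcmp V F : Obj (Rep X)" and VP: "fcmp V (fcmp F p1) : Obj (Rep P)"
 using FA.Res_obj[OF V] Fp1.Res_obj[OF V] .

lemma BC_VF: "nt BC (fcmp V F) : Hom (Rep Y) (Ind_obj P Y p2 (fcmp V (fcmp F p1))) (fcmp (Ind_obj X B G (fcmp V F)) K)"
 using nat_hom[OF BC_nat VX] by (simp add: BC_ends fcmp_assoc del: Rep_simps)

text \<open>\<open>ind_comp\<close> separates the outer index \<open>g\<close> from the object
  \<open>(x, y, \<alpha>)\<close>; the Beck-Chevalley map, evaluated at an identity, then leaves
  \<open>\<alpha>\<close> as the inner index.\<close>

lemma LC_inj:
 assumes c: "c : Obj C" and z: "(x, y, \<alpha>) : Obj P" and g: "g : Hom C (fo J y) c"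
 shows "nt (nt LC V) c * ind_inj P C (fcmp J p2) (fcmp V (fcmp F p1)) c (x, y, \<alpha>) g =
  ind_inj Y C J (fcmp (Ind_obj X B G (fcmp V F)) K) c y g * ind_inj X B G (fcmp V F) (fo K y) x \<alpha>"
proof -
 let ?I = "Ind_obj P Y p2 (fcmp V (fcmp F p1))" and ?I' = "fcmp (Ind_obj X B G (fcmp V F)) K"
 have z': "x : Obj X" "y : Obj Y" "\<alpha> : Hom B (fo G x) (fo K y)" using z by (simp_all add: Obj_P)
 have g': "g : Hom C (fo J (fo p2 (x, y, \<alpha>))) c" "g : Hom C (fo (fcmp J p2) (x, y, \<alpha>)) c" using g by simp_all
 note bc = Hom_RepD[OF BC_VF]
 note I = Rep_objD(1)[OF bc(4)] Rep_objD(1)[OF bc(5)]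
 note idy = cat_idn[OF F.catX z'(2)]
 have idy': "Idn Y y : Hom Y (fo p2 (x, y, \<alpha>)) y" using idy by simp
 note i0 = p2J.GS.inj_cm[OF Rep_objD(1)[OF VP] c z g'(2)] and i1 = JC.inj_cm[OF I(1) c z'(2) g]
  and i2 = p2.inj_cm[OF Rep_objD(1)[OF VP] z'(2) z idy'] and i3 = JC.inj_cm[OF I(2) c z'(2) g]
 note c1 = p2J.ind_comp_cm[OF VP c] and c2 = JC.Ind_map_cm[OF bc(1-3) c]
 note b = intw_cm[OF bc(1) z'(2), unfolded bc]
 have "nt (nt LC V) c = nt (fm (Ind Y C J) (nt BC (fcmp V F))) c * nt (nt (ind_comp P Y C p2 J) (fcmp V (fcmp F p1))) c"
  using V c by (simp add: LC_steps lstep1_def lstep2_def)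
 thus ?thesis
  using i0 i1 i2 i3 c1 c2 b p2J.ind_comp_inj[OF VP c z g'(1)] JC.Ind_map_inj[OF bc(1-3) c z'(2) g]
   BC_inj[OF VX z'(2) z idy] fct_idn[OF F.fctG z'(2)] cat_idl[OF G.catB z'(3)]
  by (simp add: mat_assoc fcmp_assoc flip: mat_assoc[of "nt (fm (Ind Y C J) (nt BC (fcmp V F))) c"])
qed

lemma LC_carrier:
 assumes c: "c : Obj C"
 shows "nt (nt LC V) c : \<M> (ind_dim Y C J (fcmp (Ind_obj X B G (fcmp V F)) K) c) (ind_dim P C (fcmp J p2) (fcmp V (fcmp F p1)) c)"
 using intw_cm[OF Hom_RepD(1)[OF nat_hom[OF LC_nat V]] c] Hom_RepD(2,3)[OF nat_hom[OF LC_nat V]]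
 by (simp add: LC_ends Lam1_def comp_span_eq)

lemma LC_iso: "is_iso (Rep C) (nt LC V)"
proof -
 have "nt LC V = vcomp C matcat (fm (Ind Y C J) (nt BC (fcmp V F))) (nt (ind_comp P Y C p2 J) (fcmp V (fcmp F p1)))"
  using V by (simp add: LC_steps lstep1_def lstep2_def)
 moreover have "is_iso (Rep C) (Cmp (Rep C) (fm (Ind Y C J) (nt BC (fcmp V F))) (nt (ind_comp P Y C p2 J) (fcmp V (fcmp F p1))))"
 proof (rule iso_cmp[OF cRC])
  show "nt (ind_comp P Y C p2 J) (fcmp V (fcmp F p1)) : Hom (Rep C) (Ind_obj P C (fcmp J p2) (fcmp V (fcmp F p1)))
    (fo (Ind Y C J) (Ind_obj P Y p2 (fcmp V (fcmp F p1))))"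
   using nat_hom[OF p2J.ind_comp_nat VP] by (simp del: Rep_simps)
  show "is_iso (Rep C) (nt (ind_comp P Y C p2 J) (fcmp V (fcmp F p1)))" by (rule p2J.ind_comp_Rep_iso[OF VP])
  show "fm (Ind Y C J) (nt BC (fcmp V F)) : Hom (Rep C) (fo (Ind Y C J) (Ind_obj P Y p2 (fcmp V (fcmp F p1))))
    (fo (Ind Y C J) (fcmp (Ind_obj X B G (fcmp V F)) K))" by (rule fct_hom[OF JC.functor_Ind BC_VF])
  show "is_iso (Rep C) (fm (Ind Y C J) (nt BC (fcmp V F)))"
   by (rule functor_iso[OF JC.functor_Ind cRY BC_Rep_iso[OF VX]])
 qed
 ultimately show ?thesis by simp
qed

end

end

locale strict_covers = SG: cover2 Z X B S G + TJ: cover2 Z Y B T J + SF: cover2 Z X A S F + TK: cover2 Z Y A T K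
 for Z :: "('w, 'wm) cat" and X :: "('x, 'xm) cat" and Y :: "('y, 'ym) cat" and B :: "('b, 'bm) cat" and A :: "('a, 'am) cat"
  and S T G J F K +
 assumes GS_JT: "fcmp G S = fcmp J T" and FS_KT: "fcmp F S = fcmp K T"
begin

sublocale sspan_covers Z X Y B A S T G J F K "nt_id Z B (fcmp G S)" "nt_id Z A (fcmp F S)"
 by standard (use GS_JT FS_KT is_nat_id[OF SG.S.catX SG.G.catB SG.GS.fctG] is_nat_id[OF SG.S.catX SF.G.catB SF.GS.fctG] in simp_all)

lemma strict_sspan_eq: "strict_sspan dom_span cod_span Z S T = ss"
 by (simp add: strict_sspan_def nt_id_def GS_JT FS_KT)

text \<open>The pull-push formula with both 2-cells identities, whose index shift and coefficient
  action disappear.\<close>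

lemma Lam2_strict_inj:
 assumes V: "V : Obj (Rep A)" and b: "b : Obj B" and x: "x : Obj X" and g: "g : Hom B (fo G x) b" and R: "reps Z X S x R"
 shows "nt (nt (Lam2 ss) V) b * ind_inj X B G (fcmp V F) b x g =
  mat_sum (ind_dim Y B J (fcmp V K) b) (fo V (fo F x))
   (%(z, h). ind_inj Y B J (fcmp V K) b (fo T z) (Cmp B g (fm G h)) * fm V (fm F (cat_inv X h))) R"
 unfolding Lam2_inj[OF V b x g R]
proof (rule mat_sum_cong)
 fix p assume p: "p : R"
 obtain z h where zh: "p = (z, h)" by force
 note i = reps_in[OF R p[unfolded zh]]
 note o = fct_obj[OF SG.GS.fctG i(1)] fct_obj[OF SF.GS.fctG i(1)]
 note gh = SG.G.cmp_G[OF i(2) g]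
 have c: "fm V (fm F (cat_inv X h)) : \<M> (fo V (fo F (fo S z))) (fo V (fo F x))"
  using rep_cm[OF Rep_objD(1)[OF V] fct_hom[OF SF.G.fctG grp_inv[OF SG.S.groupoids(2) i(2)]]] .
 show "(case p of (z, h) => ind_inj Y B J (fcmp V K) b (fo T z) (Cmp B (Cmp B g (fm G h)) (cat_inv B (nt (nt_id Z B (fcmp G S)) z))) *
    (fm V (nt (nt_id Z A (fcmp F S)) z) * fm V (fm F (cat_inv X h)))) =
   (case p of (z, h) => ind_inj Y B J (fcmp V K) b (fo T z) (Cmp B g (fm G h)) * fm V (fm F (cat_inv X h)))"
  using i(1) o c rep_idn[OF Rep_objD(1)[OF V] o(2)] cat_idr[OF SG.G.catB gh] by (simp add: zh cat_inv_Idn[OF SG.G.catB])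
qed simp

end

lemma strict_covers_conv:
 assumes "strict_covers Z X Y B A S T G J F K"
 shows "strict_covers Z Y X B A T S J G K F"
 using assms unfolding strict_covers_def strict_covers_axioms_def by auto

text \<open>Inverses of identity 2-cells are identities and the conditions on the legs are
  symmetric, so the converse is evaluated by the same strict formula.\<close>

lemma conv_strict_sspan:
 assumes "strict_covers Z X Y B A S T G J F K"
 shows "conv_sspan (strict_sspan \<lparr>apex = X, lbase = B, rbase = A, lleg = G, rleg = F\<rparr> \<lparr>apex = Y, lbase = B, rbase = A, lleg = J, rleg = K\<rparr> Z S T) =
  strict_sspan \<lparr>apex = Y, lbase = B, rbase = A, lleg = J, rleg = K\<rparr> \<lparr>apex = X, lbase = B, rbase = A, lleg = G, rleg = F\<rparr> Z T S"
proof -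
 interpret strict_covers Z X Y B A S T G J F K by fact
 have e: "fo G (fo S z) = fo J (fo T z)" "fo F (fo S z) = fo K (fo T z)" for z
  using arg_cong[OF GS_JT, of "%H. fo H z"] arg_cong[OF FS_KT, of "%H. fo H z"] by simp_all
 show ?thesis
  unfolding conv_sspan_def strict_sspan_def nt_inv_def
  by (auto simp: e fun_eq_iff restrict_def cat_inv_Idn[OF SG.G.catB fct_obj[OF TJ.GS.fctG, unfolded fcmp_simps]]
    cat_inv_Idn[OF SF.G.catB fct_obj[OF TK.GS.fctG, unfolded fcmp_simps]])
qed

lemma reps_idF:
 assumes "groupoid X" "x : Obj X"
 shows "reps X X idF x {(x, Idn X x)}"
 using assms cat_idl[OF groupoid_cat[OF assms(1)]] cat_idn[OF groupoid_cat[OF assms(1)]]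
 by (intro repsI) auto

locale graph_covers = strict_covers X X Y B A idF T G J F K
 for X :: "('x, 'xm) cat" and Y :: "('y, 'ym) cat" and B :: "('b, 'bm) cat" and A :: "('a, 'am) cat"
  and T G J F K
begin

text \<open>When \<open>S\<close> is the identity, \<open>(x, 1)\<close> is the only class of lifts.
  The graph of a functor \<open>T\<close> therefore merely relabels injections.\<close>

lemma Lam2_graph_inj:
 assumes V: "V : Obj (Rep A)" and b: "b : Obj B" and x: "x : Obj X" and g: "g : Hom B (fo G x) b"
 shows "nt (nt (Lam2 ss) V) b * ind_inj X B G (fcmp V F) b x g = ind_inj Y B J (fcmp V K) b (fo T x) g"
proof -
 have Gx: "fo G x = fo J (fo T x)" "fo F x = fo K (fo T x)"
  using arg_cong[OF GS_JT, of "%H. fo H x"] arg_cong[OF FS_KT, of "%H. fo H x"] by simp_all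
 note Tx = fct_obj[OF TJ.S.fctG x]
 have i: "ind_inj Y B J (fcmp V K) b (fo T x) g : \<M> (ind_dim Y B J (fcmp V K) b) (fo V (fo F x))"
  using TJ.G.inj_cm[OF VY(1)[OF V b] b Tx g[unfolded Gx]] Gx by simp
 show ?thesis
  unfolding Lam2_strict_inj[OF V b x g reps_idF[OF SG.S.groupoids(1) x]]
  using i x fct_idn[OF SG.G.fctG x] fct_idn[OF SF.G.fctG x] fct_obj[OF SF.G.fctG x]
   rep_idn[OF Rep_objD(1)[OF V]] cat_idr[OF SG.G.catB g] by (simp add: cat_inv_Idn[OF SG.S.catX])
qed

text \<open>One representative in every comma groupoid means that \<open>T\<close> is an
  equivalence. The inverse is \<open>\<Lambda>\<close> of the converse span of spans, whose sum over
  lifts then has a single term as well.\<close>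

lemma Lam2_equivalence_iso:
 assumes equivalence: "!!y. y : Obj Y ==> EX p. reps X Y T y {p}"
  and V: "V : Obj (Rep A)"
 shows "is_iso (Rep B) (nt (Lam2 ss) V)"
proof (rule Rep_iso(1)[OF SG.G.catB])
 show "nt (Lam2 ss) V : Arr (Rep B)" using nat_hom[OF Lam2_nat V] by (simp only: homset_def mem_Collect_eq)
 fix b assume b: "b : Obj B"
 interpret c: strict_covers X Y X B A T idF J G K F by (rule strict_covers_conv) unfold_locales
 let ?M = "nt (nt (Lam2 ss) V) b" and ?N = "nt (nt (Lam2 c.ss) V) b"
 note Mc = Lam2_carrier[OF V b] and Nc = c.Lam2_carrier[OF V b]
 note VF' = Rep_objD(1)[OF V] and VXf = VX(1)[OF V b] and VYf = VY(1)[OF V b]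
 have e: "fo G x = fo J (fo T x)" "fm G k = fm J (fm T k)" "fo F x = fo K (fo T x)" "fm F k = fm K (fm T k)" for x k
  using arg_cong[OF GS_JT, of "%H. fo H x"] arg_cong[OF GS_JT, of "%H. fm H k"]
   arg_cong[OF FS_KT, of "%H. fo H x"] arg_cong[OF FS_KT, of "%H. fm H k"] by simp_all
 have N: "EX z h. z : Obj X & h : Hom Y (fo T z) y & reps X Y T y {(z, h)} &
   ?N * ind_inj Y B J (fcmp V K) b y g = ind_inj X B G (fcmp V F) b z (Cmp B g (fm J h)) * fm V (fm K (cat_inv Y h))"
  if y: "y : Obj Y" and g: "g : Hom B (fo J y) b" for y g
 proof -
  obtain p where "reps X Y T y {p}" using equivalence[OF y] by blast
  then obtain z h where R: "reps X Y T y {(z, h)}" by (cases p) simp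
  have zh: "z : Obj X" "h : Hom Y (fo T z) y" using reps_in[OF R, of z h] by auto
  have gh: "Cmp B g (fm J h) : Hom B (fo G z) b" using TJ.G.cmp_G[OF zh(2) g] by (simp add: e)
  have "ind_inj X B G (fcmp V F) b z (Cmp B g (fm J h)) * fm V (fm K (cat_inv Y h)) \<in>
   \<M> (ind_dim X B G (fcmp V F) b) (fo V (fo K y))"
   using SG.G.inj_cm[OF VXf b zh(1) gh]
    rep_cm[OF VF' fct_hom[OF TK.G.fctG grp_inv[OF TJ.S.groupoids(2) zh(2)]]] by (simp add: e)
  hence "?N * ind_inj Y B J (fcmp V K) b y g = ind_inj X B G (fcmp V F) b z (Cmp B g (fm J h)) * fm V (fm K (cat_inv Y h))"
   using c.Lam2_strict_inj[OF V b y g R] by simp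
  thus ?thesis using zh R by blast
 qed
 have M: "?M * ind_inj X B G (fcmp V F) b x g = ind_inj Y B J (fcmp V K) b (fo T x) g"
  if "x : Obj X" "g : Hom B (fo G x) b" for x g using Lam2_graph_inj[OF V b that] .
 have 1: "?N * ?M = 1\<^sub>m (ind_dim X B G (fcmp V F) b)"
 proof (rule SG.G.ind_eqI[OF VXf b])
  fix x g assume x: "x : Obj X" and g: "g : Hom B (fo G x) b"
  note Tx = fct_obj[OF TJ.S.fctG x] and g' = g[unfolded e]
  obtain z h where zh: "z : Obj X" "h : Hom Y (fo T z) (fo T x)" and R: "reps X Y T (fo T x) {(z, h)}"
   and n: "?N * ind_inj Y B J (fcmp V K) b (fo T x) g = ind_inj X B G (fcmp V F) b z (Cmp B g (fm J h)) * fm V (fm K (cat_inv Y h))"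
   using N[OF Tx g'] by blast
  \<comment> \<open>\<open>x\<close> with the identity of \<open>T x\<close> is itself an object
    over \<open>T x\<close>, so it is connected to the representative \<open>z\<close>. This
    identifies the inverse of \<open>h\<close> with \<open>T k\<close>.\<close>
  obtain k where k: "k : Hom X x z" "Cmp Y h (fm T k) = Idn Y (fo T x)"
   using reps_ex[OF R x cat_idn[OF TJ.S.catB Tx]] by auto
  note Tk = fct_hom[OF TJ.S.fctG k(1)]
  note hi = grp_inv[OF TJ.S.groupoids(2) zh(2)]
  have hk: "cat_inv Y h = fm T k"
   using cat_assoc[OF TJ.S.catB Tk zh(2) hi] grp_inv_left[OF TJ.S.groupoids(2) zh(2)] cat_idl[OF TJ.S.catB Tk] cat_idr[OF TJ.S.catB hi] k(2)
   by simp
  have gh: "Cmp B g (fm J h) : Hom B (fo G z) b" using TJ.G.cmp_G[OF zh(2) g'] by (simp add: e)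
  have "Cmp B (Cmp B g (fm J h)) (fm G k) = g"
   using cat_assoc[OF SG.G.catB fct_hom[OF TJ.G.fctG Tk] fct_hom[OF TJ.G.fctG zh(2)] g']
    fct_cmp[OF TJ.G.fctG Tk zh(2)] k(2) fct_idn[OF TJ.G.fctG Tx] cat_idr[OF SG.G.catB g'] by (simp add: e)
  hence "?N * ind_inj Y B J (fcmp V K) b (fo T x) g = ind_inj X B G (fcmp V F) b x g"
   using n hk SG.G.inj_nat[OF VXf b k(1) gh] by (simp add: e)
  thus "?N * ?M * ind_inj X B G (fcmp V F) b x g = 1\<^sub>m (ind_dim X B G (fcmp V F) b) * ind_inj X B G (fcmp V F) b x g"
   using Mc Nc SG.G.inj_cm[OF VXf b x g] M[OF x g] by (simp add: mat_assoc)
 qed (use Mc Nc in auto)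
 have 2: "?M * ?N = 1\<^sub>m (ind_dim Y B J (fcmp V K) b)"
 proof (rule TJ.G.ind_eqI[OF VYf b])
  fix y g assume y: "y : Obj Y" and g: "g : Hom B (fo J y) b"
  obtain z h where zh: "z : Obj X" "h : Hom Y (fo T z) y"
   and n: "?N * ind_inj Y B J (fcmp V K) b y g = ind_inj X B G (fcmp V F) b z (Cmp B g (fm J h)) * fm V (fm K (cat_inv Y h))"
   using N[OF y g] by blast
  have gh: "Cmp B g (fm J h) : Hom B (fo G z) b" using TJ.G.cmp_G[OF zh(2) g] by (simp add: e)
  note hi = grp_inv[OF TJ.S.groupoids(2) zh(2)]
  note Kh = fct_hom[OF TK.G.fctG zh(2)] and Khi = fct_hom[OF TK.G.fctG hi]
  note i = TJ.G.inj_cm[OF VYf b y g] SG.G.inj_cm[OF VXf b zh(1) gh]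
  note r = rep_cm[OF VF' Kh] rep_cm[OF VF' Khi]
  have "?M * (?N * ind_inj Y B J (fcmp V K) b y g) = ind_inj Y B J (fcmp V K) b (fo T z) (Cmp B g (fm J h)) * fm V (fm K (cat_inv Y h))"
   unfolding n M[OF zh(1) gh, symmetric] by (rule mat_assoc[symmetric]) (use Mc i r in \<open>simp_all add: e\<close>)
  also have "\<dots> = ind_inj Y B J (fcmp V K) b y g * (fm V (fm K h) * fm V (fm K (cat_inv Y h)))"
   unfolding TJ.G.inj_nat[OF VYf b zh(2) g, symmetric] fcmp_simps
   by (rule mat_assoc) (use i r in simp_all)
  also have "fm V (fm K h) * fm V (fm K (cat_inv Y h)) = 1\<^sub>m (fo V (fo K y))"
   using rep_cmp[OF VF' Khi Kh] fct_cmp[OF TK.G.fctG hi zh(2)] grp_inv_right[OF TJ.S.groupoids(2) zh(2)]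
    fct_idn[OF TK.G.fctG y] rep_idn[OF VF' fct_obj[OF TK.G.fctG y]] by simp
  finally show "?M * ?N * ind_inj Y B J (fcmp V K) b y g = 1\<^sub>m (ind_dim Y B J (fcmp V K) b) * ind_inj Y B J (fcmp V K) b y g"
   using Mc Nc i by (simp add: mat_assoc)
 qed (use Mc Nc in auto)
 show "is_iso matcat ?M" using matcat_isoI(1)[OF Mc Nc 2 1] .
qed

end


section \<open>Finite sets and bijections\<close>

lemma SS_simps [simp]: "Obj SS = {s. finite s}" "Dom SS = dom" "Cod SS = ran" "Idn SS s = Some |` s" "Cmp SS = (oo)"
 by (simp_all add: SS_def)

lemma Hom_SS: "f : Hom SS s t \<longleftrightarrow> finite s & dom f = s & ran f = t & inj_on f s"
 by (auto simp: homset_def SS_def)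

lemma SS_eval:
 assumes "f : Hom SS s t"
 shows "n : s ==> \<exists>m\<in>t. f n = Some m" "n \<notin> s ==> f n = None" "m : t ==> \<exists>n\<in>s. f n = Some m"
  "f n = Some m ==> n : s & m : t" "f n = Some m ==> f n' = Some m ==> n = n'" "finite s" "finite t"
proof -
 have f: "finite s" "dom f = s" "ran f = t" "inj_on f s" using assms by (auto simp: Hom_SS)
 show e: "f n = Some m ==> n : s & m : t" for n m using f by (auto simp: ran_def)
 show "n : s ==> \<exists>m\<in>t. f n = Some m" using f by (force simp: ran_def)
 show "n \<notin> s ==> f n = None" using f by auto
 show "m : t ==> \<exists>n\<in>s. f n = Some m" using f by (force simp: ran_def)
 show "f n = Some m ==> f n' = Some m ==> n = n'" using inj_onD[OF f(4), of n n'] e[of n m] e[of n' m] by simp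
 show "finite s" "finite t" using f finite_ran by auto
qed

lemma Hom_SSI:
 assumes "finite s" "!!n. n : s ==> \<exists>m\<in>t. f n = Some m" "!!n. n \<notin> s ==> f n = None" "!!m. m : t ==> \<exists>n\<in>s. f n = Some m"
  and "!!n n' m. n : s ==> n' : s ==> f n = Some m ==> f n' = Some m ==> n = n'"
 shows "f : Hom SS s t"
proof -
 have "dom f = s" using assms(2,3) by (force simp: dom_def)
 moreover have "ran f = t" 
 proof
  show "ran f \<subseteq> t"
  proof
   fix m assume "m : ran f"
   then obtain n where n: "f n = Some m" by (auto simp: ran_def)
   hence "n : s" using assms(3) by fastforce
   thus "m : t" using assms(2) n by fastforce
  qed
  show "t \<subseteq> ran f" using assms(4) by (auto simp: ran_def)
 qed
 moreover have "inj_on f s" using assms(2,5) by (intro inj_onI) metis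
 ultimately show ?thesis using assms(1) by (simp add: Hom_SS)
qed

lemma cat_SS: "category SS"
proof (rule categoryI)
 fix f a b assume f: "f : Hom SS a b"
 note e = SS_eval[OF f]
 show "a : Obj SS & b : Obj SS" using e(6,7) by simp
 show "Cmp SS f (Idn SS a) = f" using e(2) by (auto simp: fun_eq_iff map_comp_def restrict_map_def)
 show "Cmp SS (Idn SS b) f = f" using e(4) by (auto simp: fun_eq_iff map_comp_def restrict_map_def split: option.splits)
next
 fix f g a b c assume f: "f : Hom SS a b" and g: "g : Hom SS b c"
 note e = SS_eval[OF f] and d = SS_eval[OF g]
 show "Cmp SS g f : Hom SS a c"
 proof (rule Hom_SSI)
  show "\<exists>m\<in>c. Cmp SS g f n = Some m" if "n : a" for n using e(1)[OF that] d(1) by (auto simp: map_comp_def)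
  show "\<exists>n\<in>a. Cmp SS g f n = Some m" if m: "m : c" for m
  proof -
   obtain k where k: "k : b" "g k = Some m" using d(3)[OF m] by blast
   obtain n where n: "n : a" "f n = Some k" using e(3)[OF k(1)] by blast
   show ?thesis by (rule bexI[OF _ n(1)]) (simp add: map_comp_def n k)
  qed
  show "n = n'" if "Cmp SS g f n = Some m" "Cmp SS g f n' = Some m" for n n' m
   using that d(5) e(5) by (auto simp: map_comp_def split: option.splits)
 qed (use e in \<open>auto simp: map_comp_def\<close>)
next
 fix s assume "s : Obj SS" thus "Idn SS s : Hom SS s s"
  by (intro Hom_SSI) (auto simp: restrict_map_def split: if_splits)
next
 fix f g h :: fset_bij
 show "Cmp SS h (Cmp SS g f) = Cmp SS (Cmp SS h g) f"
  by (auto simp: fun_eq_iff map_comp_def split: option.splits)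
qed

lemma groupoid_SS: "groupoid SS"
 unfolding groupoid_def
proof (intro conjI ballI cat_SS)
 fix f assume "f : Arr SS"
 hence f: "f : Hom SS (dom f) (ran f)" using Arr_homset[of f SS] by simp
 note e = SS_eval[OF f]
 define g where "g m = (if m : ran f then Some (SOME n. f n = Some m) else None)" for m
 have fg: "EX n. g m = Some n & f n = Some m" if "m : ran f" for m
  using that someI_ex[of "%n. f n = Some m"] by (auto simp: g_def ran_def)
 have gf: "g m = Some n" if "f n = Some m" for m n
  using fg[of m] that e(5) by (metis e(4))
 have g: "g : Hom SS (ran f) (dom f)"
 proof (rule Hom_SSI)
  show "\<exists>m\<in>dom f. g n = Some m" if "n : ran f" for n using fg[OF that] by auto
  show "\<exists>n\<in>ran f. g n = Some m" if "m : dom f" for m using that gf e(4) by blast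
  show "n = n'" if "n : ran f" "n' : ran f" "g n = Some m" "g n' = Some m" for n n' m
   using fg[OF that(1)] fg[OF that(2)] that(3,4) by simp
 qed (use e in \<open>auto simp: g_def\<close>)
 have "inverse_arrows SS f g"
 proof (rule inv_arrowsI[OF f g])
  show "Cmp SS g f = Idn SS (dom f)"
   using gf by (auto simp: fun_eq_iff map_comp_def restrict_map_def split: option.splits)
  show "Cmp SS f g = Idn SS (ran f)"
  proof
   fix m show "Cmp SS f g m = Idn SS (ran f) m"
    using fg[of m] by (cases "m : ran f") (auto simp: map_comp_def restrict_map_def g_def)
  qed
 qed
 thus "is_iso SS f" unfolding is_iso_def by (rule exI[of _ g])
qed

section \<open>Adding one element to a finite set\<close>

lemma plus1_fo: "sc s = insert 0 (Suc ` s)"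
 and plus1_0 [simp]: "scm f 0 = Some 0"
 and plus1_Suc [simp]: "scm f (Suc n) = map_option Suc (f n)"
 by (simp_all add: plus1_def)

lemma plus1_hom: "f : Hom SS s t ==> scm f : Hom SS (sc s) (sc t)"
proof (rule Hom_SSI)
 assume f: "f : Hom SS s t"
 note e = SS_eval[OF f]
 show "finite (sc s)" using e by (simp add: plus1_fo)
 show "\<exists>m\<in>sc t. scm f n = Some m" if "n : sc s" for n
  using that e(1) by (cases n) (fastforce simp: plus1_fo)+
 show "scm f n = None" if "n \<notin> sc s" for n using that e(2) by (cases n) (auto simp: plus1_fo)
 show "\<exists>n\<in>sc s. scm f n = Some m" if mt: "m : sc t" for m
 proof (cases m)
  case 0
  thus ?thesis by (intro bexI[of _ 0]) (simp_all add: plus1_fo)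
 next
  case (Suc k)
  then obtain n where "n : s" "f n = Some k" using mt Suc e(3)[of k] by (auto simp: plus1_fo)
  thus ?thesis using Suc by (intro bexI[of _ "Suc n"]) (simp_all add: plus1_fo)
 qed
 show "n = n'" if "scm f n = Some m" "scm f n' = Some m" for n n' m
  using that e(5) by (cases n; cases n'; cases m) auto
qed

lemma functor_plus1: "is_functor SS SS plus1"
proof (rule is_functorI)
 fix f g a b c assume "f : Hom SS a b" "g : Hom SS b c"
 show "scm (Cmp SS g f) = Cmp SS (scm g) (scm f)"
 proof
  fix n show "scm (Cmp SS g f) n = Cmp SS (scm g) (scm f) n"
   by (cases n) (auto simp: map_comp_def split: option.splits)
 qed
next
 fix a show "scm (Idn SS a) = Idn SS (sc a)"
 proof
  fix n show "scm (Idn SS a) n = Idn SS (sc a) n"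
   by (cases n) (auto simp: restrict_map_def plus1_fo)
 qed
qed (simp_all add: plus1_hom, simp add: plus1_fo)

lemma plus1_inject: "scm f = scm g ==> f = g"
proof
 fix n assume "scm f = scm g"
 hence "scm f (Suc n) = scm g (Suc n)" by simp
 thus "f n = g n" using injD[OF option.inj_map[OF inj_Suc]] by simp
qed

lemma plus1_fix0:
 assumes f: "f : Hom SS (sc s) (sc t)" and f0: "f 0 = Some 0"
 shows "\<exists>k\<in>Hom SS s t. f = scm k"
proof
 \<comment> \<open>The shift is undone. The truncated subtraction is harmless: \<open>f\<close> is
   injective and takes 0 to 0, so it takes no successor to 0.\<close>
 define k where "k n = map_option (%m. m - 1) (f (Suc n))" for n
 note e = SS_eval[OF f]
 have S: "f (Suc n) ~= Some 0" for n using e(5)[OF f0, of "Suc n"] by auto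
 show "f = scm k"
 proof
  fix n show "f n = scm k n"
  proof (cases n)
   case (Suc j)
   thus ?thesis using S[of j] by (cases "f (Suc j)") (auto simp: k_def)
  qed (simp add: f0)
 qed
 show "k : Hom SS s t"
 proof (rule Hom_SSI)
  show "finite s" using e(6) by (simp add: plus1_fo finite_image_iff)
  show "\<exists>m\<in>t. k n = Some m" if ns: "n : s" for n
  proof -
   obtain m where "m : sc t" "f (Suc n) = Some m" using e(1)[of "Suc n"] ns by (auto simp: plus1_fo)
   thus ?thesis using S[of n] by (auto simp: plus1_fo k_def)
  qed
  show "k n = None" if "n \<notin> s" for n using e(2)[of "Suc n"] that by (auto simp: plus1_fo k_def)
  show "\<exists>n\<in>s. k n = Some m" if mt: "m : t" for m
  proof -
   obtain n where n: "n : sc s" "f n = Some (Suc m)" using e(3)[of "Suc m"] mt by (auto simp: plus1_fo)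
   then obtain j where "n = Suc j" using f0 by (cases n) auto
   thus ?thesis using n by (intro bexI[of _ j]) (auto simp: plus1_fo k_def)
  qed
  show "n = n'" if "k n = Some m" "k n' = Some m" for n n' m
  proof -
   have "f (Suc n) = Some (Suc m)" "f (Suc n') = Some (Suc m)" using that S[of n] S[of n'] by (auto simp: k_def)
   thus ?thesis using e(5) by blast
  qed
 qed
qed

text \<open>The class of \<open>(x, g)\<close> over \<open>b\<close> is determined by the element
  \<open>g 0\<close> of \<open>b\<close>: two bijections with the same value at 0 differ by one that
  fixes 0, and such a bijection is an arrow plus one. So each element of \<open>b\<close> yields one
  representative.\<close>

lemma finite_cover_plus1: "finite_cover SS SS plus1"
proof (rule finite_coverI[OF groupoid_SS groupoid_SS functor_plus1])
 show "k = k'" if "scm k = scm k'" for k k' using plus1_inject[OF that] .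
 fix b assume "b : Obj SS"
 hence b: "finite b" by simp
 let ?ok = "%e p. finite (fst p) & snd p : Hom SS (sc (fst p)) b & snd p 0 = Some e"
 define c where "c e = (SOME p. ?ok e p)" for e
 have "\<exists>(r, h)\<in>c ` b. r : Obj SS & h : Hom SS (sc r) b & (\<exists>k\<in>Hom SS x r. Cmp SS h (scm k) = g)"
  if x: "x : Obj SS" and g: "g : Hom SS (sc x) b" for x g
 proof -
  obtain e where e: "e : b" "g 0 = Some e" using SS_eval(1)[OF g, of 0] by (auto simp: plus1_fo)
  have "?ok e (x, g)" using x g e by simp
  hence ok: "?ok e (c e)" unfolding c_def by (rule someI)
  obtain r h where rh: "c e = (r, h)" by force
  have h: "h : Hom SS (sc r) b" "h 0 = Some e" "finite r" using ok rh by simp_all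
  note hi = grp_inv[OF groupoid_SS h(1)]
  have "Cmp SS (cat_inv SS h) h 0 = Some 0"
   using grp_inv_left[OF groupoid_SS h(1)] by (simp add: restrict_map_def plus1_fo)
  hence "Cmp SS (cat_inv SS h) g 0 = Some 0" using h(2) e(2) by (simp add: map_comp_def)
  then obtain k where k: "k : Hom SS x r" "Cmp SS (cat_inv SS h) g = scm k"
   using plus1_fix0[OF cat_cmp[OF cat_SS g hi]] by blast
  have "Cmp SS h (scm k) = g"
   unfolding k(2)[symmetric] cat_assoc[OF cat_SS g hi h(1), symmetric] grp_inv_right[OF groupoid_SS h(1)]
   by (rule cat_idl[OF cat_SS g])
  thus ?thesis using h k(1) e(1) rh by (intro bexI[of _ "(r, h)"] case_prodI conjI bexI[of _ k]) (simp_all, metis image_eqI)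
 qed
 thus "EX R. finite R & (\<forall>x\<in>Obj SS. \<forall>g\<in>Hom SS (sc x) b. \<exists>(r, h)\<in>R.
   r : Obj SS & h : Hom SS (sc r) b & (\<exists>k\<in>Hom SS x r. Cmp SS h (scm k) = g))"
  using b by (intro exI[of _ "c ` b"]) blast
qed

lemma finite_cover_plus2: "finite_cover SS SS plus2"
 unfolding plus2_def by (rule finite_cover_fcmp[OF finite_cover_plus1 finite_cover_plus1])

lemmas finite_cover_idS = finite_cover_idF[OF groupoid_SS]

section \<open>The swap of the two added elements\<close>

lemma swap2_eval: "swap2 s n = (if n : fo plus2 s then Some (if n = 0 then 1 else if n = 1 then 0 else n) else None)"
 by (auto simp: swap2_def restrict_map_def)

lemma plus2_fo: "fo plus2 s = insert 0 (insert 1 ((%n. Suc (Suc n)) ` s))"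
 by (auto simp: plus2_def plus1_fo)

lemma plus2_fm: "fm plus2 f = scm (scm f)" "fo plus2 s = sc (sc s)"
 by (simp_all add: plus2_def)

lemma swap2_hom: "finite s ==> swap2 s : Hom SS (fo plus2 s) (fo plus2 s)"
proof (rule Hom_SSI)
 fix m assume "m : fo plus2 s"
 thus "\<exists>n\<in>fo plus2 s. swap2 s n = Some m"
  by (intro bexI[of _ "if m = 0 then 1 else if m = 1 then 0 else m"]) (auto simp: swap2_eval plus2_fo)
qed (auto simp: swap2_eval plus2_fo split: if_splits)

lemma swap2_swap2: "swap2 s oo swap2 s = Some |` fo plus2 s"
 by (auto simp: fun_eq_iff map_comp_def swap2_eval restrict_map_def plus2_fo)

lemma swap2_nat:
 assumes f: "f : Hom SS s t"
 shows "swap2 t oo fm plus2 f = fm plus2 f oo swap2 s"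
proof
 fix n
 note e = SS_eval[OF f]
 show "(swap2 t oo fm plus2 f) n = (fm plus2 f oo swap2 s) n"
 proof (cases n)
  case 0
  thus ?thesis by (simp add: map_comp_def plus2_fm(1) swap2_eval plus2_fo)
 next
  case (Suc m)
  thus ?thesis
  proof (cases m)
   case 0
   thus ?thesis using Suc by (simp add: map_comp_def plus2_fm(1) swap2_eval plus2_fo)
  next
   case m: (Suc j)
   show ?thesis
   proof (cases "j : s")
    case True
    thus ?thesis using e(1)[OF True] by (auto simp: Suc m map_comp_def plus2_fm(1) swap2_eval plus2_fo)
   next
    case False
    hence "swap2 s n = None" by (auto simp: Suc m swap2_eval plus2_fo)
    thus ?thesis using e(2)[OF False] by (simp add: Suc m map_comp_def plus2_fm(1))
   qed
  qed
 qed
qed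

text \<open>On the three elements added to \<open>s\<close> the two maps are the transpositions (0
  1) and (1 2), and this is their braid relation.\<close>

lemma swap2_braid:
 "swap2 (sc s) oo (scm (swap2 s) oo swap2 (sc s)) =
  scm (swap2 s) oo (swap2 (sc s) oo scm (swap2 s))"
proof
 fix n
 consider "n = 0" | "n = 1" | "n = 2" | k where "n = Suc (Suc (Suc k))" "k : s" | k where "n = Suc (Suc (Suc k))" "k \<notin> s"
  by (metis One_nat_def Suc_1 not0_implies_Suc)
 thus "(swap2 (sc s) oo (scm (swap2 s) oo swap2 (sc s))) n =
   (scm (swap2 s) oo (swap2 (sc s) oo scm (swap2 s))) n"
  by cases (auto simp: map_comp_def swap2_eval plus2_fo plus1_fo numeral_2_eq_2 image_iff)
qed

lemma is_nat_swap: "is_nat SS SS swap_nat"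
proof (rule is_natI)
 fix f a b assume f: "f : Hom SS a b"
 thus "Cmp SS (nt swap_nat b) (fm (nsrc swap_nat) f) = Cmp SS (fm (ntgt swap_nat) f) (nt swap_nat a)"
  using swap2_nat[OF f] SS_eval(6,7)[OF f] by (simp add: swap_nat_def)
next
 have "is_functor SS SS plus2" unfolding plus2_def by (rule is_functor_fcmp[OF functor_plus1 functor_plus1])
 thus "is_functor SS SS (nsrc swap_nat)" "is_functor SS SS (ntgt swap_nat)" by (simp_all add: swap_nat_def)
qed (auto simp: swap_nat_def swap2_hom)

section \<open>Functors from finite sets into iso-comma groupoids\<close>

lemma com_pair_simps [simp]:
 "fo (com_pair P Q \<theta>) s = (fo P s, fo Q s, \<theta> s)" "fcmp com_p1 (com_pair P Q \<theta>) = P" "fcmp com_p2 (com_pair P Q \<theta>) = Q"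
 by (simp_all add: com_pair_def com_p1_def com_p2_def fcmp_def)

lemma fcmp_com_pair [simp]:
 "fcmp (fcmp H com_p1) (com_pair P Q \<theta>) = fcmp H P" "fcmp (fcmp H com_p2) (com_pair P Q \<theta>) = fcmp H Q"
 by (simp_all flip: fcmp_assoc)

lemma fm_com_pair: "f : Hom SS s t ==> fm (com_pair P Q \<theta>) f = ((fo P s, fo Q s, \<theta> s), (fo P t, fo Q t, \<theta> t), fm P f, fm Q f)"
 by (auto simp: com_pair_def Hom_SS)

text \<open>Followed by the first projection the functor becomes \<open>P\<close>, a covering, so
  cancellation applies.\<close>

lemma com_pair_cover:
 assumes "cospan_covers SS SS SS G F" and P: "finite_cover SS SS P" and Q: "finite_cover SS SS Q"
  and \<theta>: "!!s. finite s ==> \<theta> s : Hom SS (fo G (fo P s)) (fo F (fo Q s))"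
  and n: "!!f s t. f : Hom SS s t ==> \<theta> t oo fm G (fm P f) = fm F (fm Q f) oo \<theta> s"
 shows "finite_cover SS (iso_comma SS SS SS G F) (com_pair P Q \<theta>)"
proof -
 interpret cospan_covers SS SS SS G F by fact
 interpret P: cover SS SS P by standard (rule P)
 interpret Q: cover SS SS Q by standard (rule Q)
 have o: "(fo P s, fo Q s, \<theta> s) : Obj (iso_comma SS SS SS G F)" if "finite s" for s
  using \<theta>[OF that] fct_obj[OF P.fctG, of s] fct_obj[OF Q.fctG, of s] that by (simp add: Obj_P)
 have F: "is_functor SS (iso_comma SS SS SS G F) (com_pair P Q \<theta>)"
 proof (rule is_functorI)
  fix a assume a: "a : Obj SS"
  thus "fo (com_pair P Q \<theta>) a : Obj (iso_comma SS SS SS G F)" using o by simp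
  show "fm (com_pair P Q \<theta>) (Idn SS a) = Idn (iso_comma SS SS SS G F) (fo (com_pair P Q \<theta>) a)"
   using fct_idn[OF P.fctG a] fct_idn[OF Q.fctG a] by (simp add: fm_com_pair[OF cat_idn[OF cat_SS a], unfolded SS_simps])
 next
  fix f a b assume f: "f : Hom SS a b"
  show "fm (com_pair P Q \<theta>) f : Hom (iso_comma SS SS SS G F) (fo (com_pair P Q \<theta>) a) (fo (com_pair P Q \<theta>) b)"
   using o SS_eval(6,7)[OF f] fct_hom[OF P.fctG f] fct_hom[OF Q.fctG f] n[OF f]
   by (simp add: fm_com_pair[OF f] Hom_P)
 next
  fix f g a b c assume f: "f : Hom SS a b" and g: "g : Hom SS b c"
  show "fm (com_pair P Q \<theta>) (Cmp SS g f) = Cmp (iso_comma SS SS SS G F) (fm (com_pair P Q \<theta>) g) (fm (com_pair P Q \<theta>) f)"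
   using fct_cmp[OF P.fctG f g] fct_cmp[OF Q.fctG f g]
   by (simp add: fm_com_pair[OF f] fm_com_pair[OF g] fm_com_pair[OF cat_cmp[OF cat_SS f g], unfolded SS_simps])
 qed
 show ?thesis
  by (rule finite_cover_cancel[OF groupoid_SS F cover_p1]) (simp add: P)
qed


section \<open>The images of the generators\<close>

interpretation I: cover SS SS idF by standard (rule finite_cover_idS)
interpretation S1: cover SS SS plus1 by standard (rule finite_cover_plus1)

lemma plus1_cospan: "cospan_covers SS SS SS plus1 plus1" and id_cospan: "cospan_covers SS SS SS idF idF"
 and id_plus1_cospan: "cospan_covers SS SS SS idF plus1" and plus1_id_cospan: "cospan_covers SS SS SS plus1 idF"
 by unfold_locales

text \<open>The letters \<open>m\<close> and \<open>p\<close> stand for \<open>Q\<^sub>-\<close> and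
  \<open>Q\<^sub>+\<close>, with the functor applied last written first: \<open>mp\<close> belongs
  to \<open>A\<close> composed after its converse.\<close>

interpretation mp: span_comp SS SS SS SS SS plus1 idF idF plus1 by unfold_locales
interpretation pm: span_comp SS SS SS SS SS idF plus1 plus1 idF by unfold_locales
interpretation mm: span_comp SS SS SS SS SS idF plus1 idF plus1 by unfold_locales
interpretation pp: span_comp SS SS SS SS SS plus1 idF plus1 idF by unfold_locales

lemma spans: "spA = mm.sp" "spAd = pp.sp" "spAdA = \<lparr>apex = SS, lbase = SS, rbase = SS, lleg = plus1, rleg = plus1\<rparr>"
 "spAA = \<lparr>apex = SS, lbase = SS, rbase = SS, lleg = idF, rleg = plus2\<rparr>"
 "spAdAd = \<lparr>apex = SS, lbase = SS, rbase = SS, lleg = plus2, rleg = idF\<rparr>"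
 "id_span SS = \<lparr>apex = SS, lbase = SS, rbase = SS, lleg = idF, rleg = idF\<rparr>"
 by (simp_all add: spA_def spAd_def conv_span_def spAdA_def spAA_def spAdAd_def id_span_def)

text \<open>\<open>T1\<close> and \<open>T2\<close> are the functors \<open>I\<^sub>1\<close> and
  \<open>I\<^sub>2\<close> of the 2-functor C; the other three are the equivalences from the reduced
  composites to the iso-comma ones.\<close>

abbreviation "T1 \<equiv> com_pair idF idF (%s. Idn SS (sc s))"
abbreviation "T2 \<equiv> com_pair plus1 plus1 swap2"
abbreviation "TAdA \<equiv> com_pair idF idF (Idn SS)"
abbreviation "TAA \<equiv> com_pair plus1 idF (%s. Idn SS (sc s))"
abbreviation "TAdAd \<equiv> com_pair idF plus1 (%s. Idn SS (sc s))"

lemma id_hom: "finite s ==> Some |` s : Hom SS s s"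
 using cat_idn[OF cat_SS, of s] by simp

lemma finite_plus1 [simp]: "finite (sc s) \<longleftrightarrow> finite s"
 by (simp add: plus1_fo finite_image_iff)

lemma SS_idl: "f : Hom SS s t ==> (Some |` t) oo f = f" and SS_idr: "f : Hom SS s t ==> f oo (Some |` s) = f"
 using cat_idl[OF cat_SS, of f s t] cat_idr[OF cat_SS, of f s t] by simp_all

lemma SS_cmp: "f : Hom SS s t ==> g : Hom SS t u ==> g oo f : Hom SS s u"
 using cat_cmp[OF cat_SS, of f s t g u] by simp

lemma SS_assoc: "(h oo g) oo f = h oo (g oo f)"
 by (auto simp: fun_eq_iff map_comp_def split: option.splits)

lemma plus1_cmp: "scm (g oo f) = scm g oo scm f"
proof
 fix n show "scm (g oo f) n = (scm g oo scm f) n"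
  by (cases n) (auto simp: map_comp_def split: option.splits)
qed

lemma plus1_idn: "finite s ==> scm (Some |` s) = Some |` (sc s)"
 using fct_idn[OF functor_plus1, of s] by simp

lemma SS_inv:
 assumes "f : Hom SS s t"
 shows "cat_inv SS f : Hom SS t s" "cat_inv SS f oo f = Some |` s" "f oo cat_inv SS f = Some |` t"
 using grp_inv[OF groupoid_SS assms] grp_inv_left[OF groupoid_SS assms] grp_inv_right[OF groupoid_SS assms] by simp_all

lemma cover_T1: "finite_cover SS mp.P T1"
 by (rule com_pair_cover[OF plus1_cospan finite_cover_idS finite_cover_idS])
  (auto simp: id_hom SS_idl[OF plus1_hom] SS_idr[OF plus1_hom] plus1_hom)

lemma cover_T2: "finite_cover SS mp.P T2"
 by (rule com_pair_cover[OF plus1_cospan finite_cover_plus1 finite_cover_plus1])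
  (use swap2_hom swap2_nat in \<open>simp_all add: plus2_fm\<close>)

lemma cover_TAdA: "finite_cover SS pm.P TAdA"
 by (rule com_pair_cover[OF id_cospan finite_cover_idS finite_cover_idS]) (auto simp: id_hom SS_idl SS_idr)

lemma cover_TAA: "finite_cover SS mm.P TAA"
 by (rule com_pair_cover[OF id_plus1_cospan finite_cover_plus1 finite_cover_idS])
  (auto simp: id_hom SS_idl[OF plus1_hom] SS_idr[OF plus1_hom] plus1_hom)

lemma cover_TAdAd: "finite_cover SS pp.P TAdAd"
 by (rule com_pair_cover[OF plus1_id_cospan finite_cover_idS finite_cover_plus1])
  (auto simp: id_hom SS_idl[OF plus1_hom] SS_idr[OF plus1_hom] plus1_hom)


interpretation sT1: graph_covers SS mp.P SS SS T1 idF "fcmp idF com_p2" idF "fcmp idF com_p1"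
 by (unfold_locales; (rule cover_T1 | simp)?)
interpretation sT2: graph_covers SS mp.P SS SS T2 plus1 "fcmp idF com_p2" plus1 "fcmp idF com_p1"
 by (unfold_locales; (simp add: cover_T2)?)
interpretation sAdA: graph_covers SS pm.P SS SS TAdA plus1 "fcmp plus1 com_p2" plus1 "fcmp plus1 com_p1"
 by (unfold_locales; (simp add: cover_TAdA)?)
interpretation sAA: graph_covers SS mm.P SS SS TAA idF "fcmp idF com_p2" plus2 "fcmp plus1 com_p1"
 by (unfold_locales; (rule cover_TAA | simp add: finite_cover_plus2 plus2_def[symmetric])?)
interpretation sAdAd: graph_covers SS pp.P SS SS TAdAd plus2 "fcmp plus1 com_p2" idF "fcmp idF com_p1"
 by (unfold_locales; (rule cover_TAdAd | simp add: finite_cover_plus2 plus2_def[symmetric])?)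
interpretation seta: strict_covers SS SS SS SS SS plus1 idF idF plus1 idF plus1
 by (unfold_locales; simp?)
interpretation su: sspan_covers SS SS SS SS SS idF idF plus2 plus2 idF idF swap_nat "nt_id SS SS idF"
 by (unfold_locales; (simp add: finite_cover_plus2 is_nat_swap swap_nat_def[THEN arg_cong[of _ _ nsrc]] swap_nat_def[THEN arg_cong[of _ _ ntgt]] is_nat_id[OF cat_SS cat_SS is_functor_idF[OF cat_SS]])?)
interpretation sv: sspan_covers SS SS SS SS SS idF idF idF idF plus2 plus2 "nt_id SS SS idF" swap_nat
 by (unfold_locales; (simp add: finite_cover_plus2 is_nat_swap swap_nat_def[THEN arg_cong[of _ _ nsrc]] swap_nat_def[THEN arg_cong[of _ _ ntgt]] is_nat_id[OF cat_SS cat_SS is_functor_idF[OF cat_SS]])?)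


text \<open>\<open>AO V\<close> and \<open>PO V\<close> are the values at \<open>V\<close> of
  \<open>\<Lambda>(A)\<close> and of \<open>\<Lambda>(A\<^sup>\<dagger>)\<close>. The first is
  essentially restriction along \<open>+1\<close>, but formally it is followed by induction along
  the identity; hence it too has injections, indexed by bijections from \<open>x\<close> to
  \<open>b\<close>.\<close>

abbreviation "AO V \<equiv> Ind_obj SS SS idF (fcmp V plus1)"
abbreviation "PO V \<equiv> Ind_obj SS SS plus1 V"
abbreviation "aj V \<equiv> ind_inj SS SS idF (fcmp V plus1)"
abbreviation "pj V \<equiv> ind_inj SS SS plus1 V"
abbreviation "da V \<equiv> ind_dim SS SS idF (fcmp V plus1)"
abbreviation "dp V \<equiv> ind_dim SS SS plus1 V"
abbreviation idS :: "nat set => fset_bij" where "idS s \<equiv> Some |` s"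

lemma SS_inv_id: "finite s ==> cat_inv SS (idS s) = idS s"
 using cat_inv_Idn[OF cat_SS, of s] by simp

lemma fo_Lam1: "fo (Lam1 spA) V = AO V" "fo (Lam1 spAd) V = PO V"
 by (simp_all add: Lam1_def spans)

lemma RepS_cat: "category RepS" by (rule category_Rep[OF cat_SS])

lemma AO_obj: "V : Obj RepS ==> AO V : Obj RepS" and PO_obj: "V : Obj RepS ==> PO V : Obj RepS"
 and V1_obj: "V : Obj RepS ==> fcmp V plus1 : Obj RepS"
 using I.Ind_obj_Rep[OF S1.Res_obj] S1.Ind_obj_Rep S1.Res_obj by blast+

lemma lin_Lam1: "linear_functor RepS RepS (Lam1 spA)" "linear_functor RepS RepS (Lam1 spAd)"
 unfolding Lam1_def spans
 using lin_fcmp[OF S1.linear_Res I.linear_Ind] lin_fcmp[OF I.linear_Res S1.linear_Ind] by simp_all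

context
 fixes V :: S_rep and b :: fset_obj assumes V: "V : Obj RepS" and b: "finite b"
begin

lemma VS: "is_functor SS matcat V" and V1: "is_functor SS matcat (fcmp V plus1)"
 using Rep_objD(1)[OF V] Rep_objD(1)[OF V1_obj[OF V]] .

lemma aj_cm: "g : Hom SS x b ==> aj V b x g : \<M> (da V b) (fo V (sc x))"
 and pj_cm: "h : Hom SS (sc x) b ==> pj V b x h : \<M> (dp V b) (fo V x)"
 using I.inj_cm[OF V1, of b x g] S1.inj_cm[OF VS, of b x h] b SS_eval(6)[of g x b] SS_eval(6)[of h "sc x" b] by auto

lemma aj_nat: "k : Hom SS x y ==> g : Hom SS y b ==> aj V b y g * fm V (scm k) = aj V b x (g oo k)"
 and pj_nat: "k : Hom SS x y ==> h : Hom SS (sc y) b ==> pj V b y h * fm V k = pj V b x (h oo scm k)"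
 using I.inj_nat[OF V1, of b k x y g] S1.inj_nat[OF VS, of b k x y h] b by auto

lemma AO_fm: "h : Hom SS b c ==> g : Hom SS x b ==> fm (AO V) h * aj V b x g = aj V c x (h oo g)"
 and PO_fm: "h : Hom SS b c ==> k : Hom SS (sc x) b ==> fm (PO V) h * pj V b x k = pj V c x (h oo k)"
 using I.Ind_obj_inj[OF V1, of h b c x g] S1.Ind_obj_inj[OF VS, of h b c x k] b SS_eval(6)[of g x b] SS_eval(6)[of k "sc x" b] by auto

lemma fmV_cm: "h : Hom SS x y ==> fm V h : \<M> (fo V y) (fo V x)"
 and fmV_cmp: "h : Hom SS x y ==> k : Hom SS y z ==> fm V (k oo h) = fm V k * fm V h"
 and fmV_one: "finite x ==> fm V (idS x) = 1\<^sub>m (fo V x)"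
 using rep_cm[OF VS, of h x y] rep_cmp[OF VS, of h x y k z] rep_idn[OF VS, of x] by auto

end

lemma fo_AO [simp]: "fo (AO V) = da V" and fo_PO [simp]: "fo (PO V) = dp V"
 by simp_all

text \<open>In this lemma and the next two, naturality of the injections moves index arrows between
  the letters of a word. For \<open>pa\<close> and \<open>pp\<close> the inner index becomes an
  identity, a normal form on which maps out of the word can be tested.\<close>

lemma pa_shift:
 assumes V: "V : Obj RepS" and b: "finite b" and g: "g : Hom SS (sc x) b" and k: "k : Hom SS z x"
 shows "pj (AO V) b x g * aj V x z k = pj (AO V) b z (g oo scm k) * aj V z z (idS z)"
proof -
 note z = SS_eval(6,7)[OF k] and o = AO_obj[OF V]
 show ?thesis
  using pj_cm[OF o b g] fmV_cm[OF o b k] aj_cm[OF V z(1) id_hom[OF z(1)]]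
   AO_fm[OF V z(1) k id_hom[OF z(1)]] SS_idr[OF k]
  by (simp add: pj_nat[OF o b k g, symmetric] mat_assoc)
qed

lemma pp_shift:
 assumes V: "V : Obj RepS" and b: "finite b" and g: "g : Hom SS (sc y) b" and h: "h : Hom SS (sc x) y"
 shows "pj (PO V) b y g * pj V y x h = pj (PO V) b (sc x) (g oo scm h) * pj V (sc x) x (idS (sc x))"
proof -
 note z = SS_eval(6,7)[OF h] and o = PO_obj[OF V]
 show ?thesis
  using pj_cm[OF o b g] fmV_cm[OF o b h] pj_cm[OF V z(1) id_hom[OF z(1)]]
   PO_fm[OF V z(1) h id_hom[OF z(1)]] SS_idr[OF h]
  by (simp add: pj_nat[OF o b h g, symmetric] mat_assoc)
qed

lemma ap_shift:
 assumes V: "V : Obj RepS" and b: "finite b" and g: "g : Hom SS y b" and k: "k : Hom SS z y" and h: "h : Hom SS (sc x) (sc z)"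
 shows "aj (PO V) b z (g oo k) * pj V (sc z) x h = aj (PO V) b y g * pj V (sc y) x (scm k oo h)"
proof -
 note o = PO_obj[OF V] and z = SS_eval(6,7)[OF h]
 note k1 = plus1_hom[OF k]
 show ?thesis
  using aj_cm[OF o b g] fmV_cm[OF o b k1] pj_cm[OF V z(2) h] PO_fm[OF V z(2) k1 h]
  by (simp add: aj_nat[OF o b k g, symmetric] mat_assoc)
qed

subsection \<open>The coherence isomorphisms\<close>

definition coh_iso :: "S_end_ntr => bool" where
 "coh_iso \<theta> \<longleftrightarrow> is_nat RepS RepS \<theta> & (\<forall>V\<in>Obj RepS. is_iso RepS (nt \<theta> V))"

lemma is_nat_transport:
 assumes "coh_iso \<theta>" "is_nat RepS RepS \<theta>'" "is_nat RepS RepS \<alpha>" "nsrc \<alpha> = nsrc \<theta>" "ntgt \<alpha> = nsrc \<theta>'"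
 shows "is_nat RepS RepS (transport \<theta>' \<theta> \<alpha>)" "nsrc (transport \<theta>' \<theta> \<alpha>) = ntgt \<theta>" "ntgt (transport \<theta>' \<theta> \<alpha>) = ntgt \<theta>'"
 using assms unfolding transport_def coh_iso_def
 by (auto intro!: is_nat_vcomp RepS_cat is_nat_inv simp del: Rep_simps)

text \<open>Conjugation by a coherence isomorphism is evaluated without inverting it: some
  \<open>u\<close> with image \<open>w\<close> under \<open>\<theta>\<close> suffices. In the
  applications \<open>u\<close> is an injection and \<open>w\<close> its image computed with the
  coherence formulas.\<close>

lemma transport_inj:
 assumes \<theta>: "coh_iso \<theta>" "is_nat RepS RepS \<theta>'" "is_nat RepS RepS \<alpha>" "nsrc \<alpha> = nsrc \<theta>" "ntgt \<alpha> = nsrc \<theta>'"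
  and V: "V : Obj RepS" and b: "finite b"
  and u: "u : \<M> (fo (fo (nsrc \<theta>) V) b) n" "nt (nt \<theta> V) b * u = w"
 shows "nt (nt (transport \<theta>' \<theta> \<alpha>) V) b * w = nt (nt \<theta>' V) b * (nt (nt \<alpha> V) b * u)"
proof -
 have bb: "b : Obj SS" using b by simp
 have n: "is_nat RepS RepS \<theta>" and i: "is_iso RepS (nt \<theta> V)" using \<theta>(1) V by (simp_all add: coh_iso_def del: Rep_simps)
 note tV = nat_hom[OF n V] and tV' = nat_hom[OF \<theta>(2) V] and aV = nat_hom[OF \<theta>(3) V]
 have c: "nt (nt \<theta> V) b : \<M> (fo (fo (ntgt \<theta>) V) b) (fo (fo (nsrc \<theta>) V) b)"
  "nt (nt \<theta>' V) b : \<M> (fo (fo (ntgt \<theta>') V) b) (fo (fo (nsrc \<theta>') V) b)"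
  "nt (nt \<alpha> V) b : \<M> (fo (fo (nsrc \<theta>') V) b) (fo (fo (nsrc \<theta>) V) b)"
  using intw_cm[OF Hom_RepD(1)[OF tV] bb] Hom_RepD(2,3)[OF tV] intw_cm[OF Hom_RepD(1)[OF tV'] bb] Hom_RepD(2,3)[OF tV']
   intw_cm[OF Hom_RepD(1)[OF aV] bb] Hom_RepD(2,3)[OF aV] \<theta>(4,5) by simp_all
 note ic = Rep_iso_component[OF i]
 have inv: "nt (cat_inv RepS (nt \<theta> V)) b = cat_inv matcat (nt (nt \<theta> V) b)"
  by (rule Rep_iso(2)[OF cat_SS HomD(1)[OF tV] ic bb])
 note ci = matcat_inv[OF ic[OF bb] c(1)]
 have "nt (nt (transport \<theta>' \<theta> \<alpha>) V) b = nt (nt \<theta>' V) b * (nt (nt \<alpha> V) b * cat_inv matcat (nt (nt \<theta> V) b))"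
  using V bb inv by (simp add: transport_def)
 moreover have "cat_inv matcat (nt (nt \<theta> V) b) * w = u"
  using ci c(1) u by (simp add: u(2)[symmetric] flip: mat_assoc)
 moreover have "w : \<M> (fo (fo (ntgt \<theta>) V) b) n" unfolding u(2)[symmetric] using c(1) u(1) by (rule mult_carrier_mat)
 ultimately show ?thesis using c ci(1) by (simp add: mat_assoc)
qed

lemma coh_isoI: "is_nat RepS RepS \<theta> ==> (!!V. V : Obj RepS ==> is_iso RepS (nt \<theta> V)) ==> coh_iso \<theta>"
 by (simp add: coh_iso_def del: Rep_simps)

lemma coh_isoD: "coh_iso \<theta> ==> is_nat RepS RepS \<theta>" by (simp add: coh_iso_def)

lemma coh_iso_vcomp:
 assumes "coh_iso \<theta>" "coh_iso \<sigma>" "nsrc \<theta> = ntgt \<sigma>"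
 shows "coh_iso (vcomp RepS RepS \<theta> \<sigma>)"
proof (rule coh_isoI)
 note n = coh_isoD[OF assms(1)] coh_isoD[OF assms(2)]
 show "is_nat RepS RepS (vcomp RepS RepS \<theta> \<sigma>)" by (rule is_nat_vcomp[OF RepS_cat RepS_cat n(2,1) assms(3)])
 fix V assume V: "V : Obj RepS"
 have "is_iso RepS (Cmp RepS (nt \<theta> V) (nt \<sigma> V))"
  by (rule iso_cmp[OF RepS_cat nat_hom[OF n(2) V] _ nat_hom[OF n(1) V, unfolded assms(3)]])
   (use assms V in \<open>simp_all add: coh_iso_def del: Rep_simps\<close>)
 thus "is_iso RepS (nt (vcomp RepS RepS \<theta> \<sigma>) V)" using V by (simp only: vcomp_simps(3))
qed

text \<open>An arrow into \<open>w\<close> has two coordinates, but both projections are faithful. A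
  factorization through the representative therefore only has to be found for one coordinate, which
  is the disjunction in the last hypothesis.\<close>

lemma com_pair_reps:
 assumes C: "cospan_covers SS SS SS G F" and T: "finite_cover SS (iso_comma SS SS SS G F) (com_pair P Q \<theta>)"
  and h: "(fo (com_pair P Q \<theta>) z, w, p, q) : Hom (iso_comma SS SS SS G F) (fo (com_pair P Q \<theta>) z) w" and z: "finite z"
  and e: "!!z' p' q'. (fo (com_pair P Q \<theta>) z', w, p', q') : Hom (iso_comma SS SS SS G F) (fo (com_pair P Q \<theta>) z') w ==>
   \<exists>k\<in>Hom SS z' z. p oo fm P k = p' \<or> q oo fm Q k = q'"
 shows "reps SS (iso_comma SS SS SS G F) (com_pair P Q \<theta>) w {(z, (fo (com_pair P Q \<theta>) z, w, p, q))}"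
proof -
 interpret cospan_covers SS SS SS G F by fact
 interpret T: cover SS "iso_comma SS SS SS G F" "com_pair P Q \<theta>" by standard (rule T)
 let ?T = "com_pair P Q \<theta>" and ?h = "(fo (com_pair P Q \<theta>) z, w, p, q)"
 show ?thesis
 proof (rule repsI)
  fix z' g assume z': "z' : Obj SS" and g: "g : Hom (iso_comma SS SS SS G F) (fo ?T z') w"
  obtain p' q' where pq: "g = (fo ?T z', w, p', q')" using g by (rule Hom_PE)
  obtain k where k: "k : Hom SS z' z" "p oo fm P k = p' \<or> q oo fm Q k = q'" using e g pq by blast
  note Tk = fct_hom[OF T.fctG k(1)]
  note hk = cat_cmp[OF category_P Tk h]
  have hk': "Cmp (iso_comma SS SS SS G F) ?h (fm ?T k) = (fo ?T z', w, p oo fm P k, q oo fm Q k)"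
   by (simp add: fm_com_pair[OF k(1)] del: com_pair_simps(1)) (simp add: com_pair_def)
  have "Cmp (iso_comma SS SS SS G F) ?h (fm ?T k) = g"
   using k(2)
  proof
   assume "p oo fm P k = p'"
   thus ?thesis by (intro p1.faithful_G[OF hk g]) (simp only: hk' pq com_p_simps)
  next
   assume "q oo fm Q k = q'"
   thus ?thesis by (intro p2.faithful_G[OF hk g]) (simp only: hk' pq com_p_simps)
  qed
  thus "EX r h k. (r, h) : {(z, ?h)} & k : Hom SS z' r & Cmp (iso_comma SS SS SS G F) h (fm ?T k) = g"
   using k(1) by blast
 qed (use h z T.lift_unique in auto)
qed

lemma coh_1: "coh_iso coh_1" "nsrc coh_1 = Lam1 (id_span SS)" "ntgt coh_1 = idF"
 and coh_1_inj: "V : Obj RepS ==> finite b ==> g : Hom SS x b ==> nt (nt coh_1 V) b * ind_inj SS SS idF V b x g = fm V g"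
proof -
 show inj: "nt (nt coh_1 V) b * ind_inj SS SS idF V b x g = fm V g" if "V : Obj RepS" "finite b" "g : Hom SS x b" for V b x g
  using I.counit_inj[OF that(1), of b x g] that SS_eval(6)[OF that(3)] by (simp add: coh_1_def Lam_unit_def)
 show "nsrc coh_1 = Lam1 (id_span SS)" "ntgt coh_1 = idF"
  by (simp_all add: coh_1_def Lam_unit_def Lam1_def spans)
 have n: "is_nat RepS RepS coh_1" unfolding coh_1_def Lam_unit_def by (rule I.counit_nat)
 show "coh_iso coh_1"
 proof (rule coh_isoI[OF n], rule Rep_iso(1)[OF cat_SS])
  fix V assume V: "V : Obj RepS"
  note VF = Rep_objD(1)[OF V]
  show "nt coh_1 V : Arr RepS" by (rule HomD(1)[OF nat_hom[OF n V]])
  fix b assume b: "b : Obj SS"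
  hence fb: "finite b" by simp
  have c: "nt (nt coh_1 V) b : \<M> (fo V b) (ind_dim SS SS idF V b)"
   using I.counit_carrier[OF V b] by (simp add: coh_1_def Lam_unit_def)
  \<comment> \<open>The injection at the identity of \<open>b\<close> will be the inverse of the
    counit.\<close>
  note i = I.inj_cm[OF VF b b, of "idS b"]
  have io: "idS b : Hom SS (fo (idF :: (nat set, fset_bij, nat set, fset_bij) fctr) b) b" using id_hom[OF fb] by simp
  note i' = i[OF io]
  have 1: "nt (nt coh_1 V) b * ind_inj SS SS idF V b b (idS b) = 1\<^sub>m (fo V b)"
   using inj[OF V fb id_hom[OF fb]] fmV_one[OF V fb fb] by simp
  have 2: "ind_inj SS SS idF V b b (idS b) * nt (nt coh_1 V) b = 1\<^sub>m (ind_dim SS SS idF V b)"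
  proof (rule I.ind_eqI[OF VF b])
   fix x g assume x: "x : Obj SS" and g: "g : Hom SS (fo (idF :: (nat set, fset_bij, nat set, fset_bij) fctr) x) b"
   have g': "g : Hom SS x b" using g by simp
   show "ind_inj SS SS idF V b b (idS b) * nt (nt coh_1 V) b * ind_inj SS SS idF V b x g = 1\<^sub>m (ind_dim SS SS idF V b) * ind_inj SS SS idF V b x g"
    using i' c I.inj_cm[OF VF b x g] inj[OF V fb g'] I.inj_nat[OF VF b g' io] SS_idl[OF g'] by (simp add: mat_assoc)
  qed (use i' c in auto)
  show "is_iso matcat (nt (nt coh_1 V) b)" using matcat_isoI(1)[OF c i' 1 2] .
 qed
qed

lemma coh_mp: "coh_iso coh_mp" "nsrc coh_mp = Lam1 (comp_span spA spAd)" "ntgt coh_mp = fcmp (Lam1 spA) (Lam1 spAd)"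
 and coh_mp_inj: "V : Obj RepS ==> finite b ==> \<alpha> : Hom SS (sc x) (sc y) ==> g : Hom SS y b ==>
  nt (nt coh_mp V) b * ind_inj mp.P SS (fcmp idF com_p2) (fcmp V (fcmp idF com_p1)) b (x, y, \<alpha>) g =
  aj (PO V) b y g * pj V (sc y) x \<alpha>"
proof -
 have e: "coh_mp = mp.LC" by (simp add: coh_mp_def spans)
 show "nsrc coh_mp = Lam1 (comp_span spA spAd)" "ntgt coh_mp = fcmp (Lam1 spA) (Lam1 spAd)"
  by (simp_all add: e mp.LC_ends spans)
 show "coh_iso coh_mp" unfolding e by (rule coh_isoI[OF mp.LC_nat mp.LC_iso])
 assume "V : Obj RepS" "finite b" and a: "\<alpha> : Hom SS (sc x) (sc y)" and g: "g : Hom SS y b"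
 thus "nt (nt coh_mp V) b * ind_inj mp.P SS (fcmp idF com_p2) (fcmp V (fcmp idF com_p1)) b (x, y, \<alpha>) g =
  aj (PO V) b y g * pj V (sc y) x \<alpha>"
  using mp.LC_inj[of V b x y \<alpha> g] SS_eval(6,7)[OF a] by (simp add: e mp.Obj_P)
qed

lemma coh_pm: "coh_iso coh_pm" "nsrc coh_pm = Lam1 spAdA" "ntgt coh_pm = fcmp (Lam1 spAd) (Lam1 spA)"
 and coh_pm_inj: "V : Obj RepS ==> finite b ==> g : Hom SS (sc x) b ==>
  nt (nt coh_pm V) b * ind_inj SS SS plus1 (fcmp V plus1) b x g = pj (AO V) b x g * aj V x x (idS x)"
proof -
 have e: "coh_pm = vcomp RepS RepS pm.LC (Lam2 sAdA.ss)"
  using sAdA.strict_sspan_eq by (simp add: coh_pm_def spans can_AdA_def pm.comp_span_eq)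
 show ends: "nsrc coh_pm = Lam1 spAdA" "ntgt coh_pm = fcmp (Lam1 spAd) (Lam1 spA)"
  using sAdA.Lam2_ends(1) pm.LC_ends(2) by (simp_all add: e spans)
 have iso: "EX p. reps SS pm.P TAdA w {p}" if w: "w : Obj pm.P" for w
 proof -
  obtain x y \<alpha> where w': "w = (x, y, \<alpha>)" by (cases w)
  have o: "finite x" "finite y" "\<alpha> : Hom SS x y" using w by (simp_all add: w' pm.Obj_P)
  \<comment> \<open>Every object \<open>(x, y, \<alpha>)\<close> is isomorphic to
    \<open>(x, x, 1)\<close> through \<open>\<alpha>\<close>, so the canonical map is an
    equivalence.\<close>
  have "reps SS pm.P TAdA w {(x, (fo TAdA x, w, idS x, \<alpha>))}"
  proof (rule com_pair_reps[OF id_cospan cover_TAdA])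
   show "(fo TAdA x, w, idS x, \<alpha>) : Hom pm.P (fo TAdA x) w"
    using w o id_hom[OF o(1)] by (simp add: w' pm.Hom_P pm.Obj_P SS_idr)
   show "\<exists>k\<in>Hom SS z' x. idS x oo fm idF k = p' \<or> \<alpha> oo fm idF k = q'"
    if "(fo TAdA z', w, p', q') : Hom pm.P (fo TAdA z') w" for z' p' q'
    using that by (intro bexI[of _ p']) (auto simp: pm.Hom_P w' SS_idl)
  qed (rule o)
  thus ?thesis by blast
 qed
 have lc: "coh_iso pm.LC" by (rule coh_isoI[OF pm.LC_nat pm.LC_iso])
 have "coh_iso (Lam2 sAdA.ss)"
  by (rule coh_isoI[OF sAdA.Lam2_nat sAdA.Lam2_equivalence_iso[OF iso]])
 thus "coh_iso coh_pm" unfolding e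
  by (rule coh_iso_vcomp[OF lc]) (use sAdA.Lam2_ends(2) pm.LC_ends(1) pm.comp_span_eq in simp)
 assume V: "V : Obj RepS" and b: "finite b" and g: "g : Hom SS (sc x) b"
 have x: "finite x" using SS_eval(6)[OF g] by simp
 have bb: "b : Obj SS" and xx: "x : Obj SS" using b x by simp_all
 have z: "(x, x, idS x) : Obj pm.P" using x id_hom[OF x] by (simp add: pm.Obj_P)
 note c = pm.LC_carrier[OF V bb] sAdA.Lam2_carrier[OF V bb]
 have i: "ind_inj SS SS plus1 (fcmp V plus1) b x g : \<M> (ind_dim SS SS plus1 (fcmp V plus1) b) (fo V (sc x))"
  using pj_cm[OF V1_obj[OF V] b g] by simp
 show "nt (nt coh_pm V) b * ind_inj SS SS plus1 (fcmp V plus1) b x g = pj (AO V) b x g * aj V x x (idS x)"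
  using V bb c i pm.LC_inj[OF V bb z, of g] sAdA.Lam2_graph_inj[OF V bb xx, of g] g by (simp add: e mat_assoc)
qed

lemma coh_mm: "coh_iso coh_mm" "nsrc coh_mm = Lam1 spAA" "ntgt coh_mm = fcmp (Lam1 spA) (Lam1 spA)"
 and coh_mm_inj: "V : Obj RepS ==> finite b ==> g : Hom SS x b ==>
  nt (nt coh_mm V) b * ind_inj SS SS idF (fcmp V plus2) b x g = aj (AO V) b x g * aj V (sc x) (sc x) (idS (sc x))"
proof -
 have e: "coh_mm = vcomp RepS RepS mm.LC (Lam2 sAA.ss)"
  using sAA.strict_sspan_eq by (simp add: coh_mm_def spans can_AA_def mm.comp_span_eq)
 show ends: "nsrc coh_mm = Lam1 spAA" "ntgt coh_mm = fcmp (Lam1 spA) (Lam1 spA)"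
  using sAA.Lam2_ends(1) mm.LC_ends(2) by (simp_all add: e spans)
 have iso: "EX p. reps SS mm.P TAA w {p}" if w: "w : Obj mm.P" for w
 proof -
  obtain x y \<alpha> where w': "w = (x, y, \<alpha>)" by (cases w)
  have o: "finite x" "finite y" "\<alpha> : Hom SS x (sc y)" using w by (simp_all add: w' mm.Obj_P)
  note ai = SS_inv[OF o(3)]
  \<comment> \<open>Here \<open>x\<close> is only isomorphic to \<open>y + 1\<close>, so the object
    is compared with \<open>(y + 1, y, 1)\<close> through the inverse of
    \<open>\<alpha>\<close>.\<close>
  have "reps SS mm.P TAA w {(y, (fo TAA y, w, cat_inv SS \<alpha>, idS y))}"
  proof (rule com_pair_reps[OF id_plus1_cospan cover_TAA])
   show "(fo TAA y, w, cat_inv SS \<alpha>, idS y) : Hom mm.P (fo TAA y) w"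
    using w o id_hom[OF o(2)] ai id_hom[of "sc y"] by (simp add: w' mm.Hom_P mm.Obj_P SS_idl plus1_idn)
   show "\<exists>k\<in>Hom SS z' y. cat_inv SS \<alpha> oo scm k = p' \<or> idS y oo fm idF k = q'"
    if "(fo TAA z', w, p', q') : Hom mm.P (fo TAA z') w" for z' p' q'
    using that by (intro bexI[of _ q']) (auto simp: mm.Hom_P w' SS_idl)
  qed (rule o)
  thus ?thesis by blast
 qed
 have lc: "coh_iso mm.LC" by (rule coh_isoI[OF mm.LC_nat mm.LC_iso])
 have "coh_iso (Lam2 sAA.ss)"
  by (rule coh_isoI[OF sAA.Lam2_nat sAA.Lam2_equivalence_iso[OF iso]])
 thus "coh_iso coh_mm" unfolding e
  by (rule coh_iso_vcomp[OF lc]) (use sAA.Lam2_ends(2) mm.LC_ends(1) mm.comp_span_eq in simp)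
 assume V: "V : Obj RepS" and b: "finite b" and g: "g : Hom SS x b"
 have x: "finite x" using SS_eval(6)[OF g] by simp
 have bb: "b : Obj SS" and xx: "x : Obj SS" using b x by simp_all
 have z: "(sc x, x, idS (sc x)) : Obj mm.P" using x id_hom[of "sc x"] by (simp add: mm.Obj_P)
 note c = mm.LC_carrier[OF V bb] sAA.Lam2_carrier[OF V bb]
 have "fcmp V plus2 : Obj RepS" unfolding plus2_def fcmp_assoc by (rule V1_obj[OF V1_obj[OF V]])
 hence i: "ind_inj SS SS idF (fcmp V plus2) b x g : \<M> (ind_dim SS SS idF (fcmp V plus2) b) (fo V (fo plus2 x))"
  using I.inj_cm[OF Rep_objD(1) bb xx, of "fcmp V plus2" g] g by (simp del: Rep_simps)
 show "nt (nt coh_mm V) b * ind_inj SS SS idF (fcmp V plus2) b x g = aj (AO V) b x g * aj V (sc x) (sc x) (idS (sc x))"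
  using V bb c i mm.LC_inj[OF V bb z, of g] sAA.Lam2_graph_inj[OF V bb xx, of g] g by (simp add: e mat_assoc)
qed

lemma coh_pp: "coh_iso coh_pp" "nsrc coh_pp = Lam1 spAdAd" "ntgt coh_pp = fcmp (Lam1 spAd) (Lam1 spAd)"
 and coh_pp_inj: "V : Obj RepS ==> finite b ==> g : Hom SS (fo plus2 x) b ==>
  nt (nt coh_pp V) b * ind_inj SS SS plus2 V b x g = pj (PO V) b (sc x) g * pj V (sc x) x (idS (sc x))"
proof -
 have e: "coh_pp = vcomp RepS RepS pp.LC (Lam2 sAdAd.ss)"
  using sAdAd.strict_sspan_eq by (simp add: coh_pp_def spans can_AdAd_def pp.comp_span_eq)
 show ends: "nsrc coh_pp = Lam1 spAdAd" "ntgt coh_pp = fcmp (Lam1 spAd) (Lam1 spAd)"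
  using sAdAd.Lam2_ends(1) pp.LC_ends(2) by (simp_all add: e spans)
 have iso: "EX p. reps SS pp.P TAdAd w {p}" if w: "w : Obj pp.P" for w
 proof -
  obtain x y \<alpha> where w': "w = (x, y, \<alpha>)" by (cases w)
  have o: "finite x" "finite y" "\<alpha> : Hom SS (sc x) y" using w by (simp_all add: w' pp.Obj_P)
  have "reps SS pp.P TAdAd w {(x, (fo TAdAd x, w, idS x, \<alpha>))}"
  proof (rule com_pair_reps[OF plus1_id_cospan cover_TAdAd])
   show "(fo TAdAd x, w, idS x, \<alpha>) : Hom pp.P (fo TAdAd x) w"
    using w o id_hom[OF o(1)] id_hom[of "sc x"] by (simp add: w' pp.Hom_P pp.Obj_P plus1_idn)
   show "\<exists>k\<in>Hom SS z' x. idS x oo fm idF k = p' \<or> \<alpha> oo scm k = q'"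
    if "(fo TAdAd z', w, p', q') : Hom pp.P (fo TAdAd z') w" for z' p' q'
    using that by (intro bexI[of _ p']) (auto simp: pp.Hom_P w' SS_idl)
  qed (rule o)
  thus ?thesis by blast
 qed
 have lc: "coh_iso pp.LC" by (rule coh_isoI[OF pp.LC_nat pp.LC_iso])
 have "coh_iso (Lam2 sAdAd.ss)"
  by (rule coh_isoI[OF sAdAd.Lam2_nat sAdAd.Lam2_equivalence_iso[OF iso]])
 thus "coh_iso coh_pp" unfolding e
  by (rule coh_iso_vcomp[OF lc]) (use sAdAd.Lam2_ends(2) pp.LC_ends(1) pp.comp_span_eq in simp)
 assume V: "V : Obj RepS" and b: "finite b" and g: "g : Hom SS (fo plus2 x) b"
 have x: "finite x" using SS_eval(6)[OF g] by (simp add: plus2_fm)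
 have bb: "b : Obj SS" and xx: "x : Obj SS" using b x by simp_all
 have z: "(x, sc x, idS (sc x)) : Obj pp.P" using x id_hom[of "sc x"] by (simp add: pp.Obj_P)
 note c = pp.LC_carrier[OF V bb] sAdAd.Lam2_carrier[OF V bb]
 have i: "ind_inj SS SS plus2 V b x g : \<M> (ind_dim SS SS plus2 V b) (fo V x)"
  using sAA.SF.G.inj_cm[OF Rep_objD(1)[OF V] bb xx g] .
 show "nt (nt coh_pp V) b * ind_inj SS SS plus2 V b x g = pj (PO V) b (sc x) g * pj V (sc x) x (idS (sc x))"
  using V bb c i pp.LC_inj[OF V bb z, of g] sAdAd.Lam2_graph_inj[OF V bb xx, of g] g by (simp add: e mat_assoc plus2_fm)
qed


subsection \<open>Formulas for the images of the generators\<close>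

interpretation cT1: strict_covers SS mp.P SS SS SS T1 idF "fcmp idF com_p2" idF "fcmp idF com_p1" idF
 by (rule strict_covers_conv) (rule sT1.strict_covers_axioms)
interpretation cT2: strict_covers SS mp.P SS SS SS T2 idF "fcmp idF com_p2" plus1 "fcmp idF com_p1" plus1
 by (rule strict_covers_conv) (rule sT2.strict_covers_axioms)
interpretation ceta: strict_covers SS SS SS SS SS idF plus1 plus1 idF plus1 idF
 by (rule strict_covers_conv) (rule seta.strict_covers_axioms)

lemma sspans: "i_id = sT1.ss" "i_AdA = sT2.ss" "eta = seta.ss" "sigma_Ad = su.ss" "sigma_A = sv.ss"
 "conv_sspan i_id = cT1.ss" "conv_sspan i_AdA = cT2.ss" "conv_sspan eta = ceta.ss"
proof -
 show e: "i_id = sT1.ss" "i_AdA = sT2.ss" "eta = seta.ss"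
  using sT1.strict_sspan_eq sT2.strict_sspan_eq seta.strict_sspan_eq
  by (simp_all add: i_id_def i_AdA_def eta_def spans mp.comp_span_eq)
 show "sigma_Ad = su.ss" "sigma_A = sv.ss" by (simp_all add: sigma_Ad_def sigma_A_def spans)
 show "conv_sspan i_id = cT1.ss" "conv_sspan i_AdA = cT2.ss" "conv_sspan eta = ceta.ss"
  unfolding e sT1.strict_sspan_eq[symmetric] sT2.strict_sspan_eq[symmetric] seta.strict_sspan_eq[symmetric]
   conv_strict_sspan[OF sT1.strict_covers_axioms] conv_strict_sspan[OF sT2.strict_covers_axioms] conv_strict_sspan[OF seta.strict_covers_axioms]
  by (rule cT1.strict_sspan_eq cT2.strict_sspan_eq ceta.strict_sspan_eq)+
qed

lemma Lam2_gen:
 "is_nat RepS RepS (Lam2 i_id)" "nsrc (Lam2 i_id) = Lam1 (id_span SS)" "ntgt (Lam2 i_id) = Lam1 (comp_span spA spAd)"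
 "is_nat RepS RepS (Lam2 (conv_sspan i_id))" "nsrc (Lam2 (conv_sspan i_id)) = Lam1 (comp_span spA spAd)" "ntgt (Lam2 (conv_sspan i_id)) = Lam1 (id_span SS)"
 "is_nat RepS RepS (Lam2 eta)" "nsrc (Lam2 eta) = Lam1 (id_span SS)" "ntgt (Lam2 eta) = Lam1 spAdA"
 "is_nat RepS RepS (Lam2 (conv_sspan eta))" "nsrc (Lam2 (conv_sspan eta)) = Lam1 spAdA" "ntgt (Lam2 (conv_sspan eta)) = Lam1 (id_span SS)"
 "is_nat RepS RepS (Lam2 sigma_Ad)" "nsrc (Lam2 sigma_Ad) = Lam1 spAdAd" "ntgt (Lam2 sigma_Ad) = Lam1 spAdAd"
 "is_nat RepS RepS (Lam2 sigma_A)" "nsrc (Lam2 sigma_A) = Lam1 spAA" "ntgt (Lam2 sigma_A) = Lam1 spAA"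
 "is_nat RepS RepS (Lam2 i_AdA)" "nsrc (Lam2 i_AdA) = Lam1 spAdA" "ntgt (Lam2 i_AdA) = Lam1 (comp_span spA spAd)"
 "is_nat RepS RepS (Lam2 (conv_sspan i_AdA))" "nsrc (Lam2 (conv_sspan i_AdA)) = Lam1 (comp_span spA spAd)" "ntgt (Lam2 (conv_sspan i_AdA)) = Lam1 spAdA"
 unfolding sspans(6-8) unfolding sspans(1-5) spans mp.comp_span_eq
 by (rule sT1.Lam2_nat cT1.Lam2_nat seta.Lam2_nat ceta.Lam2_nat su.Lam2_nat sv.Lam2_nat sT2.Lam2_nat cT2.Lam2_nat
   sT1.Lam2_ends cT1.Lam2_ends seta.Lam2_ends ceta.Lam2_ends su.Lam2_ends sv.Lam2_ends sT2.Lam2_ends cT2.Lam2_ends)+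

abbreviation "LA \<equiv> Lam1 spA"
abbreviation "LP \<equiv> Lam1 spAd"
abbreviation "homE \<equiv> Hom (End_cat RepS)"

lemma LamC_gen_hom:
 "LamC_gen gen_c : homE idF (fcmp LA LP)" "LamC_gen gen_d : homE (fcmp LA LP) idF"
 "LamC_gen gen_c' : homE idF (fcmp LP LA)" "LamC_gen gen_d' : homE (fcmp LP LA) idF"
 "LamC_gen gen_u : homE (fcmp LP LP) (fcmp LP LP)" "LamC_gen gen_v : homE (fcmp LA LA) (fcmp LA LA)"
 "LamC_gen gen_x : homE (fcmp LP LA) (fcmp LA LP)" "LamC_gen gen_y : homE (fcmp LA LP) (fcmp LP LA)"
proof -
 note l = lin_fcmp[OF lin_Lam1(2,1)] lin_fcmp[OF lin_Lam1(1,2)]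
  lin_fcmp[OF lin_Lam1(1,1)] lin_fcmp[OF lin_Lam1(2,2)] linear_functor_idF[OF RepS_cat]
 note i = coh_1 coh_mp coh_pm coh_mm coh_pp and n = coh_isoD
 note T = is_nat_transport[OF coh_1(1) n[OF coh_mp(1)]] is_nat_transport[OF coh_mp(1) n[OF coh_1(1)]]
  is_nat_transport[OF coh_1(1) n[OF coh_pm(1)]] is_nat_transport[OF coh_pm(1) n[OF coh_1(1)]]
  is_nat_transport[OF coh_pp(1) n[OF coh_pp(1)]] is_nat_transport[OF coh_mm(1) n[OF coh_mm(1)]]
  is_nat_transport[OF coh_pm(1) n[OF coh_mp(1)]] is_nat_transport[OF coh_mp(1) n[OF coh_pm(1)]]
 show "LamC_gen gen_c : homE idF (fcmp LA LP)" using T(1-3)[OF Lam2_gen(1)] l by (simp add: Hom_End_cat i Lam2_gen)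
 show "LamC_gen gen_d : homE (fcmp LA LP) idF" using T(4-6)[OF Lam2_gen(4)] l by (simp add: Hom_End_cat i Lam2_gen)
 show "LamC_gen gen_c' : homE idF (fcmp LP LA)" using T(7-9)[OF Lam2_gen(7)] l by (simp add: Hom_End_cat i Lam2_gen)
 show "LamC_gen gen_d' : homE (fcmp LP LA) idF" using T(10-12)[OF Lam2_gen(10)] l by (simp add: Hom_End_cat i Lam2_gen)
 show "LamC_gen gen_u : homE (fcmp LP LP) (fcmp LP LP)" using T(13-15)[OF Lam2_gen(13)] l by (simp add: Hom_End_cat i Lam2_gen)
 show "LamC_gen gen_v : homE (fcmp LA LA) (fcmp LA LA)" using T(16-18)[OF Lam2_gen(16)] l by (simp add: Hom_End_cat i Lam2_gen)
 show "LamC_gen gen_x : homE (fcmp LP LA) (fcmp LA LP)" using T(19-21)[OF Lam2_gen(19)] l by (simp add: Hom_End_cat i Lam2_gen)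
 show "LamC_gen gen_y : homE (fcmp LA LP) (fcmp LP LA)" using T(22-24)[OF Lam2_gen(22)] l by (simp add: Hom_End_cat i Lam2_gen)
qed

declare LamC_gen.simps [simp del]

abbreviation "gn k V b \<equiv> nt (nt (LamC_gen k) V) b"

lemma homE_carrier:
 assumes t: "\<tau> : homE F G" and V: "V : Obj RepS" and b: "finite b"
 shows "nt (nt \<tau> V) b : \<M> (fo (fo G V) b) (fo (fo F V) b)"
 using intw_cm[OF Hom_RepD(1)[OF End_component[OF t V]], of b] Hom_RepD(2,3)[OF End_component[OF t V]] b by simp

section \<open>Comma representatives of the functors \<open>T1\<close> and \<open>T2\<close>\<close>

lemma fm_cat_inv_p:
 assumes "cospan_covers SS SS SS G F" "h : Hom (iso_comma SS SS SS G F) s t"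
 shows "fm com_p1 (cat_inv (iso_comma SS SS SS G F) h) = cat_inv SS (fm com_p1 h)"
  "fm com_p2 (cat_inv (iso_comma SS SS SS G F) h) = cat_inv SS (fm com_p2 h)"
proof -
 interpret cospan_covers SS SS SS G F by fact
 show "fm com_p1 (cat_inv (iso_comma SS SS SS G F) h) = cat_inv SS (fm com_p1 h)"
  "fm com_p2 (cat_inv (iso_comma SS SS SS G F) h) = cat_inv SS (fm com_p2 h)"
  using functor_inv[OF functor_p1 category_P cat_SS grp_iso[OF groupoid_P assms(2)]]
   functor_inv[OF functor_p2 category_P cat_SS grp_iso[OF groupoid_P assms(2)]] by auto
qed

text \<open>The arrow with coordinates 1 and \<open>\<beta>\<close> starts at the image of
  \<open>x\<close>, and any other arrow from an image of \<open>T1\<close> factors through it by its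
  first coordinate.\<close>

lemma reps_T1:
 assumes k: "\<beta> : Hom SS x y"
 shows "reps SS mp.P T1 (x, y, scm \<beta>) {(x, (fo T1 x, (x, y, scm \<beta>), idS x, \<beta>))}"
proof (rule com_pair_reps[OF plus1_cospan cover_T1])
 note o = SS_eval(6,7)[OF k]
 show "(fo T1 x, (x, y, scm \<beta>), idS x, \<beta>) : Hom mp.P (fo T1 x) (x, y, scm \<beta>)"
  using o id_hom[OF o(1)] id_hom[of "sc x"] plus1_hom[OF k] k by (simp add: mp.Hom_P mp.Obj_P plus1_idn)
 show "\<exists>k\<in>Hom SS z' x. idS x oo fm idF k = p' \<or> \<beta> oo fm idF k = q'"
  if "(fo T1 z', (x, y, scm \<beta>), p', q') : Hom mp.P (fo T1 z') (x, y, scm \<beta>)" for z' p' q'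
  using that by (intro bexI[of _ p']) (auto simp: mp.Hom_P SS_idl)
 show "finite x" by (rule o)
qed

text \<open>An arrow with coordinates \<open>p\<close> and \<open>q\<close> from an image of
  \<open>T1\<close> would exhibit \<open>\<alpha>\<close> as
  \<open>(q p\<^sup>-\<^sup>1) + 1\<close>.\<close>

lemma reps_T1_empty:
 assumes n: "\<nexists>\<beta>. \<beta> : Hom SS x y & \<alpha> = scm \<beta>"
 shows "reps SS mp.P T1 (x, y, \<alpha>) {}"
proof (rule repsI)
 fix z g assume z: "z : Obj SS" and g: "g : Hom mp.P (fo T1 z) (x, y, \<alpha>)"
 from g obtain p q where "g = (fo T1 z, (x, y, \<alpha>), p, q)" by (rule mp.Hom_PE)
 with g have pq: "p : Hom SS z x" "q : Hom SS z y" "\<alpha> : Hom SS (sc x) (sc y)"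
  "scm q oo idS (sc z) = \<alpha> oo scm p" by (auto simp: mp.Hom_P mp.Obj_P)
 have "scm (q oo cat_inv SS p) = \<alpha>"
  using pq(4) SS_inv[OF pq(1)] SS_eval(7)[OF pq(1)] SS_idr[OF plus1_hom[OF pq(2)]] SS_idr[OF pq(3)]
  by (simp add: plus1_cmp SS_assoc plus1_cmp[symmetric] plus1_idn)
 thus "EX r h k. (r, h) : {} & k : Hom SS z r & Cmp mp.P h (fm T1 k) = g"
  using n SS_cmp[OF SS_inv(1)[OF pq(1)] pq(2)] by blast
qed auto

lemma reps_T2:
 assumes p: "p : Hom SS (sc z) x" and q: "q : Hom SS (sc z) y" and a: "\<alpha> : Hom SS (sc x) (sc y)"
  and e: "\<alpha> oo scm p = scm q oo swap2 z"
 shows "reps SS mp.P T2 (x, y, \<alpha>) {(z, (fo T2 z, (x, y, \<alpha>), p, q))}"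
proof (rule com_pair_reps[OF plus1_cospan cover_T2])
 show z: "finite z" using SS_eval(6)[OF p] by simp
 note o = SS_eval(7)[OF p] SS_eval(7)[OF q] and a' = SS_eval[OF a]
 show "(fo T2 z, (x, y, \<alpha>), p, q) : Hom mp.P (fo T2 z) (x, y, \<alpha>)"
  using z o p q a e swap2_hom[OF z] by (simp add: mp.Hom_P mp.Obj_P plus2_fm)
 \<comment> \<open>Evaluating the square at 1, which the swap sends to 0, forces \<open>p' 0\<close>
   to be the \<open>i\<close> with \<open>\<alpha> (i + 1) = 0\<close>. Any two choices of
   \<open>p\<close> thus agree at 0 and differ by an arrow plus one.\<close>
 have key: "EX i. p' 0 = Some i & \<alpha> (Suc i) = Some 0"
  if p': "p' : Hom SS (sc z') x" and e': "\<alpha> oo scm p' = scm q' oo swap2 z'" for z' p' q'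
 proof -
  obtain i where i: "p' 0 = Some i" using SS_eval(1)[OF p', of 0] by (auto simp: plus1_fo)
  have "swap2 z' (Suc 0) = Some 0" by (simp add: swap2_eval plus2_fo)
  thus ?thesis using fun_cong[OF e', of "Suc 0"] i by (simp add: map_comp_def)
 qed
 fix z' p' q' assume "(fo T2 z', (x, y, \<alpha>), p', q') : Hom mp.P (fo T2 z') (x, y, \<alpha>)"
 hence p': "p' : Hom SS (sc z') x" and e': "\<alpha> oo scm p' = scm q' oo swap2 z'" by (simp_all add: mp.Hom_P)
 obtain i where i: "p 0 = Some i" "\<alpha> (Suc i) = Some 0" using key[OF p e] by blast
 obtain i' where i': "p' 0 = Some i'" "\<alpha> (Suc i') = Some 0" using key[OF p' e'] by blast
 have "i' = i" using a'(5)[OF i(2) i'(2)] by simp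
 note pi = SS_inv[OF p]
 have "(cat_inv SS p oo p') 0 = Some 0"
  using fun_cong[OF pi(2), of 0] i i' \<open>i' = i\<close> by (simp add: map_comp_def restrict_map_def plus1_fo)
 then obtain k where k: "k : Hom SS z' z" "cat_inv SS p oo p' = scm k" using plus1_fix0[OF SS_cmp[OF p' pi(1)]] by blast
 have "p oo scm k = p'" using pi(3) SS_idl[OF p'] by (simp add: k(2)[symmetric] flip: SS_assoc)
 thus "\<exists>k\<in>Hom SS z' z. p oo scm k = p' \<or> q oo scm k = q'" using k(1) by blast
qed

text \<open>Evaluate the square of a hypothetical arrow at 0: the swap moves 0 to 1, so the side
  with \<open>q\<close> takes a positive value, whereas the side with \<open>\<beta>\<close> and
  \<open>p\<close> fixes 0.\<close>

lemma reps_T2_empty: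
 assumes "\<beta> : Hom SS x y"
 shows "reps SS mp.P T2 (x, y, scm \<beta>) {}"
proof (rule repsI)
 fix z g assume z: "z : Obj SS" and g: "g : Hom mp.P (fo T2 z) (x, y, scm \<beta>)"
 from g obtain p q where "g = (fo T2 z, (x, y, scm \<beta>), p, q)" by (rule mp.Hom_PE)
 with g have e: "scm q oo swap2 z = scm \<beta> oo scm p" by (auto simp: mp.Hom_P)
 have "swap2 z 0 = Some (Suc 0)" by (simp add: swap2_eval plus2_fo)
 hence "map_option Suc (q 0) = Some 0" using fun_cong[OF e, of 0] by (simp add: map_comp_def)
 thus "EX r h k. (r, h) : {} & k : Hom SS z r & Cmp mp.P h (fm T2 k) = g" by simp
qed auto

text \<open>Since \<open>\<alpha>\<close> does not fix 0, it sends 0 to some \<open>j + 1\<close>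
  and some \<open>i + 1\<close> to 0. With \<open>z\<close> the rest of \<open>x\<close>, the
  bijections \<open>p\<close> and \<open>q\<close> treat \<open>i\<close> and \<open>j\<close> as
  the element added to \<open>z\<close>; under these identifications \<open>\<alpha>\<close> becomes
  the swap of the two added elements.\<close>

lemma ex_T2:
 assumes a: "\<alpha> : Hom SS (sc x) (sc y)" and n: "\<nexists>\<beta>. \<beta> : Hom SS x y & \<alpha> = scm \<beta>"
 shows "EX z p q. p : Hom SS (sc z) x & q : Hom SS (sc z) y & \<alpha> oo scm p = scm q oo swap2 z"
proof -
 note e = SS_eval[OF a]
 have n0: "\<alpha> 0 ~= Some 0" using plus1_fix0[OF a] n by blast
 obtain j where j: "\<alpha> 0 = Some (Suc j)" "j : y" using e(1)[of 0] n0 by (auto simp: plus1_fo)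
 obtain n' where n': "n' : sc x" "\<alpha> n' = Some 0" using e(3)[of 0] by (auto simp: plus1_fo)
 then obtain i where i: "i : x" "\<alpha> (Suc i) = Some 0" using n0 by (auto simp: plus1_fo)
 define z where "z = x - {i}"
 define p where "p = (%n. case n of 0 => Some i | Suc m => if m : z then Some m else None)"
 \<comment> \<open>On \<open>z\<close> this is \<open>\<alpha>\<close> with the shift undone; by
   \<open>al\<close> below no value there is 0, so the subtraction loses nothing.\<close>
 define q where "q = (%n. case n of 0 => Some j | Suc m => if m : z then map_option (%m. m - 1) (\<alpha> (Suc m)) else None)"
 have ps: "p 0 = Some i" "p (Suc m) = (if m : z then Some m else None)" for m by (simp_all add: p_def)
 have p: "p : Hom SS (sc z) x"
 proof (rule Hom_SSI)
  show "\<exists>n\<in>sc z. p n = Some m" if "m : x" for m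
   using that ps by (intro bexI[of _ "if m = i then 0 else Suc m"]) (auto simp: plus1_fo z_def)
  show "n = n'" if "p n = Some m" "p n' = Some m" for n n' m
   using that by (cases n; cases n') (auto simp: p_def z_def split: if_splits)
  show "finite (sc z)" using e(6) by (simp add: z_def)
  show "p n = None" if "n \<notin> sc z" for n using that by (cases n) (auto simp: p_def plus1_fo)
 qed (use i in \<open>auto simp: plus1_fo ps z_def\<close>)
 have al: "EX l. \<alpha> (Suc m) = Some (Suc l)" if "m : z" for m
 proof -
  have "Suc m : sc x" using that by (simp add: plus1_fo z_def)
  then obtain l where l: "\<alpha> (Suc m) = Some l" using e(1) by blast
  thus ?thesis using e(5)[OF i(2), of "Suc m"] that by (cases l) (auto simp: z_def)
 qed
 have qe: "map_option Suc (q n) = (\<alpha> oo p') n" if "p' = (%n. case n of 0 => Some 0 | Suc m => if m : z then Some (Suc m) else None)" for n p'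
  using al j by (cases n) (fastforce simp: q_def that map_comp_def)+
 have s: "\<alpha> oo scm p = scm q oo swap2 z"
 proof
  fix n
  consider "n = 0" | "n = Suc 0" | m where "n = Suc (Suc m)" by (metis not0_implies_Suc)
  thus "(\<alpha> oo scm p) n = (scm q oo swap2 z) n"
  proof cases
   case 3
   show ?thesis
   proof (cases "m : z")
    case True
    thus ?thesis using al[OF True] by (auto simp: 3 map_comp_def swap2_eval plus2_fo ps q_def)
   qed (auto simp: 3 map_comp_def swap2_eval plus2_fo ps)
  qed (use i j in \<open>simp_all add: map_comp_def swap2_eval plus2_fo ps q_def\<close>)
 qed
 have zf: "finite z" using SS_eval(6)[OF p] by simp
 \<comment> \<open>The swap is an involution, so the square can be solved for \<open>q + 1\<close>.
   As a composite of bijections fixing 0 it comes from a bijection, which shows that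
   \<open>q\<close> is one without a direct check.\<close>
 have sw: "scm q = (\<alpha> oo scm p) oo swap2 z"
 proof
  fix n show "scm q n = ((\<alpha> oo scm p) oo swap2 z) n"
  proof (cases "n : fo plus2 z")
   case True
   thus ?thesis using fun_cong[OF arg_cong[OF swap2_swap2[of z], of "%f. scm q oo f"], of n]
    unfolding s SS_assoc by (simp add: map_comp_def restrict_map_def)
  next
   case False
   hence "scm q n = None" by (cases n; cases "n - 1") (auto simp: plus2_fo q_def)
   moreover have "swap2 z n = None" using False by (simp add: swap2_eval)
   ultimately show ?thesis by (simp add: map_comp_def)
  qed
 qed
 have "scm q : Hom SS (sc (sc z)) (sc y)"
  unfolding sw using SS_cmp[OF swap2_hom[OF zf], unfolded plus2_fm, OF SS_cmp[OF plus1_hom[OF p] a]] .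
 then obtain k where k: "k : Hom SS (sc z) y" "scm q = scm k" using plus1_fix0 by (metis plus1_0)
 hence "q : Hom SS (sc z) y" using plus1_inject[OF k(2)] by simp
 thus ?thesis using p s by blast
qed


context
 fixes V :: S_rep and b :: fset_obj assumes V: "V : Obj RepS" and b: "finite b"
begin

lemma bb: "b : Obj SS" using b by simp

lemmas VF = VS[OF V b]

lemma V2_obj: "fcmp V plus2 : Obj RepS"
 unfolding plus2_def fcmp_assoc by (rule V1_obj[OF V1_obj[OF V]])

lemma inj_carriers:
 "g : Hom SS x b ==> ind_inj SS SS idF V b x g : \<M> (ind_dim SS SS idF V b) (fo V x)"
 "g : Hom SS (fo plus2 x) b ==> ind_inj SS SS plus2 V b x g : \<M> (ind_dim SS SS plus2 V b) (fo V x)"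
 "g : Hom SS x b ==> ind_inj SS SS idF (fcmp V plus2) b x g : \<M> (ind_dim SS SS idF (fcmp V plus2) b) (fo V (fo plus2 x))"
 "w : Obj mp.P ==> g : Hom SS (fo mp.p2 w) b ==>
  ind_inj mp.P SS mp.p2 (fcmp V mp.p1) b w g : \<M> (ind_dim mp.P SS mp.p2 (fcmp V mp.p1) b) (fo V (fo mp.p1 w))"
proof -
 show "ind_inj SS SS idF V b x g : \<M> (ind_dim SS SS idF V b) (fo V x)" if g: "g : Hom SS x b"
  using I.inj_cm[OF VF bb, of x g] g SS_eval(6)[OF g] by simp
 show "ind_inj SS SS idF (fcmp V plus2) b x g : \<M> (ind_dim SS SS idF (fcmp V plus2) b) (fo V (fo plus2 x))" if g: "g : Hom SS x b"
  using I.inj_cm[OF Rep_objD(1)[OF V2_obj] bb, of x g] g SS_eval(6)[OF g] by simp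
 show "ind_inj SS SS plus2 V b x g : \<M> (ind_dim SS SS plus2 V b) (fo V x)" if g: "g : Hom SS (fo plus2 x) b"
  using sAA.SF.G.inj_cm[OF VF bb _ g] SS_eval(6)[OF g] by (simp add: plus2_fm)
 show "ind_inj mp.P SS mp.p2 (fcmp V mp.p1) b w g : \<M> (ind_dim mp.P SS mp.p2 (fcmp V mp.p1) b) (fo V (fo mp.p1 w))"
  if "w : Obj mp.P" "g : Hom SS (fo mp.p2 w) b"
  using mp.p2.inj_cm[OF Rep_objD(1)[OF mp.p1.Res_obj[OF V]] bb that] by simp
qed

text \<open>The identity of \<open>V b\<close> is the image under \<open>coh_1\<close> of the
  injection at the identity of \<open>b\<close>. The graph of \<open>T1\<close> relabels that
  injection, and \<open>coh_mp\<close> splits it into two letters.\<close>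

lemma gen_c:
 "gn gen_c V b = aj (PO V) b b (idS b) * pj V (sc b) b (idS (sc b))"
proof -
 have ib: "idS b : Hom SS b b" and ib1: "idS (sc b) : Hom SS (sc b) (sc b)" using b id_hom by simp_all
 have "gn gen_c V b * fm V (idS b) = nt (nt coh_mp V) b * (nt (nt (Lam2 i_id) V) b * ind_inj SS SS idF V b b (idS b))"
  unfolding LamC_gen.simps
  by (rule transport_inj[OF coh_1(1) coh_isoD[OF coh_mp(1)] Lam2_gen(1) _ _ V b _ coh_1_inj[OF V b ib]])
   (use inj_carriers(1)[OF ib] in \<open>simp_all add: Lam2_gen coh_1 coh_mp Lam1_def spans\<close>)
 moreover have "nt (nt (Lam2 i_id) V) b * ind_inj SS SS idF V b b (idS b) =
   ind_inj mp.P SS (fcmp idF com_p2) (fcmp V (fcmp idF com_p1)) b (b, b, idS (sc b)) (idS b)"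
  using sT1.Lam2_graph_inj[OF V bb bb, of "idS b"] ib by (simp add: sspans)
 ultimately show ?thesis
  using coh_mp_inj[OF V b ib1 ib] homE_carrier[OF LamC_gen_hom(1) V b] fmV_one[OF V b b] by simp
qed

text \<open>The converse of \<open>i_id\<close> sums over the classes of lifts along
  \<open>T1\<close>: there is one if \<open>\<alpha>\<close> has the form
  \<open>\<beta> + 1\<close>, and none otherwise.\<close>

lemma gen_d:
 assumes g: "g : Hom SS y b" and a: "\<alpha> : Hom SS (sc x) (sc y)"
 shows "\<beta> : Hom SS x y ==> \<alpha> = scm \<beta> ==>
   gn gen_d V b * (aj (PO V) b y g * pj V (sc y) x \<alpha>) = fm V (g oo \<beta>)"
  and "\<nexists>\<beta>. \<beta> : Hom SS x y & \<alpha> = scm \<beta> ==>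
   gn gen_d V b * (aj (PO V) b y g * pj V (sc y) x \<alpha>) = 0\<^sub>m (fo V b) (fo V x)"
proof -
 have w: "(x, y, \<alpha>) : Obj mp.P" using a SS_eval(6,7)[OF a] by (simp add: mp.Obj_P)
 have g': "g : Hom SS (fo (fcmp idF com_p2) (x, y, \<alpha>)) b" using g by simp
 have t: "gn gen_d V b * (aj (PO V) b y g * pj V (sc y) x \<alpha>) =
   nt (nt coh_1 V) b * (nt (nt (Lam2 (conv_sspan i_id)) V) b * ind_inj mp.P SS (fcmp idF com_p2) (fcmp V (fcmp idF com_p1)) b (x, y, \<alpha>) g)"
  unfolding LamC_gen.simps
  by (rule transport_inj[OF coh_mp(1) coh_isoD[OF coh_1(1)] Lam2_gen(4) _ _ V b _ coh_mp_inj[OF V b a g]])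
   (use inj_carriers(4)[OF w, of g] g in \<open>simp_all add: Lam2_gen coh_1 coh_mp Lam1_def mp.comp_span_eq spans\<close>)
 note L = cT1.Lam2_strict_inj[OF V bb w g']
 have c1: "nt (nt coh_1 V) b : \<M> (fo V b) (ind_dim SS SS idF V b)"
  using I.counit_carrier[OF V bb] by (simp add: coh_1_def Lam_unit_def)
 show "gn gen_d V b * (aj (PO V) b y g * pj V (sc y) x \<alpha>) = fm V (g oo \<beta>)"
  if k: "\<beta> : Hom SS x y" and ak: "\<alpha> = scm \<beta>"
 proof -
  have R: "reps SS mp.P T1 (x, y, \<alpha>) {(x, (fo T1 x, (x, y, \<alpha>), idS x, \<beta>))}" using reps_T1[OF k] by (simp only: ak)
  have x: "finite x" using SS_eval(6)[OF k] .
  have h: "(fo T1 x, (x, y, \<alpha>), idS x, \<beta>) : Hom mp.P (fo T1 x) (x, y, \<alpha>)" using reps_in(2)[OF R] by blast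
  note gk = SS_cmp[OF k g]
  note i = inj_carriers(1)[OF gk]
  show ?thesis unfolding t sspans(6) L[OF R]
   using fm_cat_inv_p(1)[OF plus1_cospan h] i coh_1_inj[OF V b gk] fmV_one[OF V b x]
   by (simp add: SS_inv_id[OF x])
 qed
 show "gn gen_d V b * (aj (PO V) b y g * pj V (sc y) x \<alpha>) = 0\<^sub>m (fo V b) (fo V x)"
  if "\<nexists>\<beta>. \<beta> : Hom SS x y & \<alpha> = scm \<beta>"
  unfolding t sspans(6) L[OF reps_T1_empty[OF that]] using c1 by simp
qed

lemma coh_pm_carrier: "nt (nt coh_pm V) b : \<M> (dp (AO V) b) (dp (fcmp V plus1) b)"
 using intw_cm[OF Hom_RepD(1)[OF nat_hom[OF coh_isoD[OF coh_pm(1)] V]] bb] Hom_RepD(2,3)[OF nat_hom[OF coh_isoD[OF coh_pm(1)] V]]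
 by (simp add: coh_pm Lam1_def spans)

lemma coh_pm_inj':
 assumes h: "h : Hom SS (sc z) b" and M: "M : \<M> (fo V (sc z)) n"
 shows "nt (nt coh_pm V) b * (pj (fcmp V plus1) b z h * M) = pj (AO V) b z h * (aj V z z (idS z) * M)"
proof -
 have z: "finite z" using SS_eval(6)[OF h] by simp
 have i: "pj (fcmp V plus1) b z h : \<M> (dp (fcmp V plus1) b) (fo V (sc z))"
  using pj_cm[OF V1_obj[OF V] b h] by simp
 note c = pj_cm[OF AO_obj[OF V] b h] aj_cm[OF V z id_hom[OF z]]
 show ?thesis
  unfolding assoc_mult_mat[OF coh_pm_carrier i M, symmetric] coh_pm_inj[OF V b h] using c M by (simp add: mat_assoc)
qed

text \<open>The unit is taken along \<open>+1\<close>, so the sum over representatives remains: one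
  term for each way of removing an element from \<open>b\<close>.\<close>

lemma gen_c':
 assumes R: "reps SS SS plus1 b R"
 shows "gn gen_c' V b =
  mat_sum (dp (AO V) b) (fo V b) (%(z, h). pj (AO V) b z h * (aj V z z (idS z) * fm V (cat_inv SS h))) R"
proof -
 have ib: "idS b : Hom SS b b" using b id_hom by simp
 have ib': "idS b : Hom SS (fo (idF :: (nat set, fset_bij, nat set, fset_bij) fctr) b) b" using ib by simp
 have "gn gen_c' V b * fm V (idS b) = nt (nt coh_pm V) b * (nt (nt (Lam2 eta) V) b * ind_inj SS SS idF V b b (idS b))"
  unfolding LamC_gen.simps
  by (rule transport_inj[OF coh_1(1) coh_isoD[OF coh_pm(1)] Lam2_gen(7) _ _ V b _ coh_1_inj[OF V b ib]])
   (use inj_carriers(1)[OF ib] in \<open>simp_all add: Lam2_gen coh_1 coh_pm Lam1_def spans\<close>)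
 hence 1: "gn gen_c' V b = nt (nt coh_pm V) b * (nt (nt (Lam2 eta) V) b * ind_inj SS SS idF V b b (idS b))"
  using homE_carrier[OF LamC_gen_hom(3) V b] fmV_one[OF V b b] by simp
 have m: "pj (fcmp V plus1) b z h * fm V (cat_inv SS h) : \<M> (dp (fcmp V plus1) b) (fo V b)"
  and e: "nt (nt coh_pm V) b * (pj (fcmp V plus1) b z h * fm V (cat_inv SS h)) = pj (AO V) b z h * (aj V z z (idS z) * fm V (cat_inv SS h))"
  and zh: "finite z" "h : Hom SS (sc z) b"
  if "(z, h) : R" for z h
 proof -
  note zh = reps_in[OF R that]
  show z: "finite z" "h : Hom SS (sc z) b" using zh by simp_all
  note c = pj_cm[OF V1_obj[OF V] b z(2)] fmV_cm[OF V b SS_inv(1)[OF z(2)]] pj_cm[OF AO_obj[OF V] b z(2)] aj_cm[OF V z(1) id_hom[OF z(1)]]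
  show "pj (fcmp V plus1) b z h * fm V (cat_inv SS h) : \<M> (dp (fcmp V plus1) b) (fo V b)" using c by simp
  show "nt (nt coh_pm V) b * (pj (fcmp V plus1) b z h * fm V (cat_inv SS h)) = pj (AO V) b z h * (aj V z z (idS z) * fm V (cat_inv SS h))"
   by (rule coh_pm_inj'[OF z(2) c(2)])
 qed
 have 2: "nt (nt (Lam2 eta) V) b * ind_inj SS SS idF V b b (idS b) =
   mat_sum (dp (fcmp V plus1) b) (fo V b) (%(z, h). pj (fcmp V plus1) b z h * fm V (cat_inv SS h)) R"
 proof -
  have "nt (nt (Lam2 eta) V) b * ind_inj SS SS idF V b b (idS b) =
   mat_sum (dp (fcmp V plus1) b) (fo V b) (%(z, h). pj (fcmp V plus1) b z (idS b oo h) * fm V (cat_inv SS h)) R"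
   using seta.Lam2_strict_inj[OF V bb bb ib' R] by (simp add: sspans)
  also have "\<dots> = mat_sum (dp (fcmp V plus1) b) (fo V b) (%(z, h). pj (fcmp V plus1) b z h * fm V (cat_inv SS h)) R"
  proof (rule mat_sum_cong[OF HOL.refl])
   fix l assume l: "l : R"
   obtain z h where zh': "l = (z, h)" by force
   show "(case l of (z, h) => pj (fcmp V plus1) b z (idS b oo h) * fm V (cat_inv SS h)) =
    (case l of (z, h) => pj (fcmp V plus1) b z h * fm V (cat_inv SS h))"
    using SS_idl[OF zh(2)[OF l[unfolded zh']]] by (simp add: zh')
  qed
  finally show ?thesis .
 qed
 have "nt (nt coh_pm V) b * mat_sum (dp (fcmp V plus1) b) (fo V b) (%(z, h). pj (fcmp V plus1) b z h * fm V (cat_inv SS h)) R =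
   mat_sum (dp (AO V) b) (fo V b) (%l. nt (nt coh_pm V) b * (case l of (z, h) => pj (fcmp V plus1) b z h * fm V (cat_inv SS h))) R"
  by (rule mult_mat_sum[OF coh_pm_carrier]) (use m in force)
 also have "\<dots> = mat_sum (dp (AO V) b) (fo V b) (%(z, h). pj (AO V) b z h * (aj V z z (idS z) * fm V (cat_inv SS h))) R"
 proof (rule mat_sum_cong[OF HOL.refl])
  fix l assume l: "l : R"
  obtain z h where zh': "l = (z, h)" by force
  show "nt (nt coh_pm V) b * (case l of (z, h) => pj (fcmp V plus1) b z h * fm V (cat_inv SS h)) =
   (case l of (z, h) => pj (AO V) b z h * (aj V z z (idS z) * fm V (cat_inv SS h)))"
   using e[OF l[unfolded zh']] by (simp add: zh')
 qed
 finally show ?thesis unfolding 1 2 .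
qed

text \<open>Once the inner index is an identity, the converse of \<open>eta\<close> merges the two
  letters into one injection, and \<open>coh_1\<close> applies \<open>V\<close> to its
  index.\<close>

lemma gen_d':
 assumes g: "g : Hom SS (sc x) b" and k: "k : Hom SS z x"
 shows "gn gen_d' V b * (pj (AO V) b x g * aj V x z k) = fm V (g oo scm k)"
proof -
 define h where "h = g oo scm k"
 have z: "finite z" using SS_eval(6)[OF k] .
 hence zz: "z : Obj SS" by simp
 have h: "h : Hom SS (sc z) b" unfolding h_def by (rule SS_cmp[OF plus1_hom[OF k] g])
 have R: "reps SS SS idF z {(z, idS z)}" using reps_idF[OF groupoid_SS zz] by simp
 note i = pj_cm[OF V1_obj[OF V] b h]
 have "gn gen_d' V b * (pj (AO V) b z h * aj V z z (idS z)) =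
   nt (nt coh_1 V) b * (nt (nt (Lam2 (conv_sspan eta)) V) b * pj (fcmp V plus1) b z h)"
  unfolding LamC_gen.simps
  by (rule transport_inj[OF coh_pm(1) coh_isoD[OF coh_1(1)] Lam2_gen(10) _ _ V b _ coh_pm_inj[OF V b h]])
   (use i in \<open>simp_all add: Lam2_gen coh_1 coh_pm Lam1_def spans\<close>)
 also have "nt (nt (Lam2 (conv_sspan eta)) V) b * pj (fcmp V plus1) b z h = ind_inj SS SS idF V b (sc z) h"
  using ceta.Lam2_strict_inj[OF V bb zz h R] inj_carriers(1)[OF h] SS_inv_id[OF z] fmV_one[OF V b, of "sc z"] z
   SS_idr[OF h] by (simp add: sspans(8) plus1_idn)
 finally show ?thesis using coh_1_inj[OF V b h] pa_shift[OF V b g k] by (simp add: h_def)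
qed

lemma gen_u:
 assumes g: "g : Hom SS (sc y) b" and h: "h : Hom SS (sc x) y"
 shows "gn gen_u V b * (pj (PO V) b y g * pj V y x h) =
  pj (PO V) b (sc x) ((g oo scm h) oo swap2 x) * pj V (sc x) x (idS (sc x))"
proof -
 define f where "f = g oo scm h"
 have x: "finite x" using SS_eval(6)[OF h] by simp
 hence xx: "x : Obj SS" by simp
 have f: "f : Hom SS (fo plus2 x) b" unfolding f_def plus2_fm by (rule SS_cmp[OF plus1_hom[OF h] g])
 note s = swap2_hom[OF x]
 note fs = SS_cmp[OF s f]
 have R: "reps SS SS idF x {(x, idS x)}" using reps_idF[OF groupoid_SS xx] by simp
 \<comment> \<open>The pull-push formula contains the inverse of the 2-cell on the left leg; the
   swap is its own inverse.\<close>
 have si: "cat_inv SS (swap2 x) = swap2 x" by (rule cat_inv_eq[OF cat_SS], rule inv_arrowsI[OF s s]) (simp_all add: swap2_swap2)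
 have "gn gen_u V b * (pj (PO V) b (sc x) f * pj V (sc x) x (idS (sc x))) =
   nt (nt coh_pp V) b * (nt (nt (Lam2 sigma_Ad) V) b * ind_inj SS SS plus2 V b x f)"
  unfolding LamC_gen.simps
  by (rule transport_inj[OF coh_pp(1) coh_isoD[OF coh_pp(1)] Lam2_gen(13) _ _ V b _ coh_pp_inj[OF V b f]])
   (use inj_carriers(2)[OF f] in \<open>simp_all add: Lam2_gen coh_pp Lam1_def spans\<close>)
 also have "nt (nt (Lam2 sigma_Ad) V) b * ind_inj SS SS plus2 V b x f = ind_inj SS SS plus2 V b x (f oo swap2 x)"
  using su.Lam2_inj[OF V bb xx f R] inj_carriers(2)[OF fs] SS_inv_id[OF x] fmV_one[OF V b x] x
   SS_idr[OF f] by (simp add: sspans plus1_idn plus2_fm swap_nat_def si)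
 finally show ?thesis using coh_pp_inj[OF V b fs] pp_shift[OF V b g h] by (simp add: f_def)
qed

text \<open>For \<open>v\<close> the swap sits on the right leg and acts through \<open>V\<close> on
  the coefficients, whereas for \<open>u\<close> it sits on the left leg and acts on the index of
  the injection.\<close>

lemma gen_v:
 assumes g: "g : Hom SS y b" and h: "h : Hom SS x (sc y)"
 shows "gn gen_v V b * (aj (AO V) b y g * aj V (sc y) x h) =
  aj (AO V) b y g * (aj V (sc y) (sc y) (idS (sc y)) * fm V (swap2 y oo scm h))"
proof -
 have y: "finite y" using SS_eval(6)[OF g] .
 hence yy: "y : Obj SS" and y1: "finite (sc y)" by simp_all
 note s = swap2_hom[OF y] and i = id_hom[OF y1] and h1 = plus1_hom[OF h]
 have R: "reps SS SS idF y {(y, idS y)}" using reps_idF[OF groupoid_SS yy] by simp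
 have o: "fo plus2 y = sc (sc y)" by (simp add: plus2_fm)
 note c = aj_cm[OF AO_obj[OF V] b g] aj_cm[OF V y1 i] aj_cm[OF V y1 h] fmV_cm[OF V b h1] fmV_cm[OF V b s, unfolded o]
 have sh: "fm V (swap2 y oo scm h) = fm V (swap2 y) * fm V (scm h)" using fmV_cmp[OF V b h1, of "swap2 y"] s o by simp
 have "gn gen_v V b * (aj (AO V) b y g * aj V (sc y) (sc y) (idS (sc y))) =
   nt (nt coh_mm V) b * (nt (nt (Lam2 sigma_A) V) b * ind_inj SS SS idF (fcmp V plus2) b y g)"
  unfolding LamC_gen.simps
  by (rule transport_inj[OF coh_mm(1) coh_isoD[OF coh_mm(1)] Lam2_gen(16) _ _ V b _ coh_mm_inj[OF V b g]])
   (use inj_carriers(3)[OF g] in \<open>simp_all add: Lam2_gen coh_mm Lam1_def spans\<close>)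
 also have "nt (nt (Lam2 sigma_A) V) b * ind_inj SS SS idF (fcmp V plus2) b y g = ind_inj SS SS idF (fcmp V plus2) b y g * fm V (swap2 y)"
  using sv.Lam2_inj[OF V bb yy _ R, of g] g inj_carriers(3)[OF g] SS_inv_id[OF y] fmV_one[OF V b, of "fo plus2 y"] y
   SS_idr[OF g] c by (simp add: sspans plus1_idn plus2_fm swap_nat_def)
 finally have 1: "gn gen_v V b * (aj (AO V) b y g * aj V (sc y) (sc y) (idS (sc y))) =
   nt (nt coh_mm V) b * (ind_inj SS SS idF (fcmp V plus2) b y g * fm V (swap2 y))" .
 have cm: "nt (nt coh_mm V) b : \<M> (da (AO V) b) (ind_dim SS SS idF (fcmp V plus2) b)"
  using intw_cm[OF Hom_RepD(1)[OF nat_hom[OF coh_isoD[OF coh_mm(1)] V]] bb] Hom_RepD(2,3)[OF nat_hom[OF coh_isoD[OF coh_mm(1)] V]]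
  by (simp add: coh_mm Lam1_def spans)
 have gc: "gn gen_v V b : \<M> (da (AO V) b) (da (AO V) b)"
  using homE_carrier[OF LamC_gen_hom(6) V b] by (simp add: fo_Lam1)
 have ah: "aj V (sc y) x h = aj V (sc y) (sc y) (idS (sc y)) * fm V (scm h)"
  using aj_nat[OF V y1 h i] SS_idl[OF h] by simp
 have "gn gen_v V b * (aj (AO V) b y g * aj V (sc y) x h) =
   gn gen_v V b * (aj (AO V) b y g * aj V (sc y) (sc y) (idS (sc y))) * fm V (scm h)"
  unfolding ah using c gc by (simp add: mat_assoc)
 also have "\<dots> = (nt (nt coh_mm V) b * ind_inj SS SS idF (fcmp V plus2) b y g) * fm V (swap2 y) * fm V (scm h)"
  unfolding 1 using c cm inj_carriers(3)[OF g] o by (simp add: mat_assoc)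
 also have "\<dots> = aj (AO V) b y g * (aj V (sc y) (sc y) (idS (sc y)) * fm V (swap2 y oo scm h))"
  unfolding coh_mm_inj[OF V b g] sh using c by (simp add: mat_assoc)
 finally show ?thesis .
qed

lemma gen_x:
 assumes g: "g : Hom SS (sc y) b" and h: "h : Hom SS x y"
 shows "gn gen_x V b * (pj (AO V) b y g * aj V y x h) =
  aj (PO V) b (sc x) (g oo scm h) * pj V (sc (sc x)) (sc x) (swap2 x)"
proof -
 define f where "f = g oo scm h"
 have x: "finite x" using SS_eval(6)[OF h] by simp
 hence xx: "x : Obj SS" by simp
 have f: "f : Hom SS (sc x) b" unfolding f_def by (rule SS_cmp[OF plus1_hom[OF h] g])
 note i = pj_cm[OF V1_obj[OF V] b f]
 have "gn gen_x V b * (pj (AO V) b x f * aj V x x (idS x)) =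
   nt (nt coh_mp V) b * (nt (nt (Lam2 i_AdA) V) b * pj (fcmp V plus1) b x f)"
  unfolding LamC_gen.simps
  by (rule transport_inj[OF coh_pm(1) coh_isoD[OF coh_mp(1)] Lam2_gen(19) _ _ V b _ coh_pm_inj[OF V b f]])
   (use i in \<open>simp_all add: Lam2_gen coh_mp coh_pm Lam1_def spans\<close>)
 also have "nt (nt (Lam2 i_AdA) V) b * pj (fcmp V plus1) b x f =
   ind_inj mp.P SS (fcmp idF com_p2) (fcmp V (fcmp idF com_p1)) b (sc x, sc x, swap2 x) f"
  using sT2.Lam2_graph_inj[OF V bb xx f] by (simp add: sspans)
 finally show ?thesis
  using coh_mp_inj[OF V b swap2_hom[OF x, unfolded plus2_fm] f] pa_shift[OF V b g h] by (simp add: f_def)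
qed

text \<open>The sum now runs over lifts along \<open>T2\<close>. There is none if
  \<open>\<alpha>\<close> fixes the added element; otherwise \<open>p\<close> and \<open>q\<close>
  describe the only class.\<close>

lemma gen_y:
 assumes g: "g : Hom SS y b" and a: "\<alpha> : Hom SS (sc x) (sc y)"
 shows "\<beta> : Hom SS x y ==> \<alpha> = scm \<beta> ==>
   gn gen_y V b * (aj (PO V) b y g * pj V (sc y) x \<alpha>) = 0\<^sub>m (dp (AO V) b) (fo V x)"
  and "p : Hom SS (sc z) x ==> q : Hom SS (sc z) y ==> \<alpha> oo scm p = scm q oo swap2 z ==>
   gn gen_y V b * (aj (PO V) b y g * pj V (sc y) x \<alpha>) =
   pj (AO V) b z (g oo q) * (aj V z z (idS z) * fm V (cat_inv SS p))"
proof -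
 have w: "(x, y, \<alpha>) : Obj mp.P" using a SS_eval(6,7)[OF a] by (simp add: mp.Obj_P)
 have g': "g : Hom SS (fo (fcmp idF com_p2) (x, y, \<alpha>)) b" using g by simp
 have t: "gn gen_y V b * (aj (PO V) b y g * pj V (sc y) x \<alpha>) =
   nt (nt coh_pm V) b * (nt (nt (Lam2 (conv_sspan i_AdA)) V) b * ind_inj mp.P SS (fcmp idF com_p2) (fcmp V (fcmp idF com_p1)) b (x, y, \<alpha>) g)"
  unfolding LamC_gen.simps
  by (rule transport_inj[OF coh_mp(1) coh_isoD[OF coh_pm(1)] Lam2_gen(22) _ _ V b _ coh_mp_inj[OF V b a g]])
   (use inj_carriers(4)[OF w, of g] g in \<open>simp_all add: Lam2_gen coh_pm coh_mp Lam1_def mp.comp_span_eq spans\<close>)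
 note L = cT2.Lam2_strict_inj[OF V bb w g']
 show "gn gen_y V b * (aj (PO V) b y g * pj V (sc y) x \<alpha>) = 0\<^sub>m (dp (AO V) b) (fo V x)"
  if "\<beta> : Hom SS x y" "\<alpha> = scm \<beta>"
  unfolding t sspans(7) L[OF reps_T2_empty[OF that(1), folded that(2)]] using coh_pm_carrier by simp
 show "gn gen_y V b * (aj (PO V) b y g * pj V (sc y) x \<alpha>) =
   pj (AO V) b z (g oo q) * (aj V z z (idS z) * fm V (cat_inv SS p))"
  if p: "p : Hom SS (sc z) x" and q: "q : Hom SS (sc z) y" and e: "\<alpha> oo scm p = scm q oo swap2 z"
 proof -
  note R = reps_T2[OF p q a e]
  have z: "finite z" using SS_eval(6)[OF p] by simp
  have h: "(fo T2 z, (x, y, \<alpha>), p, q) : Hom mp.P (fo T2 z) (x, y, \<alpha>)" using reps_in(2)[OF R] by blast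
  note gq = SS_cmp[OF q g]
  note c = pj_cm[OF V1_obj[OF V] b gq] pj_cm[OF AO_obj[OF V] b gq] fmV_cm[OF V b SS_inv(1)[OF p]] aj_cm[OF V z id_hom[OF z]]
  show ?thesis unfolding t sspans(7) L[OF R]
   using fm_cat_inv_p(1)[OF plus1_cospan h] coh_pm_inj'[OF gq c(3)] c by simp
 qed
qed

end


section \<open>The relations\<close>

lemma gn_cm:
 assumes V: "V : Obj RepS" and b: "finite b"
 shows "gn gen_c V b : \<M> (da (PO V) b) (fo V b)" "gn gen_d V b : \<M> (fo V b) (da (PO V) b)"
  "gn gen_c' V b : \<M> (dp (AO V) b) (fo V b)" "gn gen_d' V b : \<M> (fo V b) (dp (AO V) b)"
  "gn gen_u V b : \<M> (dp (PO V) b) (dp (PO V) b)" "gn gen_v V b : \<M> (da (AO V) b) (da (AO V) b)"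
  "gn gen_x V b : \<M> (da (PO V) b) (dp (AO V) b)" "gn gen_y V b : \<M> (dp (AO V) b) (da (PO V) b)"
 using LamC_gen_hom[THEN homE_carrier, OF V b] by (simp_all add: fo_Lam1)

section \<open>Equality tests on words of injections\<close>

lemma A_eqI:
 assumes V: "V : Obj RepS" and b: "finite b" and h: "h : \<M> m (da V b)" "h' : \<M> m (da V b)"
  and e: "!!x g. finite x ==> g : Hom SS x b ==> h * aj V b x g = h' * aj V b x g"
 shows "h = h'"
 by (rule I.ind_eqI[OF V1[OF V b] _ h]) (use b e in simp_all)

lemma P_eqI:
 assumes V: "V : Obj RepS" and b: "finite b" and h: "h : \<M> m (dp V b)" "h' : \<M> m (dp V b)"
  and e: "!!x g. finite x ==> g : Hom SS (sc x) b ==> h * pj V b x g = h' * pj V b x g"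
 shows "h = h'"
 by (rule S1.ind_eqI[OF VS[OF V b] _ h]) (use b e in simp_all)

lemma AP_eqI:
 assumes V: "V : Obj RepS" and b: "finite b" and h: "h : \<M> m (da (PO V) b)" "h' : \<M> m (da (PO V) b)"
  and e: "!!x y g \<alpha>. finite x ==> finite y ==> g : Hom SS y b ==> \<alpha> : Hom SS (sc x) (sc y) ==>
   h * (aj (PO V) b y g * pj V (sc y) x \<alpha>) = h' * (aj (PO V) b y g * pj V (sc y) x \<alpha>)"
 shows "h = h'"
proof (rule A_eqI[OF PO_obj[OF V] b h])
 fix y g assume y: "finite y" and g: "g : Hom SS y b"
 hence y1: "finite (sc y)" by simp
 have a: "aj (PO V) b y g : \<M> (da (PO V) b) (dp V (sc y))" using aj_cm[OF PO_obj[OF V] b g] by simp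
 show "h * aj (PO V) b y g = h' * aj (PO V) b y g"
 proof (rule P_eqI[OF V y1 mult_carrier_mat[OF h(1) a] mult_carrier_mat[OF h(2) a]])
  fix x \<alpha> assume x: "finite x" and al: "\<alpha> : Hom SS (sc x) (sc y)"
  note p = pj_cm[OF V y1 al]
  show "h * aj (PO V) b y g * pj V (sc y) x \<alpha> = h' * aj (PO V) b y g * pj V (sc y) x \<alpha>"
   unfolding assoc_mult_mat[OF h(1) a p] assoc_mult_mat[OF h(2) a p] by (rule e[OF x y g al])
 qed
qed

lemma PA_eqI:
 assumes V: "V : Obj RepS" and b: "finite b" and h: "h : \<M> m (dp (AO V) b)" "h' : \<M> m (dp (AO V) b)"
  and e: "!!x g. finite x ==> g : Hom SS (sc x) b ==> h * (pj (AO V) b x g * aj V x x (idS x)) = h' * (pj (AO V) b x g * aj V x x (idS x))"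
 shows "h = h'"
proof (rule P_eqI[OF AO_obj[OF V] b h])
 fix y g assume y: "finite y" and g: "g : Hom SS (sc y) b"
 have a: "pj (AO V) b y g : \<M> (dp (AO V) b) (da V y)" using pj_cm[OF AO_obj[OF V] b g] by simp
 show "h * pj (AO V) b y g = h' * pj (AO V) b y g"
 proof (rule A_eqI[OF V y mult_carrier_mat[OF h(1) a] mult_carrier_mat[OF h(2) a]])
  fix x k assume x: "finite x" and k: "k : Hom SS x y"
  note p = aj_cm[OF V y k]
  show "h * pj (AO V) b y g * aj V y x k = h' * pj (AO V) b y g * aj V y x k"
   unfolding assoc_mult_mat[OF h(1) a p] assoc_mult_mat[OF h(2) a p] pa_shift[OF V b g k]
   by (rule e[OF x SS_cmp[OF plus1_hom[OF k] g]])
 qed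
qed

lemma PP_eqI:
 assumes V: "V : Obj RepS" and b: "finite b" and h: "h : \<M> m (dp (PO V) b)" "h' : \<M> m (dp (PO V) b)"
  and e: "!!x g. finite x ==> g : Hom SS (sc (sc x)) b ==>
   h * (pj (PO V) b (sc x) g * pj V (sc x) x (idS (sc x))) = h' * (pj (PO V) b (sc x) g * pj V (sc x) x (idS (sc x)))"
 shows "h = h'"
proof (rule P_eqI[OF PO_obj[OF V] b h])
 fix y g assume y: "finite y" and g: "g : Hom SS (sc y) b"
 have a: "pj (PO V) b y g : \<M> (dp (PO V) b) (dp V y)" using pj_cm[OF PO_obj[OF V] b g] by simp
 show "h * pj (PO V) b y g = h' * pj (PO V) b y g"
 proof (rule P_eqI[OF V y mult_carrier_mat[OF h(1) a] mult_carrier_mat[OF h(2) a]])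
  fix x k assume x: "finite x" and k: "k : Hom SS (sc x) y"
  note p = pj_cm[OF V y k]
  show "h * pj (PO V) b y g * pj V y x k = h' * pj (PO V) b y g * pj V y x k"
   unfolding assoc_mult_mat[OF h(1) a p] assoc_mult_mat[OF h(2) a p] pp_shift[OF V b g k]
   by (rule e[OF x SS_cmp[OF plus1_hom[OF k] g]])
 qed
qed

text \<open>The test for the braid relation. Shifting brings both inner indices to identities, so
  that one bijection from \<open>x + 3\<close> to \<open>b\<close> carries all the
  information.\<close>

lemma PPP_eqI:
 assumes V: "V : Obj RepS" and b: "finite b" and h: "h : \<M> m (dp (PO (PO V)) b)" "h' : \<M> m (dp (PO (PO V)) b)"
  and e: "!!x g. finite x ==> g : Hom SS (sc (sc (sc x))) b ==>
   h * (pj (PO (PO V)) b (sc (sc x)) g * (pj (PO V) (sc (sc x)) (sc x) (idS (sc (sc x))) * pj V (sc x) x (idS (sc x)))) =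
   h' * (pj (PO (PO V)) b (sc (sc x)) g * (pj (PO V) (sc (sc x)) (sc x) (idS (sc (sc x))) * pj V (sc x) x (idS (sc x))))"
 shows "h = h'"
proof (rule P_eqI[OF PO_obj[OF PO_obj[OF V]] b h])
 fix y g assume y: "finite y" and g: "g : Hom SS (sc y) b"
 have a: "pj (PO (PO V)) b y g : \<M> (dp (PO (PO V)) b) (dp (PO V) y)" using pj_cm[OF PO_obj[OF PO_obj[OF V]] b g] by simp
 show "h * pj (PO (PO V)) b y g = h' * pj (PO (PO V)) b y g"
 proof (rule PP_eqI[OF V y mult_carrier_mat[OF h(1) a] mult_carrier_mat[OF h(2) a]])
  fix x k assume x: "finite x" and k: "k : Hom SS (sc (sc x)) y"
  let ?x1 = "sc x" and ?x2 = "sc (sc x)"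
  have f: "finite ?x1" "finite ?x2" using x by simp_all
  let ?q = "pj V ?x1 x (idS ?x1)" and ?r = "pj (PO V) ?x2 ?x1 (idS ?x2)"
  have c: "pj (PO V) y ?x1 k : \<M> (dp (PO V) y) (dp V ?x1)" "?q : \<M> (dp V ?x1) (fo V x)"
   "?r : \<M> (dp (PO V) ?x2) (dp V ?x1)"
   using pj_cm[OF PO_obj[OF V] y k] pj_cm[OF V f(1) id_hom[OF f(1)]] pj_cm[OF PO_obj[OF V] f(2) id_hom[OF f(2)]] by simp_all
  note p = mult_carrier_mat[OF c(1,2)]
  note gk = SS_cmp[OF plus1_hom[OF k] g]
  have gc: "pj (PO (PO V)) b ?x2 (g oo scm k) : \<M> (dp (PO (PO V)) b) (dp (PO V) ?x2)"
   using pj_cm[OF PO_obj[OF PO_obj[OF V]] b gk] by simp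
  have s: "pj (PO (PO V)) b y g * (pj (PO V) y ?x1 k * ?q) = pj (PO (PO V)) b ?x2 (g oo scm k) * (?r * ?q)"
   unfolding assoc_mult_mat[OF a c(1,2), symmetric] pp_shift[OF PO_obj[OF V] b g k] assoc_mult_mat[OF gc c(3,2)] ..
  show "h * pj (PO (PO V)) b y g * (pj (PO V) y ?x1 k * ?q) = h' * pj (PO (PO V)) b y g * (pj (PO V) y ?x1 k * ?q)"
   unfolding assoc_mult_mat[OF h(1) a p] assoc_mult_mat[OF h(2) a p] s by (rule e[OF x gk])
 qed
qed

lemma AA_eqI:
 assumes V: "V : Obj RepS" and b: "finite b" and h: "h : \<M> m (da (AO V) b)" "h' : \<M> m (da (AO V) b)"
  and e: "!!y g. finite y ==> g : Hom SS y b ==>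
   h * (aj (AO V) b y g * aj V (sc y) (sc y) (idS (sc y))) = h' * (aj (AO V) b y g * aj V (sc y) (sc y) (idS (sc y)))"
 shows "h = h'"
proof (rule A_eqI[OF AO_obj[OF V] b h])
 fix y g assume y: "finite y" and g: "g : Hom SS y b"
 hence y1: "finite (sc y)" by simp
 have a: "aj (AO V) b y g : \<M> (da (AO V) b) (da V (sc y))" using aj_cm[OF AO_obj[OF V] b g] by simp
 show "h * aj (AO V) b y g = h' * aj (AO V) b y g"
 proof (rule A_eqI[OF V y1 mult_carrier_mat[OF h(1) a] mult_carrier_mat[OF h(2) a]])
  fix x k assume x: "finite x" and k: "k : Hom SS x (sc y)"
  note p = aj_cm[OF V y1 id_hom[OF y1]] and v = fmV_cm[OF V y1 plus1_hom[OF k]]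
  have "aj V (sc y) x k = aj V (sc y) (sc y) (idS (sc y)) * fm V (scm k)"
   using aj_nat[OF V y1 k id_hom[OF y1]] SS_idl[OF k] by simp
  thus "h * aj (AO V) b y g * aj V (sc y) x k = h' * aj (AO V) b y g * aj V (sc y) x k"
   using e[OF y g] a p v h
   by (simp add: assoc_mult_mat[OF _ p v, symmetric, of _ "m"] assoc_mult_mat[OF h(1) a p] assoc_mult_mat[OF h(2) a p])
 qed
qed

lemma LA_carrier: "\<tau> : Hom RepS V W ==> finite b ==> nt (fm LA \<tau>) b : \<M> (da W b) (da V b)"
 and LA_inj: "\<tau> : Hom RepS V W ==> finite b ==> g : Hom SS x b ==>
  nt (fm LA \<tau>) b * aj V b x g = aj W b x g * nt \<tau> (sc x)"
 and LP_carrier: "\<tau> : Hom RepS V W ==> finite b ==> nt (fm LP \<tau>) b : \<M> (dp W b) (dp V b)"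
 and LP_inj: "\<tau> : Hom RepS V W ==> finite b ==> h : Hom SS (sc x) b ==>
  nt (fm LP \<tau>) b * pj V b x h = pj W b x h * nt \<tau> x"
proof -
 assume t: "\<tau> : Hom RepS V W" and b: "finite b"
 note n = Hom_RepD(1-3)[OF t]
 have F: "fm LA \<tau> = fm (Ind SS SS idF) (whisk_r SS \<tau> plus1)" "fm LP \<tau> = fm (Ind SS SS plus1) (whisk_r SS \<tau> idF)"
  by (simp_all add: Lam1_def spans Res_def)
 have w: "is_nat SS matcat (whisk_r SS \<tau> plus1)" "nsrc (whisk_r SS \<tau> plus1) = fcmp V plus1" "ntgt (whisk_r SS \<tau> plus1) = fcmp W plus1"
  using is_nat_whisk_r[OF cat_SS functor_plus1 n(1)] n by auto
 have w': "is_nat SS matcat (whisk_r SS \<tau> idF)" "nsrc (whisk_r SS \<tau> idF) = V" "ntgt (whisk_r SS \<tau> idF) = W"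
  using is_nat_whisk_r[OF cat_SS is_functor_idF[OF cat_SS] n(1)] n by auto
 have bb: "b : Obj SS" using b by simp
 show "nt (fm LA \<tau>) b : \<M> (da W b) (da V b)" "nt (fm LP \<tau>) b : \<M> (dp W b) (dp V b)"
  unfolding F using I.Ind_map_cm[OF w bb] S1.Ind_map_cm[OF w' bb] by simp_all
 show "nt (fm LA \<tau>) b * aj V b x g = aj W b x g * nt \<tau> (sc x)" if g: "g : Hom SS x b"
  unfolding F using I.Ind_map_inj[OF w bb, of x g] g SS_eval(6)[OF g] by simp
 show "nt (fm LP \<tau>) b * pj V b x h = pj W b x h * nt \<tau> x" if h: "h : Hom SS (sc x) b"
  unfolding F using S1.Ind_map_inj[OF w' bb, of x h] h SS_eval(6)[OF h] by simp
qed

lemma LamC_component: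
 assumes "V : Obj RepS"
 shows "nt (LamC_gen gen_c) V : Hom RepS V (AO (PO V))" "nt (LamC_gen gen_d) V : Hom RepS (AO (PO V)) V"
  "nt (LamC_gen gen_c') V : Hom RepS V (PO (AO V))" "nt (LamC_gen gen_d') V : Hom RepS (PO (AO V)) V"
  "nt (LamC_gen gen_u) V : Hom RepS (PO (PO V)) (PO (PO V))"
 using LamC_gen_hom[THEN End_component, OF assms] by (simp_all only: fo_Lam1 fcmp_simps idF_simps)

text \<open>A word in these two letters depends on its indices only through
  \<open>(g + 1) \<alpha>\<close>. This is the shape in which \<open>c d\<close> returns it.\<close>

lemma ap_normal:
 assumes V: "V : Obj RepS" and b: "finite b" and g: "g : Hom SS y b" and a: "\<alpha> : Hom SS (sc x) (sc y)"
 shows "aj (PO V) b y g * pj V (sc y) x \<alpha> = aj (PO V) b b (idS b) * pj V (sc b) x (scm g oo \<alpha>)"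
 using ap_shift[OF V b id_hom[OF b] g a] SS_idl[OF g] by simp

context
 fixes V :: S_rep and b :: fset_obj assumes V: "V : Obj RepS" and b: "finite b"
begin

lemma rel_cd_xy: "gn gen_c V b * gn gen_d V b + gn gen_x V b * gn gen_y V b = 1\<^sub>m (da (PO V) b)"
proof (rule AP_eqI[OF V b])
 note G = gn_cm[OF V b]
 show "gn gen_c V b * gn gen_d V b + gn gen_x V b * gn gen_y V b : \<M> (da (PO V) b) (da (PO V) b)" using G by simp
 fix x y g \<alpha> assume x: "finite x" and y: "finite y" and g: "g : Hom SS y b" and a: "\<alpha> : Hom SS (sc x) (sc y)"
 let ?t = "aj (PO V) b y g * pj V (sc y) x \<alpha>"
 have b1: "finite (sc b)" and y1: "finite (sc y)" using b y by simp_all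
 note i = id_hom[OF b] and i1 = id_hom[OF b1]
 have t: "?t : \<M> (da (PO V) b) (fo V x)" using aj_cm[OF PO_obj[OF V] b g] pj_cm[OF V y1 a] by simp
 have "gn gen_c V b * (gn gen_d V b * ?t) + gn gen_x V b * (gn gen_y V b * ?t) = ?t"
 \<comment> \<open>The two cases are complementary: in the first \<open>y\<close> vanishes and
   \<open>c d\<close> reproduces the word, in the second \<open>d\<close> vanishes and
   \<open>x y\<close> does.\<close>
 proof (cases "\<exists>\<beta>. \<beta> : Hom SS x y & \<alpha> = scm \<beta>")
  case True
  then obtain \<beta> where k: "\<beta> : Hom SS x y" "\<alpha> = scm \<beta>" by blast
  note gk = SS_cmp[OF k(1) g]
  note c = aj_cm[OF PO_obj[OF V] b i] pj_cm[OF V b1 i1] fmV_cm[OF V b gk]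
  have "gn gen_c V b * fm V (g oo \<beta>) = aj (PO V) b b (idS b) * (pj V (sc b) b (idS (sc b)) * fm V (g oo \<beta>))"
   unfolding gen_c[OF V b] using c by (simp add: mat_assoc)
  also have "\<dots> = ?t"
   unfolding ap_normal[OF V b g a] pj_nat[OF V b1 gk i1] using k(2) SS_idl[OF plus1_hom[OF gk]] by (simp add: plus1_cmp)
  finally have "gn gen_c V b * fm V (g oo \<beta>) = ?t" .
  thus ?thesis unfolding gen_d(1)[OF V b g a k] gen_y(1)[OF V b g a k] using G t by simp
 next
  case False
  hence n: "\<nexists>\<beta>. \<beta> : Hom SS x y & \<alpha> = scm \<beta>" .
  obtain z p q where p: "p : Hom SS (sc z) x" and q: "q : Hom SS (sc z) y" and e: "\<alpha> oo scm p = scm q oo swap2 z"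
   using ex_T2[OF a n] by blast
  have z: "finite z" using SS_eval(6)[OF p] by simp
  hence z1: "finite (sc z)" and z2: "finite (sc (sc z))" by simp_all
  note gq = SS_cmp[OF q g] and pi = SS_inv[OF p] and s = swap2_hom[OF z, unfolded plus2_fm]
  note p1 = plus1_hom[OF pi(1)]
  note c = pj_cm[OF AO_obj[OF V] b gq] aj_cm[OF V z id_hom[OF z]] fmV_cm[OF V b pi(1)]
   aj_cm[OF PO_obj[OF V] b gq] pj_cm[OF V z2 s]
  \<comment> \<open>The square relating \<open>\<alpha>\<close>, \<open>p\<close>, \<open>q\<close>
    and the swap is solved for \<open>\<alpha>\<close>.\<close>
  have E: "scm q oo (swap2 z oo scm (cat_inv SS p)) = \<alpha>"
   using pi(3) SS_idr[OF a] x by (simp add: SS_assoc[symmetric] e[symmetric]) (simp add: SS_assoc plus1_cmp[symmetric] plus1_idn)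
  have "gn gen_x V b * (pj (AO V) b z (g oo q) * (aj V z z (idS z) * fm V (cat_inv SS p))) =
    gn gen_x V b * (pj (AO V) b z (g oo q) * aj V z z (idS z)) * fm V (cat_inv SS p)"
   using c G by (simp add: mat_assoc)
  also have "\<dots> = aj (PO V) b (sc z) (g oo q) * (pj V (sc (sc z)) (sc z) (swap2 z) * fm V (cat_inv SS p))"
   unfolding gen_x[OF V b gq id_hom[OF z]] using c SS_idr[OF gq] z by (simp add: mat_assoc plus1_idn)
  also have "\<dots> = ?t"
   unfolding pj_nat[OF V z2 pi(1) s] ap_shift[OF V b g q SS_cmp[OF p1 s]] E ..
  finally show ?thesis unfolding gen_d(2)[OF V b g a n] gen_y(2)[OF V b g a p q e] using G t by simp
 qed
 thus "(gn gen_c V b * gn gen_d V b + gn gen_x V b * gn gen_y V b) * ?t = 1\<^sub>m (da (PO V) b) * ?t"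
  using G left_mult_one_mat[OF t] t by (simp add: add_mult_distrib_mat[of _ "da (PO V) b" "da (PO V) b" _ _ "fo V x"] assoc_mult_mat[of _ "da (PO V) b" _ _ "da (PO V) b" _ "fo V x"])
qed simp

lemma rel_yx: "gn gen_y V b * gn gen_x V b = 1\<^sub>m (dp (AO V) b)"
proof (rule PA_eqI[OF V b])
 note G = gn_cm[OF V b]
 show "gn gen_y V b * gn gen_x V b : \<M> (dp (AO V) b) (dp (AO V) b)" using G by simp
 fix x g assume x: "finite x" and g: "g : Hom SS (sc x) b"
 let ?t = "pj (AO V) b x g * aj V x x (idS x)"
 have x1: "finite (sc x)" using x by simp
 note s = swap2_hom[OF x, unfolded plus2_fm] and i = id_hom[OF x] and i1 = id_hom[OF x1]
 note c = pj_cm[OF AO_obj[OF V] b g] aj_cm[OF V x i]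
 \<comment> \<open>The comparison arrow produced by \<open>x\<close> is the swap itself, so
   \<open>y\<close> can be evaluated with \<open>p\<close> and \<open>q\<close> identities.\<close>
 have e: "swap2 x oo scm (idS (sc x)) = scm (idS (sc x)) oo swap2 x"
  using SS_idl[OF s] SS_idr[OF s] by (simp add: plus1_idn[OF x1])
 have "gn gen_y V b * gn gen_x V b * ?t = gn gen_y V b * (aj (PO V) b (sc x) g * pj V (sc (sc x)) (sc x) (swap2 x))"
  using gen_x[OF V b g i] G c SS_idr[OF g] by (simp add: plus1_idn[OF x] assoc_mult_mat[of _ "dp (AO V) b" "da (PO V) b" _ "dp (AO V) b" _ "fo V (sc x)"])
 thus "gn gen_y V b * gn gen_x V b * ?t = 1\<^sub>m (dp (AO V) b) * ?t"
  unfolding gen_y(2)[OF V b g s i1 i1 e] using c SS_idr[OF g] fmV_one[OF V b x1] by (simp add: SS_inv_id[OF x1])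
qed simp

lemma rel_dc: "gn gen_d V b * gn gen_c V b = 1\<^sub>m (fo V b)"
proof -
 have b1: "finite (sc b)" using b by simp
 show ?thesis unfolding gen_c[OF V b] gen_d(1)[OF V b id_hom[OF b] id_hom[OF b1] id_hom[OF b] plus1_idn[OF b, symmetric]]
  using SS_idl[OF id_hom[OF b]] fmV_one[OF V b b] by simp
qed

lemma rel_uu: "gn gen_u V b * gn gen_u V b = 1\<^sub>m (dp (PO V) b)"
proof (rule PP_eqI[OF V b])
 note G = gn_cm[OF V b]
 show "gn gen_u V b * gn gen_u V b : \<M> (dp (PO V) b) (dp (PO V) b)" using G by simp
 fix x g assume x: "finite x" and g: "g : Hom SS (sc (sc x)) b"
 let ?t = "%g. pj (PO V) b (sc x) g * pj V (sc x) x (idS (sc x))"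
 have x1: "finite (sc x)" using x by simp
 note i1 = id_hom[OF x1] and s = swap2_hom[OF x, unfolded plus2_fm]
 have u: "gn gen_u V b * ?t g = ?t (g oo swap2 x)" if g: "g : Hom SS (sc (sc x)) b" for g
  unfolding gen_u[OF V b g i1] using SS_idr[OF g] by (simp add: plus1_idn[OF x1])
 have t: "?t g : \<M> (dp (PO V) b) (fo V x)" using pj_cm[OF PO_obj[OF V] b g] pj_cm[OF V x1 i1] by simp
 have "gn gen_u V b * (gn gen_u V b * ?t g) = ?t g"
  unfolding u[OF g] u[OF SS_cmp[OF s g]] SS_assoc swap2_swap2 using SS_idr[OF g] by (simp add: plus2_fm)
 thus "gn gen_u V b * gn gen_u V b * ?t g = 1\<^sub>m (dp (PO V) b) * ?t g"
  unfolding assoc_mult_mat[OF G(5) G(5) t] using left_mult_one_mat[OF t] by simp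
qed simp

lemma rel_vv: "gn gen_v V b * gn gen_v V b = 1\<^sub>m (da (AO V) b)"
proof (rule AA_eqI[OF V b])
 note G = gn_cm[OF V b]
 show "gn gen_v V b * gn gen_v V b : \<M> (da (AO V) b) (da (AO V) b)" using G by simp
 fix y g assume y: "finite y" and g: "g : Hom SS y b"
 let ?a = "aj (AO V) b y g" and ?i = "aj V (sc y) (sc y) (idS (sc y))" and ?s = "fm V (swap2 y)"
 have y1: "finite (sc y)" using y by simp
 note i1 = id_hom[OF y1] and s = swap2_hom[OF y, unfolded plus2_fm]
 have c: "?a : \<M> (da (AO V) b) (da V (sc y))" "?i : \<M> (da V (sc y)) (fo V (sc (sc y)))"
  "?s : \<M> (fo V (sc (sc y))) (fo V (sc (sc y)))"
  using aj_cm[OF AO_obj[OF V] b g] aj_cm[OF V y1 i1] fmV_cm[OF V b s] by simp_all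
 note ai = mult_carrier_mat[OF c(1,2)]
 have v: "gn gen_v V b * (?a * ?i) = ?a * ?i * ?s"
  using gen_v[OF V b g i1] c SS_idr[OF s] by (simp add: plus1_idn[OF y1] mat_assoc)
 have "gn gen_v V b * (?a * ?i * ?s) = gn gen_v V b * (?a * ?i) * ?s"
  by (rule assoc_mult_mat[OF G(6) ai c(3), symmetric])
 also have "\<dots> = ?a * ?i * (?s * ?s)" unfolding v by (rule assoc_mult_mat[OF ai c(3) c(3)])
 also have "?s * ?s = 1\<^sub>m (fo V (sc (sc y)))"
  using fmV_cmp[OF V b s s] fmV_one[OF V b, of "fo plus2 y"] y by (simp add: swap2_swap2 plus2_fm)
 finally show "gn gen_v V b * gn gen_v V b * (?a * ?i) = 1\<^sub>m (da (AO V) b) * (?a * ?i)"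
  unfolding assoc_mult_mat[OF G(6) G(6) ai] v using right_mult_one_mat[OF ai] left_mult_one_mat[OF ai] by simp
qed simp

text \<open>Between \<open>c\<close> and \<open>d\<close> the transformation \<open>u\<close> turns
  the comparison into \<open>g + 1\<close> after the swap. This does not fix the added element, so
  \<open>d\<close> annihilates it.\<close>

lemma rel_duc: "gn gen_d (PO V) b * (nt (fm LA (nt (LamC_gen gen_u) V)) b * gn gen_c (PO V) b) = 0\<^sub>m (dp V b) (dp V b)"
proof (rule P_eqI[OF V b])
 note W = PO_obj[OF V] note W2 = PO_obj[OF W]
 note U = LamC_component(5)[OF V]
 have G: "gn gen_d (PO V) b : \<M> (dp V b) (da (PO (PO V)) b)" "gn gen_c (PO V) b : \<M> (da (PO (PO V)) b) (dp V b)"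
  using gn_cm(1,2)[OF W b] by simp_all
 note F = LA_carrier[OF U b]
 show "gn gen_d (PO V) b * (nt (fm LA (nt (LamC_gen gen_u) V)) b * gn gen_c (PO V) b) : \<M> (dp V b) (dp V b)" using G F by simp
 fix x g assume x: "finite x" and g: "g : Hom SS (sc x) b"
 let ?p = "pj V b x g" and ?x1 = "sc x" and ?b1 = "sc b"
 have f: "finite ?x1" "finite ?b1" using x b by simp_all
 note i = id_hom[OF b] and i1 = id_hom[OF f(2)] and s = swap2_hom[OF x, unfolded plus2_fm]
 note g1 = plus1_hom[OF g]
 have c: "aj (PO (PO V)) b b (idS b) : \<M> (da (PO (PO V)) b) (dp (PO V) ?b1)" "pj (PO V) ?b1 b (idS ?b1) : \<M> (dp (PO V) ?b1) (dp V b)"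
  "?p : \<M> (dp V b) (fo V x)" "gn gen_u V ?b1 : \<M> (dp (PO V) ?b1) (dp (PO V) ?b1)"
  using aj_cm[OF W2 b i] pj_cm[OF W f(2) i1] pj_cm[OF V b g] gn_cm(5)[OF V f(2)] by simp_all
 let ?h = "scm g oo swap2 x"
 note h = SS_cmp[OF s g1]
 have c': "pj (PO V) ?b1 ?x1 ?h : \<M> (dp (PO V) ?b1) (dp V ?x1)" "pj V ?x1 x (idS ?x1) : \<M> (dp V ?x1) (fo V x)"
  using pj_cm[OF W f(2) h] pj_cm[OF V f(1) id_hom[OF f(1)]] by simp_all
 have u: "gn gen_u V ?b1 * (pj (PO V) ?b1 b (idS ?b1) * ?p) = pj (PO V) ?b1 ?x1 ?h * pj V ?x1 x (idS ?x1)"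
  unfolding gen_u[OF V f(2) i1 g] using SS_idl[OF g1] by simp
 have "gn gen_d (PO V) b * (nt (fm LA (nt (LamC_gen gen_u) V)) b * gn gen_c (PO V) b) * ?p =
   gn gen_d (PO V) b * ((nt (fm LA (nt (LamC_gen gen_u) V)) b * aj (PO (PO V)) b b (idS b)) * (pj (PO V) ?b1 b (idS ?b1) * ?p))"
  unfolding gen_c[OF W b] using G F c by (simp add: mat_assoc)
 also have "\<dots> = gn gen_d (PO V) b * (aj (PO (PO V)) b b (idS b) * (gn gen_u V ?b1 * (pj (PO V) ?b1 b (idS ?b1) * ?p)))"
  unfolding LA_inj[OF U b i] using G F c by (simp add: mat_assoc)
 also have "\<dots> = (gn gen_d (PO V) b * (aj (PO (PO V)) b b (idS b) * pj (PO V) ?b1 ?x1 ?h)) * pj V ?x1 x (idS ?x1)"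
  unfolding u using G c c' by (simp add: mat_assoc)
 also have "gn gen_d (PO V) b * (aj (PO (PO V)) b b (idS b) * pj (PO V) ?b1 ?x1 ?h) = 0\<^sub>m (fo (PO V) b) (fo (PO V) ?x1)"
 proof (rule gen_d(2)[OF W b i h])
  show "\<nexists>\<beta>. \<beta> : Hom SS ?x1 b & ?h = scm \<beta>"
  proof
   assume "\<exists>\<beta>. \<beta> : Hom SS ?x1 b & ?h = scm \<beta>"
   then obtain \<beta> where "?h = scm \<beta>" by blast
   \<comment> \<open>The swap sends 0 to 1, and \<open>g + 1\<close> sends 1 to a successor.\<close>
   hence "?h 0 = Some 0" by simp
   thus False by (simp add: map_comp_def swap2_eval plus2_fo)
  qed
 qed
 finally show "gn gen_d (PO V) b * (nt (fm LA (nt (LamC_gen gen_u) V)) b * gn gen_c (PO V) b) * ?p = 0\<^sub>m (dp V b) (dp V b) * ?p"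
  using c c' by simp
qed simp

text \<open>Both operators act on the outermost index by composition on the right, \<open>U1\<close>
  with the swap of the first two added elements and \<open>U2\<close> with its shift. The relation
  thus reduces to the braid relation for bijections.\<close>

lemma rel_braid:
 defines "U2 \<equiv> nt (fm LP (nt (LamC_gen gen_u) V)) b" and "U1 \<equiv> gn gen_u (PO V) b"
 shows "U1 * (U2 * U1) = U2 * (U1 * U2)"
proof (rule PPP_eqI[OF V b])
 note W = PO_obj[OF V] note W2 = PO_obj[OF W]
 note U = LamC_component(5)[OF V]
 have G: "U1 : \<M> (dp (PO (PO V)) b) (dp (PO (PO V)) b)" "U2 : \<M> (dp (PO (PO V)) b) (dp (PO (PO V)) b)"
  unfolding U1_def U2_def using gn_cm(5)[OF W b] LP_carrier[OF U b] by simp_all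
 show "U1 * (U2 * U1) : \<M> (dp (PO (PO V)) b) (dp (PO (PO V)) b)" "U2 * (U1 * U2) : \<M> (dp (PO (PO V)) b) (dp (PO (PO V)) b)"
  using G by simp_all
 fix x g assume x: "finite x" and g: "g : Hom SS (sc (sc (sc x))) b"
 let ?x1 = "sc x" and ?x2 = "sc (sc x)"
 have f: "finite ?x1" "finite ?x2" using x by simp_all
 let ?q = "pj V ?x1 x (idS ?x1)" and ?r = "%k. pj (PO V) ?x2 ?x1 k"
 let ?T = "%g. pj (PO (PO V)) b ?x2 g * (?r (idS ?x2) * ?q)"
 note i1 = id_hom[OF f(1)] and i2 = id_hom[OF f(2)] and s = swap2_hom[OF x, unfolded plus2_fm] and s1 = swap2_hom[OF f(1), unfolded plus2_fm]
 note ps = plus1_hom[OF s]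
 have c: "?q : \<M> (dp V ?x1) (fo V x)" "?r (idS ?x2) : \<M> (dp (PO V) ?x2) (dp V ?x1)" "?r (swap2 x) : \<M> (dp (PO V) ?x2) (dp V ?x1)"
  "gn gen_u V ?x2 : \<M> (dp (PO V) ?x2) (dp (PO V) ?x2)"
  using pj_cm[OF V f(1) i1] pj_cm[OF W f(2) i2] pj_cm[OF W f(2) s] gn_cm(5)[OF V f(2)] by simp_all
 have cg: "pj (PO (PO V)) b ?x2 g : \<M> (dp (PO (PO V)) b) (dp (PO V) ?x2)" if "g : Hom SS (sc ?x2) b" for g
  using pj_cm[OF W2 b that] by simp
 have u1: "U1 * ?T g = ?T (g oo swap2 ?x1)" if g: "g : Hom SS (sc ?x2) b" for g
 proof -
  have "U1 * ?T g = U1 * (pj (PO (PO V)) b ?x2 g * ?r (idS ?x2)) * ?q" using G c cg[OF g] by (simp add: mat_assoc)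
  also have "\<dots> = pj (PO (PO V)) b ?x2 (g oo swap2 ?x1) * ?r (idS ?x2) * ?q"
   unfolding U1_def gen_u[OF W b g i2] using SS_idr[OF g] by (simp add: plus1_idn[OF f(2)])
  also have "\<dots> = ?T (g oo swap2 ?x1)" using c cg[OF SS_cmp[OF s1 g]] by (simp add: mat_assoc)
  finally show ?thesis .
 qed
 have u2: "U2 * ?T g = ?T (g oo scm (swap2 x))" if g: "g : Hom SS (sc ?x2) b" for g
 proof -
  have "U2 * ?T g = (U2 * pj (PO (PO V)) b ?x2 g) * (?r (idS ?x2) * ?q)" using G c cg[OF g] by (simp add: mat_assoc)
  also have "\<dots> = pj (PO (PO V)) b ?x2 g * (gn gen_u V ?x2 * (?r (idS ?x2) * ?q))"
   unfolding U2_def LP_inj[OF U b g] using c cg[OF g] by (simp add: mat_assoc)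
  also have "\<dots> = pj (PO (PO V)) b ?x2 g * ?r (swap2 x) * ?q"
   unfolding gen_u[OF V f(2) i2 i1] using SS_idl[OF s] i2 c cg[OF g] by (simp add: plus1_idn[OF f(1)] SS_idr[OF i2] mat_assoc)
  also have "\<dots> = pj (PO (PO V)) b ?x2 (g oo scm (swap2 x)) * ?r (idS ?x2) * ?q"
   unfolding pp_shift[OF W b g s] ..
  also have "\<dots> = ?T (g oo scm (swap2 x))" using c cg[OF SS_cmp[OF ps g]] by (simp add: mat_assoc)
  finally show ?thesis .
 qed
 have T: "?T g : \<M> (dp (PO (PO V)) b) (fo V x)" using c cg[OF g] by simp
 have as: "A * (B * C) * ?T g = A * (B * (C * ?T g))"
  if c: "A : \<M> (dp (PO (PO V)) b) (dp (PO (PO V)) b)" "B : \<M> (dp (PO (PO V)) b) (dp (PO (PO V)) b)" "C : \<M> (dp (PO (PO V)) b) (dp (PO (PO V)) b)" for A B C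
  unfolding assoc_mult_mat[OF c(1) mult_carrier_mat[OF c(2,3)] T] assoc_mult_mat[OF c(2,3) T] ..
 note g1 = SS_cmp[OF s1 g] and g2 = SS_cmp[OF ps g]
 show "U1 * (U2 * U1) * ?T g = U2 * (U1 * U2) * ?T g"
  unfolding as[OF G(1) G(2) G(1)] as[OF G(2) G(1) G(2)] u1[OF g] u2[OF g] u2[OF g1] u1[OF g2] u1[OF SS_cmp[OF ps g1]] u2[OF SS_cmp[OF s1 g2]]
  unfolding SS_assoc swap2_braid ..
qed


text \<open>\<open>c\<close> inserts a pair of letters with identity indices, and \<open>d'\<close>
  contracts the first of them with the letter at \<open>g\<close>, which hands the index
  \<open>g\<close> to the remaining letter.\<close>

lemma rel_zigzag1:
 "gn gen_d' (PO V) b * nt (fm LP (nt (LamC_gen gen_c) V)) b = 1\<^sub>m (dp V b)"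
proof (rule P_eqI[OF V b])
 note W = PO_obj[OF V] note C = LamC_component(1)[OF V]
 have G: "gn gen_d' (PO V) b : \<M> (dp V b) (dp (AO (PO V)) b)" using gn_cm(4)[OF W b] by simp
 note F = LP_carrier[OF C b]
 show "gn gen_d' (PO V) b * nt (fm LP (nt (LamC_gen gen_c) V)) b : \<M> (dp V b) (dp V b)" using G F by simp
 fix x g assume x: "finite x" and g: "g : Hom SS (sc x) b"
 have x1: "finite (sc x)" using x by simp
 note i = id_hom[OF x] and i1 = id_hom[OF x1]
 have c: "pj (AO (PO V)) b x g : \<M> (dp (AO (PO V)) b) (da (PO V) x)" "pj V b x g : \<M> (dp V b) (fo V x)"
  "aj (PO V) x x (idS x) : \<M> (da (PO V) x) (dp V (sc x))" "pj V (sc x) x (idS (sc x)) : \<M> (dp V (sc x)) (fo V x)"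
  using pj_cm[OF AO_obj[OF W] b g] pj_cm[OF V b g] aj_cm[OF W x i] pj_cm[OF V x1 i1] by simp_all
 have "gn gen_d' (PO V) b * nt (fm LP (nt (LamC_gen gen_c) V)) b * pj V b x g = gn gen_d' (PO V) b * (pj (AO (PO V)) b x g * gn gen_c V x)"
  using LP_inj[OF C b g] G F c by (simp add: mat_assoc)
 also have "\<dots> = (gn gen_d' (PO V) b * (pj (AO (PO V)) b x g * aj (PO V) x x (idS x))) * pj V (sc x) x (idS (sc x))"
  unfolding gen_c[OF V x] using G c by (simp add: mat_assoc)
 also have "\<dots> = pj V b x g"
  unfolding gen_d'[OF W b g i] using PO_fm[OF V x1 g i1] SS_idr[OF g] by (simp add: plus1_idn[OF x])
 finally show "gn gen_d' (PO V) b * nt (fm LP (nt (LamC_gen gen_c) V)) b * pj V b x g = 1\<^sub>m (dp V b) * pj V b x g"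
  using left_mult_one_mat[OF c(2)] by simp
qed simp

lemma rel_zigzag2:
 "nt (fm LA (nt (LamC_gen gen_d') V)) b * gn gen_c (AO V) b = 1\<^sub>m (da V b)"
proof (rule A_eqI[OF V b])
 note W = AO_obj[OF V] note C = LamC_component(4)[OF V]
 have G: "gn gen_c (AO V) b : \<M> (da (PO (AO V)) b) (da V b)" using gn_cm(1)[OF W b] by simp
 note F = LA_carrier[OF C b]
 show "nt (fm LA (nt (LamC_gen gen_d') V)) b * gn gen_c (AO V) b : \<M> (da V b) (da V b)" using G F by simp
 fix x g assume x: "finite x" and g: "g : Hom SS x b"
 have b1: "finite (sc b)" using b by simp
 note i = id_hom[OF b] and i1 = id_hom[OF b1]
 have c: "aj (PO (AO V)) b b (idS b) : \<M> (da (PO (AO V)) b) (dp (AO V) (sc b))" "aj V b x g : \<M> (da V b) (fo V (sc x))"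
  "pj (AO V) (sc b) b (idS (sc b)) : \<M> (dp (AO V) (sc b)) (da V b)" "aj V b b (idS b) : \<M> (da V b) (fo V (sc b))"
  using aj_cm[OF PO_obj[OF W] b i] aj_cm[OF V b g] pj_cm[OF W b1 i1] aj_cm[OF V b i] by simp_all
 note d = gn_cm(4)[OF V b1]
 have "nt (fm LA (nt (LamC_gen gen_d') V)) b * gn gen_c (AO V) b * aj V b x g =
   nt (fm LA (nt (LamC_gen gen_d') V)) b * aj (PO (AO V)) b b (idS b) * (pj (AO V) (sc b) b (idS (sc b)) * aj V b x g)"
  unfolding gen_c[OF W b] using F c by (simp add: mat_assoc)
 also have "\<dots> = aj V b b (idS b) * (gn gen_d' V (sc b) * (pj (AO V) (sc b) b (idS (sc b)) * aj V b x g))"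
  unfolding LA_inj[OF C b i] using c d by (simp add: mat_assoc)
 also have "\<dots> = aj V b x g"
  unfolding gen_d'[OF V b1 i1 g] using aj_nat[OF V b g i] SS_idl[OF g] SS_idl[OF plus1_hom[OF g]] by simp
 finally show "nt (fm LA (nt (LamC_gen gen_d') V)) b * gn gen_c (AO V) b * aj V b x g = 1\<^sub>m (da V b) * aj V b x g"
  using left_mult_one_mat[OF c(2)] by simp
qed simp

text \<open>\<open>c'\<close> contributes a sum over the elements of \<open>x + 1\<close>, and
  \<open>d\<close> kills every term except the one that removes the added element.\<close>

lemma rel_zigzag3:
 "gn gen_d (AO V) b * nt (fm LA (nt (LamC_gen gen_c') V)) b = 1\<^sub>m (da V b)"
proof (rule A_eqI[OF V b])
 note W = AO_obj[OF V] note C = LamC_component(3)[OF V]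
 have G: "gn gen_d (AO V) b : \<M> (da V b) (da (PO (AO V)) b)" using gn_cm(2)[OF W b] by simp
 note F = LA_carrier[OF C b]
 show "gn gen_d (AO V) b * nt (fm LA (nt (LamC_gen gen_c') V)) b : \<M> (da V b) (da V b)" using G F by simp
 fix x g assume x: "finite x" and g: "g : Hom SS x b"
 let ?x1 = "sc x"
 have x1: "finite ?x1" using x by simp
 obtain R where R: "reps SS SS plus1 ?x1 R" using S1.ex_reps[of ?x1] x by auto
 have c: "aj (PO (AO V)) b x g : \<M> (da (PO (AO V)) b) (dp (AO V) ?x1)" "aj V b x g : \<M> (da V b) (fo V ?x1)"
  using aj_cm[OF PO_obj[OF W] b g] aj_cm[OF V b g] by simp_all
 note c' = gn_cm(3)[OF V x1]
 let ?M = "%(z, h). pj (AO V) ?x1 z h * (aj V z z (idS z) * fm V (cat_inv SS h))"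
 let ?N = "%l. gn gen_d (AO V) b * (aj (PO (AO V)) b x g * ?M l)"
 have m: "?M l : \<M> (dp (AO V) ?x1) (fo V ?x1)" if "l : R" for l
 proof -
  obtain z h where l: "l = (z, h)" by force
  have zh: "finite z" "h : Hom SS (sc z) ?x1" using reps_in[OF R that[unfolded l]] by simp_all
  show ?thesis using pj_cm[OF W x1 zh(2)] aj_cm[OF V zh(1) id_hom[OF zh(1)]] fmV_cm[OF V b SS_inv(1)[OF zh(2)]] by (simp add: l)
 qed
 have am: "aj (PO (AO V)) b x g * ?M l : \<M> (da (PO (AO V)) b) (fo V ?x1)" if "l : R" for l
  using mult_carrier_mat[OF c(1) m[OF that]] .
 have s1: "aj (PO (AO V)) b x g * mat_sum (dp (AO V) ?x1) (fo V ?x1) ?M R = mat_sum (da (PO (AO V)) b) (fo V ?x1) (%l. aj (PO (AO V)) b x g * ?M l) R"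
  by (rule mult_mat_sum[OF c(1) m])
 have s2: "gn gen_d (AO V) b * mat_sum (da (PO (AO V)) b) (fo V ?x1) (%l. aj (PO (AO V)) b x g * ?M l) R = mat_sum (da V b) (fo V ?x1) ?N R"
  by (rule mult_mat_sum[OF G am])
 have "gn gen_d (AO V) b * nt (fm LA (nt (LamC_gen gen_c') V)) b * aj V b x g = gn gen_d (AO V) b * (aj (PO (AO V)) b x g * gn gen_c' V ?x1)"
  using LA_inj[OF C b g] G F c by (simp add: mat_assoc)
 also have "\<dots> = mat_sum (da V b) (fo V ?x1) ?N R"
  unfolding gen_c'[OF V x1 R] s1 s2 ..
 also have "\<dots> = aj V b x g"
 proof -
  have N: "?N (z, h) = (gn gen_d (AO V) b * (aj (PO (AO V)) b x g * pj (AO V) ?x1 z h)) * (aj V z z (idS z) * fm V (cat_inv SS h))"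
   if "finite z" "h : Hom SS (sc z) ?x1" for z h
   using G c pj_cm[OF W x1 that(2)] aj_cm[OF V that(1) id_hom[OF that(1)]] fmV_cm[OF V b SS_inv(1)[OF that(2)]] by (simp add: mat_assoc)
  have ii: "idS ?x1 : Hom SS (sc x) ?x1" by (rule id_hom[OF x1])
  \<comment> \<open>The surviving term is the representative of the identity of
    \<open>x + 1\<close>.\<close>
  obtain r h k where rh: "(r, h) : R" and k: "k : Hom SS x r" "h oo scm k = idS ?x1"
   using reps_ex[OF R _ ii] x by auto
  have r: "finite r" "h : Hom SS (sc r) ?x1" using reps_in[OF R rh] by simp_all
  define \<beta> where "\<beta> = cat_inv SS k"
  note ki = SS_inv[OF k(1)]
  have bt: "\<beta> : Hom SS r x" "h = scm \<beta>"
  proof -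
   show "\<beta> : Hom SS r x" unfolding \<beta>_def by (rule ki)
   have "h = (h oo scm k) oo scm \<beta>"
    using ki(3) SS_idr[OF r(2)] by (simp add: SS_assoc plus1_cmp[symmetric] \<beta>_def plus1_idn[OF r(1)])
   thus "h = scm \<beta>" unfolding k(2) using SS_idl[OF plus1_hom[OF ki(1)]] by (simp add: \<beta>_def)
  qed
  note gb = SS_cmp[OF bt(1) g] and hi = SS_inv[OF r(2)]
  have "?N (r, h) = fm (AO V) (g oo \<beta>) * (aj V r r (idS r) * fm V (cat_inv SS h))"
   unfolding N[OF r] gen_d(1)[OF W b g r(2) bt] ..
  also have "\<dots> = (fm (AO V) (g oo \<beta>) * aj V r r (idS r)) * fm V (cat_inv SS h)"
   using fmV_cm[OF W b gb] aj_cm[OF V r(1) id_hom[OF r(1)]] fmV_cm[OF V b hi(1)] by (simp add: mat_assoc)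
  also have "\<dots> = aj V b r (g oo \<beta>) * fm V (scm k)"
  proof -
   have "cat_inv SS h = scm k"
    unfolding bt(2)
   proof (rule cat_inv_eq[OF cat_SS], rule inv_arrowsI[OF plus1_hom[OF bt(1)] plus1_hom[OF k(1)]])
    show "Cmp SS (scm k) (scm \<beta>) = Idn SS (sc r)" using ki(3) by (simp add: plus1_cmp[symmetric] \<beta>_def plus1_idn[OF r(1)])
    show "Cmp SS (scm \<beta>) (scm k) = Idn SS ?x1" using ki(2) by (simp add: plus1_cmp[symmetric] \<beta>_def plus1_idn[OF x])
   qed
   thus ?thesis using AO_fm[OF V r(1) gb id_hom[OF r(1)]] SS_idr[OF gb] by simp
  qed
  also have "\<dots> = aj V b x g" unfolding aj_nat[OF V b k(1) gb] using ki(2) SS_idr[OF g] by (simp add: SS_assoc \<beta>_def)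
  finally have e: "?N (r, h) = aj V b x g" .
  \<comment> \<open>If \<open>d\<close> did not vanish here, \<open>h'\<close> would be some
    \<open>\<gamma> + 1\<close> and would represent the identity of \<open>x + 1\<close> as well,
    against uniqueness of representatives.\<close>
  have z: "?N l = 0\<^sub>m (da V b) (fo V ?x1)" if l: "l : R" "l ~= (r, h)" for l
  proof -
   obtain r' h' where l': "l = (r', h')" by force
   have r': "finite r'" "h' : Hom SS (sc r') ?x1" using reps_in[OF R l(1)[unfolded l']] by simp_all
   have "\<nexists>\<beta>. \<beta> : Hom SS r' x & h' = scm \<beta>"
   proof
    assume "\<exists>\<beta>. \<beta> : Hom SS r' x & h' = scm \<beta>"
    then obtain \<gamma> where g': "\<gamma> : Hom SS r' x" "h' = scm \<gamma>" by blast
    note gi = SS_inv[OF g'(1)]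
    have "h' oo scm (cat_inv SS \<gamma>) = idS ?x1" using gi(3) by (simp add: g'(2) plus1_cmp[symmetric] plus1_idn[OF x])
    thus False using reps_unique[OF R _ ii rh k(1) _ l(1)[unfolded l'] gi(1)] k(2) x l(2) l' by auto
   qed
   from gen_d(2)[OF W b g r'(2) this] show ?thesis
    unfolding l' N[OF r'] using aj_cm[OF V r'(1) id_hom[OF r'(1)]] fmV_cm[OF V b SS_inv(1)[OF r'(2)]] by simp
  qed
  show ?thesis unfolding e[symmetric]
   by (rule mat_sum_delta[OF reps_finite[OF R] rh _ z]) (use mult_carrier_mat[OF G am[OF rh]] in simp_all)
 qed
 finally show "gn gen_d (AO V) b * nt (fm LA (nt (LamC_gen gen_c') V)) b * aj V b x g = 1\<^sub>m (da V b) * aj V b x g"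
  using left_mult_one_mat[OF c(2)] by simp
qed simp

text \<open>\<open>d\<close> is applied to the comparison given by \<open>g\<close> followed by the
  inverse of \<open>h\<close>. It has the form \<open>k + 1\<close> exactly for the representative
  of \<open>(x, g)\<close>, so only that term of the sum survives.\<close>

lemma rel_zigzag4:
 "nt (fm LP (nt (LamC_gen gen_d) V)) b * gn gen_c' (PO V) b = 1\<^sub>m (dp V b)"
proof (rule P_eqI[OF V b])
 note W = PO_obj[OF V] note C = LamC_component(2)[OF V]
 have G: "gn gen_c' (PO V) b : \<M> (dp (AO (PO V)) b) (dp V b)" using gn_cm(3)[OF W b] by simp
 note F = LP_carrier[OF C b]
 show "nt (fm LP (nt (LamC_gen gen_d) V)) b * gn gen_c' (PO V) b : \<M> (dp V b) (dp V b)" using G F by simp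
 fix x g assume x: "finite x" and g: "g : Hom SS (sc x) b"
 have bb: "b : Obj SS" using b by simp
 obtain R where R: "reps SS SS plus1 b R" using S1.ex_reps[OF bb] by auto
 note p = pj_cm[OF V b g]
 let ?D = "nt (fm LP (nt (LamC_gen gen_d) V)) b"
 let ?M = "%(z, h). pj (AO (PO V)) b z h * (aj (PO V) z z (idS z) * fm (PO V) (cat_inv SS h))"
 let ?N = "%l. ?D * (?M l * pj V b x g)"
 have m: "?M l : \<M> (dp (AO (PO V)) b) (dp V b)" if "l : R" for l
 proof -
  obtain z h where l: "l = (z, h)" by force
  have zh: "finite z" "h : Hom SS (sc z) b" using reps_in[OF R that[unfolded l]] by simp_all
  show ?thesis using pj_cm[OF AO_obj[OF W] b zh(2)] aj_cm[OF W zh(1) id_hom[OF zh(1)]] fmV_cm[OF W b SS_inv(1)[OF zh(2)]] by (simp add: l)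
 qed
 have mp: "?M l * pj V b x g : \<M> (dp (AO (PO V)) b) (fo V x)" if "l : R" for l
  using mult_carrier_mat[OF m[OF that] p] .
 have s1: "mat_sum (dp (AO (PO V)) b) (dp V b) ?M R * pj V b x g = mat_sum (dp (AO (PO V)) b) (fo V x) (%l. ?M l * pj V b x g) R"
  by (rule mat_sum_mult[OF p m])
 have s2: "?D * mat_sum (dp (AO (PO V)) b) (fo V x) (%l. ?M l * pj V b x g) R = mat_sum (dp V b) (fo V x) ?N R"
  by (rule mult_mat_sum[OF F mp])
 have "?D * gn gen_c' (PO V) b * pj V b x g = ?D * (gn gen_c' (PO V) b * pj V b x g)" by (rule assoc_mult_mat[OF F G p])
 also have "\<dots> = mat_sum (dp V b) (fo V x) ?N R"
  unfolding gen_c'[OF W b R, unfolded fo_PO] s1 s2 ..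
 also have "\<dots> = pj V b x g"
 proof -
  have N: "?N (z, h) = pj V b z h * (gn gen_d V z * (aj (PO V) z z (idS z) * pj V (sc z) x (cat_inv SS h oo g)))"
   if z: "finite z" and h: "h : Hom SS (sc z) b" for z h
  proof -
   note hi = SS_inv(1)[OF h]
   have z1: "finite (sc z)" using z by simp
   have c: "pj (AO (PO V)) b z h : \<M> (dp (AO (PO V)) b) (da (PO V) z)" "aj (PO V) z z (idS z) : \<M> (da (PO V) z) (dp V (sc z))"
    "fm (PO V) (cat_inv SS h) : \<M> (dp V (sc z)) (dp V b)" "pj V b z h : \<M> (dp V b) (fo V z)"
    "pj V (sc z) x (cat_inv SS h oo g) : \<M> (dp V (sc z)) (fo V x)"
    using pj_cm[OF AO_obj[OF W] b h] aj_cm[OF W z id_hom[OF z]] fmV_cm[OF W b hi] pj_cm[OF V b h]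
     pj_cm[OF V z1 SS_cmp[OF g hi]] by simp_all
   have "?N (z, h) = (?D * pj (AO (PO V)) b z h) * (aj (PO V) z z (idS z) * (fm (PO V) (cat_inv SS h) * pj V b x g))"
    using c p F by (simp add: mat_assoc)
   thus ?thesis unfolding LP_inj[OF C b h] PO_fm[OF V b hi g] using c gn_cm(2)[OF V z] by (simp add: mat_assoc)
  qed
  obtain r h k where rh: "(r, h) : R" and k: "k : Hom SS x r" "h oo scm k = g"
   using reps_ex[OF R _ g] x by auto
  have r: "finite r" "h : Hom SS (sc r) b" using reps_in[OF R rh] by simp_all
  note hi = SS_inv[OF r(2)]
  have hk: "cat_inv SS h oo g = scm k"
   unfolding k(2)[symmetric] using hi(2) SS_idl[OF plus1_hom[OF k(1)]] by (simp add: SS_assoc[symmetric])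
  have e: "?N (r, h) = pj V b x g"
   unfolding N[OF r] hk gen_d(1)[OF V r(1) id_hom[OF r(1)] plus1_hom[OF k(1)] k(1) HOL.refl] SS_idl[OF k(1)] pj_nat[OF V b k(1) r(2)] k(2) ..
  have z: "?N l = 0\<^sub>m (dp V b) (fo V x)" if l: "l : R" "l ~= (r, h)" for l
  proof -
   obtain r' h' where l': "l = (r', h')" by force
   have r': "finite r'" "h' : Hom SS (sc r') b" using reps_in[OF R l(1)[unfolded l']] by simp_all
   note hi' = SS_inv[OF r'(2)]
   have "\<nexists>\<beta>. \<beta> : Hom SS x r' & cat_inv SS h' oo g = scm \<beta>"
   proof
    assume "\<exists>\<beta>. \<beta> : Hom SS x r' & cat_inv SS h' oo g = scm \<beta>"
    then obtain \<gamma> where g': "\<gamma> : Hom SS x r'" "cat_inv SS h' oo g = scm \<gamma>" by blast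
    have "h' oo scm \<gamma> = g" unfolding g'(2)[symmetric] using hi'(3) SS_idl[OF g] by (simp add: SS_assoc[symmetric])
    thus False using reps_unique[OF R _ g rh k(1) _ l(1)[unfolded l'] g'(1)] k(2) x l(2) l' by auto
   qed
   from gen_d(2)[OF V r'(1) id_hom[OF r'(1)] SS_cmp[OF g hi'(1)] this] show ?thesis
    unfolding l' N[OF r'] using pj_cm[OF V b r'(2)] by simp
  qed
  have "mat_sum (dp V b) (fo V x) ?N R = ?N (r, h)"
   by (rule mat_sum_delta[OF reps_finite[OF R] rh _ z]) (use mult_carrier_mat[OF F mp[OF rh]] in simp_all)
  thus ?thesis unfolding e .
 qed
 finally show "?D * gn gen_c' (PO V) b * pj V b x g = 1\<^sub>m (dp V b) * pj V b x g"
  using left_mult_one_mat[OF p] by simp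
qed simp

end

subsection \<open>The representation of \<open>H'\<close>\<close>

lemma tar_id_right:
 assumes C: "category C" and s: "\<sigma> : Hom (End_cat C) F G" and H: "linear_functor C C H" and a: "a : Obj C"
 shows "nt (tar (End_tens C) \<sigma> (nt_id C C H)) a = nt \<sigma> (fo H a)"
proof -
 note Ha = fct_obj[OF lin_fct[OF H] a]
 have F: "is_functor C C F" using s by (simp add: Hom_End_cat lin_fct)
 show ?thesis
  using tar_component(1)[OF C s nt_id_hom[OF C H] a] a fct_idn[OF F Ha] cat_idr[OF C End_component[OF s Ha]] by simp
qed

lemma tar_id_left:
 assumes C: "category C" and s: "\<sigma> : Hom (End_cat C) F G" and H: "linear_functor C C H" and a: "a : Obj C"
 shows "nt (tar (End_tens C) (nt_id C C H) \<sigma>) a = fm H (nt \<sigma> a)"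
proof -
 have "is_functor C C G" using s by (simp add: Hom_End_cat lin_fct)
 note Ga = fct_obj[OF this a]
 show ?thesis
  using tar_component(1)[OF C nt_id_hom[OF C H] s a] Ga
   cat_idl[OF C fct_hom[OF lin_fct[OF H] End_component[OF s a]]] by simp
qed

lemma homE_eqI:
 assumes t: "\<tau> : homE F G" and s: "\<sigma> : homE F G" and e: "!!V b. V : Obj RepS ==> finite b ==> nt (nt \<tau> V) b = nt (nt \<sigma> V) b"
 shows "\<tau> = \<sigma>"
proof (rule End_cat_eqI[OF t s])
 fix V assume V: "V : Obj RepS"
 note a = Hom_RepD[OF End_component[OF t V]] and c = Hom_RepD[OF End_component[OF s V]]
 show "nt \<tau> V = nt \<sigma> V"
  by (rule ntr_eqI[where C = SS]) (use a(2,3) c(2,3) nat_ext[OF a(1)] nat_ext[OF c(1)] e[OF V] in simp_all)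
qed

lemmas End_RepS = category_End_cat[OF RepS_cat]

interpretation R: hp_interpretation "End_cat RepS" "End_tens RepS" LP LA LamC_gen
proof -
 note L = lin_category_Rep[OF cat_SS]
 interpret lin_category "End_cat RepS" by (rule lin_category_End_cat[OF L])
 show "hp_interpretation (End_cat RepS) (End_tens RepS) LP LA"
  by unfold_locales
   (use monoidal_End_cat[OF RepS_cat] has_biprods_End_cat[OF L has_biprods_Rep[OF cat_SS]] has_zero_End_cat[OF L has_zero_Rep[OF cat_SS]]
    tar_add_right[OF L] tar_add_left[OF L] tar_zer_right[OF L] tar_zer_left[OF L] lin_Lam1 in \<open>auto simp del: Rep_simps\<close>)
qed


lemma homE_idl: "\<tau> : homE F G ==> vcomp RepS RepS (nt_id RepS RepS G) \<tau> = \<tau>"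
 and homE_idr: "\<tau> : homE F G ==> vcomp RepS RepS \<tau> (nt_id RepS RepS F) = \<tau>"
 and homE_cmp: "\<tau> : homE F G ==> \<sigma> : homE G H ==> vcomp RepS RepS \<sigma> \<tau> : homE F H"
 using cat_idl[OF End_RepS, of \<tau> F G] cat_idr[OF End_RepS, of \<tau> F G] cat_cmp[OF End_RepS, of \<tau> F G \<sigma> H] by simp_all

lemma homE_inv_id: "linear_functor RepS RepS F ==> cat_inv (End_cat RepS) (nt_id RepS RepS F) = nt_id RepS RepS F"
 using cat_inv_Idn[OF End_RepS, of F] by simp

lemma linear_words:
 "linear_functor RepS RepS idF" "linear_functor RepS RepS (fcmp LA LP)" "linear_functor RepS RepS (fcmp LP LA)"
 "linear_functor RepS RepS (fcmp LP LP)" "linear_functor RepS RepS (fcmp LA LA)"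
 "linear_functor RepS RepS (fcmp LA (fcmp LP LP))" "linear_functor RepS RepS (fcmp LP (fcmp LP LP))"
 "linear_functor RepS RepS (fcmp LP (fcmp LA LP))" "linear_functor RepS RepS (fcmp LA (fcmp LP LA))"
proof -
 note l = lin_fcmp[OF lin_Lam1(2,1)] lin_fcmp[OF lin_Lam1(1,2)]
  lin_fcmp[OF lin_Lam1(2,2)] lin_fcmp[OF lin_Lam1(1,1)]
 show "linear_functor RepS RepS idF" by (rule linear_functor_idF[OF RepS_cat])
 show "linear_functor RepS RepS (fcmp LA LP)" "linear_functor RepS RepS (fcmp LP LA)"
  "linear_functor RepS RepS (fcmp LP LP)" "linear_functor RepS RepS (fcmp LA LA)" by (fact l)+
 show "linear_functor RepS RepS (fcmp LA (fcmp LP LP))" "linear_functor RepS RepS (fcmp LP (fcmp LP LP))"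
  "linear_functor RepS RepS (fcmp LP (fcmp LA LP))" "linear_functor RepS RepS (fcmp LA (fcmp LP LA))"
  using lin_fcmp[OF l(3) lin_Lam1(1)] lin_fcmp[OF l(3) lin_Lam1(2)]
   lin_fcmp[OF l(1) lin_Lam1(2)] lin_fcmp[OF l(2) lin_Lam1(1)] .
qed

lemma homE_vcomp:
 "V : Obj RepS ==> finite b ==> nt (nt (vcomp RepS RepS \<sigma> \<tau>) V) b = nt (nt \<sigma> V) b * nt (nt \<tau> V) b"
 "V : Obj RepS ==> finite b ==> nt (nt (nt_id RepS RepS F) V) b = 1\<^sub>m (fo (fo F V) b)"
 "V : Obj RepS ==> finite b ==> nt (nt (Add (fun_cat RepS RepS) \<sigma> \<tau>) V) b = nt (nt \<sigma> V) b + nt (nt \<tau> V) b"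
 "V : Obj RepS ==> finite b ==> nt (nt (Zer (fun_cat RepS RepS) F G) V) b = 0\<^sub>m (fo (fo G V) b) (fo (fo F V) b)"
 by simp_all

abbreviation "tE \<equiv> tar (End_tens RepS)"
abbreviation "iE \<equiv> nt_id RepS RepS"

interpretation R: hp_representation "End_cat RepS" "End_tens RepS" LP LA LamC_gen
proof
 note h = LamC_gen_hom and l = linear_words and ip = nt_id_hom[OF RepS_cat lin_Lam1(2)] and im = nt_id_hom[OF RepS_cat lin_Lam1(1)]
 note i = nt_id_hom[OF RepS_cat] and t = tar_hom[OF RepS_cat] and W = fo_Lam1
 note tr = tar_id_right[OF RepS_cat] and tl = tar_id_left[OF RepS_cat]
 note r = homE_inv_id homE_vcomp W
 show "LamC_gen k : Hom (End_cat RepS) (R.io (gen_dom k)) (R.io (gen_cod k))" for k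
  using h by (cases k) simp_all
 show "Add (End_cat RepS) (Cmp (End_cat RepS) (LamC_gen gen_c) (LamC_gen gen_d)) (Cmp (End_cat RepS) (LamC_gen gen_x) (LamC_gen gen_y)) =
   Idn (End_cat RepS) (tob (End_tens RepS) LA LP)"
  using R.add_hom[OF homE_cmp[OF h(2,1)] homE_cmp[OF h(8,7)]] i[OF l(2)] rel_cd_xy
  by (intro homE_eqI[where F = "fcmp LA LP" and G = "fcmp LA LP"]) (simp_all add: homE_vcomp W del: Rep_simps vcomp_simps nt_id_simps fun_cat_lin_simps)
 show "Cmp (End_cat RepS) (LamC_gen gen_y) (LamC_gen gen_x) = Idn (End_cat RepS) (tob (End_tens RepS) LP LA)"
  using homE_cmp[OF h(7,8)] i[OF l(3)] rel_yx
  by (intro homE_eqI[where F = "fcmp LP LA" and G = "fcmp LP LA"]) (simp_all add: homE_vcomp W del: Rep_simps vcomp_simps nt_id_simps)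
 show "Cmp (End_cat RepS) (LamC_gen gen_d) (LamC_gen gen_c) = Idn (End_cat RepS) (tun (End_tens RepS))"
  using homE_cmp[OF h(1,2)] i[OF l(1)] rel_dc
  by (intro homE_eqI[where F = idF and G = idF]) (simp_all add: homE_vcomp W del: Rep_simps vcomp_simps nt_id_simps)
 show "Cmp (End_cat RepS) (LamC_gen gen_u) (LamC_gen gen_u) = Idn (End_cat RepS) (tob (End_tens RepS) LP LP)"
  using homE_cmp[OF h(5,5)] i[OF l(4)] rel_uu
  by (intro homE_eqI[where F = "fcmp LP LP" and G = "fcmp LP LP"]) (simp_all add: homE_vcomp W del: Rep_simps vcomp_simps nt_id_simps)
 show "Cmp (End_cat RepS) (LamC_gen gen_v) (LamC_gen gen_v) = Idn (End_cat RepS) (tob (End_tens RepS) LA LA)"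
  using homE_cmp[OF h(6,6)] i[OF l(5)] rel_vv
  by (intro homE_eqI[where F = "fcmp LA LA" and G = "fcmp LA LA"]) (simp_all add: homE_vcomp W del: Rep_simps vcomp_simps nt_id_simps)
 \<comment> \<open>Words in three functors are strictly associative; fixing one bracketing lets the
   whiskered generators be composed directly.\<close>
 have fa: "fcmp (fcmp F G) H = fcmp F (fcmp G H)" for F G H :: "(S_rep, S_intw, S_rep, S_intw) fctr" by (simp add: fcmp_assoc)
 have c1: "tE (LamC_gen gen_c) (iE LP) : homE LP (fcmp LA (fcmp LP LP))" and c2: "tE (iE LP) (LamC_gen gen_c) : homE LP (fcmp LP (fcmp LA LP))"
  and c3: "tE (LamC_gen gen_c) (iE LA) : homE LA (fcmp LA (fcmp LP LA))" and u1: "tE (LamC_gen gen_u) (iE LP) : homE (fcmp LP (fcmp LP LP)) (fcmp LP (fcmp LP LP))"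
  and u2: "tE (iE LP) (LamC_gen gen_u) : homE (fcmp LP (fcmp LP LP)) (fcmp LP (fcmp LP LP))" and u3: "tE (iE LA) (LamC_gen gen_u) : homE (fcmp LA (fcmp LP LP)) (fcmp LA (fcmp LP LP))"
  and d1: "tE (LamC_gen gen_d) (iE LP) : homE (fcmp LA (fcmp LP LP)) LP" and d2: "tE (LamC_gen gen_d) (iE LA) : homE (fcmp LA (fcmp LP LA)) LA"
  and d3: "tE (iE LP) (LamC_gen gen_d) : homE (fcmp LP (fcmp LA LP)) LP" and d'1: "tE (LamC_gen gen_d') (iE LP) : homE (fcmp LP (fcmp LA LP)) LP"
  and d'2: "tE (iE LA) (LamC_gen gen_d') : homE (fcmp LA (fcmp LP LA)) LA"
  and c'1: "tE (iE LA) (LamC_gen gen_c') : homE LA (fcmp LA (fcmp LP LA))" and c'2: "tE (LamC_gen gen_c') (iE LP) : homE LP (fcmp LP (fcmp LA LP))"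
  using t[OF h(1) ip] t[OF ip h(1)] t[OF h(1) im] t[OF h(5) ip] t[OF ip h(5)] t[OF im h(5)] t[OF h(2) ip] t[OF h(2) im] t[OF ip h(2)]
   t[OF h(4) ip] t[OF im h(4)] t[OF im h(3)] t[OF h(3) ip] by (simp_all add: fa)
 \<comment> \<open>Interpreted associators and unitors are identity transformations, hence so are
   their inverses. Erasing them leaves composites of whiskered generators.\<close>
 note S = homE_inv_id[OF lin_Lam1(1)] homE_inv_id[OF lin_Lam1(2)] homE_inv_id[OF l(6)] homE_inv_id[OF l(7)] homE_inv_id[OF l(8)] homE_inv_id[OF l(9)]
 show "R.im duc_term = Zer (End_cat RepS) LP LP"
 proof -
  have "R.im duc_term =
    vcomp RepS RepS (tE (LamC_gen gen_d) (iE LP)) (vcomp RepS RepS (tE (iE LA) (LamC_gen gen_u)) (tE (LamC_gen gen_c) (iE LP)))"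
   using homE_idr[OF c1] homE_idl[OF c1] homE_idl[OF homE_cmp[OF c1 u3]] homE_idl[OF homE_cmp[OF homE_cmp[OF c1 u3] d1]] by (simp add: S)
  \<comment> \<open>On components, whiskering a generator either evaluates it at another
    representation or applies \<open>LA\<close> or \<open>LP\<close> to it. What remains is the
    matrix relation proved before.\<close>
  also have "\<dots> = Zer (fun_cat RepS RepS) LP LP"
   using homE_cmp[OF homE_cmp[OF c1 u3] d1] R.zer_hom[of LP LP] lin_Lam1(2) rel_duc
   by (intro homE_eqI[where F = LP and G = LP]) (simp_all add: homE_vcomp W tr[OF h(2)] tr[OF h(1)] tl[OF h(5)] lin_Lam1 del: Rep_simps vcomp_simps fun_cat_lin_simps End_tens_simps)
  finally show ?thesis by simp
 qed
 show "R.im (hu1 \<cdot>\<^sub>h hu2 \<cdot>\<^sub>h hu1) = R.im (hu2 \<cdot>\<^sub>h hu1 \<cdot>\<^sub>h hu2)"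
 proof -
  let ?u1 = "tE (LamC_gen gen_u) (iE LP)" and ?u2 = "tE (iE LP) (LamC_gen gen_u)"
  have "R.im (hu1 \<cdot>\<^sub>h hu2 \<cdot>\<^sub>h hu1) = vcomp RepS RepS ?u1 (vcomp RepS RepS ?u2 ?u1)" "R.im (hu2 \<cdot>\<^sub>h hu1 \<cdot>\<^sub>h hu2) = vcomp RepS RepS ?u2 (vcomp RepS RepS ?u1 ?u2)"
   using homE_idl[OF u1] homE_idl[OF u2] homE_idr[OF u2] by (simp_all add: S)
  moreover have "vcomp RepS RepS ?u1 (vcomp RepS RepS ?u2 ?u1) = vcomp RepS RepS ?u2 (vcomp RepS RepS ?u1 ?u2)"
   by (rule homE_eqI[OF homE_cmp[OF homE_cmp[OF u1 u2] u1] homE_cmp[OF homE_cmp[OF u2 u1] u2]])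
    (use rel_braid in \<open>simp_all add: homE_vcomp W tr[OF h(5)] tl[OF h(5)] lin_Lam1 del: Rep_simps vcomp_simps End_tens_simps\<close>)
  ultimately show ?thesis by simp
 qed
 have eqI: "vcomp RepS RepS \<sigma> \<tau> = iE F"
  if "\<tau> : homE F G" "\<sigma> : homE G F" "!!V b. V : Obj RepS ==> finite b ==> nt (nt \<sigma> V) b * nt (nt \<tau> V) b = 1\<^sub>m (fo (fo F V) b)" "linear_functor RepS RepS F" for \<sigma> \<tau> F G
  using homE_cmp[OF that(1,2)] i[OF that(4)] that(3) by (intro homE_eqI[where F = F and G = F]) (simp_all add: homE_vcomp del: Rep_simps vcomp_simps nt_id_simps)
 show "R.im zigzag1_term = Idn (End_cat RepS) LP"
  using homE_idr[OF c2] homE_idl[OF c2] homE_idl[OF homE_cmp[OF c2 d'1]] eqI[OF c2 d'1 _ lin_Lam1(2)] rel_zigzag1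
  by (simp add: S W tr[OF h(4)] tl[OF h(1)] lin_Lam1 del: Rep_simps vcomp_simps End_tens_simps(6-))
 show "R.im zigzag2_term = Idn (End_cat RepS) LA"
  using homE_idr[OF c3] homE_idl[OF c3] homE_idl[OF homE_cmp[OF c3 d'2]] eqI[OF c3 d'2 _ lin_Lam1(1)] rel_zigzag2
  by (simp add: S W tr[OF h(1)] tl[OF h(4)] lin_Lam1 del: Rep_simps vcomp_simps End_tens_simps(6-))
 show "R.im zigzag3_term = Idn (End_cat RepS) LA"
  using homE_idr[OF c'1] homE_idl[OF c'1] homE_idl[OF homE_cmp[OF c'1 d2]] eqI[OF c'1 d2 _ lin_Lam1(1)] rel_zigzag3
  by (simp add: S W tr[OF h(2)] tl[OF h(3)] lin_Lam1 del: Rep_simps vcomp_simps End_tens_simps(6-))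
 show "R.im zigzag4_term = Idn (End_cat RepS) LP"
  using homE_idr[OF c'2] homE_idl[OF c'2] homE_idl[OF homE_cmp[OF c'2 d3]] eqI[OF c'2 d3 _ lin_Lam1(2)] rel_zigzag4
  by (simp add: S W tr[OF h(3)] tl[OF h(2)] lin_Lam1 del: Rep_simps vcomp_simps End_tens_simps(6-))
qed


section \<open>Representations of \<open>S\<close> and of the symmetric groups\<close>

subsection \<open>Coproducts of categories\<close>

context
 fixes C :: "nat => ('o, 'm, 'z) cat_scheme" assumes C: "!!n. category (C n)"
begin

definition coprod_obs :: "(nat => 'o) set" where
 "coprod_obs = {V. (ALL n. V n : Obj (C n)) & finite {n. \<not> is_zero_obj (C n) (V n)}}"

lemma coprod_simps:
 "Obj (coprod_cat C) = coprod_obs" "Idn (coprod_cat C) V n = Idn (C n) (V n)" "Cmp (coprod_cat C) \<psi> \<phi> n = Cmp (C n) (\<psi> n) (\<phi> n)"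
 by (simp_all add: coprod_cat_def coprod_obs_def)

lemma Hom_coprod:
 "\<phi> : Hom (coprod_cat C) V W \<longleftrightarrow> (ALL n. \<phi> n : Hom (C n) (V n) (W n)) & V : coprod_obs & W : coprod_obs"
proof -
 let ?D = "%n. Dom (C n) (\<phi> n)" and ?E = "%n. Cod (C n) (\<phi> n)"
 have 1: "\<phi> : Hom (coprod_cat C) V W \<longleftrightarrow> (ALL n. \<phi> n : Arr (C n)) & ?D : coprod_obs & ?E : coprod_obs & ?D = V & ?E = W"
  unfolding homset_def coprod_cat_def coprod_obs_def Let_def by simp
 have 2: "(ALL n. \<phi> n : Hom (C n) (V n) (W n)) \<longleftrightarrow> (ALL n. \<phi> n : Arr (C n)) & ?D = V & ?E = W"
  unfolding homset_def fun_eq_iff by blast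
 show ?thesis unfolding 1 2 by blast
qed

lemma category_coprod: "category (coprod_cat C)"
proof (rule categoryI)
 fix f g h a b c d assume "f : Hom (coprod_cat C) a b" "g : Hom (coprod_cat C) b c" "h : Hom (coprod_cat C) c d"
 hence "f n : Hom (C n) (a n) (b n)" "g n : Hom (C n) (b n) (c n)" "h n : Hom (C n) (c n) (d n)" for n
  by (simp_all add: Hom_coprod)
 from cat_assoc[OF C this] show "Cmp (coprod_cat C) h (Cmp (coprod_cat C) g f) = Cmp (coprod_cat C) (Cmp (coprod_cat C) h g) f"
  by (simp add: coprod_simps fun_eq_iff)
next
 fix f g a b c assume "f : Hom (coprod_cat C) a b" "g : Hom (coprod_cat C) b c"
 hence "f n : Hom (C n) (a n) (b n)" "g n : Hom (C n) (b n) (c n)" "a : coprod_obs" "c : coprod_obs" for n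
  by (simp_all add: Hom_coprod)
 with cat_cmp[OF C this(1,2)] show "Cmp (coprod_cat C) g f : Hom (coprod_cat C) a c"
  by (simp add: Hom_coprod coprod_simps)
next
 fix f a b assume f: "f : Hom (coprod_cat C) a b"
 hence "f n : Hom (C n) (a n) (b n)" for n by (simp add: Hom_coprod)
 from cat_idr[OF C this] cat_idl[OF C this]
 show "Cmp (coprod_cat C) f (Idn (coprod_cat C) a) = f" "Cmp (coprod_cat C) (Idn (coprod_cat C) b) f = f"
  by (simp_all add: coprod_simps fun_eq_iff)
 show "a : Obj (coprod_cat C) & b : Obj (coprod_cat C)" using f by (simp add: Hom_coprod coprod_simps)
next
 fix a assume "a : Obj (coprod_cat C)"
 thus "Idn (coprod_cat C) a : Hom (coprod_cat C) a a"
  using cat_idn[OF C] by (simp add: Hom_coprod coprod_simps) (simp add: coprod_obs_def)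
qed

lemma coprod_iso:
 assumes f: "\<phi> : Hom (coprod_cat C) V W" and i: "!!n. is_iso (C n) (\<phi> n)"
 shows "is_iso (coprod_cat C) \<phi>"
proof -
 have h: "\<phi> n : Hom (C n) (V n) (W n)" for n using f by (simp add: Hom_coprod)
 have g: "(%n. cat_inv (C n) (\<phi> n)) : Hom (coprod_cat C) W V"
  using f cat_inv_hom[OF C i h] by (simp add: Hom_coprod)
 have "inverse_arrows (coprod_cat C) \<phi> (%n. cat_inv (C n) (\<phi> n))"
  by (rule inv_arrowsI[OF f g]) (simp_all add: fun_eq_iff coprod_simps cat_inv_left[OF C i h] cat_inv_right[OF C i h])
 thus ?thesis unfolding is_iso_def by (rule exI[of _ "%n. cat_inv (C n) (\<phi> n)"])
qed

end

subsection \<open>The symmetric groups inside \<open>S\<close>\<close>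

abbreviation "BS n \<equiv> deloop (sym_group n)"
abbreviation "J n \<equiv> fm (sym_incl n)"

lemma BS_simps [simp]: "Obj (BS n) = UNIV" "Idn (BS n) u = id" "Cmp (BS n) g f = g \<circ> f"
 by (simp_all add: deloop_def sym_group_def)

lemma Hom_BS: "f : Hom (BS n) a b \<longleftrightarrow> f permutes {1..n}"
 by (simp add: homset_def deloop_def sym_group_def)

lemma category_BS: "category (BS n)"
 by (rule categoryI) (auto simp: Hom_BS permutes_compose permutes_id)

lemma sym_incl_fo [simp]: "fo (sym_incl n) u = {1..n}"
 by (simp add: sym_incl_def)

lemma J_eval: "J n p i = (if i : {1..n} then Some (p i) else None)"
 by (simp add: sym_incl_def restrict_map_def)

lemma J_hom: "p permutes {1..n} ==> J n p : Hom SS {1..n} {1..n}"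
proof (rule Hom_SSI)
 fix m assume p: "p permutes {1..n}" and m: "m : {1..n}"
 obtain i where "i : {1..n}" "p i = m" using m permutes_image[OF p] by (metis imageE)
 thus "\<exists>i\<in>{1..n}. J n p i = Some m" by (auto simp: J_eval)
next
 show "\<exists>m\<in>{1..n}. J n p i = Some m" if "p permutes {1..n}" "i : {1..n}" for i
  using that permutes_in_image[OF that(1)] by (auto simp: J_eval)
next
 fix i i' m assume "p permutes {1..n}" "J n p i = Some m" "J n p i' = Some m"
 thus "i = i'" by (auto simp: J_eval split: if_splits dest: permutes_inj injD)
qed (auto simp: J_eval)

lemma J_cmp: "f permutes {1..n} ==> J n (g \<circ> f) = J n g oo J n f"
 using permutes_in_image[of f "{1..n}"] by (auto simp: fun_eq_iff J_eval map_comp_def)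

lemma J_id: "J n id = idS {1..n}"
 by (auto simp: fun_eq_iff J_eval restrict_map_def)

lemma functor_J: "is_functor (BS n) SS (sym_incl n)"
 by (rule is_functorI) (auto simp: Hom_BS J_hom J_cmp J_id simp del: One_nat_def)

text \<open>Elements of the symmetric group are total functions that fix everything outside
  \<open>{1..n}\<close>, whereas arrows of \<open>S\<close> are partial functions; the passage
  between them extends by the identity.\<close>

definition perm_of :: "fset_bij => nat => nat" where
 "perm_of u i = (case u i of None => i | Some j => j)"

lemma perm_of:
 assumes u: "u : Hom SS {1..n} {1..n}"
 shows "perm_of u permutes {1..n}" "J n (perm_of u) = u"
proof -
 note e = SS_eval[OF u]
 have v: "u i = (if i : {1..n} then Some (perm_of u i) else None)" for i
  using e(1,2)[of i] by (auto simp: perm_of_def)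
 thus "J n (perm_of u) = u" by (auto simp: fun_eq_iff J_eval)
 show "perm_of u permutes {1..n}"
 proof (rule bij_imp_permutes)
  have "inj_on (perm_of u) {1..n}" using e(5) v by (intro inj_onI) metis
  moreover have "perm_of u ` {1..n} \<subseteq> {1..n}" using e(1) v by fastforce
  ultimately show "bij_betw (perm_of u) {1..n} {1..n}"
   by (simp add: bij_betw_def endo_inj_surj)
  show "perm_of u i = i" if "i \<notin> {1..n}" for i using e(2)[OF that] by (simp add: perm_of_def)
 qed
qed

lemma J_inject: "p permutes {1..n} ==> q permutes {1..n} ==> J n p = J n q ==> p = q"
proof
 fix i assume p: "p permutes {1..n}" and q: "q permutes {1..n}" and e: "J n p = J n q"
 show "p i = q i"
  using fun_cong[OF e, of i] permutes_not_in[OF p, of i] permutes_not_in[OF q, of i] by (cases "i : {1..n}") (simp_all add: J_eval)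
qed

lemma perm_of_J: "p permutes {1..n} ==> perm_of (J n p) = p"
 using perm_of[OF J_hom] J_inject by blast

lemma perm_of_cmp:
 assumes u: "u : Hom SS {1..n} {1..n}" and v: "v : Hom SS {1..n} {1..n}"
 shows "perm_of (v oo u) = perm_of v \<circ> perm_of u"
 by (rule J_inject[OF perm_of(1)[OF SS_cmp[OF u v]] permutes_compose[OF perm_of(1)[OF u] perm_of(1)[OF v]]])
  (simp add: J_cmp[OF perm_of(1)[OF u]] perm_of(2)[OF u] perm_of(2)[OF v] perm_of(2)[OF SS_cmp[OF u v]])

subsection \<open>Standard forms of finite sets\<close>

text \<open>On a standard set the enumeration is required to be the identity, so that extending
  representations to \<open>S\<close> and restricting them again gives back the original
  action.\<close>

definition enum_of :: "nat set => fset_bij" where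
 "enum_of s = (if s = {1..card s} then idS s else SOME e. e : Hom SS {1..card s} s)"

lemma enum_of: "finite s ==> enum_of s : Hom SS {1..card s} s"
proof -
 assume s: "finite s"
 obtain f where f: "bij_betw f {1..card s} s" using ex_bij_betw_nat_finite_1[OF s] by blast
 have "(%i. if i : {1..card s} then Some (f i) else None) : Hom SS {1..card s} s"
 proof (rule Hom_SSI)
  fix m assume "m : s"
  then obtain i where "i : {1..card s}" "f i = m" using f by (metis bij_betw_iff_bijections)
  thus "\<exists>n\<in>{1..card s}. (if n : {1..card s} then Some (f n) else None) = Some m" by auto
 next
  fix n n' m assume "n : {1..card s}" "n' : {1..card s}" "(if n : {1..card s} then Some (f n) else None) = Some m"
   "(if n' : {1..card s} then Some (f n') else None) = Some m"
  thus "n = n'" using f by (metis bij_betw_def inj_onD option.inject)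
 next
  fix n assume "n : {1..card s}"
  thus "\<exists>m\<in>s. (if n : {1..card s} then Some (f n) else None) = Some m" using bij_betwE[OF f] by auto
 qed auto
 hence "EX e. e : Hom SS {1..card s} s" by blast
 from someI_ex[OF this] show ?thesis using id_hom[OF s] by (auto simp: enum_of_def)
qed

lemma enum_of_std: "enum_of {1..n} = idS {1..n}"
 by (simp add: enum_of_def)

text \<open>Conjugation by the chosen enumerations, i.e. the effect on arrows of the retraction of
  \<open>S\<close> onto its skeleton of standard sets.\<close>

definition std_of :: "fset_bij => fset_bij" where
 "std_of f = cat_inv SS (enum_of (ran f)) oo (f oo enum_of (dom f))"

lemma hom_card: "f : Hom SS s t ==> card t = card s"
proof -
 assume f: "f : Hom SS s t"
 have "bij_betw (%n. the (f n)) s t"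
  unfolding bij_betw_def
 proof
  show "inj_on (%n. the (f n)) s" using SS_eval(1,5)[OF f] by (intro inj_onI) (metis option.sel)
  show "(%n. the (f n)) ` s = t" using SS_eval(1,3)[OF f] by (force simp: image_iff)
 qed
 thus ?thesis by (rule bij_betw_same_card[symmetric])
qed

lemma std_of:
 assumes f: "f : Hom SS s t"
 shows "std_of f : Hom SS {1..card s} {1..card s}" "std_of f = cat_inv SS (enum_of t) oo (f oo enum_of s)"
proof -
 have d: "dom f = s" "ran f = t" using f by (simp_all add: Hom_SS)
 note st = SS_eval(6,7)[OF f]
 show "std_of f = cat_inv SS (enum_of t) oo (f oo enum_of s)" by (simp add: std_of_def d)
 thus "std_of f : Hom SS {1..card s} {1..card s}"
  using SS_cmp[OF SS_cmp[OF enum_of[OF st(1)] f] SS_inv(1)[OF enum_of[OF st(2)]]] hom_card[OF f] by simp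
qed

lemma std_of_cmp:
 assumes f: "f : Hom SS s t" and g: "g : Hom SS t u"
 shows "std_of (g oo f) = std_of g oo std_of f"
proof -
 note st = SS_eval(6,7)[OF f]
 note e = enum_of[OF st(2)] enum_of[OF st(1)]
 have "enum_of t oo (cat_inv SS (enum_of t) oo (f oo enum_of s)) = f oo enum_of s"
  using SS_inv(3)[OF e(1)] SS_idl[OF SS_cmp[OF e(2) f]] by (simp add: SS_assoc[symmetric])
 thus ?thesis unfolding std_of(2)[OF f] std_of(2)[OF g] std_of(2)[OF SS_cmp[OF f g]] SS_assoc by simp
qed

lemma std_of_idn: "finite s ==> std_of (idS s) = idS {1..card s}"
 using std_of(2)[OF id_hom, of s] SS_idl[OF enum_of, of s] SS_inv(2)[OF enum_of, of s] by simp

lemma std_of_J: "p permutes {1..n} ==> std_of (J n p) = J n p"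
 using std_of(2)[OF J_hom, of p n] SS_idr[OF J_hom, of p n] SS_idl[OF J_hom, of p n] SS_inv_id[of "{1..n}"] by (simp add: enum_of_std del: One_nat_def)

lemma SS_isomorphic: "finite s ==> isomorphic_obj SS {1..card s} s"
 unfolding isomorphic_obj_def using enum_of grp_iso[OF groupoid_SS enum_of] by blast

subsection \<open>The equivalence\<close>

text \<open>A one-object groupoid has a single class, so the support condition is void.\<close>

lemma Rep_BS_obj: "V : Obj (Rep (BS n)) \<longleftrightarrow> is_functor (BS n) matcat V"
proof -
 have "isomorphic_obj (BS n) () ()" unfolding isomorphic_obj_def
  using cat_idn[OF category_BS] is_iso_Idn[OF category_BS, of "()" n] by (metis BS_simps(1) UNIV_I)
 hence "fin_supp (BS n) V" by (auto simp: fin_supp_def intro!: exI[of _ "{()}"])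
 thus ?thesis by simp
qed

text \<open>This translates the finiteness condition of \<open>coprod_cat\<close>, phrased with zero
  objects, into a condition on dimensions.\<close>

lemma Rep_BS_zero:
 assumes V: "V : Obj (Rep (BS n))"
 shows "is_zero_obj (Rep (BS n)) V \<longleftrightarrow> fo V () = 0"
proof
 interpret lin_category "Rep (BS n)" by (rule lin_category_Rep[OF category_BS])
 assume "is_zero_obj (Rep (BS n)) V"
 \<comment> \<open>A zero object has only one endomorphism, so its identity is the zero map;
   compared as matrices this forces dimension 0.\<close>
 hence "Zer (Rep (BS n)) V V = Idn (Rep (BS n)) V"
  using zer_hom[OF V V] cat_idn[OF cat V] V unfolding is_zero_obj_def by blast
 from arg_cong[OF this, of "\<lambda>\<tau>. nt \<tau> ()"] have "0\<^sub>m (fo V ()) (fo V ()) = (1\<^sub>m (fo V ()) :: complex mat)" by simp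
 hence "(0\<^sub>m (fo V ()) (fo V ()) :: complex mat) $$ (0, 0) = (1\<^sub>m (fo V ()) :: complex mat) $$ (0, 0)" by simp
 thus "fo V () = 0" by (cases "fo V ()") auto
next
 interpret lin_category "Rep (BS n)" by (rule lin_category_Rep[OF category_BS])
 assume z: "fo V () = 0"
 have u: "\<tau> = \<sigma>" if t: "\<tau> : Hom (Rep (BS n)) A B" "\<sigma> : Hom (Rep (BS n)) A B" and AB: "fo A () = 0 \<or> fo B () = 0" for \<tau> \<sigma> A B
 proof (rule ntr_eqI[where C = "BS n"])
  note a = Hom_RepD[OF t(1)] and c = Hom_RepD[OF t(2)]
  show "nsrc \<tau> = nsrc \<sigma>" "ntgt \<tau> = ntgt \<sigma>" "nt \<tau> : extensional (Obj (BS n))" "nt \<sigma> : extensional (Obj (BS n))"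
   using a(1-3) c(1-3) nat_ext by auto
  fix x
  have "nt \<tau> () : \<M> (fo B ()) (fo A ())" "nt \<sigma> () : \<M> (fo B ()) (fo A ())"
   using intw_cm[OF a(1), of "()"] intw_cm[OF c(1), of "()"] a c by simp_all
  thus "nt \<tau> x = nt \<sigma> x" using AB by (intro eq_matI) auto
 qed
 show "is_zero_obj (Rep (BS n)) V"
  unfolding is_zero_obj_def
 proof (intro conjI ballI V)
  fix B assume B: "B : Obj (Rep (BS n))"
  show "EX! f. f : Hom (Rep (BS n)) V B"
   using zer_hom[OF V B] u[of _ V B] z by blast
  show "EX! f. f : Hom (Rep (BS n)) B V"
   using zer_hom[OF B V] u[of _ B V] z by blast
 qed
qed

lemmas cBS = category_Rep[OF category_BS]

lemma sym_obj: "W : Obj sym_reps \<longleftrightarrow> (ALL n. is_functor (BS n) matcat (W n)) & finite {n. fo (W n) () ~= 0}"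
proof -
 have "W : Obj sym_reps \<longleftrightarrow> (ALL n. W n : Obj (Rep (BS n))) & finite {n. \<not> is_zero_obj (Rep (BS n)) (W n)}"
  by (simp only: sym_reps_def coprod_simps[OF cBS] coprod_obs_def[OF cBS] mem_Collect_eq)
 thus ?thesis using Rep_BS_zero[of "W _"] by (auto simp: Rep_BS_obj simp del: Rep_simps)
qed

lemma Hom_sym: "\<phi> : Hom sym_reps V W \<longleftrightarrow> (ALL n. \<phi> n : Hom (Rep (BS n)) (V n) (W n)) & V : Obj sym_reps & W : Obj sym_reps"
 by (simp only: sym_reps_def Hom_coprod[OF cBS] coprod_simps(1)[OF cBS])

lemma sym_simps: "Idn sym_reps V n = nt_id (BS n) matcat (V n)" "Cmp sym_reps \<psi> \<phi> n = vcomp (BS n) matcat (\<psi> n) (\<phi> n)"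
 by (simp_all add: sym_reps_def coprod_simps[OF cBS])

lemma category_sym: "category sym_reps"
 unfolding sym_reps_def by (rule category_coprod[OF cBS])

lemma Rep_BS_homI:
 assumes "is_functor (BS n) matcat V" "is_functor (BS n) matcat W" "nsrc \<tau> = V" "ntgt \<tau> = W" "nt \<tau> : extensional UNIV"
  and "nt \<tau> () : \<M> (fo W ()) (fo V ())" "!!p. p permutes {1..n} ==> nt \<tau> () * fm V p = fm W p * nt \<tau> ()"
 shows "\<tau> : Hom (Rep (BS n)) V W"
proof -
 have "is_nat (BS n) matcat \<tau>"
  by (rule is_natI) (use assms in \<open>simp_all add: Hom_BS Hom_matcat\<close>)
 thus ?thesis using assms Rep_BS_obj[of V n] Rep_BS_obj[of W n] by (simp add: Hom_Rep)
qed

text \<open>Isomorphism classes of finite sets are cardinalities, so finite support means that only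
  finitely many degrees are nonzero.\<close>

lemma fin_supp_SS: "fin_supp SS V \<longleftrightarrow> finite {n. EX s. finite s & card s = n & fo V s ~= 0}"
proof
 assume "fin_supp SS V"
 then obtain K where K: "finite K" "!!x. finite x ==> fo V x ~= 0 ==> \<exists>k\<in>K. isomorphic_obj SS k x" by (auto simp: fin_supp_def)
 have "{n. EX s. finite s & card s = n & fo V s ~= 0} \<subseteq> card ` K"
  using K(2) hom_card by (fastforce simp: isomorphic_obj_def image_iff)
 thus "finite {n. EX s. finite s & card s = n & fo V s ~= 0}" using K(1) finite_surj by blast
next
 assume f: "finite {n. EX s. finite s & card s = n & fo V s ~= 0}" (is "finite ?N")
 have "\<exists>k\<in>(%n. {1..n}) ` ?N. isomorphic_obj SS k x" if "finite x" "fo V x ~= 0" for x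
  using SS_isomorphic[OF that(1)] that by blast
 thus "fin_supp SS V" unfolding fin_supp_def using f by (intro exI[of _ "(%n. {1..n}) ` ?N"]) auto
qed

text \<open>The quasi-inverse on objects: the space over a set depends on its cardinality only, and
  a bijection acts through the permutation that it induces on enumerations.\<close>

definition std_rep :: "(nat => (unit, nat => nat) rep) => S_rep" where
 "std_rep W = \<lparr>fo = (%s. fo (W (card s)) ()), fm = (%f. fm (W (card (dom f))) (perm_of (std_of f)))\<rparr>"

definition std_intw :: "(nat => (unit, nat => nat) intw) => S_intw" where
 "std_intw \<phi> = \<lparr>nsrc = std_rep (%n. nsrc (\<phi> n)), ntgt = std_rep (%n. ntgt (\<phi> n)), nt = (\<lambda>s\<in>Obj SS. nt (\<phi> (card s)) ())\<rparr>"

definition sym_ext where "sym_ext = \<lparr>fo = std_rep, fm = std_intw\<rparr>"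

lemma std_rep_fm: "f : Hom SS s t ==> fm (std_rep W) f = fm (W (card s)) (perm_of (std_of f))"
 by (simp add: std_rep_def Hom_SS)

lemma std_rep_obj:
 assumes W: "W : Obj sym_reps"
 shows "std_rep W : Obj RepS"
proof -
 have F: "is_functor (BS n) matcat (W n)" for n using W by (simp add: sym_obj)
 have "is_functor SS matcat (std_rep W)"
 proof (rule is_functorI)
  fix a assume a: "a : Obj SS"
  have "perm_of (idS {1..card a}) = id" using perm_of_J[OF permutes_id, of "card a"] by (simp only: J_id)
  thus "fm (std_rep W) (Idn SS a) = Idn matcat (fo (std_rep W) a)"
   using a std_rep_fm[OF id_hom] std_of_idn fct_idn[OF F, of "()" "card a"] by (simp add: std_rep_def del: One_nat_def)
 next
  fix f a b assume f: "f : Hom SS a b"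
  have "perm_of (std_of f) : Hom (BS (card a)) () ()" using perm_of(1)[OF std_of(1)[OF f]] by (simp add: Hom_BS)
  from fct_hom[OF F this] show "fm (std_rep W) f : Hom matcat (fo (std_rep W) a) (fo (std_rep W) b)"
   unfolding std_rep_fm[OF f] using hom_card[OF f] by (simp add: std_rep_def)
 next
  fix f g a b c assume f: "f : Hom SS a b" and g: "g : Hom SS b c"
  note p = perm_of(1)[OF std_of(1)[OF f]] perm_of(1)[OF std_of(1)[OF g], unfolded hom_card[OF f]]
  have "fm (W (card a)) (perm_of (std_of g) \<circ> perm_of (std_of f)) = fm (W (card a)) (perm_of (std_of g)) * fm (W (card a)) (perm_of (std_of f))"
   using fct_cmp[OF F, of "perm_of (std_of f)" "card a" "()" "()" "perm_of (std_of g)" "()"] p by (simp add: Hom_BS)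
  thus "fm (std_rep W) (Cmp SS g f) = Cmp matcat (fm (std_rep W) g) (fm (std_rep W) f)"
   using perm_of_cmp[OF std_of(1)[OF f] std_of(1)[OF g, unfolded hom_card[OF f]]]
   by (simp add: std_rep_fm[OF f] std_rep_fm[OF g] std_rep_fm[OF SS_cmp[OF f g]] std_of_cmp[OF f g] hom_card[OF f])
 qed (simp add: std_rep_def)
 moreover have "fin_supp SS (std_rep W)"
 proof -
  have "finite {n. fo (W n) () ~= 0}" using W by (simp add: sym_obj)
  thus ?thesis unfolding fin_supp_SS by (rule rev_finite_subset) (auto simp: std_rep_def)
 qed
 ultimately show ?thesis by simp
qed

lemma Hom_BS_D:
 assumes t: "\<tau> : Hom (Rep (BS n)) V W"
 shows "nt \<tau> () : \<M> (fo W ()) (fo V ())" "p permutes {1..n} ==> nt \<tau> () * fm V p = fm W p * nt \<tau> ()"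
  "nsrc \<tau> = V" "ntgt \<tau> = W" "nt \<tau> : extensional UNIV"
 using intw_cm[OF Hom_RepD(1)[OF t], of "()"] intw_nat[OF Hom_RepD(1)[OF t], of p "()" "()"] Hom_RepD(2,3)[OF t] nat_ext[OF Hom_RepD(1)[OF t]]
 by (simp_all add: Hom_BS)

lemma sym_ext_functor: "is_functor sym_reps RepS sym_ext"
proof (rule is_functorI)
 show "fo sym_ext W : Obj RepS" if "W : Obj sym_reps" for W using std_rep_obj[OF that] by (simp add: sym_ext_def del: Rep_simps)
next
 fix W assume W: "W : Obj sym_reps"
 show "fm sym_ext (Idn sym_reps W) = Idn RepS (fo sym_ext W)"
 proof (rule ntr_eqI[where C = SS])
  show "nt (Idn RepS (fo sym_ext W)) : extensional (Obj SS)" by (simp del: SS_simps)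
  show "nt (fm sym_ext (Idn sym_reps W)) s = nt (Idn RepS (fo sym_ext W)) s" if "s : Obj SS" for s
   using that by (simp add: sym_ext_def std_intw_def sym_simps) (simp add: std_rep_def)
 qed (simp_all add: sym_ext_def std_intw_def sym_simps)
next
 fix \<phi> V W assume p: "\<phi> : Hom sym_reps V W"
 hence n: "\<phi> n : Hom (Rep (BS n)) (V n) (W n)" for n by (simp add: Hom_sym)
 have o: "V : Obj sym_reps" "W : Obj sym_reps" using p by (simp_all add: Hom_sym)
 note d = Hom_BS_D[OF n] and oo = std_rep_obj[OF o(1)] std_rep_obj[OF o(2)]
 have "is_nat SS matcat (std_intw \<phi>)"
 proof (rule is_natI)
  fix f a b assume f: "f : Hom SS a b"
  thus "Cmp matcat (nt (std_intw \<phi>) b) (fm (nsrc (std_intw \<phi>)) f) = Cmp matcat (fm (ntgt (std_intw \<phi>)) f) (nt (std_intw \<phi>) a)"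
   using d(2)[OF perm_of(1)[OF std_of(1)[OF f]]] SS_eval(6,7)[OF f] by (simp add: std_intw_def std_rep_fm[OF f] d(3,4) hom_card[OF f])
 next
  fix a assume "a : Obj SS"
  thus "nt (std_intw \<phi>) a : Hom matcat (fo (nsrc (std_intw \<phi>)) a) (fo (ntgt (std_intw \<phi>)) a)"
   using d(1)[of "card a"] by (simp add: std_intw_def d(3,4) Hom_matcat) (simp add: std_rep_def)
 qed (use oo in \<open>simp_all add: std_intw_def d(3,4)\<close>)
 thus "fm sym_ext \<phi> : Hom RepS (fo sym_ext V) (fo sym_ext W)"
  using oo by (simp add: sym_ext_def Hom_Rep) (simp add: std_intw_def d(3,4))
next
 fix \<phi> \<psi> U V W assume p: "\<phi> : Hom sym_reps U V" "\<psi> : Hom sym_reps V W"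
 show "fm sym_ext (Cmp sym_reps \<psi> \<phi>) = Cmp RepS (fm sym_ext \<psi>) (fm sym_ext \<phi>)"
 proof (rule ntr_eqI[where C = SS])
  show "nt (Cmp RepS (fm sym_ext \<psi>) (fm sym_ext \<phi>)) : extensional (Obj SS)" by (simp del: SS_simps)
 qed (simp_all add: sym_ext_def std_intw_def sym_simps)
qed

lemma sym_res_simps:
 "fo sym_restriction V n = fcmp V (sym_incl n)" "fm sym_restriction \<tau> n = whisk_r (BS n) \<tau> (sym_incl n)"
 by (simp_all add: sym_restriction_def Res_def)

lemma sym_restriction_obj:
 assumes V: "V : Obj RepS"
 shows "fo sym_restriction V : Obj sym_reps"
proof -
 have "{n. fo V {1..n} ~= 0} \<subseteq> {n. EX s. finite s & card s = n & fo V s ~= 0}"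
  by (auto intro!: exI[of _ "{1.._}"] simp del: One_nat_def)
 thus ?thesis
  using V finite_subset is_functor_fcmp[OF functor_J] by (auto simp: sym_obj sym_res_simps fin_supp_SS)
qed

lemma sym_restriction_functor: "is_functor RepS sym_reps sym_restriction"
proof (rule is_functorI)
 show "fo sym_restriction V : Obj sym_reps" if "V : Obj RepS" for V by (rule sym_restriction_obj[OF that])
next
 fix V assume V: "V : Obj RepS"
 show "fm sym_restriction (Idn RepS V) = Idn sym_reps (fo sym_restriction V)"
 proof
  fix n show "fm sym_restriction (Idn RepS V) n = Idn sym_reps (fo sym_restriction V) n"
   by (rule ntr_eqI[where C = "BS n"]) (simp_all add: sym_res_simps sym_simps)
 qed
next
 fix \<tau> V W assume t: "\<tau> : Hom RepS V W"
 note r = Hom_RepD[OF t]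
 have o: "fin_supp (BS n) (fcmp U (sym_incl n))" if "U : Obj RepS" for U n
  using Rep_BS_obj[of "fcmp U (sym_incl n)" n] is_functor_fcmp[OF functor_J Rep_objD(1)[OF that], of n] by simp
 have "fm sym_restriction \<tau> n : Hom (Rep (BS n)) (fo sym_restriction V n) (fo sym_restriction W n)" for n
  using is_nat_whisk_r[OF category_BS functor_J r(1)] r(2,3) o[OF r(4)] o[OF r(5)]
  by (simp add: sym_res_simps Hom_Rep)
 thus "fm sym_restriction \<tau> : Hom sym_reps (fo sym_restriction V) (fo sym_restriction W)"
  using sym_restriction_obj[OF r(4)] sym_restriction_obj[OF r(5)] by (simp add: Hom_sym)
next
 fix \<tau> \<sigma> U V W assume "\<tau> : Hom RepS U V" "\<sigma> : Hom RepS V W"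
 show "fm sym_restriction (Cmp RepS \<sigma> \<tau>) = Cmp sym_reps (fm sym_restriction \<sigma>) (fm sym_restriction \<tau>)"
 proof
  fix n show "fm sym_restriction (Cmp RepS \<sigma> \<tau>) n = Cmp sym_reps (fm sym_restriction \<sigma>) (fm sym_restriction \<tau>) n"
   by (rule ntr_eqI[where C = "BS n"]) (simp_all add: sym_res_simps sym_simps)
 qed
qed

lemma std_rep_restriction:
 assumes V: "V : Obj RepS"
 shows "fo (std_rep (fo sym_restriction V)) s = fo V {1..card s}"
  and "f : Hom SS s t ==> fm (std_rep (fo sym_restriction V)) f = fm V (std_of f)"
 using std_rep_fm[of f s t] perm_of(2)[OF std_of(1), of f s t] by (simp_all add: sym_res_simps, simp add: std_rep_def sym_res_simps)

definition to_std :: S_end_ntr where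
 "to_std = \<lparr>nsrc = idF, ntgt = fcmp sym_ext sym_restriction, nt = (\<lambda>V\<in>Obj RepS. \<lparr>nsrc = V,
   ntgt = std_rep (fo sym_restriction V), nt = (\<lambda>s\<in>Obj SS. fm V (cat_inv SS (enum_of s)))\<rparr>)\<rparr>"

lemma to_std:
 "is_nat RepS RepS to_std" "V : Obj RepS ==> is_iso RepS (nt to_std V)"
proof -
 have c: "nt (nt to_std V) s = fm V (cat_inv SS (enum_of s))"
  "fm V (cat_inv SS (enum_of s)) : \<M> (fo V {1..card s}) (fo V s)" if "V : Obj RepS" "finite s" for V s
  using that rep_cm[OF Rep_objD(1)[OF that(1)] SS_inv(1)[OF enum_of[OF that(2)]]] by (simp_all add: to_std_def)
 have e: "nsrc (nt to_std V) = V" "ntgt (nt to_std V) = std_rep (fo sym_restriction V)" "nt (nt to_std V) : extensional (Obj SS)" if "V : Obj RepS" for V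
  using that by (simp_all add: to_std_def)
 show n: "is_nat RepS RepS to_std"
 proof (rule Rep_ntI[OF cat_SS cat_SS])
  show "is_functor RepS RepS (nsrc to_std)" "is_functor RepS RepS (ntgt to_std)"
   using is_functor_idF[OF RepS_cat] is_functor_fcmp[OF sym_restriction_functor sym_ext_functor] by (simp_all add: to_std_def)
  show "nt to_std : extensional (Obj RepS)" by (simp add: to_std_def)
  show "nsrc (nt to_std V) = fo (nsrc to_std) V & ntgt (nt to_std V) = fo (ntgt to_std) V & nt (nt to_std V) : extensional (Obj SS)"
   if "V : Obj RepS" for V using e[OF that] by (simp add: to_std_def sym_ext_def)
  show "nt (nt to_std V) b : \<M> (fo (fo (ntgt to_std) V) b) (fo (fo (nsrc to_std) V) b)" if V: "V : Obj RepS" and b: "b : Obj SS" for V b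
   using c[OF V, of b] b std_rep_restriction(1)[OF V, of b] by (simp del: Rep_simps) (simp add: to_std_def sym_ext_def)
  show "nt (nt to_std V) t * fm (fo (nsrc to_std) V) f = fm (fo (ntgt to_std) V) f * nt (nt to_std V) s"
   if V: "V : Obj RepS" and f: "f : Hom SS s t" for V f s t
  proof -
   note st = SS_eval(6,7)[OF f] note E = enum_of[OF st(1)] enum_of[OF st(2)]
   note i = SS_inv(1)[OF E(1)] SS_inv(1)[OF E(2)] and VF = Rep_objD(1)[OF V]
   \<comment> \<open>Naturality of the comparison is the defining formula of \<open>std_of\<close>,
     with the enumeration of the source moved to the other side.\<close>
   have "std_of f oo cat_inv SS (enum_of s) = cat_inv SS (enum_of t) oo f"
    unfolding std_of(2)[OF f] SS_assoc SS_inv(3)[OF E(1)] SS_idr[OF f] ..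
   thus ?thesis
    using rep_cmp[OF VF f i(2)] rep_cmp[OF VF i(1) std_of(1)[OF f]] c(1)[OF V st(1)] c(1)[OF V st(2)] std_rep_restriction(2)[OF V f]
    by (simp add: to_std_def sym_ext_def del: Rep_simps)
  qed
  show "nt (nt to_std W) b * nt (fm (nsrc to_std) \<sigma>) b = nt (fm (ntgt to_std) \<sigma>) b * nt (nt to_std V) b"
   if s: "\<sigma> : Hom RepS V W" and b: "b : Obj SS" for \<sigma> V W b
  proof -
   note r = Hom_RepD[OF s] have fb: "finite b" using b by simp
   show ?thesis using intw_nat[OF r(1) SS_inv(1)[OF enum_of[OF fb]]] c(1)[OF r(4) fb] c(1)[OF r(5) fb] fb r(2,3)
    by (simp add: to_std_def sym_ext_def std_intw_def sym_res_simps del: Rep_simps)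
  qed
 qed
 show "is_iso RepS (nt to_std V)" if V: "V : Obj RepS"
 proof (rule Rep_iso(1)[OF cat_SS HomD(1)[OF nat_hom[OF n V]]])
  fix s assume "s : Obj SS"
  hence s: "finite s" by simp
  note E = enum_of[OF s] note i = SS_inv[OF E] and VF = Rep_objD(1)[OF V]
  show "is_iso matcat (nt (nt to_std V) s)"
   unfolding c(1)[OF V s]
   by (rule matcat_isoI(1)[OF c(2)[OF V s] rep_cm[OF VF E]])
    (use rep_cmp[OF VF E i(1)] rep_cmp[OF VF i(1) E] i rep_idn[OF VF, of s] rep_idn[OF VF, of "{1..card s}"] s in simp_all)
 qed
qed

text \<open>The components are identity matrices, yet the representations that they connect need
  agree only on permutations, since functors are not normalised off their source. Hence an
  isomorphism is used in place of an equality.\<close>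

definition from_std :: "(nat => (unit, nat => nat) rep, nat => (unit, nat => nat) intw, nat => (unit, nat => nat) rep, nat => (unit, nat => nat) intw) ntr" where
 "from_std = \<lparr>nsrc = fcmp sym_restriction sym_ext, ntgt = idF, nt = (\<lambda>W\<in>Obj sym_reps. (%n.
   \<lparr>nsrc = fo sym_restriction (std_rep W) n, ntgt = W n, nt = (%_. 1\<^sub>m (fo (W n) ()))\<rparr>))\<rparr>"

lemma from_std:
 "is_nat sym_reps sym_reps from_std" "W : Obj sym_reps ==> is_iso sym_reps (nt from_std W)"
proof -
 have f: "fo (fo sym_restriction (std_rep W) n) () = fo (W n) ()" for W n
  by (simp add: sym_res_simps std_rep_def)
 \<comment> \<open>Standard sets are enumerated by the identity, so standardisation leaves
   permutations of \<open>{1..n}\<close> unchanged.\<close>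
 have m: "fm (fo sym_restriction (std_rep W) n) p = fm (W n) p" if "p permutes {1..n}" for W n p
  using std_rep_fm[OF J_hom[OF that], of W] std_of_J[OF that] perm_of_J[OF that] by (simp add: sym_res_simps)
 have o: "fo sym_restriction (std_rep W) : Obj sym_reps" if "W : Obj sym_reps" for W
  by (rule sym_restriction_obj[OF std_rep_obj[OF that]])
 have h: "nt from_std W n : Hom (Rep (BS n)) (fo sym_restriction (std_rep W) n) (W n)" if W: "W : Obj sym_reps" for W n
 proof -
  have F: "is_functor (BS n) matcat (W n)" "is_functor (BS n) matcat (fo sym_restriction (std_rep W) n)" using W o[OF W] by (simp_all add: sym_obj)
  show ?thesis
  proof (rule Rep_BS_homI[OF F(2,1)])
   fix p assume p: "p permutes {1..n}"
   have "fm (W n) p : \<M> (fo (W n) ()) (fo (W n) ())" using rep_cm[OF F(1), of p "()" "()"] p by (simp add: Hom_BS)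
   thus "nt (nt from_std W n) () * fm (fo sym_restriction (std_rep W) n) p = fm (W n) p * nt (nt from_std W n) ()"
    using W m[OF p] by (simp add: from_std_def)
  qed (use W f in \<open>simp_all add: from_std_def\<close>)
 qed
 have H: "nt from_std W : Hom sym_reps (fo sym_restriction (std_rep W)) W" if "W : Obj sym_reps" for W
  using h[OF that] o[OF that] that by (simp add: Hom_sym)
 show "is_nat sym_reps sym_reps from_std"
 proof (rule is_natI)
  show "is_functor sym_reps sym_reps (nsrc from_std)" "is_functor sym_reps sym_reps (ntgt from_std)"
   using is_functor_idF[OF category_sym] is_functor_fcmp[OF sym_ext_functor sym_restriction_functor] by (simp_all add: from_std_def)
  show "nt from_std : extensional (Obj sym_reps)" by (simp add: from_std_def)
  show "nt from_std W : Hom sym_reps (fo (nsrc from_std) W) (fo (ntgt from_std) W)" if "W : Obj sym_reps" for W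
   using H[OF that] by (simp add: from_std_def sym_ext_def)
  fix \<phi> V W assume p: "\<phi> : Hom sym_reps V W"
  hence n: "\<phi> n : Hom (Rep (BS n)) (V n) (W n)" for n by (simp add: Hom_sym)
  have VW: "V : Obj sym_reps" "W : Obj sym_reps" using p by (simp_all add: Hom_sym)
  note d = Hom_BS_D[OF n]
  show "Cmp sym_reps (nt from_std W) (fm (nsrc from_std) \<phi>) = Cmp sym_reps (fm (ntgt from_std) \<phi>) (nt from_std V)"
  proof
   fix n show "Cmp sym_reps (nt from_std W) (fm (nsrc from_std) \<phi>) n = Cmp sym_reps (fm (ntgt from_std) \<phi>) (nt from_std V) n"
    by (rule ntr_eqI[where C = "BS n"])
     (use VW d(3,4) right_mult_one_mat[OF d(1)[of n]] left_mult_one_mat[OF d(1)[of n]] in \<open>simp_all add: from_std_def sym_simps sym_ext_def std_intw_def sym_res_simps\<close>)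
  qed
 qed
 show "is_iso sym_reps (nt from_std W)" if W: "W : Obj sym_reps"
  unfolding sym_reps_def
 proof (rule coprod_iso[OF cBS H[OF W, unfolded sym_reps_def]])
  fix n
  show "is_iso (Rep (BS n)) (nt from_std W n)"
   by (rule Rep_iso(1)[OF category_BS HomD(1)[OF h[OF W]]])
    (use W is_iso_Idn[OF category_matcat, of "fo (W n) ()"] in \<open>simp add: from_std_def\<close>)
 qed
qed

theorem sym_restriction_equivalence: "is_equivalence RepS sym_reps sym_restriction"
 unfolding is_equivalence_def
proof (intro conjI exI ballI)
 show "nsrc to_std = idF" "ntgt to_std = fcmp sym_ext sym_restriction" "nsrc from_std = fcmp sym_restriction sym_ext" "ntgt from_std = idF"
  by (simp_all add: to_std_def from_std_def)
qed (rule RepS_cat category_sym sym_restriction_functor sym_ext_functor to_std from_std; assumption?)+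


theorem corollary3p3:
  shows "is_equivalence RepS sym_reps sym_restriction \<and>
    (\<exists>F \<phi> \<phi>0.
       strong_monoidal_functor Hp Hp_tens (End_cat RepS) (End_tens RepS) F \<phi> \<phi>0 \<and>
       additive_functor Hp (End_cat RepS) F \<and>
       fo F HQp = Lam1 spAd \<and>
       fo F HQm = Lam1 spA \<and>
       (\<forall>k. Cmp (End_cat RepS) (fm F (hcls (HGen k))) (word_comparison \<phi> \<phi>0 (gen_dom k)) =
            Cmp (End_cat RepS) (word_comparison \<phi> \<phi>0 (gen_cod k)) (LamC_gen k)))"
  using sym_restriction_equivalence R.representation_exists by (rule conjI)

end
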